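(* Let $f\colon\mathcal{X}'\to\mathcal{X}$ be a representable morphism of stacks. Assume that $f$ is weakly parashrinkable. Let $Y$ be a paracompact topological space. Then $f_*\colon\mathrm{Map}(Y,\mathcal{X}')\to\mathrm{Map}(Y,\mathcal{X})$ is a universal weak equivalence. If $Y$ is compact, then $f_*$ is weakly parashrinkable.
   Context: All topological spaces are assumed compactly generated; $\mathsf{CGTop}$ is the category of compactly generated spaces, and all stacks are stacks (in groupoids) over $\mathsf{CGTop}$ for the topology of open covers. A morphism $f\colon\mathcal{X}\to\mathcal{Y}$ of stacks is representable if for every topological space $T$ and morphism $T\to\mathcal{Y}$ the fiber product $T\times_{\mathcal{Y}}\mathcal{X}$ is equivalent to a topological space. A representable morphism is a universal weak equivalence if every such base extension $T\times_{\mathcal{Y}}\mathcal{X}\to T$ is a weak equivalence of topological spaces. The mapping stack $\mathrm{Map}(\mathcal{Y},\mathcal{X})$ is the stack $T\mapsto\mathrm{Hom}(T\times\mathcal{Y},\mathcal{X})$, where $\mathrm{Hom}$ is the groupoid of stack morphisms; $f_*$ is the morphism given by composition with $f$. A representable morphism $f\colon\mathcal{X}\to\mathcal{Y}$ is weakly parashrinkable if for every paracompact space $T$ and every morphism $p\colon T\to\mathcal{Y}$, the space $\mathrm{Map}_p(T,\mathcal{X})$ of lifts of $p$ to $\mathcal{X}$ (the fiber of $f_*\colon\mathrm{Map}(T,\mathcal{X})\to\mathrm{Map}(T,\mathcal{Y})$ over the point corresponding to $p$; equivalently, the space of sections of $T\times_{\mathcal{Y}}\mathcal{X}\to T$) is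 weakly contractible and non-empty. *)

theory Defs
  imports "HOL-Analysis.Analysis" "HOL-Library.Equipollence"
begin

section \<open>The category of compactly generated spaces\<close>

text \<open>
  HOL has no type of all topological spaces.  The spaces are those whose points lie in a fixed
  type \<^typ>\<open>'u\<close> and whose cardinality is smaller than that of \<^typ>\<open>'u\<close>, where \<^typ>\<open>'u\<close>
  is required to be a universe: its cardinality is an uncountable strong limit.  Thus the real
  line, products, subspaces, quotients and function spaces are available up to homeomorphism.
  Every uncountable Grothendieck universe satisfies the condition; regularity is not demanded.
\<close>

definition universe :: "'u itself \<Rightarrow> bool" where
  "universe _ \<longleftrightarrow> (UNIV :: nat set) \<prec> (UNIV :: 'u set) \<and>
     (\<forall>A :: 'u set. A \<prec> (UNIV :: 'u set) \<longrightarrow> Pow A \<prec> (UNIV :: 'u set))"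

definition small_space :: "'u topology \<Rightarrow> bool" where
  "small_space X \<longleftrightarrow> topspace X \<prec> (UNIV :: 'u set)"

text \<open>
  The topology is final with respect to all maps from compact Hausdorff spaces; no separation
  axiom is imposed.  For Hausdorff \<open>X\<close> this is \<^const>\<open>k_space\<close>; in general \<^const>\<open>k_space\<close>
  tests with all compact subsets, Hausdorff or not, which is a different notion.
\<close>

definition compactly_generated :: "'u topology \<Rightarrow> bool" where
  "compactly_generated X \<longleftrightarrow>
     (\<forall>A \<subseteq> topspace X.
        (\<forall>(K :: 'u topology) k. small_space K \<and> compact_space K \<and> Hausdorff_space K \<and>
            continuous_map K X k \<longrightarrow> openin K {x \<in> topspace K. k x \<in> A})
        \<longrightarrow> openin X A)"

definition CGTop :: "'u topology set" where
  "CGTop = {X. small_space X \<and> compactly_generated X}"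

text \<open>Maps are made extensional so that equality of maps is equality of HOL functions.\<close>

definition cmap :: "'u topology \<Rightarrow> 'u topology \<Rightarrow> ('u \<Rightarrow> 'u) set" where
  "cmap S T = {g \<in> extensional (topspace S). continuous_map S T g}"

definition idmap :: "'u topology \<Rightarrow> 'u \<Rightarrow> 'u" where
  "idmap S = (\<lambda>x\<in>topspace S. x)"

text \<open>As is customary, paracompact spaces are Hausdorff.\<close>

definition paracompact_space :: "'a topology \<Rightarrow> bool" where
  "paracompact_space X \<longleftrightarrow> Hausdorff_space X \<and>
     (\<forall>\<U>. (\<forall>U\<in>\<U>. openin X U) \<and> \<Union>\<U> = topspace X \<longrightarrow>
        (\<exists>\<V>. (\<forall>V\<in>\<V>. openin X V \<and> (\<exists>U\<in>\<U>. V \<subseteq> U)) \<and> \<Union>\<V> = topspace X \<and>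
             locally_finite_in X \<V>))"


section \<open>Weak equivalences of spaces\<close>

definition cube :: "nat \<Rightarrow> (nat \<Rightarrow> real) topology" where
  "cube n = product_topology (\<lambda>_. top_of_set {0..1}) {..<n}"

definition cube_boundary :: "nat \<Rightarrow> (nat \<Rightarrow> real) set" where
  "cube_boundary n = {t \<in> topspace (cube n). \<exists>i<n. t i = 0 \<or> t i = 1}"

definition spheroids :: "nat \<Rightarrow> 'a topology \<Rightarrow> 'a \<Rightarrow> ((nat \<Rightarrow> real) \<Rightarrow> 'a) set" where
  "spheroids n X x = {g. continuous_map (cube n) X g \<and> g ` cube_boundary n \<subseteq> {x}}"

definition homotopy_rel ::
    "nat \<Rightarrow> 'a topology \<Rightarrow> 'a \<Rightarrow> ((nat \<Rightarrow> real) \<Rightarrow> 'a) rel" where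
  "homotopy_rel n X x =
     {(g, h). homotopic_with (\<lambda>k. k ` cube_boundary n \<subseteq> {x}) (cube n) X g h}"

definition homotopy_group ::
    "nat \<Rightarrow> 'a topology \<Rightarrow> 'a \<Rightarrow> ((nat \<Rightarrow> real) \<Rightarrow> 'a) set set" where
  "homotopy_group n X x = spheroids n X x // homotopy_rel n X x"

text \<open>
  The map induced on homotopy groups is always a homomorphism, so being an isomorphism is being
  a bijection and the group structure need not be mentioned.
\<close>

definition weak_equivalence :: "'a topology \<Rightarrow> 'b topology \<Rightarrow> ('a \<Rightarrow> 'b) \<Rightarrow> bool" where
  "weak_equivalence X Y f \<longleftrightarrow> continuous_map X Y f \<and>
     bij_betw (\<lambda>C. \<Union>c\<in>C. {y. path_component_of Y (f c) y})
       (path_components_of X) (path_components_of Y) \<and>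
     (\<forall>n\<ge>1. \<forall>x\<in>topspace X.
        bij_betw (\<lambda>C. homotopy_rel n Y (f x) `` ((\<lambda>g. f \<circ> g) ` C))
          (homotopy_group n X x) (homotopy_group n Y (f x)))"

definition weakly_contractible :: "'a topology \<Rightarrow> bool" where
  "weakly_contractible X \<longleftrightarrow> weak_equivalence X (discrete_topology {()}) (\<lambda>_. ())"


section \<open>Categories fibered in groupoids over compactly generated spaces\<close>

text \<open>\<open>Cmp X g f\<close> is the composite of \<open>f\<close> followed by \<open>g\<close>.\<close>

record ('o, 'm, 'u) fibcat =
  Obj :: "'o set"
  Arr :: "'m set"
  Dom :: "'m \<Rightarrow> 'o"
  Cod :: "'m \<Rightarrow> 'o"
  Id :: "'o \<Rightarrow> 'm"
  Cmp :: "'m \<Rightarrow> 'm \<Rightarrow> 'm"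
  Base :: "'o \<Rightarrow> 'u topology"
  BaseMap :: "'m \<Rightarrow> 'u \<Rightarrow> 'u"

definition category :: "('o, 'm, 'u) fibcat \<Rightarrow> bool" where
  "category X \<longleftrightarrow>
     (\<forall>m\<in>Arr X. Dom X m \<in> Obj X \<and> Cod X m \<in> Obj X) \<and>
     (\<forall>x\<in>Obj X. Id X x \<in> Arr X \<and> Dom X (Id X x) = x \<and> Cod X (Id X x) = x) \<and>
     (\<forall>m\<in>Arr X. \<forall>n\<in>Arr X. Cod X m = Dom X n \<longrightarrow>
        Cmp X n m \<in> Arr X \<and> Dom X (Cmp X n m) = Dom X m \<and> Cod X (Cmp X n m) = Cod X n) \<and>
     (\<forall>m\<in>Arr X. Cmp X m (Id X (Dom X m)) = m \<and> Cmp X (Id X (Cod X m)) m = m) \<and>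
     (\<forall>l\<in>Arr X. \<forall>m\<in>Arr X. \<forall>n\<in>Arr X. Cod X l = Dom X m \<and> Cod X m = Dom X n \<longrightarrow>
        Cmp X n (Cmp X m l) = Cmp X (Cmp X n m) l)"

definition over_CGTop :: "('o, 'm, 'u) fibcat \<Rightarrow> bool" where
  "over_CGTop X \<longleftrightarrow>
     (\<forall>x\<in>Obj X. Base X x \<in> CGTop \<and> BaseMap X (Id X x) = idmap (Base X x)) \<and>
     (\<forall>m\<in>Arr X. BaseMap X m \<in> cmap (Base X (Dom X m)) (Base X (Cod X m))) \<and>
     (\<forall>m\<in>Arr X. \<forall>n\<in>Arr X. Cod X m = Dom X n \<longrightarrow>
        BaseMap X (Cmp X n m) =
          compose (topspace (Base X (Dom X m))) (BaseMap X n) (BaseMap X m))"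

definition fibered_in_groupoids :: "('o, 'm, 'u) fibcat \<Rightarrow> bool" where
  "fibered_in_groupoids X \<longleftrightarrow> category X \<and> over_CGTop X \<and>
     (\<forall>S\<in>CGTop. \<forall>y\<in>Obj X. \<forall>g\<in>cmap S (Base X y).
        \<exists>m\<in>Arr X. Cod X m = y \<and> Base X (Dom X m) = S \<and> BaseMap X m = g) \<and>
     (\<forall>m\<in>Arr X. \<forall>n\<in>Arr X. \<forall>g\<in>cmap (Base X (Dom X n)) (Base X (Dom X m)).
        Cod X m = Cod X n \<and>
        compose (topspace (Base X (Dom X n))) (BaseMap X m) g = BaseMap X n \<longrightarrow>
        (\<exists>!k. k \<in> Arr X \<and> Dom X k = Dom X n \<and> Cod X k = Dom X m \<and>
              BaseMap X k = g \<and> Cmp X m k = n))"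

definition vertical :: "('o, 'm, 'u) fibcat \<Rightarrow> 'm \<Rightarrow> bool" where
  "vertical X m \<longleftrightarrow> Base X (Dom X m) = Base X (Cod X m) \<and>
     BaseMap X m = idmap (Base X (Dom X m))"

record ('o, 'm, 'p, 'n) mor =
  OM :: "'o \<Rightarrow> 'p"
  AM :: "'m \<Rightarrow> 'n"

definition morphism ::
    "('o, 'm, 'u) fibcat \<Rightarrow> ('p, 'n, 'u) fibcat \<Rightarrow> ('o, 'm, 'p, 'n) mor \<Rightarrow> bool" where
  "morphism A B F \<longleftrightarrow>
     OM F \<in> Obj A \<rightarrow>\<^sub>E Obj B \<and> AM F \<in> Arr A \<rightarrow>\<^sub>E Arr B \<and>
     (\<forall>x\<in>Obj A. Base B (OM F x) = Base A x \<and> AM F (Id A x) = Id B (OM F x)) \<and>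
     (\<forall>m\<in>Arr A. Dom B (AM F m) = OM F (Dom A m) \<and> Cod B (AM F m) = OM F (Cod A m) \<and>
        BaseMap B (AM F m) = BaseMap A m) \<and>
     (\<forall>m\<in>Arr A. \<forall>n\<in>Arr A. Cod A m = Dom A n \<longrightarrow>
        AM F (Cmp A n m) = Cmp B (AM F n) (AM F m))"

definition id_mor :: "('o, 'm, 'u) fibcat \<Rightarrow> ('o, 'm, 'o, 'm) mor" where
  "id_mor A = \<lparr>OM = (\<lambda>x\<in>Obj A. x), AM = (\<lambda>m\<in>Arr A. m)\<rparr>"

definition comp_mor :: "('o, 'm, 'u) fibcat \<Rightarrow> ('p, 'n, 'q, 'k) mor \<Rightarrow> ('o, 'm, 'p, 'n) mor \<Rightarrow>
    ('o, 'm, 'q, 'k) mor" where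
  "comp_mor A G F = \<lparr>OM = compose (Obj A) (OM G) (OM F), AM = compose (Arr A) (AM G) (AM F)\<rparr>"

text \<open>
  2-morphisms are natural transformations with vertical components.  When \<open>B\<close> is fibered in
  groupoids its vertical arrows are invertible, hence so is every 2-morphism.
\<close>

definition two_morphism :: "('o, 'm, 'u) fibcat \<Rightarrow> ('p, 'n, 'u) fibcat \<Rightarrow>
    ('o, 'm, 'p, 'n) mor \<Rightarrow> ('o, 'm, 'p, 'n) mor \<Rightarrow> ('o \<Rightarrow> 'n) \<Rightarrow> bool" where
  "two_morphism A B F G \<eta> \<longleftrightarrow>
     \<eta> \<in> Obj A \<rightarrow>\<^sub>E Arr B \<and>
     (\<forall>x\<in>Obj A. Dom B (\<eta> x) = OM F x \<and> Cod B (\<eta> x) = OM G x \<and> vertical B (\<eta> x)) \<and>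
     (\<forall>m\<in>Arr A. Cmp B (\<eta> (Cod A m)) (AM F m) = Cmp B (AM G m) (\<eta> (Dom A m)))"

definition equivalence ::
    "('o, 'm, 'u) fibcat \<Rightarrow> ('p, 'n, 'u) fibcat \<Rightarrow> ('o, 'm, 'p, 'n) mor \<Rightarrow> bool" where
  "equivalence A B E \<longleftrightarrow> morphism A B E \<and>
     (\<exists>G. morphism B A G \<and>
        (\<exists>\<eta>. two_morphism A A (comp_mor A G E) (id_mor A) \<eta>) \<and>
        (\<exists>\<epsilon>. two_morphism B B (comp_mor B E G) (id_mor B) \<epsilon>))"


section \<open>Spaces as stacks, and the stack condition\<close>

text \<open>\<open>rep T\<close> is the slice category of \<open>CGTop\<close> over \<open>T\<close>, that is, the space \<open>T\<close> as a stack.\<close>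

type_synonym 'u slice_obj = "'u topology \<times> ('u \<Rightarrow> 'u)"
type_synonym 'u slice_arr = "'u slice_obj \<times> ('u \<Rightarrow> 'u) \<times> 'u slice_obj"

definition rep :: "'u topology \<Rightarrow> ('u slice_obj, 'u slice_arr, 'u) fibcat" where
  "rep T = \<lparr>
     Obj = {(U, u). U \<in> CGTop \<and> u \<in> cmap U T},
     Arr = {((U, u), g, (V, v)) | U u g V v. U \<in> CGTop \<and> u \<in> cmap U T \<and>
              V \<in> CGTop \<and> v \<in> cmap V T \<and> g \<in> cmap U V \<and> compose (topspace U) v g = u},
     Dom = (\<lambda>(x, g, y). x),
     Cod = (\<lambda>(x, g, y). y),
     Id = (\<lambda>x. (x, idmap (fst x), x)),
     Cmp = (\<lambda>(y, h, z) (x, g, _). (x, compose (topspace (fst x)) h g, z)),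
     Base = fst,
     BaseMap = (\<lambda>(x, g, y). g)\<rparr>"

text \<open>The sieve on \<open>U\<close> generated by an open cover, as a full subcategory of \<open>rep U\<close>.\<close>

definition sieve :: "'u topology \<Rightarrow> 'u set set \<Rightarrow> ('u slice_obj, 'u slice_arr, 'u) fibcat" where
  "sieve U \<U> = (let Ob = {(W, w) \<in> Obj (rep U). \<exists>V\<in>\<U>. w ` topspace W \<subseteq> V} in
     (rep U)\<lparr>Obj := Ob,
             Arr := {m \<in> Arr (rep U). Dom (rep U) m \<in> Ob \<and> Cod (rep U) m \<in> Ob}\<rparr>)"

definition restrict_mor :: "('o, 'm, 'u) fibcat \<Rightarrow> ('o, 'm, 'p, 'n) mor \<Rightarrow>
    ('o, 'm, 'p, 'n) mor" where
  "restrict_mor A F = \<lparr>OM = restrict (OM F) (Obj A), AM = restrict (AM F) (Arr A)\<rparr>"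

text \<open>
  Descent for every open cover \<open>\<U>\<close> of every space \<open>U\<close>: restriction
  \<open>Hom (rep U, X) \<rightarrow> Hom (sieve U \<U>, X)\<close> is an equivalence of groupoids.  Here
  \<open>Hom (rep U, X)\<close> is the fiber of \<open>X\<close> over \<open>U\<close> by the Yoneda lemma, and a morphism from
  the sieve to \<open>X\<close> is a descent datum for the cover; the two conjuncts say that morphisms and
  objects glue.
\<close>

definition stack :: "('o, 'm, 'u) fibcat \<Rightarrow> bool" where
  "stack X \<longleftrightarrow> fibered_in_groupoids X \<and>
     (\<forall>U\<in>CGTop. \<forall>\<U>. (\<forall>V\<in>\<U>. openin U V) \<and> \<Union>\<U> = topspace U \<longrightarrow>
        (\<forall>F G \<eta>. morphism (rep U) X F \<and> morphism (rep U) X G \<and>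
            two_morphism (sieve U \<U>) X
              (restrict_mor (sieve U \<U>) F) (restrict_mor (sieve U \<U>) G) \<eta> \<longrightarrow>
            (\<exists>!\<zeta>. two_morphism (rep U) X F G \<zeta> \<and> restrict \<zeta> (Obj (sieve U \<U>)) = \<eta>)) \<and>
        (\<forall>D. morphism (sieve U \<U>) X D \<longrightarrow>
            (\<exists>F. morphism (rep U) X F \<and>
               (\<exists>\<eta>. two_morphism (sieve U \<U>) X (restrict_mor (sieve U \<U>) F) D \<eta>))))"


section \<open>Fiber products, representability, universal weak equivalences\<close>

text \<open>
  The 2-fiber product of \<open>F : A \<rightarrow> C\<close> and \<open>G : B \<rightarrow> C\<close>: objects \<open>(a, b, \<phi>)\<close> with
  \<open>\<phi> : F a \<rightarrow> G b\<close> a vertical arrow (hence invertible).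
\<close>

type_synonym ('o, 'p, 'k) fp_obj = "'o \<times> 'p \<times> 'k"
type_synonym ('o, 'm, 'p, 'n, 'k) fp_arr =
  "('o, 'p, 'k) fp_obj \<times> ('m \<times> 'n) \<times> ('o, 'p, 'k) fp_obj"

definition fiber_product :: "('o, 'm, 'u) fibcat \<Rightarrow> ('p, 'n, 'u) fibcat \<Rightarrow> ('q, 'k, 'u) fibcat \<Rightarrow>
    ('o, 'm, 'q, 'k) mor \<Rightarrow> ('p, 'n, 'q, 'k) mor \<Rightarrow>
    (('o, 'p, 'k) fp_obj, ('o, 'm, 'p, 'n, 'k) fp_arr, 'u) fibcat" where
  "fiber_product A B C F G = (let
     Ob = {(a, b, \<phi>). a \<in> Obj A \<and> b \<in> Obj B \<and> \<phi> \<in> Arr C \<and> Base A a = Base B b \<and>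
             Dom C \<phi> = OM F a \<and> Cod C \<phi> = OM G b \<and> vertical C \<phi>} in
   \<lparr>Obj = Ob,
    Arr = {((a, b, \<phi>), (m, n), (a', b', \<phi>')) | a b \<phi> m n a' b' \<phi>'.
             (a, b, \<phi>) \<in> Ob \<and> (a', b', \<phi>') \<in> Ob \<and>
             m \<in> Arr A \<and> Dom A m = a \<and> Cod A m = a' \<and>
             n \<in> Arr B \<and> Dom B n = b \<and> Cod B n = b' \<and>
             BaseMap A m = BaseMap B n \<and>
             Cmp C \<phi>' (AM F m) = Cmp C (AM G n) \<phi>},
    Dom = (\<lambda>(x, m, y). x),
    Cod = (\<lambda>(x, m, y). y),
    Id = (\<lambda>(a, b, \<phi>). ((a, b, \<phi>), (Id A a, Id B b), (a, b, \<phi>))),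
    Cmp = (\<lambda>(y, (m', n'), z) (x, (m, n), _). (x, (Cmp A m' m, Cmp B n' n), z)),
    Base = (\<lambda>(a, b, \<phi>). Base A a),
    BaseMap = (\<lambda>(x, (m, n), y). BaseMap A m)\<rparr>)"

definition fp_proj1 ::
    "(('o, 'p, 'k) fp_obj, ('o, 'm, 'p, 'n, 'k) fp_arr, 'u) fibcat \<Rightarrow>
     (('o, 'p, 'k) fp_obj, ('o, 'm, 'p, 'n, 'k) fp_arr, 'o, 'm) mor" where
  "fp_proj1 P = \<lparr>OM = (\<lambda>x\<in>Obj P. fst x), AM = (\<lambda>m\<in>Arr P. fst (fst (snd m)))\<rparr>"

text \<open>The map of spaces \<open>Z \<rightarrow> T\<close> corresponding to a morphism \<open>rep Z \<rightarrow> rep T\<close> (Yoneda).\<close>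

definition underlying_map :: "'u topology \<Rightarrow>
    ('u slice_obj, 'u slice_arr, 'u slice_obj, 'u slice_arr) mor \<Rightarrow> 'u \<Rightarrow> 'u" where
  "underlying_map Z H = snd (OM H (Z, idmap Z))"

definition representable ::
    "('o, 'm, 'u) fibcat \<Rightarrow> ('p, 'n, 'u) fibcat \<Rightarrow> ('o, 'm, 'p, 'n) mor \<Rightarrow> bool" where
  "representable X Y f \<longleftrightarrow> morphism X Y f \<and>
     (\<forall>T\<in>CGTop. \<forall>p. morphism (rep T) Y p \<longrightarrow>
        (\<exists>Z\<in>CGTop. \<exists>E. equivalence (rep Z) (fiber_product (rep T) X Y p f) E))"

text \<open>
  The space \<open>Z\<close> and the equivalence \<open>E\<close> are unique up to isomorphism, so it does not matter
  that all choices are considered.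
\<close>

definition universal_weak_equivalence ::
    "('o, 'm, 'u) fibcat \<Rightarrow> ('p, 'n, 'u) fibcat \<Rightarrow> ('o, 'm, 'p, 'n) mor \<Rightarrow> bool" where
  "universal_weak_equivalence X Y f \<longleftrightarrow> representable X Y f \<and>
     (\<forall>T\<in>CGTop. \<forall>p. morphism (rep T) Y p \<longrightarrow>
        (\<forall>Z\<in>CGTop. \<forall>E. equivalence (rep Z) (fiber_product (rep T) X Y p f) E \<longrightarrow>
           weak_equivalence Z T (underlying_map Z
             (comp_mor (rep Z) (fp_proj1 (fiber_product (rep T) X Y p f)) E))))"


section \<open>Mapping stacks\<close>

definition prod_stack :: "('o, 'm, 'u) fibcat \<Rightarrow> ('p, 'n, 'u) fibcat \<Rightarrow>
    ('o \<times> 'p, 'm \<times> 'n, 'u) fibcat" where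
  "prod_stack A B = \<lparr>
     Obj = {(a, b). a \<in> Obj A \<and> b \<in> Obj B \<and> Base A a = Base B b},
     Arr = {(m, n). m \<in> Arr A \<and> n \<in> Arr B \<and> BaseMap A m = BaseMap B n \<and>
              Base A (Dom A m) = Base B (Dom B n) \<and> Base A (Cod A m) = Base B (Cod B n)},
     Dom = (\<lambda>(m, n). (Dom A m, Dom B n)),
     Cod = (\<lambda>(m, n). (Cod A m, Cod B n)),
     Id = (\<lambda>(a, b). (Id A a, Id B b)),
     Cmp = (\<lambda>(m', n') (m, n). (Cmp A m' m, Cmp B n' n)),
     Base = (\<lambda>(a, b). Base A a),
     BaseMap = (\<lambda>(m, n). BaseMap A m)\<rparr>"

text \<open>The morphism \<open>g \<times> id : S \<times> Y \<rightarrow> T \<times> Y\<close> for a map of spaces \<open>g : S \<rightarrow> T\<close>.\<close>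

definition times_id :: "'u topology \<Rightarrow> ('u \<Rightarrow> 'u) \<Rightarrow> ('p, 'n, 'u) fibcat \<Rightarrow>
    ('u slice_obj \<times> 'p, 'u slice_arr \<times> 'n, 'u slice_obj \<times> 'p, 'u slice_arr \<times> 'n) mor" where
  "times_id S g Y = (let post = (\<lambda>(U, u). (U, compose (topspace U) g u)) in
   \<lparr>OM = restrict (\<lambda>(x, y). (post x, y)) (Obj (prod_stack (rep S) Y)),
    AM = restrict (\<lambda>((x, k, x'), n). ((post x, k, post x'), n)) (Arr (prod_stack (rep S) Y))\<rparr>)"

text \<open>
  \<open>Map Y X\<close> is the category fibered in groupoids associated with \<open>T \<mapsto> Hom (T \<times> Y, X)\<close>
  (strictly functorial in \<open>T\<close>): objects over \<open>T\<close> are morphisms \<open>F : T \<times> Y \<rightarrow> X\<close>, and an arrow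
  from \<open>(S, F)\<close> to \<open>(T, G)\<close> is a map \<open>g : S \<rightarrow> T\<close> with a 2-morphism from \<open>F\<close> to
  \<open>G \<circ> (g \<times> id)\<close>.
\<close>

type_synonym ('o, 'm, 'p, 'n, 'u) map_obj =
  "'u topology \<times> ('u slice_obj \<times> 'o, 'u slice_arr \<times> 'm, 'p, 'n) mor"
type_synonym ('o, 'm, 'p, 'n, 'u) map_arr =
  "('o, 'm, 'p, 'n, 'u) map_obj \<times> (('u \<Rightarrow> 'u) \<times> ('u slice_obj \<times> 'o \<Rightarrow> 'n)) \<times>
   ('o, 'm, 'p, 'n, 'u) map_obj"

definition Map :: "('o, 'm, 'u) fibcat \<Rightarrow> ('p, 'n, 'u) fibcat \<Rightarrow>
    (('o, 'm, 'p, 'n, 'u) map_obj, ('o, 'm, 'p, 'n, 'u) map_arr, 'u) fibcat" where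
  "Map Y X = (let Ob = {(T, F). T \<in> CGTop \<and> morphism (prod_stack (rep T) Y) X F} in
   \<lparr>Obj = Ob,
    Arr = {((S, F), (g, \<eta>), (T, G)) | S F g \<eta> T G.
             (S, F) \<in> Ob \<and> (T, G) \<in> Ob \<and> g \<in> cmap S T \<and>
             two_morphism (prod_stack (rep S) Y) X F
               (comp_mor (prod_stack (rep S) Y) G (times_id S g Y)) \<eta>},
    Dom = (\<lambda>(x, m, y). x),
    Cod = (\<lambda>(x, m, y). y),
    Id = (\<lambda>(T, F). ((T, F),
            (idmap T, \<lambda>z\<in>Obj (prod_stack (rep T) Y). Id X (OM F z)), (T, F))),
    Cmp = (\<lambda>(_, (h, \<theta>), z) ((S, F), (g, \<eta>), _).
            ((S, F), (compose (topspace S) h g,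
              \<lambda>w\<in>Obj (prod_stack (rep S) Y). Cmp X (\<theta> (OM (times_id S g Y) w)) (\<eta> w)), z)),
    Base = fst,
    BaseMap = (\<lambda>(x, (g, \<eta>), y). g)\<rparr>)"

text \<open>\<open>f\<^sub>* : Map Y X' \<rightarrow> Map Y X\<close>, composition with \<open>f : X' \<rightarrow> X\<close>.\<close>

definition pushforward :: "('o, 'm, 'u) fibcat \<Rightarrow> ('p, 'n, 'u) fibcat \<Rightarrow> ('p, 'n, 'q, 'k) mor \<Rightarrow>
    (('o, 'm, 'p, 'n, 'u) map_obj, ('o, 'm, 'p, 'n, 'u) map_arr,
     ('o, 'm, 'q, 'k, 'u) map_obj, ('o, 'm, 'q, 'k, 'u) map_arr) mor" where
  "pushforward Y X' f = (let post = (\<lambda>(T, F). (T, comp_mor (prod_stack (rep T) Y) f F)) in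
   \<lparr>OM = restrict post (Obj (Map Y X')),
    AM = restrict (\<lambda>(x, (g, \<eta>), y).
           (post x, (g, compose (Obj (prod_stack (rep (fst x)) Y)) (AM f) \<eta>), post y))
           (Arr (Map Y X'))\<rparr>)"


section \<open>Weakly parashrinkable morphisms\<close>

definition point :: "'u topology" where
  "point = discrete_topology {undefined}"

text \<open>
  The point of \<open>Map T Y\<close> corresponding to \<open>p : T \<rightarrow> Y\<close>: the morphism \<open>point \<rightarrow> Map T Y\<close>
  which over each \<open>U\<close> is the composite of the projection \<open>U \<times> T \<rightarrow> T\<close> with \<open>p\<close>.
\<close>

definition name_of :: "('o, 'm, 'u) fibcat \<Rightarrow> ('p, 'n, 'u) fibcat \<Rightarrow> ('o, 'm, 'p, 'n) mor \<Rightarrow>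
    ('u slice_obj, 'u slice_arr, ('o, 'm, 'p, 'n, 'u) map_obj, ('o, 'm, 'p, 'n, 'u) map_arr) mor"
  where
  "name_of T Y p = (let ob = (\<lambda>(U, u). (U,
       \<lparr>OM = \<lambda>z\<in>Obj (prod_stack (rep U) T). OM p (snd z),
        AM = \<lambda>m\<in>Arr (prod_stack (rep U) T). AM p (snd m)\<rparr>)) in
   \<lparr>OM = restrict ob (Obj (rep point)),
    AM = restrict (\<lambda>(x, g, y).
           (ob x, (g, \<lambda>z\<in>Obj (prod_stack (rep (fst x)) T). Id Y (OM p (snd z))), ob y))
           (Arr (rep point))\<rparr>)"

text \<open>\<open>Map\<^sub>p(T, X)\<close>: the fiber of \<open>f\<^sub>* : Map T X \<rightarrow> Map T Y\<close> over the point given by \<open>p\<close>.\<close>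

definition lifts where
  "lifts T X Y f p =
     fiber_product (rep point) (Map T X) (Map T Y) (name_of T Y p) (pushforward T X f)"

definition weakly_parashrinkable ::
    "('o, 'm, 'u) fibcat \<Rightarrow> ('p, 'n, 'u) fibcat \<Rightarrow> ('o, 'm, 'p, 'n) mor \<Rightarrow> bool" where
  "weakly_parashrinkable X Y f \<longleftrightarrow> representable X Y f \<and>
     (\<forall>T\<in>CGTop. paracompact_space T \<longrightarrow>
        (\<forall>p. morphism (rep T) Y p \<longrightarrow>
           (\<exists>Z\<in>CGTop. (\<exists>E. equivalence (rep Z) (lifts (rep T) X Y f p) E) \<and>
              weakly_contractible Z \<and> topspace Z \<noteq> {})))"

end

theory Submission
  imports Defs
begin

text \<open>
  A morphism of stacks is representable iff it has universal arrows from every space: the fiber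
  product with the space has a terminal object, and this object is the space that it is.  By the
  Yoneda lemma for the terminal object \<open>T \<otimes> Y\<close> of \<open>T \<times> Y\<close>, the objects and arrows of
  \<open>Map Y X\<close> over \<open>T\<close> are those of \<open>X\<close> over the space \<open>T \<otimes> Y\<close>.  Hence a universal arrow of
  \<open>f\<^sub>*\<close> from \<open>T\<close> is the space \<open>Z \<rightarrow> T\<close> of sections along \<open>Y\<close> of the space \<open>W \<rightarrow> T \<otimes> Y\<close>
  pulled back from \<open>f\<close>, and this space exists: it carries the compactly generated refinement of a
  compact-open topology.

  Maps \<open>D \<rightarrow> Z\<close> over \<open>T\<close> are sections of \<open>W\<close> over \<open>D \<otimes> Y\<close>.  If \<open>D\<close> is compact Hausdorff, then
  \<open>D \<otimes> Y\<close> is paracompact, so these sections form a nonempty weakly contractible space: every map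
  \<open>D \<rightarrow> T\<close> lifts to \<open>Z\<close>, and any two lifts are homotopic through lifts.  Applied to cubes and
  their boundaries, this makes \<open>Z \<rightarrow> T\<close> a weak equivalence.  If \<open>Y\<close> is compact and \<open>T\<close>
  paracompact, then \<open>T \<otimes> Y\<close> is itself paracompact, and the space of sections of \<open>Z \<rightarrow> T\<close> is by
  currying the weakly contractible space of sections of \<open>W \<rightarrow> T \<otimes> Y\<close>.
\<close>

section \<open>Compactly generated products\<close>

text \<open>The definitions of representability and of spaces of lifts are phrased with equivalences
  and fiber products. In a universal arrow the map to \<open>T\<close> and the connecting
  isomorphism are absorbed into one arrow \<open>f b -> x\<close>, so that afterwards only equations
  between arrows and maps of spaces remain. The passage is needed in both directions, since the
  definition of a universal weak equivalence speaks of every representing space.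

  The topological obstacle is that spaces need not be Hausdorff and that products in
  \<open>CGTop\<close> can be finer than ordinary ones. Openness and continuity are therefore tested
  along maps from compact Hausdorff spaces rather than on compact subsets, and products are shown
  paracompact by making one factor compact Hausdorff, where both topologies agree.

  The homotopical obstacle is that weak parashrinkability produces lifts over a whole space without
  control on a closed subspace, whereas homotopy groups need lifts prescribed on the boundary of a
  cube. Uniqueness of lifts up to homotopy makes up for this.\<close>

definition upair :: "'u \<Rightarrow> 'u \<Rightarrow> 'u" where
  "upair = curry (SOME h. inj h)"

definition ufst :: "'u \<Rightarrow> 'u" where "ufst p = (SOME a. \<exists>b. p = upair a b)"

definition usnd :: "'u \<Rightarrow> 'u" where "usnd p = (SOME b. \<exists>a. p = upair a b)"

text \<open>Copies a space along an injection into another type; the inverse map is pulled back, so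
  \<open>i\<close> becomes a homeomorphism onto its image. Products, function spaces and cubes enter
  \<open>'u topology\<close> in this way.\<close>

definition transport :: "('a \<Rightarrow> 'b) \<Rightarrow> 'a topology \<Rightarrow> 'b topology" where
  "transport i X = pullback_topology (i ` topspace X) (inv_into (topspace X) i) X"

lemma topspace_transport [simp]: "inj_on i (topspace X) \<Longrightarrow> topspace (transport i X) = i ` topspace X"
  by (auto simp: transport_def topspace_pullback_topology)

lemma openin_transport:
  assumes "inj_on i (topspace X)"
  shows "openin (transport i X) A \<longleftrightarrow> (\<exists>U. openin X U \<and> A = i ` U)"
proof -
  have "inv_into (topspace X) i -` U \<inter> i ` topspace X = i ` U" if "openin X U" for U
    using openin_subset[OF that] assms by (force simp: image_iff)
  then show ?thesis
    unfolding transport_def openin_pullback_topology by metis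
qed

lemma continuous_map_into_transport:
  assumes "inj_on i (topspace X)"
  shows "continuous_map X (transport i X) i"
proof -
  have "{x \<in> topspace X. i x \<in> i ` U} = U" if "openin X U" for U
    using openin_subset[OF that] assms by (auto dest: inj_onD)
  then show ?thesis
    unfolding continuous_map_def using assms by (auto simp: openin_transport)
qed

lemma continuous_map_from_transport:
  assumes "inj_on i (topspace X)"
  shows "continuous_map (transport i X) X (inv_into (topspace X) i)"
  unfolding transport_def
  using continuous_map_pullback[OF continuous_map_id, of "i ` topspace X" "inv_into (topspace X) i" X]
  by (simp add: o_def)

lemma homeomorphic_maps_transport:
  assumes "inj_on i (topspace X)"
  shows "homeomorphic_maps X (transport i X) i (inv_into (topspace X) i)"
  using assms continuous_map_into_transport continuous_map_from_transport
  by (auto simp: homeomorphic_maps_def)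

lemma homeomorphic_space_transport:
  "inj_on i (topspace X) \<Longrightarrow> X homeomorphic_space transport i X"
  using homeomorphic_maps_transport homeomorphic_space_def by blast

text \<open>The k-ification: the finest topology on the points of \<open>X\<close> for which all
  continuous maps from small compact Hausdorff spaces to \<open>X\<close> stay continuous.\<close>

definition kify :: "'u topology \<Rightarrow> 'u topology" where
  "kify X = topology (\<lambda>A. A \<subseteq> topspace X \<and>
     (\<forall>(K :: 'u topology) k. small_space K \<and> compact_space K \<and> Hausdorff_space K \<and>
        continuous_map K X k \<longrightarrow> openin K {x \<in> topspace K. k x \<in> A}))"

lemma openin_kify:
  "openin (kify (X :: 'u topology)) A \<longleftrightarrow> A \<subseteq> topspace X \<and>
     (\<forall>(K :: 'u topology) k. small_space K \<and> compact_space K \<and> Hausdorff_space K \<and>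
        continuous_map K X k \<longrightarrow> openin K {x \<in> topspace K. k x \<in> A})"
proof -
  let ?P = "\<lambda>A. A \<subseteq> topspace X \<and>
     (\<forall>(K :: 'u topology) k. small_space K \<and> compact_space K \<and> Hausdorff_space K \<and>
        continuous_map K X k \<longrightarrow> openin K {x \<in> topspace K. k x \<in> A})"
  have "istopology ?P"
    unfolding istopology_def
  proof (intro conjI allI impI; (elim conjE)?)
    fix S T and K :: "'u topology" and k
    assume S: "\<forall>(K :: 'u topology) k. small_space K \<and> compact_space K \<and> Hausdorff_space K \<and>
        continuous_map K X k \<longrightarrow> openin K {x \<in> topspace K. k x \<in> S}"
      and T: "\<forall>(K :: 'u topology) k. small_space K \<and> compact_space K \<and> Hausdorff_space K \<and>
        continuous_map K X k \<longrightarrow> openin K {x \<in> topspace K. k x \<in> T}"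
      and K: "small_space K" "compact_space K" "Hausdorff_space K" "continuous_map K X k"
    have "{x \<in> topspace K. k x \<in> S \<inter> T} = {x \<in> topspace K. k x \<in> S} \<inter> {x \<in> topspace K. k x \<in> T}"
      by auto
    then show "openin K {x \<in> topspace K. k x \<in> S \<inter> T}"
      using S T K by auto
  next
    fix \<K> and K :: "'u topology" and k
    assume S: "\<forall>A\<in>\<K>. ?P A"
      and K: "small_space K" "compact_space K" "Hausdorff_space K" "continuous_map K X k"
    have "{x \<in> topspace K. k x \<in> \<Union>\<K>} = (\<Union>A\<in>\<K>. {x \<in> topspace K. k x \<in> A})"
      by auto
    then show "openin K {x \<in> topspace K. k x \<in> \<Union>\<K>}"
      using S K by auto
  qed auto
  then show ?thesis
    unfolding kify_def by (simp add: topology_inverse')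
qed

lemma openin_kify_mono: "openin X A \<Longrightarrow> openin (kify X) A"
  unfolding openin_kify
  by (intro conjI allI impI; (elim conjE)?; rule openin_subset openin_continuous_map_preimage)

lemma topspace_kify [simp]: "topspace (kify X) = topspace X"
proof
  show "topspace (kify X) \<subseteq> topspace X"
    using openin_kify[of X "topspace (kify X)"] by simp
  show "topspace X \<subseteq> topspace (kify X)"
    using openin_kify_mono[of X "topspace X"] openin_subset[of "kify X"] by simp
qed

lemma continuous_map_from_kify: "continuous_map X Y f \<Longrightarrow> continuous_map (kify X) Y f"
  by (auto simp: continuous_map_def intro: openin_kify_mono)

lemma compactly_generatedD:
  assumes "compactly_generated X" "A \<subseteq> topspace X"
    and "\<And>(K :: 'u topology) k. \<lbrakk>small_space K; compact_space K; Hausdorff_space K; continuous_map K X k\<rbrakk>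
           \<Longrightarrow> openin K {x \<in> topspace K. k x \<in> A}"
  shows "openin (X :: 'u topology) A"
  using assms unfolding compactly_generated_def by blast

text \<open>By definition of compact generation, the preimage of an open set under \<open>f\<close>
  is tested along each \<open>k\<close>, where it becomes the preimage under
  \<open>f \<circ> k\<close>. Evaluation maps are shown continuous through this.\<close>

lemma continuous_map_cgI:
  assumes "compactly_generated S" and "\<And>x. x \<in> topspace S \<Longrightarrow> f x \<in> topspace X"
    and *: "\<And>(K :: 'u topology) k. \<lbrakk>small_space K; compact_space K; Hausdorff_space K; continuous_map K S k\<rbrakk>
           \<Longrightarrow> continuous_map K X (f \<circ> k)"
  shows "continuous_map (S :: 'u topology) X f"
  unfolding continuous_map_def
proof (intro conjI allI impI)
  fix A assume A: "openin X A"
  show "openin S {x \<in> topspace S. f x \<in> A}"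
  proof (rule compactly_generatedD[OF assms(1)])
    fix K :: "'u topology" and k
    assume K: "small_space K" "compact_space K" "Hausdorff_space K" "continuous_map K S k"
    then have "openin K {x \<in> topspace K. (f \<circ> k) x \<in> A}"
      using *[OF K] A by (simp add: continuous_map_def)
    moreover have "{x \<in> topspace K. (f \<circ> k) x \<in> A} = {x \<in> topspace K. k x \<in> {x \<in> topspace S. f x \<in> A}}"
      using K(4) by (auto simp: continuous_map_def)
    ultimately show "openin K {x \<in> topspace K. k x \<in> {x \<in> topspace S. f x \<in> A}}" by simp
  qed auto
qed (use assms in auto)

lemma compact_Hausdorff_compactly_generated:
  assumes "small_space K" "compact_space K" "Hausdorff_space K"
  shows "compactly_generated K"
  unfolding compactly_generated_def
proof (intro allI impI)
  fix A assume A: "A \<subseteq> topspace K" and *: "\<forall>(K' :: 'a topology) k. small_space K' \<and> compact_space K' \<and>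
      Hausdorff_space K' \<and> continuous_map K' K k \<longrightarrow> openin K' {x \<in> topspace K'. k x \<in> A}"
  have "openin K {x \<in> topspace K. id x \<in> A}"
    using *[rule_format, of K id] assms by simp
  moreover have "{x \<in> topspace K. id x \<in> A} = A" using A by auto
  ultimately show "openin K A" by simp
qed

lemma compact_Hausdorff_CGTop:
  "\<lbrakk>small_space K; compact_space K; Hausdorff_space K\<rbrakk> \<Longrightarrow> K \<in> CGTop"
  by (simp add: CGTop_def compact_Hausdorff_compactly_generated)

text \<open>With \<open>continuous_map_from_kify\<close> this makes \<open>kify\<close> the
  coreflection onto compactly generated spaces: an open set of \<open>kify X\<close> is one whose
  preimage is open under every test map, and \<open>f \<circ> k\<close> is such a test map.\<close>

lemma continuous_map_into_kify:
  fixes S X :: "'u topology"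
  assumes S: "compactly_generated S" and f: "continuous_map S X f"
  shows "continuous_map S (kify X) f"
proof -
  have *: "continuous_map K (kify X) g"
    if "small_space K" "compact_space K" "Hausdorff_space K" "continuous_map K X g" for K :: "'u topology" and g
  proof -
    have "openin K {x \<in> topspace K. g x \<in> U}" if "openin (kify X) U" for U
      using openin_kify[THEN iffD1, OF that, THEN conjunct2, rule_format, of K g]
        \<open>small_space K\<close> \<open>compact_space K\<close> \<open>Hausdorff_space K\<close> \<open>continuous_map K X g\<close> by simp
    then show ?thesis
      using \<open>continuous_map K X g\<close> by (simp add: continuous_map_def)
  qed
  show ?thesis
    using S
  proof (rule continuous_map_cgI)
    show "f x \<in> topspace (kify X)" if "x \<in> topspace S" for x
      using f that by (auto simp: continuous_map_def)
    show "continuous_map K (kify X) (f \<circ> k)"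
      if "small_space K" "compact_space K" "Hausdorff_space K" "continuous_map K S k" for K :: "'u topology" and k
      using * that f continuous_map_compose by blast
  qed
qed

lemma compactly_generated_kify: "compactly_generated (kify (X :: 'u topology))"
  unfolding compactly_generated_def
proof (intro allI impI)
  fix A assume A: "A \<subseteq> topspace (kify X)" and *: "\<forall>(K :: 'u topology) k. small_space K \<and> compact_space K \<and>
      Hausdorff_space K \<and> continuous_map K (kify X) k \<longrightarrow> openin K {x \<in> topspace K. k x \<in> A}"
  show "openin (kify X) A"
    unfolding openin_kify
  proof (intro conjI allI impI)
    fix K :: "'u topology" and k
    assume "small_space K \<and> compact_space K \<and> Hausdorff_space K \<and> continuous_map K X k"
    then show "openin K {x \<in> topspace K. k x \<in> A}"
      using * continuous_map_into_kify compact_Hausdorff_compactly_generated by blast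
  qed (use A in auto)
qed

lemma kify_CGTop: "topspace X \<prec> (UNIV :: 'u set) \<Longrightarrow> kify (X :: 'u topology) \<in> CGTop"
  by (simp add: CGTop_def small_space_def compactly_generated_kify)

text \<open>The categorical product of \<open>CGTop\<close>, on points coded in \<open>'u\<close>.
  The ordinary product of compactly generated spaces need not be compactly generated, hence
  \<open>kify\<close>.\<close>

definition uprod :: "'u topology \<Rightarrow> 'u topology \<Rightarrow> 'u topology"  (infixr \<open>\<otimes>\<close> 80) where
  "S \<otimes> T = kify (transport (case_prod upair) (prod_topology S T))"

section \<open>Cardinality: small sets in the universe\<close>

lemma Times_lesspoll:
  includes cardinal_syntax
  assumes "infinite C" "A \<prec> C" "B \<prec> C"
  shows "A \<times> B \<prec> C"
proof -
  \<comment> \<open>By symmetry the first factor may be taken to be the smaller one; both products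
    then have the cardinality of \<open>B\<close>, unless \<open>B\<close> is finite or
    \<open>A\<close> is empty.\<close>
  have *: "A \<times> B \<prec> C" "B \<times> A \<prec> C" if "|A| \<le>o |B|" "B \<prec> C" for A :: "'x set" and B :: "'y set"
  proof -
    consider "finite B" | "infinite B" "A = {}" | "infinite B" "A \<noteq> {}" by blast
    then have "A \<times> B \<prec> C \<and> B \<times> A \<prec> C"
    proof cases
      case 1
      then have "finite A" using that(1) card_of_ordLeq_finite by blast
      then show ?thesis using 1 assms(1) by (simp add: finite_lesspoll_infinite)
    next
      case 2
      then show ?thesis using assms(1) by (simp add: finite_lesspoll_infinite)
    next
      case 3
      then have "|B \<times> A| =o |B|" "|A \<times> B| =o |B|"
        using that(1) card_of_Times_infinite[of B A] by auto
      then show ?thesis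
        using that(2) by (simp add: eqpoll_iff_card_of_ordIso[symmetric] eq_lesspoll_trans)
    qed
    then show "A \<times> B \<prec> C" "B \<times> A \<prec> C" by auto
  qed
  have "|A| \<le>o |B| \<or> |B| \<le>o |A|"
    by (simp add: card_of_Well_order ordLeq_total)
  then show ?thesis using *[of A B] *[of B A] assms by auto
qed

locale cg_universe =
  fixes ty :: "'u itself"
  assumes universe: "universe ty"
begin

text \<open>A predicate on sets of any type: sets of maps, of reals and of pairs lie outside
  \<open>'u\<close>, and each has to be moved into \<open>'u\<close> before a topology on it counts
  as a space.\<close>

definition small :: "'a set \<Rightarrow> bool" where
  "small A \<longleftrightarrow> (\<exists>i :: 'a \<Rightarrow> 'u. inj_on i A \<and> i ` A \<prec> (UNIV :: 'u set))"

lemma small_image: "small A \<Longrightarrow> small (f ` A)"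
proof -
  assume "small A"
  then obtain i :: "_ \<Rightarrow> 'u" where i: "inj_on i A" "i ` A \<prec> (UNIV :: 'u set)"
    by (auto simp: small_def)
  have "inj_on (i \<circ> inv_into A f) (f ` A)"
    by (intro comp_inj_on inj_on_inv_into inj_on_subset[OF i(1)]) (auto simp: inv_into_into)
  moreover have "(i \<circ> inv_into A f) ` f ` A \<subseteq> i ` A"
    by (auto simp: inv_into_into)
  then have "(i \<circ> inv_into A f) ` f ` A \<prec> (UNIV :: 'u set)"
    using i(2) lesspoll_trans1 subset_imp_lepoll by blast
  ultimately show ?thesis
    unfolding small_def by blast
qed

lemma small_subset: "\<lbrakk>small B; A \<subseteq> B\<rbrakk> \<Longrightarrow> small A"
  unfolding small_def by (meson image_mono inj_on_subset lesspoll_trans1 subset_imp_lepoll)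

lemma nat_lesspoll: "(UNIV :: nat set) \<prec> (UNIV :: 'u set)"
  using universe by (auto simp: universe_def)

lemma Pow_lesspoll: "(A :: 'u set) \<prec> (UNIV :: 'u set) \<Longrightarrow> Pow A \<prec> (UNIV :: 'u set)"
  using universe by (auto simp: universe_def)

lemma infinite_u: "infinite (UNIV :: 'u set)"
  using nat_lesspoll infinite_le_lepoll lesspoll_imp_lepoll by blast

text \<open>An infinite set is equipollent to its square, so the choice in the definition of
  \<open>upair\<close> selects an injection.\<close>

lemma inj_upair: "inj (case_prod (upair :: 'u \<Rightarrow> 'u \<Rightarrow> 'u))"
proof -
  have "(UNIV :: ('u \<times> 'u) set) \<lesssim> (UNIV :: 'u set)"
    using card_of_Times_same_infinite[OF infinite_u] eqpoll_iff_card_of_ordIso eqpoll_imp_lepoll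
    by fastforce
  then have "\<exists>h :: 'u \<times> 'u \<Rightarrow> 'u. inj h"
    by (auto simp: lepoll_def)
  then have "inj (SOME h :: 'u \<times> 'u \<Rightarrow> 'u. inj h)"
    by (rule someI_ex)
  then show ?thesis
    by (simp add: upair_def)
qed

lemma upair_eq [simp]: "upair a b = upair c d \<longleftrightarrow> a = c \<and> b = (d :: 'u)"
  using inj_upair by (auto dest: injD[where x = "(a, b)" and y = "(c, d)"])

lemma ufst_upair [simp]: "ufst (upair a b) = (a :: 'u)"
  unfolding ufst_def by (rule some_equality) auto

lemma usnd_upair [simp]: "usnd (upair a b) = (b :: 'u)"
  unfolding usnd_def by (rule some_equality) auto

lemma finite_lesspoll: "finite A \<Longrightarrow> A \<prec> (UNIV :: 'u set)"
  using finite_lesspoll_infinite infinite_u by blast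

lemma upair_image_lesspoll:
  "\<lbrakk>(A :: 'u set) \<prec> (UNIV :: 'u set); (B :: 'u set) \<prec> (UNIV :: 'u set)\<rbrakk>
    \<Longrightarrow> case_prod upair ` (A \<times> B) \<prec> (UNIV :: 'u set)"
  by (rule lesspoll_trans1[OF image_lepoll Times_lesspoll[OF infinite_u]])

lemma small_u: "(A :: 'u set) \<prec> (UNIV :: 'u set) \<Longrightarrow> small A"
  unfolding small_def by (rule exI[of _ id]) simp

lemma small_Times:
  assumes "small A" "small B"
  shows "small (A \<times> B)"
proof -
  obtain i j :: "_ \<Rightarrow> 'u" where ij: "inj_on i A" "i ` A \<prec> (UNIV :: 'u set)"
    "inj_on j B" "j ` B \<prec> (UNIV :: 'u set)"
    using assms by (auto simp: small_def)
  define h where "h = (\<lambda>(a, b). upair (i a) (j b))"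
  have "inj_on h (A \<times> B)"
    using ij by (auto simp: inj_on_def h_def)
  moreover have "h ` (A \<times> B) = case_prod upair ` (i ` A \<times> j ` B)"
    by (force simp: h_def)
  ultimately show ?thesis
    unfolding small_def using upair_image_lesspoll ij by metis
qed

text \<open>The strong limit condition of \<open>universe\<close> enters through this lemma; it
  bounds function spaces and the real line.\<close>

lemma small_Pow:
  assumes "small A"
  shows "small (Pow A)"
proof -
  obtain i :: "_ \<Rightarrow> 'u" where i: "inj_on i A" "i ` A \<prec> (UNIV :: 'u set)"
    using assms by (auto simp: small_def)
  have "Pow A \<lesssim> Pow (i ` A)"
    unfolding lepoll_def using i(1) by (intro exI[of _ "image i"]) (auto simp: inj_on_image_Pow)
  then have *: "Pow A \<prec> (UNIV :: 'u set)"
    using Pow_lesspoll[OF i(2)] lesspoll_trans1 by blast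
  then obtain j :: "_ \<Rightarrow> 'u" where j: "inj_on j (Pow A)"
    using lesspoll_imp_lepoll[of "Pow A" "UNIV :: 'u set"] by (auto simp: lepoll_def)
  then have "j ` Pow A \<prec> (UNIV :: 'u set)"
    using * by simp
  then show ?thesis using j by (auto simp: small_def)
qed

text \<open>An extensional function is recovered from its graph, which is a subset of
  \<open>A \<times> B\<close>.\<close>

lemma small_funs:
  fixes A :: "'a set" and B :: "'b set"
  assumes "small A" "small B"
  shows "small {f \<in> extensional A. f ` A \<subseteq> B}"
proof -
  let ?F = "{f \<in> extensional A. f ` A \<subseteq> B}"
  define gr where "gr = (\<lambda>f :: 'a \<Rightarrow> 'b. {(a, f a) | a. a \<in> A})"
  define un where "un = (\<lambda>G :: ('a \<times> 'b) set. \<lambda>a\<in>A. THE b. (a, b) \<in> G)"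
  have "un (gr f) = f" if "f \<in> ?F" for f
  proof
    show "un (gr f) a = f a" for a
      using that by (auto simp: un_def gr_def restrict_def extensional_def)
  qed
  then have "?F \<subseteq> un ` gr ` ?F"
    by (metis (no_types, lifting) image_eqI subsetI)
  moreover have "gr ` ?F \<subseteq> Pow (A \<times> B)" by (auto simp: gr_def)
  then have "small (un ` gr ` ?F)"
    by (intro small_image small_subset[OF small_Pow[OF small_Times[OF assms]]])
  ultimately show ?thesis
    using small_subset by blast
qed

lemma small_countable: "countable A \<Longrightarrow> small A"
proof -
  assume "countable A"
  then have "A \<lesssim> (UNIV :: nat set)"
    by (auto simp: lepoll_def countable_def)
  then have "A \<prec> (UNIV :: 'u set)"
    using nat_lesspoll lesspoll_trans1 by blast
  then obtain i :: "_ \<Rightarrow> 'u" where i: "inj_on i A"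
    using lesspoll_imp_lepoll[of A "UNIV :: 'u set"] by (auto simp: lepoll_def)
  then have "i ` A \<prec> (UNIV :: 'u set)"
    using \<open>A \<prec> (UNIV :: 'u set)\<close> by simp
  then show ?thesis using i by (auto simp: small_def)
qed

text \<open>A real is the supremum of the rationals below it, so a sequence of reals is coded by a
  set of pairs of a natural number and a rational. The points of the cubes are such
  sequences.\<close>

lemma small_real_functions: "small (UNIV :: (nat \<Rightarrow> real) set)"
proof -
  define un where "un = (\<lambda>G :: (nat \<times> rat) set. \<lambda>n. Sup {real_of_rat q | q. (n, q) \<in> G})"
  have "un {(n, q). real_of_rat q < f n} = f" for f :: "nat \<Rightarrow> real"
  proof
    fix n
    have "Sup {real_of_rat q | q. real_of_rat q < f n} = f n"
    proof (rule cSup_eq_non_empty)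
      obtain q where "real_of_rat q < f n"
        using of_rat_dense[of "f n - 1" "f n"] by auto
      then show "{real_of_rat q | q. real_of_rat q < f n} \<noteq> {}" by blast
      show "f n \<le> y" if "\<And>x. x \<in> {real_of_rat q | q. real_of_rat q < f n} \<Longrightarrow> x \<le> y" for y
      proof (rule ccontr)
        assume "\<not> f n \<le> y"
        then obtain q where "y < real_of_rat q" "real_of_rat q < f n"
          using of_rat_dense[of y "f n"] by auto
        then show False using that by fastforce
      qed
    qed auto
    then show "un {(n, q). real_of_rat q < f n} n = f n"
      by (simp add: un_def)
  qed
  then have "UNIV \<subseteq> un ` Pow UNIV" by (metis Pow_UNIV UNIV_I image_eqI subsetI)
  moreover have "small (un ` Pow UNIV)"
    by (intro small_image small_Pow small_countable countableI_type)
  ultimately show ?thesis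
    using small_subset by blast
qed

lemma small_real: "small (UNIV :: real set)"
proof -
  have "x \<in> (\<lambda>f. f 0) ` (UNIV :: (nat \<Rightarrow> real) set)" for x :: real
    by (rule image_eqI[of _ _ "\<lambda>_. x"]) auto
  then have "(UNIV :: real set) \<subseteq> (\<lambda>f. f 0) ` (UNIV :: (nat \<Rightarrow> real) set)"
    by blast
  then show ?thesis
    using small_real_functions small_image small_subset by blast
qed

end

text \<open>By the tube lemma the slice at \<open>x\<close> has a product neighbourhood inside
  \<open>W\<close>. This turns a family of open conditions indexed by a compact space into one open
  condition.\<close>

lemma openin_forall_compact:
  assumes "openin (prod_topology X Y) W" "compact_space Y"
  shows "openin X {x \<in> topspace X. \<forall>y\<in>topspace Y. (x, y) \<in> W}"
proof (subst openin_subopen, intro ballI)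
  fix x assume x: "x \<in> {x \<in> topspace X. \<forall>y\<in>topspace Y. (x, y) \<in> W}"
  then have "\<exists>U V. openin X U \<and> openin Y V \<and> x \<in> U \<and> topspace Y \<subseteq> V \<and> U \<times> V \<subseteq> W"
    using assms by (intro tube_lemma_right) (auto simp: compact_space_def)
  then obtain U V where "openin X U" "x \<in> U" "topspace Y \<subseteq> V" "U \<times> V \<subseteq> W"
    by auto
  then show "\<exists>U. openin X U \<and> x \<in> U \<and> U \<subseteq> {x \<in> topspace X. \<forall>y\<in>topspace Y. (x, y) \<in> W}"
    using openin_subset by (intro exI[of _ U]) blast
qed

text \<open>Regularity of \<open>K\<close>. The closed set \<open>C\<close> is again compact
  Hausdorff, so it can serve as a test space.\<close>

lemma compact_Hausdorff_closed_neighbourhood: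
  assumes "compact_space K" "Hausdorff_space K" "openin K V" "x \<in> V"
  obtains U C where "openin K U" "closedin K C" "x \<in> U" "U \<subseteq> C" "C \<subseteq> V"
proof -
  have "neighbourhood_base_of (closedin K) K"
    using assms compact_Hausdorff_imp_regular_space neighbourhood_base_of_closedin by blast
  then have "\<exists>U C. openin K U \<and> closedin K C \<and> x \<in> U \<and> U \<subseteq> C \<and> C \<subseteq> V"
    using assms(3,4) by (simp add: neighbourhood_base_of)
  then show thesis using that by auto
qed

lemma closedin_compact_Hausdorff_subtopology:
  assumes "compact_space K" "Hausdorff_space K" "closedin K C"
  shows "compact_space (subtopology K C)" "Hausdorff_space (subtopology K C)"
    "topspace (subtopology K C) = C"
  using assms closedin_compact_space compact_space_subtopology Hausdorff_space_subtopology
    closedin_subset[OF assms(3)] by auto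

lemma small_space_subtopology: "small_space K \<Longrightarrow> small_space (subtopology K C)"
  unfolding small_space_def by (metis inf_le1 lesspoll_trans1 subset_imp_lepoll topspace_subtopology)

section \<open>Extensional continuous maps and products in \<open>CGTop\<close>\<close>

lemma cmap_eqI:
  "\<lbrakk>f \<in> cmap S T; g \<in> cmap S T'; \<And>x. x \<in> topspace S \<Longrightarrow> f x = g x\<rbrakk> \<Longrightarrow> f = g"
  by (auto simp: cmap_def intro: extensionalityI)

lemma cmap_restrictI: "continuous_map S T f \<Longrightarrow> restrict f (topspace S) \<in> cmap S T"
  by (auto simp: cmap_def intro: continuous_map_eq)

lemma cmap_continuous: "f \<in> cmap S T \<Longrightarrow> continuous_map S T f"
  by (simp add: cmap_def)

lemma cmap_app: "\<lbrakk>f \<in> cmap S T; x \<in> topspace S\<rbrakk> \<Longrightarrow> f x \<in> topspace T"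
  by (auto simp: cmap_def continuous_map_def)

lemma compose_cmap: "\<lbrakk>f \<in> cmap S T; g \<in> cmap T U\<rbrakk> \<Longrightarrow> compose (topspace S) g f \<in> cmap S U"
  unfolding compose_def by (rule cmap_restrictI) (auto simp: cmap_def o_def dest: continuous_map_compose)

lemma idmap_cmap [simp]: "idmap S \<in> cmap S S"
  unfolding idmap_def by (rule cmap_restrictI) simp

context cg_universe
begin

lemma CGTop_small: "S \<in> CGTop \<Longrightarrow> small (topspace (S :: 'u topology))"
  by (simp add: CGTop_def small_space_def small_u)

lemma CGTop_cg: "S \<in> CGTop \<Longrightarrow> compactly_generated S"
  by (simp add: CGTop_def)

text \<open>Cubes and the interval have points outside \<open>'u\<close>; they are replaced by
  homeomorphic test spaces in \<open>CGTop\<close>.\<close>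

lemma compact_Hausdorff_transport:
  fixes K :: "'a topology"
  assumes "compact_space K" "Hausdorff_space K" "small (topspace K)"
  obtains D :: "'u topology" and i where "D \<in> CGTop" "small_space D" "compact_space D" "Hausdorff_space D"
    "homeomorphic_maps K D i (inv_into (topspace K) i)"
proof -
  obtain i :: "'a \<Rightarrow> 'u" where i: "inj_on i (topspace K)" "i ` topspace K \<prec> (UNIV :: 'u set)"
    using assms(3) by (auto simp: small_def)
  have h: "K homeomorphic_space transport i K"
    using i homeomorphic_space_transport by blast
  have *: "compact_space (transport i K)" "Hausdorff_space (transport i K)"
    using assms h homeomorphic_compact_space homeomorphic_Hausdorff_space by blast+
  moreover have "small_space (transport i K)"
    using i by (simp add: small_space_def)
  ultimately show ?thesis
    using i that compact_Hausdorff_CGTop homeomorphic_maps_transport by blast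
qed

text \<open>The coreflection property for a source of another type, obtained through a homeomorphic
  copy in \<open>'u\<close>.\<close>

lemma continuous_map_compact_into_kify:
  fixes K :: "'a topology" and X :: "'u topology"
  assumes "compact_space K" "Hausdorff_space K" "small (topspace K)" and f: "continuous_map K X f"
  shows "continuous_map K (kify X) f"
proof -
  obtain D :: "'u topology" and i where D: "D \<in> CGTop" "compact_space D" "Hausdorff_space D"
    and h: "homeomorphic_maps K D i (inv_into (topspace K) i)"
    using compact_Hausdorff_transport assms by metis
  have "continuous_map D X (f \<circ> inv_into (topspace K) i)"
    using h f by (auto simp: homeomorphic_maps_def intro: continuous_map_compose)
  then have "continuous_map D (kify X) (f \<circ> inv_into (topspace K) i)"
    using D continuous_map_into_kify CGTop_cg by blast
  then have "continuous_map K (kify X) (f \<circ> inv_into (topspace K) i \<circ> i)"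
    using h by (auto simp: homeomorphic_maps_def intro: continuous_map_compose)
  then show ?thesis
    by (rule continuous_map_eq) (use h in \<open>auto simp: homeomorphic_maps_def\<close>)
qed

lemma inj_on_upair: "inj_on (case_prod upair) (A :: ('u \<times> 'u) set)"
  using inj_upair inj_on_subset by blast

lemma topspace_uprod: "topspace (S \<otimes> T) = case_prod upair ` (topspace S \<times> topspace (T :: 'u topology))"
  by (simp add: uprod_def inj_on_upair)

lemma upair_in_uprod [simp]:
  "upair a b \<in> topspace (S \<otimes> T) \<longleftrightarrow> a \<in> topspace S \<and> b \<in> topspace (T :: 'u topology)"
  by (auto simp: topspace_uprod image_iff)

lemma uprodE:
  assumes "p \<in> topspace (S \<otimes> (T :: 'u topology))"
  obtains a b where "p = upair a b" "a \<in> topspace S" "b \<in> topspace T"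
  using assms by (auto simp: topspace_uprod)

lemma uprod_CGTop [simp]: "\<lbrakk>S \<in> CGTop; T \<in> CGTop\<rbrakk> \<Longrightarrow> S \<otimes> T \<in> (CGTop :: 'u topology set)"
  unfolding uprod_def
  by (rule kify_CGTop)
    (auto simp: inj_on_upair CGTop_def small_space_def intro!: Times_lesspoll infinite_u)

lemma continuous_map_from_uprod:
  fixes S T :: "'u topology"
  assumes "continuous_map (prod_topology S T) X f"
  shows "continuous_map (S \<otimes> T) X (\<lambda>p. f (ufst p, usnd p))"
proof -
  let ?i = "case_prod upair :: 'u \<times> 'u \<Rightarrow> 'u" and ?P = "prod_topology S T"
  have "continuous_map (S \<otimes> T) X (f \<circ> inv_into (topspace ?P) ?i)"
    unfolding uprod_def
    by (intro continuous_map_from_kify continuous_map_compose[OF continuous_map_from_transport]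
        inj_on_upair assms)
  moreover have "(f \<circ> inv_into (topspace ?P) ?i) p = f (ufst p, usnd p)" if p: "p \<in> topspace (S \<otimes> T)" for p
  proof -
    obtain a b where "p = upair a b" "a \<in> topspace S" "b \<in> topspace T"
      using p by (rule uprodE)
    then have p: "p = ?i (a, b)" "(a, b) \<in> topspace ?P" by auto
    then have "inv_into (topspace ?P) ?i p = (a, b)"
      using inv_into_f_f[OF inj_on_upair] by metis
    then show ?thesis using p by simp
  qed
  ultimately show ?thesis
    by (rule continuous_map_eq)
qed

lemma continuous_map_ufst: "continuous_map (S \<otimes> T) (S :: 'u topology) ufst"
  using continuous_map_from_uprod[OF continuous_map_fst] by simp

lemma continuous_map_usnd: "continuous_map (S \<otimes> T) (T :: 'u topology) usnd"
  using continuous_map_from_uprod[OF continuous_map_snd] by simp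

lemma continuous_map_upair_transport:
  fixes S T :: "'u topology"
  assumes "continuous_map U S a" "continuous_map U T b"
  shows "continuous_map U (transport (case_prod upair) (prod_topology S T)) (\<lambda>u. upair (a u) (b u))"
proof -
  have "continuous_map U (prod_topology S T) (\<lambda>u. (a u, b u))"
    using assms by (simp add: continuous_map_pairwise o_def)
  from continuous_map_compose[OF this continuous_map_into_transport[OF inj_on_upair]]
  show ?thesis by (simp add: o_def)
qed

lemma continuous_map_upair:
  fixes U S T :: "'u topology"
  assumes "compactly_generated U" "continuous_map U S a" "continuous_map U T b"
  shows "continuous_map U (S \<otimes> T) (\<lambda>u. upair (a u) (b u))"
  unfolding uprod_def using assms by (intro continuous_map_into_kify continuous_map_upair_transport)

lemma continuous_map_upair_compact:
  fixes S T :: "'u topology" and U :: "'a topology"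
  assumes "compact_space U" "Hausdorff_space U" "small (topspace U)" "continuous_map U S a" "continuous_map U T b"
  shows "continuous_map U (S \<otimes> T) (\<lambda>u. upair (a u) (b u))"
  unfolding uprod_def using assms by (intro continuous_map_compact_into_kify continuous_map_upair_transport)

text \<open>The ordinary product of two compact Hausdorff spaces is compact Hausdorff, so its maps
  into an ordinary product are continuous also for the finer topology of
  \<open>S \<otimes> T\<close>.\<close>

lemma continuous_map_upair_prod:
  fixes S T :: "'u topology" and K :: "'a topology" and L :: "'b topology"
  assumes "compact_space K" "Hausdorff_space K" "small (topspace K)" "continuous_map K S a"
    and "compact_space L" "Hausdorff_space L" "small (topspace L)" "continuous_map L T b"
  shows "continuous_map (prod_topology K L) (S \<otimes> T) (\<lambda>(x, y). upair (a x) (b y))"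
proof -
  have "continuous_map (prod_topology K L) (S \<otimes> T) (\<lambda>u. upair ((a \<circ> fst) u) ((b \<circ> snd) u))"
    using assms
    by (intro continuous_map_upair_compact)
      (auto simp: compact_space_prod_topology Hausdorff_space_prod_topology small_Times simp del: o_apply
        intro!: continuous_map_compose[OF continuous_map_fst] continuous_map_compose[OF continuous_map_snd])
  then show ?thesis by (simp add: o_def case_prod_unfold)
qed

definition prj1 :: "'u topology \<Rightarrow> 'u topology \<Rightarrow> 'u \<Rightarrow> 'u" where
  "prj1 S T = restrict ufst (topspace (S \<otimes> T))"

definition prj2 :: "'u topology \<Rightarrow> 'u topology \<Rightarrow> 'u \<Rightarrow> 'u" where
  "prj2 S T = restrict usnd (topspace (S \<otimes> T))"

text \<open>The map \<open>g \<times> id\<close> on spaces, the counterpart of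
  \<open>times_id\<close> on stacks.\<close>

definition umap :: "'u topology \<Rightarrow> 'u topology \<Rightarrow> ('u \<Rightarrow> 'u) \<Rightarrow> 'u \<Rightarrow> 'u" where
  "umap S Y g = (\<lambda>p\<in>topspace (S \<otimes> Y). upair (g (ufst p)) (usnd p))"

lemma prj1_cmap [simp]: "prj1 S T \<in> cmap (S \<otimes> T) S"
  unfolding prj1_def by (intro cmap_restrictI continuous_map_ufst)

lemma prj2_cmap [simp]: "prj2 S T \<in> cmap (S \<otimes> T) T"
  unfolding prj2_def by (intro cmap_restrictI continuous_map_usnd)

lemma prj_upair [simp]:
  "\<lbrakk>a \<in> topspace S; b \<in> topspace T\<rbrakk> \<Longrightarrow> prj1 S T (upair a b) = a"
  "\<lbrakk>a \<in> topspace S; b \<in> topspace T\<rbrakk> \<Longrightarrow> prj2 S T (upair a b) = b"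
  by (simp_all add: prj1_def prj2_def)

lemma umap_upair [simp]:
  "\<lbrakk>a \<in> topspace S; b \<in> topspace Y\<rbrakk> \<Longrightarrow> umap S Y g (upair a b) = upair (g a) b"
  by (simp add: umap_def)

lemma umap_cmap:
  fixes S Y :: "'u topology"
  assumes "S \<in> CGTop" "Y \<in> CGTop" "g \<in> cmap S T"
  shows "umap S Y g \<in> cmap (S \<otimes> Y) (T \<otimes> Y)"
  unfolding umap_def
proof (rule cmap_restrictI)
  have "continuous_map (S \<otimes> Y) T (g \<circ> ufst)"
    by (rule continuous_map_compose[OF continuous_map_ufst cmap_continuous[OF assms(3)]])
  then have "continuous_map (S \<otimes> Y) (T \<otimes> Y) (\<lambda>p. upair ((g \<circ> ufst) p) (usnd p))"
    using assms by (intro continuous_map_upair continuous_map_usnd) (simp_all add: CGTop_cg o_def)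
  then show "continuous_map (S \<otimes> Y) (T \<otimes> Y) (\<lambda>p. upair (g (ufst p)) (usnd p))" by (simp add: o_def)
qed

section \<open>Spaces of sections\<close>

text \<open>The universal property of the dependent product (Weil restriction) of \<open>W\<close>
  along the projection from \<open>T \<otimes> Y\<close> to \<open>T\<close>: a map from
  \<open>U\<close> to \<open>Z\<close> over \<open>T\<close> is the same as a map from
  \<open>U \<otimes> Y\<close> to \<open>W\<close> over \<open>T \<otimes> Y\<close>. The structure
  map is \<open>z\<close>, and \<open>e\<close> is evaluation.\<close>

definition section_space :: "'u topology \<Rightarrow> 'u topology \<Rightarrow> 'u topology \<Rightarrow> ('u \<Rightarrow> 'u) \<Rightarrow>
    'u topology \<Rightarrow> ('u \<Rightarrow> 'u) \<Rightarrow> ('u \<Rightarrow> 'u) \<Rightarrow> bool" where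
  "section_space T Y W w Z z e \<longleftrightarrow> z \<in> cmap Z T \<and> e \<in> cmap (Z \<otimes> Y) W \<and>
     (\<forall>a\<in>topspace Z. \<forall>y\<in>topspace Y. w (e (upair a y)) = upair (z a) y) \<and>
     (\<forall>U\<in>CGTop. \<forall>g\<in>cmap U T. \<forall>k\<in>cmap (U \<otimes> Y) W.
        (\<forall>u\<in>topspace U. \<forall>y\<in>topspace Y. w (k (upair u y)) = upair (g u) y) \<longrightarrow>
        (\<exists>!j. j \<in> cmap U Z \<and> (\<forall>u\<in>topspace U. z (j u) = g u) \<and>
           (\<forall>u\<in>topspace U. \<forall>y\<in>topspace Y. e (upair (j u) y) = k (upair u y))))"

lemma exists_section_space:
  assumes T: "T \<in> CGTop" and Y: "Y \<in> CGTop" and W: "W \<in> CGTop" and w: "w \<in> cmap W (T \<otimes> Y)"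
  shows "\<exists>Z\<in>CGTop. \<exists>z e. section_space T Y W w Z z e"
proof -
  \<comment> \<open>A point over \<open>t\<close> is a section of \<open>W\<close> over the slice at
    \<open>t\<close>; extensionality makes equal sections equal functions.\<close>
  define Z0 where "Z0 = {(t, s). t \<in> topspace T \<and> s \<in> extensional (topspace Y) \<and> continuous_map Y W s \<and>
    (\<forall>y\<in>topspace Y. w (s y) = upair t y)}"
  \<comment> \<open>A subbasis: the first sets make the projection to \<open>T\<close> continuous,
    the second ones are compact-open. Compactness is tested along maps into \<open>Y\<close> and not
    on subsets, because \<open>Y\<close> need not be Hausdorff.\<close>
  define bas where "bas = {{p \<in> Z0. fst p \<in> V} | V. openin T V} \<union>
    {{p \<in> Z0. \<forall>a\<in>topspace K. snd p (k a) \<in> V} | (K :: 'u topology) k V.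
       small_space K \<and> compact_space K \<and> Hausdorff_space K \<and> continuous_map K Y k \<and> openin W V}"
  define \<tau> where "\<tau> = topology_generated_by bas"
  have "\<Union>bas = Z0"
  proof
    show "\<Union>bas \<subseteq> Z0" by (auto simp: bas_def)
    have "{p \<in> Z0. fst p \<in> topspace T} \<in> bas" by (auto simp: bas_def)
    moreover have "{p \<in> Z0. fst p \<in> topspace T} = Z0" by (auto simp: Z0_def)
    ultimately show "Z0 \<subseteq> \<Union>bas" by auto
  qed
  then have top_\<tau>: "topspace \<tau> = Z0" by (simp add: \<tau>_def)
  have open1: "openin \<tau> {p \<in> Z0. fst p \<in> V}" if "openin T V" for V
    unfolding \<tau>_def using that by (intro topology_generated_by_Basis) (auto simp: bas_def)
  have open2: "openin \<tau> {p \<in> Z0. \<forall>a\<in>topspace K. snd p (k a) \<in> V}"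
    if "small_space K" "compact_space K" "Hausdorff_space K" "continuous_map K Y k" "openin W V"
    for K :: "'u topology" and k V
    unfolding \<tau>_def using that by (intro topology_generated_by_Basis) (auto simp: bas_def)
  \<comment> \<open>The sections are bounded by functions between small sets, so the set of points
    can be moved into \<open>'u\<close>.\<close>
  have "Z0 \<subseteq> topspace T \<times> {f \<in> extensional (topspace Y). f ` topspace Y \<subseteq> topspace W}"
    by (auto simp: Z0_def continuous_map_def)
  then have "small Z0"
    by (rule small_subset[OF small_Times[OF CGTop_small[OF T]
            small_funs[OF CGTop_small[OF Y] CGTop_small[OF W]]]])
  then obtain i :: "_ \<Rightarrow> 'u" where i: "inj_on i Z0" "i ` Z0 \<prec> (UNIV :: 'u set)"
    by (auto simp: small_def)
  define Z where "Z = kify (transport i \<tau>)"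
  define r where "r = inv_into Z0 i"
  have Z: "Z \<in> CGTop" "topspace Z = i ` Z0"
    using i by (auto simp: Z_def top_\<tau> intro: kify_CGTop)
  have r: "continuous_map Z \<tau> r"
    unfolding Z_def r_def top_\<tau>[symmetric] using i(1) top_\<tau>
    by (intro continuous_map_from_kify continuous_map_from_transport) simp
  have r_i [simp]: "r (i p) = p" if "p \<in> Z0" for p
    using that i by (simp add: r_def)
  have r_Z0: "r a \<in> Z0" if "a \<in> topspace Z" for a
    using that Z by auto
  have i_r: "i (r a) = a" if "a \<in> topspace Z" for a
    using that Z by auto
  define z where "z = restrict (fst \<circ> r) (topspace Z)"
  define e where "e = (\<lambda>p\<in>topspace (Z \<otimes> Y). snd (r (ufst p)) (usnd p))"
  have fst: "continuous_map \<tau> T fst"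
    unfolding continuous_map_def using open1 by (auto simp: top_\<tau> Z0_def)
  have z: "z \<in> cmap Z T"
    unfolding z_def by (intro cmap_restrictI continuous_map_compose[OF r fst])
  \<comment> \<open>Evaluation is tested on maps \<open>k = (a, b)\<close> from compact Hausdorff
    spaces.\<close>
  have "continuous_map (Z \<otimes> Y) W (\<lambda>p. snd (r (ufst p)) (usnd p))"
  proof (rule continuous_map_cgI)
    show "compactly_generated (Z \<otimes> Y)" using Z Y CGTop_cg uprod_CGTop by blast
    show "snd (r (ufst p)) (usnd p) \<in> topspace W" if "p \<in> topspace (Z \<otimes> Y)" for p
      using that r_Z0 by (elim uprodE) (fastforce simp: Z0_def continuous_map_def)
    fix K :: "'u topology" and k
    assume K: "small_space K" "compact_space K" "Hausdorff_space K" "continuous_map K (Z \<otimes> Y) k"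
    define a where "a = ufst \<circ> k"
    define b where "b = usnd \<circ> k"
    have a: "continuous_map K Z a" and b: "continuous_map K Y b"
      unfolding a_def b_def using K(4) continuous_map_compose continuous_map_ufst continuous_map_usnd by blast+
    have aZ0: "r (a l) \<in> Z0" if "l \<in> topspace K" for l
      using a that r_Z0 by (auto simp: continuous_map_def)
    show "continuous_map K W ((\<lambda>p. snd (r (ufst p)) (usnd p)) \<circ> k)"
      unfolding continuous_map_def
    proof (intro conjI allI impI)
      show "(\<lambda>p. snd (r (ufst p)) (usnd p)) \<circ> k \<in> topspace K \<rightarrow> topspace W"
        using aZ0 b by (fastforce simp: Z0_def continuous_map_def a_def b_def)
      fix V assume V: "openin W V"
      show "openin K {l \<in> topspace K. ((\<lambda>p. snd (r (ufst p)) (usnd p)) \<circ> k) l \<in> V}" (is "openin K ?A")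
      proof (subst openin_subopen, intro ballI)
        fix l0 assume l0: "l0 \<in> ?A"
        let ?s = "snd (r (a l0))"
        have "continuous_map Y W ?s"
          using aZ0[of l0] l0 by (auto simp: Z0_def)
        then have 1: "openin K {l \<in> topspace K. (?s \<circ> b) l \<in> V}"
          using b V by (intro openin_continuous_map_preimage[OF continuous_map_compose])
        have 2: "l0 \<in> {l \<in> topspace K. (?s \<circ> b) l \<in> V}"
          using l0 by (simp add: a_def b_def)
        obtain U C where U: "openin K U" "closedin K C" "l0 \<in> U" "U \<subseteq> C"
            "C \<subseteq> {l \<in> topspace K. (?s \<circ> b) l \<in> V}"
          using compact_Hausdorff_closed_neighbourhood[OF K(2,3) 1 2] .
        have C: "small_space (subtopology K C)" "compact_space (subtopology K C)"
            "Hausdorff_space (subtopology K C)" "topspace (subtopology K C) = C"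
          using U K small_space_subtopology closedin_compact_Hausdorff_subtopology by blast+
        let ?B = "{p \<in> Z0. \<forall>c\<in>C. snd p (b c) \<in> V}"
        have "openin \<tau> ?B"
          using open2[OF C(1-3) continuous_map_from_subtopology[OF b] V] C(4) by simp
        then have "openin K {l \<in> topspace K. (r \<circ> a) l \<in> ?B}"
          by (intro openin_continuous_map_preimage[OF continuous_map_compose[OF a r]])
        then have "openin K (U \<inter> {l \<in> topspace K. (r \<circ> a) l \<in> ?B})"
          using U(1) by blast
        moreover have "l0 \<in> U \<inter> {l \<in> topspace K. (r \<circ> a) l \<in> ?B}"
          using U l0 aZ0 by auto
        moreover have "U \<inter> {l \<in> topspace K. (r \<circ> a) l \<in> ?B} \<subseteq> ?A"
          using U(4) by (auto simp: a_def b_def)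
        ultimately show "\<exists>U. openin K U \<and> l0 \<in> U \<and> U \<subseteq> ?A" by blast
      qed
    qed
  qed
  then have e: "e \<in> cmap (Z \<otimes> Y) W"
    unfolding e_def by (rule cmap_restrictI)
  have e_eq: "e (upair a y) = snd (r a) y" if "a \<in> topspace Z" "y \<in> topspace Y" for a y
    using that by (simp add: e_def)
  have "section_space T Y W w Z z e"
    unfolding section_space_def
  proof (intro conjI ballI impI)
    show "w (e (upair a y)) = upair (z a) y" if "a \<in> topspace Z" "y \<in> topspace Y" for a y
      using that r_Z0[of a] by (auto simp: e_eq z_def Z0_def)
    fix U g k
    assume U: "U \<in> CGTop" and g: "g \<in> cmap U T" and k: "k \<in> cmap (U \<otimes> Y) W"
      and wk: "\<forall>u\<in>topspace U. \<forall>y\<in>topspace Y. w (k (upair u y)) = upair (g u) y"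
    \<comment> \<open>The transpose of \<open>k\<close>: \<open>u\<close> goes to the section over
      the slice at \<open>g u\<close> that \<open>k\<close> determines.\<close>
    define h where "h = (\<lambda>u. (g u, \<lambda>y\<in>topspace Y. k (upair u y)))"
    have hZ0: "h u \<in> Z0" if "u \<in> topspace U" for u
    proof -
      have "continuous_map Y (U \<otimes> Y) (\<lambda>y. upair ((\<lambda>_. u) y) (id y))"
        using that Y by (intro continuous_map_upair) (auto simp: CGTop_cg)
      from continuous_map_compose[OF this cmap_continuous[OF k]]
      have "continuous_map Y W (\<lambda>y\<in>topspace Y. k (upair u y))"
        by (auto simp: o_def intro: continuous_map_eq)
      then show ?thesis
        using that g wk by (auto simp: h_def Z0_def cmap_app)
    qed
    have "continuous_map U \<tau> h"
      unfolding \<tau>_def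
    proof (rule continuous_on_generated_topo)
      show "h ` topspace U \<subseteq> \<Union>bas"
        using hZ0 \<open>\<Union>bas = Z0\<close> by auto
      fix B assume "B \<in> bas"
      then consider V where "B = {p \<in> Z0. fst p \<in> V}" "openin T V"
        | K :: "'u topology" and \<kappa> V where "B = {p \<in> Z0. \<forall>a\<in>topspace K. snd p (\<kappa> a) \<in> V}"
          "small_space K" "compact_space K" "Hausdorff_space K" "continuous_map K Y \<kappa>" "openin W V"
        unfolding bas_def by auto
      then show "openin U (h -` B \<inter> topspace U)"
      proof cases
        case 1
        then have "h -` B \<inter> topspace U = {u \<in> topspace U. g u \<in> V}"
          using hZ0 by (auto simp: h_def)
        then show ?thesis
          using openin_continuous_map_preimage[OF cmap_continuous[OF g] 1(2)] by metis
      next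
        case 2
        have "h -` B \<inter> topspace U = {u \<in> topspace U. \<forall>a\<in>topspace K. k (upair u (\<kappa> a)) \<in> V}"
          using hZ0 2 by (auto simp: h_def continuous_map_def)
        \<comment> \<open>Openness in \<open>U\<close> is tested on a compact Hausdorff
          \<open>L\<close>. Over \<open>L\<close> the condition is indexed by the compact
          \<open>K\<close>, and the tube lemma applies on the product of \<open>L\<close> and
          \<open>K\<close>.\<close>
        moreover have "openin U {u \<in> topspace U. \<forall>a\<in>topspace K. k (upair u (\<kappa> a)) \<in> V}"
        proof (rule compactly_generatedD)
          show "compactly_generated U" using U CGTop_cg by blast
          fix L :: "'u topology" and l
          assume L: "small_space L" "compact_space L" "Hausdorff_space L" "continuous_map L U l"
          have "continuous_map (prod_topology L K) (U \<otimes> Y) (\<lambda>(x, y). upair (l x) (\<kappa> y))"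
            using L 2 by (intro continuous_map_upair_prod) (auto simp: small_space_def small_u)
          from continuous_map_compose[OF this cmap_continuous[OF k]]
          have "openin (prod_topology L K) {q \<in> topspace (prod_topology L K). (k \<circ> (\<lambda>(x, y). upair (l x) (\<kappa> y))) q \<in> V}"
            using \<open>openin W V\<close> openin_continuous_map_preimage by blast
          from openin_forall_compact[OF this \<open>compact_space K\<close>]
          show "openin L {x \<in> topspace L. l x \<in> {u \<in> topspace U. \<forall>a\<in>topspace K. k (upair u (\<kappa> a)) \<in> V}}"
            by (rule back_subst[of "openin L"]) (use L(4) in \<open>auto simp: continuous_map_def\<close>)
        qed auto
        ultimately show ?thesis by simp
      qed
    qed
    then have "continuous_map U (transport i \<tau>) (i \<circ> h)"
      using i(1) top_\<tau> by (intro continuous_map_compose[OF _ continuous_map_into_transport]) auto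
    then have ih: "restrict (i \<circ> h) (topspace U) \<in> cmap U Z"
      unfolding Z_def using U CGTop_cg by (intro cmap_restrictI continuous_map_into_kify)
    show "\<exists>!j. j \<in> cmap U Z \<and> (\<forall>u\<in>topspace U. z (j u) = g u) \<and>
           (\<forall>u\<in>topspace U. \<forall>y\<in>topspace Y. e (upair (j u) y) = k (upair u y))"
    proof (rule ex1I[of _ "restrict (i \<circ> h) (topspace U)"], intro conjI ballI)
      show "z (restrict (i \<circ> h) (topspace U) u) = g u" if "u \<in> topspace U" for u
        using that hZ0 Z by (auto simp: z_def h_def)
      show "e (upair (restrict (i \<circ> h) (topspace U) u) y) = k (upair u y)"
        if "u \<in> topspace U" "y \<in> topspace Y" for u y
        using that hZ0 Z by (subst e_eq) (auto simp: h_def)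
      fix j assume j: "j \<in> cmap U Z \<and> (\<forall>u\<in>topspace U. z (j u) = g u) \<and>
           (\<forall>u\<in>topspace U. \<forall>y\<in>topspace Y. e (upair (j u) y) = k (upair u y))"
      show "j = restrict (i \<circ> h) (topspace U)"
      proof (rule cmap_eqI[OF _ ih])
        show "j \<in> cmap U Z" using j by blast
        fix u assume u: "u \<in> topspace U"
        have ju: "j u \<in> topspace Z" using cmap_app[of j U Z u] j u by blast
        have "fst (r (j u)) = g u" using j u ju by (auto simp: z_def)
        moreover have "snd (r (j u)) = (\<lambda>y\<in>topspace Y. k (upair u y))"
        proof (rule extensionalityI)
          show "snd (r (j u)) \<in> extensional (topspace Y)" using r_Z0[OF ju] by (auto simp: Z0_def)
          show "snd (r (j u)) y = (\<lambda>y\<in>topspace Y. k (upair u y)) y" if "y \<in> topspace Y" for y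
            using that j u ju e_eq by auto
        qed auto
        ultimately have "r (j u) = h u" by (simp add: h_def prod_eq_iff)
        then show "j u = restrict (i \<circ> h) (topspace U) u"
          using i_r[OF ju] u by simp
      qed
    qed (use ih in auto)
  qed (use z e in auto)
  then show ?thesis using Z by blast
qed

end

section \<open>Paracompactness\<close>

lemma paracompact_spaceD:
  assumes "paracompact_space X" "\<And>U. U \<in> \<U> \<Longrightarrow> openin X U" "\<Union>\<U> = topspace X"
  shows "\<exists>\<V>. (\<forall>V\<in>\<V>. openin X V \<and> (\<exists>U\<in>\<U>. V \<subseteq> U)) \<and> \<Union>\<V> = topspace X \<and> locally_finite_in X \<V>"
proof -
  have "(\<forall>U\<in>\<U>. openin X U) \<and> \<Union>\<U> = topspace X" using assms by blast
  then show ?thesis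
    using assms(1) unfolding paracompact_space_def by presburger
qed

lemma homeomorphic_paracompact_space:
  assumes X: "paracompact_space X" and h: "homeomorphic_maps X Y f g"
  shows "paracompact_space Y"
  unfolding paracompact_space_def
proof (intro conjI allI impI)
  have hY: "X homeomorphic_space Y" using h homeomorphic_space_def by blast
  then show "Hausdorff_space Y"
    using X homeomorphic_Hausdorff_space[of X Y] by (simp add: paracompact_space_def)
  have hf: "homeomorphic_map X Y f" and hg: "homeomorphic_map Y X g"
    using h by (auto simp: homeomorphic_maps_map)
  have gf: "g (f x) = x" if "x \<in> topspace X" for x using that h by (auto simp: homeomorphic_maps_def)
  have fg: "f (g y) = y" if "y \<in> topspace Y" for y using that h by (auto simp: homeomorphic_maps_def)
  have fX: "f x \<in> topspace Y" if "x \<in> topspace X" for x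
    using that h by (auto simp: homeomorphic_maps_def continuous_map_def)
  have gY: "g y \<in> topspace X" if "y \<in> topspace Y" for y
    using that h by (auto simp: homeomorphic_maps_def continuous_map_def)
  have opf: "openin Y (f ` U)" if "openin X U" for U
    using homeomorphic_imp_open_map[OF hf] that by (simp add: open_map_def)
  have opg: "openin X (g ` U)" if "openin Y U" for U
    using homeomorphic_imp_open_map[OF hg] that by (simp add: open_map_def)
  fix \<U> assume \<U>: "(\<forall>U\<in>\<U>. openin Y U) \<and> \<Union>\<U> = topspace Y"
  have "openin X U" if "U \<in> (\<lambda>U. g ` U) ` \<U>" for U
    using that \<U> opg by auto
  moreover have "\<Union>((\<lambda>U. g ` U) ` \<U>) = topspace X"
  proof -
    have "\<Union>((\<lambda>U. g ` U) ` \<U>) = g ` \<Union>\<U>" by blast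
    also have "\<dots> = g ` topspace Y" using \<U> by simp
    finally have "\<Union>((\<lambda>U. g ` U) ` \<U>) = g ` topspace Y" .
    then show ?thesis using homeomorphic_imp_surjective_map[OF hg] by simp
  qed
  ultimately have "\<exists>\<V>. (\<forall>V\<in>\<V>. openin X V \<and> (\<exists>U\<in>(\<lambda>U. g ` U) ` \<U>. V \<subseteq> U)) \<and> \<Union>\<V> = topspace X \<and>
      locally_finite_in X \<V>"
    by (rule paracompact_spaceD[OF X])
  then obtain \<V> where \<V>: "\<And>V. V \<in> \<V> \<Longrightarrow> openin X V" "\<And>V. V \<in> \<V> \<Longrightarrow> \<exists>U\<in>(\<lambda>U. g ` U) ` \<U>. V \<subseteq> U"
    "\<Union>\<V> = topspace X" "locally_finite_in X \<V>"
    by metis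
  show "\<exists>\<V>. (\<forall>V\<in>\<V>. openin Y V \<and> (\<exists>U\<in>\<U>. V \<subseteq> U)) \<and> \<Union>\<V> = topspace Y \<and> locally_finite_in Y \<V>"
  proof (intro exI[of _ "(\<lambda>V. f ` V) ` \<V>"] conjI ballI)
    show "openin Y W" if "W \<in> (\<lambda>V. f ` V) ` \<V>" for W using that \<V>(1) opf by auto
    show "\<exists>U\<in>\<U>. W \<subseteq> U" if W: "W \<in> (\<lambda>V. f ` V) ` \<V>" for W
    proof -
      obtain V U where "W = f ` V" "U \<in> \<U>" "V \<subseteq> g ` U" using W \<V>(2) by blast
      moreover then have "U \<subseteq> topspace Y" using \<U> by blast
      ultimately have "W \<subseteq> U" using fg by (fastforce simp: subset_iff image_iff)
      then show ?thesis using \<open>U \<in> \<U>\<close> by blast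
    qed
    have "\<Union>((\<lambda>V. f ` V) ` \<V>) = f ` \<Union>\<V>" by blast
    also have "\<dots> = f ` topspace X" using \<V>(3) by simp
    finally have "\<Union>((\<lambda>V. f ` V) ` \<V>) = f ` topspace X" .
    then show top: "\<Union>((\<lambda>V. f ` V) ` \<V>) = topspace Y"
      using homeomorphic_imp_surjective_map[OF hf] by simp
    show "locally_finite_in Y ((\<lambda>V. f ` V) ` \<V>)"
      unfolding locally_finite_in_def
    proof (intro conjI ballI)
      fix y assume y: "y \<in> topspace Y"
      then obtain N where N: "openin X N" "g y \<in> N" "finite {V \<in> \<V>. V \<inter> N \<noteq> {}}"
        using \<V>(4) gY unfolding locally_finite_in_def by meson
      have "{W \<in> (\<lambda>V. f ` V) ` \<V>. W \<inter> f ` N \<noteq> {}} \<subseteq> (\<lambda>V. f ` V) ` {V \<in> \<V>. V \<inter> N \<noteq> {}}"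
      proof
        fix W assume "W \<in> {W \<in> (\<lambda>V. f ` V) ` \<V>. W \<inter> f ` N \<noteq> {}}"
        then obtain V x x' where V: "W = f ` V" "V \<in> \<V>" "x \<in> V" "f x = f x'" "x' \<in> N" by auto
        then have "x \<in> topspace X" "x' \<in> topspace X"
          using openin_subset[OF \<V>(1)[OF V(2)]] openin_subset[OF N(1)] by auto
        then have "x = x'" using gf V(4) by metis
        then show "W \<in> (\<lambda>V. f ` V) ` {V \<in> \<V>. V \<inter> N \<noteq> {}}" using V by blast
      qed
      then have "finite {W \<in> (\<lambda>V. f ` V) ` \<V>. W \<inter> f ` N \<noteq> {}}"
        by (rule finite_subset[OF _ finite_imageI[OF N(3)]])
      moreover have "y \<in> f ` N" using N(2) fg[OF y] by force
      ultimately show "\<exists>M. openin Y M \<and> y \<in> M \<and> finite {W \<in> (\<lambda>V. f ` V) ` \<V>. W \<inter> M \<noteq> {}}"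
        using opf[OF N(1)] by blast
    qed (use top in simp)
  qed
qed

text \<open>By the tube lemma each \<open>y\<close> has a neighbourhood \<open>V y\<close> over
  which finitely many members \<open>F y\<close> of the cover suffice. A locally finite refinement
  of the sets \<open>V y\<close> carries these finite families along.\<close>

lemma paracompact_space_prod_compact:
  assumes K: "compact_space K" "Hausdorff_space K" and Y: "paracompact_space Y"
  shows "paracompact_space (prod_topology Y K)"
  unfolding paracompact_space_def
proof (intro conjI allI impI)
  show "Hausdorff_space (prod_topology Y K)"
    using K Y by (simp add: paracompact_space_def Hausdorff_space_prod_topology)
  fix \<U> assume \<U>: "(\<forall>U\<in>\<U>. openin (prod_topology Y K) U) \<and> \<Union>\<U> = topspace (prod_topology Y K)"
  have "\<exists>F V. finite F \<and> F \<subseteq> \<U> \<and> openin Y V \<and> y \<in> V \<and> V \<times> topspace K \<subseteq> \<Union>F" if y: "y \<in> topspace Y" for y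
  proof -
    have "compactin (prod_topology Y K) ({y} \<times> topspace K)"
      using y K by (simp add: compactin_Times compact_space_def)
    moreover have "{y} \<times> topspace K \<subseteq> \<Union>\<U>" using \<U> y by auto
    ultimately obtain F where F: "finite F" "F \<subseteq> \<U>" "{y} \<times> topspace K \<subseteq> \<Union>F"
      using \<U> compactinD[of "prod_topology Y K"] by metis
    have "openin (prod_topology Y K) (\<Union>F)" using F(2) \<U> by blast
    then have "\<exists>U V. openin Y U \<and> openin K V \<and> y \<in> U \<and> topspace K \<subseteq> V \<and> U \<times> V \<subseteq> \<Union>F"
      using K y F(3) by (intro tube_lemma_right) (auto simp: compact_space_def)
    then obtain U V where "openin Y U" "y \<in> U" "topspace K \<subseteq> V" "U \<times> V \<subseteq> \<Union>F" by auto
    then show ?thesis using F by (intro exI[of _ F] exI[of _ U]) auto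
  qed
  then obtain F V where FV: "\<And>y. y \<in> topspace Y \<Longrightarrow>
      finite (F y) \<and> F y \<subseteq> \<U> \<and> openin Y (V y) \<and> y \<in> V y \<and> V y \<times> topspace K \<subseteq> \<Union>(F y)"
    by metis
  have 1: "openin Y U" if "U \<in> V ` topspace Y" for U using that FV by auto
  have 2: "\<Union>(V ` topspace Y) = topspace Y"
  proof
    show "\<Union>(V ` topspace Y) \<subseteq> topspace Y" by (rule Union_least) (rule openin_subset[OF 1])
  qed (use FV in auto)
  obtain \<W> where \<W>0: "(\<forall>W\<in>\<W>. openin Y W \<and> (\<exists>U\<in>V ` topspace Y. W \<subseteq> U)) \<and> \<Union>\<W> = topspace Y \<and>
      locally_finite_in Y \<W>"
    using paracompact_spaceD[OF Y 1 2] ..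
  then have \<W>: "\<And>W. W \<in> \<W> \<Longrightarrow> openin Y W" "\<Union>\<W> = topspace Y" "locally_finite_in Y \<W>"
    by simp_all
  have "\<exists>y\<in>topspace Y. W \<subseteq> V y" if "W \<in> \<W>" for W
    using \<W>0 that by auto
  then obtain c where c: "\<And>W. W \<in> \<W> \<Longrightarrow> c W \<in> topspace Y \<and> W \<subseteq> V (c W)"
    by metis
  \<comment> \<open>Each \<open>W\<close> uses the finite family of one chosen centre
    \<open>c W\<close>. Over a neighbourhood that meets finitely many \<open>W\<close>, only
    finitely many of these sets arise.\<close>
  define \<V> where "\<V> = {(W \<times> topspace K) \<inter> U | W U. W \<in> \<W> \<and> U \<in> F (c W)}"
  show "\<exists>\<V>. (\<forall>V\<in>\<V>. openin (prod_topology Y K) V \<and> (\<exists>U\<in>\<U>. V \<subseteq> U)) \<and>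
      \<Union>\<V> = topspace (prod_topology Y K) \<and> locally_finite_in (prod_topology Y K) \<V>"
  proof (intro exI[of _ \<V>] conjI ballI)
    show "openin (prod_topology Y K) A" if A: "A \<in> \<V>" for A
    proof -
      obtain W U where WU: "A = (W \<times> topspace K) \<inter> U" "W \<in> \<W>" "U \<in> F (c W)"
        using A unfolding \<V>_def by blast
      then have "U \<in> \<U>" using FV[of "c W"] c[of W] by auto
      then have "openin (prod_topology Y K) U" using \<U> by simp
      then show ?thesis using WU \<W>(1)[OF WU(2)] by (simp add: openin_Int openin_prod_Times_iff)
    qed
    show "\<exists>U\<in>\<U>. A \<subseteq> U" if A: "A \<in> \<V>" for A
    proof -
      obtain W U where WU: "A = (W \<times> topspace K) \<inter> U" "W \<in> \<W>" "U \<in> F (c W)"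
        using A unfolding \<V>_def by blast
      then have "U \<in> \<U>" using FV[of "c W"] c[of W] by auto
      then show ?thesis using WU by auto
    qed
    show top: "\<Union>\<V> = topspace (prod_topology Y K)"
    proof
      show "\<Union>\<V> \<subseteq> topspace (prod_topology Y K)" using \<W>(2) by (auto simp: \<V>_def)
      show "topspace (prod_topology Y K) \<subseteq> \<Union>\<V>"
      proof
        fix p assume p: "p \<in> topspace (prod_topology Y K)"
        then have "fst p \<in> \<Union>\<W>" using \<W>(2) by auto
        then obtain W where W: "W \<in> \<W>" "fst p \<in> W" by blast
        then have "p \<in> V (c W) \<times> topspace K" using p c[OF W(1)] by auto
        then obtain U where U: "U \<in> F (c W)" "p \<in> U" using FV[of "c W"] c[OF W(1)] by auto
        have "(W \<times> topspace K) \<inter> U \<in> \<V>" unfolding \<V>_def using W(1) U(1) by blast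
        moreover have "p \<in> (W \<times> topspace K) \<inter> U" using W U p by auto
        ultimately show "p \<in> \<Union>\<V>" by blast
      qed
    qed
    show "locally_finite_in (prod_topology Y K) \<V>"
      unfolding locally_finite_in_def
    proof (intro conjI ballI)
      fix p assume p: "p \<in> topspace (prod_topology Y K)"
      then obtain N where N: "openin Y N" "fst p \<in> N" "finite {W \<in> \<W>. W \<inter> N \<noteq> {}}"
        using \<W>(3) unfolding locally_finite_in_def by (metis mem_Times_iff topspace_prod_topology)
      have "{A \<in> \<V>. A \<inter> (N \<times> topspace K) \<noteq> {}} \<subseteq>
          (\<Union>W\<in>{W \<in> \<W>. W \<inter> N \<noteq> {}}. (\<lambda>U. (W \<times> topspace K) \<inter> U) ` F (c W))"
        by (auto simp: \<V>_def)
      moreover have "finite (\<Union>W\<in>{W \<in> \<W>. W \<inter> N \<noteq> {}}. (\<lambda>U. (W \<times> topspace K) \<inter> U) ` F (c W))"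
        using N(3) FV c by simp
      ultimately have "finite {A \<in> \<V>. A \<inter> (N \<times> topspace K) \<noteq> {}}"
        by (rule finite_subset)
      moreover have "openin (prod_topology Y K) (N \<times> topspace K)" "p \<in> N \<times> topspace K"
        using N p by (auto simp: openin_prod_Times_iff)
      ultimately show "\<exists>M. openin (prod_topology Y K) M \<and> p \<in> M \<and> finite {A \<in> \<V>. A \<inter> M \<noteq> {}}"
        by blast
    qed (use top in simp)
  qed
qed

context cg_universe
begin

text \<open>A compact Hausdorff factor makes the ordinary product compactly generated. Given
  \<open>A\<close> open in \<open>Y \<otimes> K\<close> and a point of it, choose a closed
  neighbourhood \<open>C\<close> of the second coordinate inside the slice of \<open>A\<close>. The
  set of \<open>y\<close> for which \<open>A\<close> contains the pairs of \<open>y\<close> with all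
  points of \<open>C\<close> is open: on a test space \<open>L\<close> this is the tube lemma for
  the product of \<open>L\<close> and \<open>C\<close>.\<close>

lemma uprod_compact_eq:
  assumes K: "compact_space K" "Hausdorff_space K" "K \<in> CGTop" and Y: "Y \<in> (CGTop :: 'u topology set)"
  shows "Y \<otimes> K = transport (case_prod upair) (prod_topology Y K)" (is "_ = ?P")
proof (rule topology_eq[THEN iffD2], intro allI iffI)
  fix A assume A: "openin (Y \<otimes> K) A"
  define B where "B = {(y, k). (y, k) \<in> topspace (prod_topology Y K) \<and> upair y k \<in> A}"
  have "openin (prod_topology Y K) B"
  proof (subst openin_subopen, intro ballI)
    fix p assume "p \<in> B"
    then obtain y0 k0 where p: "p = (y0, k0)" "y0 \<in> topspace Y" "k0 \<in> topspace K" "upair y0 k0 \<in> A"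
      by (auto simp: B_def)
    have "continuous_map K (Y \<otimes> K) (\<lambda>k. upair y0 k)"
      using continuous_map_upair[of K Y "\<lambda>_. y0" K id] CGTop_cg[OF K(3)] p by simp
    then have 1: "openin K {k \<in> topspace K. upair y0 k \<in> A}"
      using A by (rule openin_continuous_map_preimage)
    have 2: "k0 \<in> {k \<in> topspace K. upair y0 k \<in> A}" using p by simp
    obtain U C where U: "openin K U" "closedin K C" "k0 \<in> U" "U \<subseteq> C" "C \<subseteq> {k \<in> topspace K. upair y0 k \<in> A}"
      using compact_Hausdorff_closed_neighbourhood[OF K(1,2) 1 2] .
    note C = closedin_compact_Hausdorff_subtopology[OF K(1,2) U(2)]
    have "openin Y {y \<in> topspace Y. \<forall>k\<in>C. upair y k \<in> A}"
    proof (rule compactly_generatedD)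
      show "compactly_generated Y" using Y CGTop_cg by blast
      fix L :: "'u topology" and l
      assume L: "small_space L" "compact_space L" "Hausdorff_space L" "continuous_map L Y l"
      have "continuous_map (prod_topology L (subtopology K C)) (Y \<otimes> K) (\<lambda>(x, y). upair (l x) (id y))"
        using L C small_subset[OF CGTop_small[OF K(3)] closedin_subset[OF U(2)]]
        by (intro continuous_map_upair_prod) (auto simp: small_space_def small_u continuous_map_from_subtopology)
      from openin_continuous_map_preimage[OF this A]
      have "openin (prod_topology L (subtopology K C))
          {q \<in> topspace (prod_topology L (subtopology K C)). (\<lambda>(x, y). upair (l x) (id y)) q \<in> A}" .
      from openin_forall_compact[OF this C(1)]
      show "openin L {x \<in> topspace L. l x \<in> {y \<in> topspace Y. \<forall>k\<in>C. upair y k \<in> A}}"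
        by (rule back_subst[of "openin L"]) (use L(4) C(3) in \<open>auto simp: continuous_map_def\<close>)
    qed auto
    then have "openin (prod_topology Y K) ({y \<in> topspace Y. \<forall>k\<in>C. upair y k \<in> A} \<times> U)"
      using U(1) by (simp add: openin_prod_Times_iff)
    moreover have "p \<in> {y \<in> topspace Y. \<forall>k\<in>C. upair y k \<in> A} \<times> U" using p U by auto
    moreover have "{y \<in> topspace Y. \<forall>k\<in>C. upair y k \<in> A} \<times> U \<subseteq> B"
      using U openin_subset[OF U(1)] by (auto simp: B_def)
    ultimately show "\<exists>M. openin (prod_topology Y K) M \<and> p \<in> M \<and> M \<subseteq> B" by blast
  qed
  moreover have "A = case_prod upair ` B"
    using openin_subset[OF A] by (auto simp: B_def topspace_uprod image_iff)
  ultimately show "openin ?P A"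
    by (auto simp: openin_transport inj_on_upair)
next
  show "openin (Y \<otimes> K) A" if "openin ?P A" for A
    using that unfolding uprod_def by (rule openin_kify_mono)
qed

lemma paracompact_uprod_compact:
  assumes "compact_space K" "Hausdorff_space K" "K \<in> CGTop" "Y \<in> (CGTop :: 'u topology set)" "paracompact_space Y"
  shows "paracompact_space (Y \<otimes> K)"
  using homeomorphic_paracompact_space[OF paracompact_space_prod_compact[OF assms(1,2,5)]
      homeomorphic_maps_transport[OF inj_on_upair]]
  by (simp add: uprod_compact_eq[OF assms(1-4)])

lemma homeomorphic_maps_uprod_swap:
  assumes "S \<in> CGTop" "T \<in> (CGTop :: 'u topology set)"
  shows "homeomorphic_maps (S \<otimes> T) (T \<otimes> S) (\<lambda>p. upair (usnd p) (ufst p)) (\<lambda>p. upair (usnd p) (ufst p))"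
  unfolding homeomorphic_maps_def
  using assms by (auto simp: CGTop_cg elim!: uprodE
      intro!: continuous_map_upair continuous_map_ufst continuous_map_usnd)

lemma paracompact_compact_uprod:
  assumes "compact_space K" "Hausdorff_space K" "K \<in> CGTop" "Y \<in> (CGTop :: 'u topology set)" "paracompact_space Y"
  shows "paracompact_space (K \<otimes> Y)"
  using homeomorphic_paracompact_space[OF paracompact_uprod_compact[OF assms]
      homeomorphic_maps_uprod_swap[OF assms(4,3)]] .

end

section \<open>Homotopy lifting and weak equivalences\<close>

lemma continuous_map_compose':
  "\<lbrakk>continuous_map X Y f; continuous_map Y Z g\<rbrakk> \<Longrightarrow> continuous_map X Z (\<lambda>x. g (f x))"
  using continuous_map_compose[of X Y f Z g] by (simp add: o_def)

text \<open>
  Cubes are handled through the gauge \<open>N\<close>, the sup-norm distance from the centre scaled so that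
  the boundary is \<open>N = 1\<close>, together with the dilations \<open>D M\<close> by \<open>1/M\<close> about the centre.
\<close>

definition dilation_structure :: "'a topology \<Rightarrow> ('a \<Rightarrow> real) \<Rightarrow> (real \<Rightarrow> 'a \<Rightarrow> 'a) \<Rightarrow> bool" where
  "dilation_structure A N D \<longleftrightarrow> continuous_map A euclideanreal N \<and>
     (\<forall>t\<in>topspace A. 0 \<le> N t \<and> N t \<le> 1 \<and> D 1 t = t) \<and>
     continuous_map (subtopology (prod_topology euclideanreal A) {(M, t). 1/2 \<le> M \<and> M \<le> 1 \<and> N t \<le> M}) A
       (\<lambda>(M, t). D M t) \<and>
     (\<forall>M t. 1/2 \<le> M \<and> M \<le> 1 \<and> t \<in> topspace A \<and> N t \<le> M \<longrightarrow> N (D M t) = N t / M)"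

text \<open>Joint continuity in factor and point allows the factor to vary with the point, as it
  must in a collar.\<close>

lemma dilation_continuous:
  assumes "dilation_structure A N D" and m: "continuous_map X euclideanreal m" and a: "continuous_map X A a"
    and *: "\<And>x. x \<in> topspace X \<Longrightarrow> 1/2 \<le> m x \<and> m x \<le> 1 \<and> N (a x) \<le> m x"
  shows "continuous_map X A (\<lambda>x. D (m x) (a x))"
proof -
  let ?S = "{(M, t). 1/2 \<le> M \<and> M \<le> 1 \<and> N t \<le> M}"
  have D: "continuous_map (subtopology (prod_topology euclideanreal A) ?S) A (\<lambda>(M, t). D M t)"
    using assms(1) by (simp add: dilation_structure_def)
  have "continuous_map X (subtopology (prod_topology euclideanreal A) ?S) (\<lambda>x. (m x, a x))"
    using m a * by (simp add: continuous_map_in_subtopology continuous_map_pairwise o_def)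
  from continuous_map_compose'[OF this D] show ?thesis by simp
qed

lemma unit_interval_iff: "(x::real) \<in> {0..1} \<longleftrightarrow> \<bar>2 * x - 1\<bar> \<le> 1"
  by (auto simp: abs_le_iff)

lemma dilation_structure_interval:
  "dilation_structure (top_of_set {0..1::real}) (\<lambda>s. \<bar>2 * s - 1\<bar>) (\<lambda>M s. 1/2 + (s - 1/2) / M)"
proof -
  let ?I = "top_of_set {0..1::real}" and ?N = "\<lambda>s::real. \<bar>2 * s - 1\<bar>" and ?D = "\<lambda>M s::real. 1/2 + (s - 1/2) / M"
  have N: "?N (?D M s) = ?N s / M" if "1/2 \<le> M" for M s
  proof -
    have "2 * ?D M s - 1 = (2 * s - 1) / M" using that by (simp add: field_simps)
    then show ?thesis using that by simp
  qed
  have le: "?N (?D M s) \<le> 1" if "1/2 \<le> M" "?N s \<le> M" for M s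
    using that by (subst N) auto
  have "continuous_map ?I euclideanreal ?N"
    by (intro continuous_map_from_subtopology continuous_intros) auto
  moreover have "continuous_map (subtopology (prod_topology euclideanreal ?I) {(M, t). 1/2 \<le> M \<and> M \<le> 1 \<and> ?N t \<le> M}) ?I
       (\<lambda>(M, t). ?D M t)" (is "continuous_map ?S _ _")
  proof -
    have 1: "continuous_map ?S euclideanreal fst" "continuous_map ?S ?I snd"
      by (auto intro: continuous_map_from_subtopology continuous_map_fst continuous_map_snd)
    then have 2: "continuous_map ?S euclideanreal snd"
      by (simp add: continuous_map_in_subtopology)
    have "continuous_map ?S euclideanreal (\<lambda>p. ?D (fst p) (snd p))"
      using 1 2 by (intro continuous_intros) auto
    moreover have "?D (fst p) (snd p) \<in> {0..1}" if "p \<in> topspace ?S" for p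
      by (rule unit_interval_iff[THEN iffD2, OF le]) (use that in auto)
    ultimately show ?thesis
      unfolding continuous_map_in_subtopology case_prod_unfold by (intro conjI funcsetI)
  qed
  ultimately show ?thesis
    unfolding dilation_structure_def using N by (auto simp: abs_le_iff)
qed

text \<open>For the interval and a cube, the maximum of the gauges is 1 exactly on the two ends and
  on the sides of the cylinder, so homotopies are lifted in the same way as spheroids.\<close>

lemma dilation_structure_prod:
  assumes A: "dilation_structure A N D" and A': "dilation_structure A' N' D'"
  shows "dilation_structure (prod_topology A A') (\<lambda>p. max (N (fst p)) (N' (snd p)))
    (\<lambda>M p. (D M (fst p), D' M (snd p)))"
proof -
  let ?P = "prod_topology A A'"
  let ?N = "\<lambda>p. max (N (fst p)) (N' (snd p))" and ?D = "\<lambda>M p. (D M (fst p), D' M (snd p))"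
  let ?S = "subtopology (prod_topology euclideanreal ?P) {(M, t). 1/2 \<le> M \<and> M \<le> 1 \<and> ?N t \<le> M}"
  have "continuous_map A euclideanreal N" "continuous_map A' euclideanreal N'"
    using assms by (auto simp: dilation_structure_def)
  then have "continuous_map ?P euclideanreal ?N"
    by (intro continuous_intros continuous_map_compose'[OF continuous_map_fst] continuous_map_compose'[OF continuous_map_snd])
  moreover have "continuous_map ?S ?P (\<lambda>(M, t). ?D M t)"
  proof -
    have 1: "continuous_map ?S euclideanreal fst" "continuous_map ?S ?P snd"
      by (auto intro: continuous_map_from_subtopology continuous_map_fst continuous_map_snd)
    have "continuous_map ?S A (\<lambda>q. D (fst q) (fst (snd q)))"
      by (rule dilation_continuous[OF A 1(1) continuous_map_compose'[OF 1(2) continuous_map_fst]]) auto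
    moreover have "continuous_map ?S A' (\<lambda>q. D' (fst q) (snd (snd q)))"
      by (rule dilation_continuous[OF A' 1(1) continuous_map_compose'[OF 1(2) continuous_map_snd]]) auto
    ultimately show ?thesis
      by (simp add: continuous_map_pairwise o_def case_prod_unfold)
  qed
  moreover have "?N (?D M p) = ?N p / M" if "1/2 \<le> M" "M \<le> 1" "p \<in> topspace ?P" "?N p \<le> M" for M p
  proof -
    have "N (D M (fst p)) = N (fst p) / M" "N' (D' M (snd p)) = N' (snd p) / M"
      using that assms unfolding dilation_structure_def by auto
    then show ?thesis using that(1) by (simp add: max_divide_distrib_right)
  qed
  moreover have "\<forall>t\<in>topspace ?P. 0 \<le> ?N t \<and> ?N t \<le> 1 \<and> ?D 1 t = t"
    using assms by (auto simp: dilation_structure_def le_max_iff_disj)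
  ultimately show ?thesis
    unfolding dilation_structure_def by blast
qed

text \<open>The factor 2 gives the faces the value 1. The value 0 for \<open>n = 0\<close> agrees
  with the empty boundary of the cube of dimension 0.\<close>

fun cube_norm :: "nat \<Rightarrow> (nat \<Rightarrow> real) \<Rightarrow> real" where
  "cube_norm 0 t = 0"
| "cube_norm (Suc n) t = max (cube_norm n t) \<bar>2 * t n - 1\<bar>"

lemma cube_norm_nonneg: "0 \<le> cube_norm n t"
  by (induction n) (auto simp: le_max_iff_disj)

lemma cube_norm_le_iff: "0 \<le> c \<Longrightarrow> cube_norm n t \<le> c \<longleftrightarrow> (\<forall>i<n. \<bar>2 * t i - 1\<bar> \<le> c)"
  by (induction n) (auto simp: less_Suc_eq)

lemma cube_norm_scale:
  "1/2 \<le> M \<Longrightarrow> (\<And>i. i < n \<Longrightarrow> s i = 1/2 + (t i - 1/2) / M) \<Longrightarrow> cube_norm n s = cube_norm n t / M"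
proof (induction n)
  case (Suc n)
  have "2 * s n - 1 = (2 * t n - 1) / M" using Suc.prems by (simp add: field_simps)
  then show ?case using Suc by (simp add: max_divide_distrib_right)
qed simp

lemma topspace_cube: "topspace (cube n) = {..<n} \<rightarrow>\<^sub>E {0..1}"
  by (simp add: cube_def)

lemma cube_norm_ge_iff: "0 < c \<Longrightarrow> c \<le> cube_norm n t \<longleftrightarrow> (\<exists>i<n. c \<le> \<bar>2 * t i - 1\<bar>)"
  by (induction n) (auto simp: less_Suc_eq le_max_iff_disj)

lemma cube_norm_le_1: "t \<in> topspace (cube n) \<Longrightarrow> cube_norm n t \<le> 1"
  by (auto simp: cube_norm_le_iff topspace_cube abs_le_iff PiE_iff)

lemma cube_norm_eq_1:
  assumes "t \<in> topspace (cube n)"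
  shows "cube_norm n t = 1 \<longleftrightarrow> t \<in> cube_boundary n"
proof -
  have "cube_norm n t = 1 \<longleftrightarrow> 1 \<le> cube_norm n t"
    using cube_norm_le_1[OF assms] by linarith
  also have "\<dots> \<longleftrightarrow> (\<exists>i<n. 1 \<le> \<bar>2 * t i - 1\<bar>)"
    by (rule cube_norm_ge_iff) simp
  also have "\<dots> \<longleftrightarrow> (\<exists>i<n. t i = 0 \<or> t i = 1)"
  proof -
    have "1 \<le> \<bar>2 * t i - 1\<bar> \<longleftrightarrow> t i = 0 \<or> t i = 1" if "i < n" for i
    proof -
      have "0 \<le> t i" "t i \<le> 1" using assms that by (auto simp: topspace_cube PiE_iff)
      then show ?thesis by (auto simp: abs_if)
    qed
    then show ?thesis by blast
  qed
  finally show ?thesis using assms by (simp add: cube_boundary_def)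
qed

lemma continuous_map_cube_component: "i < n \<Longrightarrow> continuous_map (cube n) euclideanreal (\<lambda>t. t i)"
  using continuous_map_product_projection[of i "{..<n}" "\<lambda>_. top_of_set {0..1::real}"]
  by (simp add: cube_def continuous_map_in_subtopology)

lemma dilation_structure_cube:
  "dilation_structure (cube n) (cube_norm n) (\<lambda>M t. \<lambda>i\<in>{..<n}. 1/2 + (t i - 1/2) / M)"
proof -
  let ?D = "\<lambda>M t. \<lambda>i\<in>{..<n}. 1/2 + (t i - 1/2) / M :: real"
  let ?S = "subtopology (prod_topology euclideanreal (cube n)) {(M, t). 1/2 \<le> M \<and> M \<le> 1 \<and> cube_norm n t \<le> M}"
  have "continuous_map (cube n) euclideanreal (cube_norm m)" if "m \<le> n" for m
    using that
  proof (induction m)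
    case (Suc m)
    then have "continuous_map (cube n) euclideanreal (\<lambda>t. max (cube_norm m t) \<bar>2 * t m - 1\<bar>)"
      by (intro continuous_intros continuous_map_cube_component) auto
    then show ?case by (rule continuous_map_eq) simp
  next
    case 0
    have "cube_norm 0 = (\<lambda>_. 0)" by (rule ext) simp
    then show ?case by simp
  qed
  moreover have "continuous_map ?S (cube n) (\<lambda>(M, t). ?D M t)"
  proof -
    have 1: "continuous_map ?S euclideanreal fst" "continuous_map ?S (cube n) snd"
      by (auto intro: continuous_map_from_subtopology continuous_map_fst continuous_map_snd)
    have "continuous_map ?S (top_of_set {0..1}) (\<lambda>q. ?D (fst q) (snd q) i)" if i: "i < n" for i
    proof -
      have "continuous_map ?S euclideanreal (\<lambda>q. 1/2 + (snd q i - 1/2) / fst q)"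
        using 1 i by (intro continuous_intros continuous_map_compose'[OF _ continuous_map_cube_component]) auto
      \<comment> \<open>The dilated point lies in the cube because its norm is
        \<open>cube_norm n (snd q) / fst q\<close>, which is at most 1 on this domain.\<close>
      moreover have "1/2 + (snd q i - 1/2) / fst q \<in> {0..1}" if q: "q \<in> topspace ?S" for q
      proof -
        have "cube_norm n (?D (fst q) (snd q)) = cube_norm n (snd q) / fst q"
          using q by (intro cube_norm_scale) auto
        also have "\<dots> \<le> 1" using q by auto
        finally have "\<bar>2 * ?D (fst q) (snd q) i - 1\<bar> \<le> 1"
          using i by (simp only: cube_norm_le_iff)
        then have "?D (fst q) (snd q) i \<in> {0..1}" by (simp only: unit_interval_iff)
        then show ?thesis using i by simp
      qed
      ultimately show ?thesis
        using i by (intro continuous_map_in_subtopology[THEN iffD2] conjI funcsetI) simp_all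
    qed
    then have "continuous_map ?S (cube n) (\<lambda>q. ?D (fst q) (snd q))"
      unfolding cube_def by (subst continuous_map_componentwise) auto
    then show ?thesis by (simp add: case_prod_unfold)
  qed
  moreover have "cube_norm n t \<le> 1 \<and> ?D 1 t = t" if "t \<in> topspace (cube n)" for t
  proof
    show "cube_norm n t \<le> 1"
      using that by (rule cube_norm_le_1)
    show "?D 1 t = t"
      using that by (intro extensionalityI[of _ "{..<n}"]) (auto simp: topspace_cube PiE_iff)
  qed
  ultimately show ?thesis
    unfolding dilation_structure_def using cube_norm_nonneg cube_norm_scale by simp
qed

section \<open>Lifting up to homotopy\<close>

context cg_universe
begin

text \<open>Not the homotopy lifting property of a fibration: maps from compact Hausdorff spaces
  lift, and two lifts of the same map are homotopic through lifts, with nothing prescribed on a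
  subspace. This is the form in which weak parashrinkability is used.\<close>

definition homotopy_lifting :: "'u topology \<Rightarrow> 'u topology \<Rightarrow> ('u \<Rightarrow> 'u) \<Rightarrow> bool" where
  "homotopy_lifting Z T z \<longleftrightarrow> continuous_map Z T z \<and>
    (\<forall>D::'u topology. D \<in> CGTop \<and> compact_space D \<and> Hausdorff_space D \<longrightarrow>
      (\<forall>q. continuous_map D T q \<longrightarrow> (\<exists>s. continuous_map D Z s \<and> (\<forall>d\<in>topspace D. z (s d) = q d))) \<and>
      (\<forall>s0 s1. continuous_map D Z s0 \<and> continuous_map D Z s1 \<and> (\<forall>d\<in>topspace D. z (s0 d) = z (s1 d)) \<longrightarrow>
        (\<exists>H. continuous_map (prod_topology (top_of_set {0..1::real}) D) Z (\<lambda>(t, d). H t d) \<and>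
           (\<forall>d\<in>topspace D. H 0 d = s0 d \<and> H 1 d = s1 d \<and> (\<forall>t\<in>{0..1}. z (H t d) = z (s0 d))))))"

lemma homotopy_liftingD:
  fixes D :: "'u topology"
  assumes "homotopy_lifting Z T z" "D \<in> CGTop" "compact_space D" "Hausdorff_space D"
  shows "continuous_map D T q \<Longrightarrow> \<exists>s. continuous_map D Z s \<and> (\<forall>d\<in>topspace D. z (s d) = q d)"
    and "\<lbrakk>continuous_map D Z s0; continuous_map D Z s1; \<forall>d\<in>topspace D. z (s0 d) = z (s1 d)\<rbrakk> \<Longrightarrow>
        \<exists>H. continuous_map (prod_topology (top_of_set {0..1::real}) D) Z (\<lambda>(t, d). H t d) \<and>
           (\<forall>d\<in>topspace D. H 0 d = s0 d \<and> H 1 d = s1 d \<and> (\<forall>t\<in>{0..1}. z (H t d) = z (s0 d)))"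
proof -
  note * = assms(1)[unfolded homotopy_lifting_def, THEN conjunct2, THEN spec, THEN mp,
      OF conjI[OF assms(2) conjI[OF assms(3,4)]]]
  show "\<exists>s. continuous_map D Z s \<and> (\<forall>d\<in>topspace D. z (s d) = q d)" if "continuous_map D T q"
    using *[THEN conjunct1, THEN spec, THEN mp, OF that] .
  show "\<exists>H. continuous_map (prod_topology (top_of_set {0..1::real}) D) Z (\<lambda>(t, d). H t d) \<and>
           (\<forall>d\<in>topspace D. H 0 d = s0 d \<and> H 1 d = s1 d \<and> (\<forall>t\<in>{0..1}. z (H t d) = z (s0 d)))"
    if "continuous_map D Z s0" "continuous_map D Z s1" "\<forall>d\<in>topspace D. z (s0 d) = z (s1 d)"
    using *[THEN conjunct2, THEN spec, THEN spec, THEN mp, OF conjI[OF that(1) conjI[OF that(2,3)]]] .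
qed

text \<open>This lemma and the next carry the two halves of \<open>homotopy_lifting\<close> over to
  sources of other types, such as cubes.\<close>

lemma homotopy_lifting_exists:
  fixes A :: "'a topology"
  assumes "homotopy_lifting Z T z" and A: "compact_space A" "Hausdorff_space A" "small (topspace A)"
    and q: "continuous_map A T q"
  obtains s where "continuous_map A Z s" "\<And>a. a \<in> topspace A \<Longrightarrow> z (s a) = q a"
proof -
  obtain D :: "'u topology" and i where D: "D \<in> CGTop" "compact_space D" "Hausdorff_space D"
    and h: "homeomorphic_maps A D i (inv_into (topspace A) i)"
    using compact_Hausdorff_transport[OF A] by metis
  let ?r = "inv_into (topspace A) i"
  have i: "continuous_map A D i" and r: "continuous_map D A ?r"
    and ri: "\<And>a. a \<in> topspace A \<Longrightarrow> ?r (i a) = a"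
    using h by (auto simp: homeomorphic_maps_def)
  have "continuous_map D T (\<lambda>d. q (?r d))" using continuous_map_compose'[OF r q] .
  then obtain s where s: "continuous_map D Z s" "\<forall>d\<in>topspace D. z (s d) = q (?r d)"
    using homotopy_liftingD(1)[OF assms(1) D] by auto
  show thesis
  proof
    show "continuous_map A Z (\<lambda>a. s (i a))" using continuous_map_compose'[OF i s(1)] .
    show "z (s (i a)) = q a" if "a \<in> topspace A" for a
    proof -
      have "i a \<in> topspace D" using i that by (auto simp: continuous_map_def)
      then show ?thesis using s(2) ri[OF that] by simp
    qed
  qed
qed

lemma homotopy_lifting_unique:
  fixes A :: "'a topology"
  assumes "homotopy_lifting Z T z" and A: "compact_space A" "Hausdorff_space A" "small (topspace A)"
    and s: "continuous_map A Z s0" "continuous_map A Z s1" "\<And>a. a \<in> topspace A \<Longrightarrow> z (s0 a) = z (s1 a)"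
  obtains H where "continuous_map (prod_topology (top_of_set {0..1::real}) A) Z (\<lambda>(t, a). H t a)"
    "\<And>a. a \<in> topspace A \<Longrightarrow> H 0 a = s0 a" "\<And>a. a \<in> topspace A \<Longrightarrow> H 1 a = s1 a"
    "\<And>t a. \<lbrakk>t \<in> {0..1}; a \<in> topspace A\<rbrakk> \<Longrightarrow> z (H t a) = z (s0 a)"
proof -
  obtain D :: "'u topology" and i where D: "D \<in> CGTop" "compact_space D" "Hausdorff_space D"
    and h: "homeomorphic_maps A D i (inv_into (topspace A) i)"
    using compact_Hausdorff_transport[OF A] by metis
  let ?r = "inv_into (topspace A) i"
  have i: "continuous_map A D i" and r: "continuous_map D A ?r"
    and ri: "\<And>a. a \<in> topspace A \<Longrightarrow> ?r (i a) = a"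
    using h by (auto simp: homeomorphic_maps_def)
  have iD: "i a \<in> topspace D" if "a \<in> topspace A" for a using i that by (auto simp: continuous_map_def)
  have "continuous_map D Z (\<lambda>d. s0 (?r d))" "continuous_map D Z (\<lambda>d. s1 (?r d))"
    using continuous_map_compose'[OF r s(1)] continuous_map_compose'[OF r s(2)] .
  note 1 = this
  have 2: "\<forall>d\<in>topspace D. z (s0 (?r d)) = z (s1 (?r d))"
    using s(3) r by (auto simp: continuous_map_def)
  obtain H where H: "continuous_map (prod_topology (top_of_set {0..1::real}) D) Z (\<lambda>(t, d). H t d)"
    "\<forall>d\<in>topspace D. H 0 d = s0 (?r d) \<and> H 1 d = s1 (?r d) \<and> (\<forall>t\<in>{0..1}. z (H t d) = z (s0 (?r d)))"
    using homotopy_liftingD(2)[OF assms(1) D 1 2] by auto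
  show thesis
  proof
    let ?P = "prod_topology (top_of_set {0..1::real}) A"
    have "continuous_map ?P (prod_topology (top_of_set {0..1::real}) D) (\<lambda>p. (fst p, i (snd p)))"
      by (simp add: continuous_map_pairwise o_def continuous_map_fst continuous_map_compose'[OF continuous_map_snd i])
    from continuous_map_compose'[OF this H(1)]
    show "continuous_map ?P Z (\<lambda>(t, a). H t (i a))" by (simp add: case_prod_unfold)
    show "H 0 (i a) = s0 a" "H 1 (i a) = s1 a" if "a \<in> topspace A" for a
      using H(2)[rule_format, OF iD[OF that]] ri[OF that] by simp_all
    show "z (H t (i a)) = z (s0 a)" if "t \<in> {0..1}" "a \<in> topspace A" for t a
      using H(2)[rule_format, OF iD[OF that(2)]] ri[OF that(2)] that(1) by simp
  qed
qed

text \<open>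
  Relative lifting: a lift over the whole cube need not extend the lift \<open>\<sigma>\<close> given on the boundary,
  but the two are homotopic there; this homotopy is inserted in the collar \<open>1/2 \<le> N \<le> 1\<close>.
\<close>

lemma relative_lifting:
  fixes A :: "'a topology"
  assumes hl: "homotopy_lifting Z T z" and A: "compact_space A" "Hausdorff_space A" "small (topspace A)"
    and ds: "dilation_structure A N D"
    and q: "continuous_map A T q"
    and \<sigma>: "continuous_map (subtopology A {a. N a = 1}) Z \<sigma>"
    and z\<sigma>: "\<And>a. \<lbrakk>a \<in> topspace A; N a = 1\<rbrakk> \<Longrightarrow> z (\<sigma> a) = q a"
  obtains \<sigma>' h where "continuous_map A Z \<sigma>'" "\<And>a. \<lbrakk>a \<in> topspace A; N a = 1\<rbrakk> \<Longrightarrow> \<sigma>' a = \<sigma> a"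
    "continuous_map (prod_topology (top_of_set {0..1::real}) A) T (\<lambda>(t, a). h t a)"
    "\<And>a. a \<in> topspace A \<Longrightarrow> h 0 a = z (\<sigma>' a)" "\<And>a. a \<in> topspace A \<Longrightarrow> h 1 a = q a"
    "\<And>t a. \<lbrakk>t \<in> {0..1}; a \<in> topspace A; N a = 1\<rbrakk> \<Longrightarrow> h t a = q a"
proof -
  have contN: "continuous_map A euclideanreal N"
    and N: "\<And>a. a \<in> topspace A \<Longrightarrow> 0 \<le> N a \<and> N a \<le> 1" and D1: "\<And>a. a \<in> topspace A \<Longrightarrow> D 1 a = a"
    and ND: "\<And>M a. \<lbrakk>1/2 \<le> M; M \<le> 1; a \<in> topspace A; N a \<le> M\<rbrakk> \<Longrightarrow> N (D M a) = N a / M"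
    using ds by (auto simp: dilation_structure_def)
  \<comment> \<open>A lift over all of \<open>A\<close>, in general different from
    \<open>\<sigma>\<close> where \<open>N = 1\<close>.\<close>
  obtain \<sigma>0 where \<sigma>0: "continuous_map A Z \<sigma>0" "\<And>a. a \<in> topspace A \<Longrightarrow> z (\<sigma>0 a) = q a"
    using homotopy_lifting_exists[OF hl A q] by metis
  let ?B = "subtopology A {a. N a = 1}"
  have "closedin A {a \<in> topspace A. N a \<in> {1}}"
    using contN by (rule closedin_continuous_map_preimage) simp
  then have closedB: "closedin A (topspace A \<inter> {a. N a = 1})" by (simp add: Int_def)
  have B: "compact_space ?B" "Hausdorff_space ?B" "small (topspace ?B)"
    using closedin_compact_Hausdorff_subtopology(1,2)[OF A(1,2) closedB] small_subset[OF A(3), of "topspace ?B"]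
    by (simp_all add: subtopology_restrict)
  \<comment> \<open>On the boundary \<open>\<sigma>0\<close> and \<open>\<sigma>\<close> lift the
    same map, hence are homotopic through lifts.\<close>
  obtain H where H: "continuous_map (prod_topology (top_of_set {0..1::real}) ?B) Z (\<lambda>(t, a). H t a)"
    "\<And>a. a \<in> topspace ?B \<Longrightarrow> H 0 a = \<sigma>0 a" "\<And>a. a \<in> topspace ?B \<Longrightarrow> H 1 a = \<sigma> a"
    "\<And>t a. \<lbrakk>t \<in> {0..1}; a \<in> topspace ?B\<rbrakk> \<Longrightarrow> z (H t a) = z (\<sigma>0 a)"
    by (rule homotopy_lifting_unique[OF hl B continuous_map_from_subtopology[OF \<sigma>0(1)] \<sigma>])
      (use \<sigma>0(2) z\<sigma> in auto)
  \<comment> \<open>The map \<open>r\<close> dilates the part \<open>N \<le> 1/2\<close> by the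
    factor 2 and sends the collar \<open>N \<ge> 1/2\<close> radially to the boundary
    \<open>N = 1\<close>.\<close>
  define r where "r = (\<lambda>a. D (max (N a) (1/2)) a)"
  have r: "continuous_map A A r"
    unfolding r_def
    using continuous_map_id[of A, unfolded id_def] N
    by (intro dilation_continuous[OF ds] continuous_intros contN) auto
  have Nr: "N (r a) = N a / max (N a) (1/2)" if "a \<in> topspace A" for a
    unfolding r_def using that N by (intro ND) auto
  have rA: "r a \<in> topspace A" if "a \<in> topspace A" for a
    using r that by (auto simp: continuous_map_def)
  have rB: "r a \<in> topspace ?B" if "a \<in> topspace A" "1/2 \<le> N a" for a
    using rA Nr that by (auto simp: max_def)
  have r1: "r a = a" if "a \<in> topspace A" "N a = 1" for a
    using that D1 by (simp add: r_def)
  \<comment> \<open>Across the collar the homotopy runs from \<open>\<sigma>0\<close> at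
    \<open>N = 1/2\<close> to \<open>\<sigma>\<close> at \<open>N = 1\<close>.\<close>
  define \<sigma>' where "\<sigma>' = (\<lambda>a. if N a \<le> 1/2 then \<sigma>0 (r a) else H (2 * N a - 1) (r a))"
  have z\<sigma>': "z (\<sigma>' a) = q (r a)" if "a \<in> topspace A" for a
    using that rB[OF that] rA[OF that] N[OF that] H(4) \<sigma>0(2) by (auto simp: \<sigma>'_def)
  show thesis
  proof
    show "continuous_map A Z \<sigma>'"
      unfolding \<sigma>'_def
    proof (rule continuous_map_cases_le)
      show "continuous_map (subtopology A {a \<in> topspace A. N a \<le> 1/2}) Z (\<lambda>a. \<sigma>0 (r a))"
        by (intro continuous_map_from_subtopology continuous_map_compose'[OF r] \<sigma>0)
      let ?S = "subtopology A {a \<in> topspace A. 1/2 \<le> N a}"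
      have "continuous_map ?S (prod_topology (top_of_set {0..1::real}) ?B) (\<lambda>a. (2 * N a - 1, r a))"
        unfolding continuous_map_pairwise o_def fst_conv snd_conv continuous_map_in_subtopology
        using N rB by (intro conjI funcsetI continuous_intros continuous_map_from_subtopology contN r) auto
      from continuous_map_compose'[OF this H(1)]
      show "continuous_map ?S Z (\<lambda>a. H (2 * N a - 1) (r a))" by simp
      show "\<sigma>0 (r a) = H (2 * N a - 1) (r a)" if "a \<in> topspace A" "N a = 1/2" for a
      proof -
        have e: "2 * N a - 1 = 0" using that by simp
        have "H 0 (r a) = \<sigma>0 (r a)" using H(2)[OF rB[of a]] that by simp
        then show ?thesis unfolding e by (rule sym)
      qed
    qed (auto intro: contN)
    show "\<sigma>' a = \<sigma> a" if "a \<in> topspace A" "N a = 1" for a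
      using that r1[OF that] H(3)[of a] by (simp add: \<sigma>'_def)
    let ?P = "prod_topology (top_of_set {0..1::real}) A"
    \<comment> \<open>The factor moves linearly from that of \<open>r\<close> at
      \<open>t = 0\<close> to 1, the identity, at \<open>t = 1\<close>; on the boundary it is 1
      throughout. Composed with \<open>q\<close> this joins \<open>z \<circ> \<sigma>'\<close> to
      \<open>q\<close> relative to the boundary.\<close>
    let ?m = "\<lambda>t a. (1 - t) * max (N a) (1/2) + t"
    have m: "1/2 \<le> ?m t a \<and> ?m t a \<le> 1 \<and> N a \<le> ?m t a" if "t \<in> {0..1}" "a \<in> topspace A" for t a
    proof -
      have "(1 - t) * max (N a) (1/2) \<le> (1 - t) * 1"
        using that N[of a] by (intro mult_left_mono) auto
      moreover have "max (N a) (1/2) \<le> ?m t a"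
      proof -
        have "0 \<le> t * (1 - max (N a) (1/2))" using that N[of a] by simp
        then show ?thesis by (simp add: algebra_simps)
      qed
      ultimately show ?thesis by simp
    qed
    have fs: "continuous_map ?P euclideanreal fst" "continuous_map ?P A snd"
      using continuous_map_fst[of "top_of_set {0..1::real}" A] by (auto simp: continuous_map_in_subtopology continuous_map_snd)
    have "continuous_map ?P A (\<lambda>p. D (?m (fst p) (snd p)) (snd p))"
      using m by (intro dilation_continuous[OF ds] continuous_intros fs continuous_map_compose'[OF fs(2) contN]) auto
    from continuous_map_compose'[OF this q]
    show "continuous_map ?P T (\<lambda>(t, a). q (D (?m t a) a))" by (simp add: case_prod_unfold)
    show "q (D (?m 0 a) a) = z (\<sigma>' a)" if "a \<in> topspace A" for a
      using z\<sigma>'[OF that] by (simp add: r_def)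
    show "q (D (?m 1 a) a) = q a" if "a \<in> topspace A" for a using D1[OF that] by simp
    show "q (D (?m t a) a) = q a" if "t \<in> {0..1}" "a \<in> topspace A" "N a = 1" for t a
      using that D1[OF that(2)] by simp
  qed
qed

lemma small_cube: "small (topspace (cube n))" and compact_cube: "compact_space (cube n)"
    and Hausdorff_cube: "Hausdorff_space (cube n)"
proof -
  show "small (topspace (cube n))" by (rule small_subset[OF small_real_functions]) simp
  show "compact_space (cube n)"
    by (auto simp: cube_def compact_space_product_topology compact_space_subtopology)
  show "Hausdorff_space (cube n)"
    by (auto simp: cube_def Hausdorff_space_product_topology Hausdorff_space_subtopology)
qed

lemma small_interval: "small (topspace (top_of_set {0..1::real}))"
    and compact_interval: "compact_space (top_of_set {0..1::real})"
    and Hausdorff_interval: "Hausdorff_space (top_of_set {0..1::real})"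
  by (auto intro: small_subset[OF small_real] compact_space_subtopology Hausdorff_space_subtopology)

end

text \<open>Path components and homotopy groups are both quotients by a relation, and both induced
  maps send a class to the class generated by its image, so one argument serves for both. It works
  with representatives: the image of the class of \<open>a\<close> generates the class of
  \<open>\<phi> a\<close>.\<close>

lemma bij_betw_quotient_classes:
  assumes refl: "\<And>a. a \<in> S \<Longrightarrow> (a, a) \<in> R" and "sym R" "trans R"
    and refl': "\<And>a. a \<in> S' \<Longrightarrow> (a, a) \<in> R'" and "sym R'" "trans R'"
    and \<phi>: "\<And>a. a \<in> S \<Longrightarrow> \<phi> a \<in> S'" and R: "\<And>a b. (a, b) \<in> R \<Longrightarrow> (\<phi> a, \<phi> b) \<in> R'"
    and inj: "\<And>a b. \<lbrakk>a \<in> S; b \<in> S; (\<phi> a, \<phi> b) \<in> R'\<rbrakk> \<Longrightarrow> (a, b) \<in> R"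
    and surj: "\<And>c. c \<in> S' \<Longrightarrow> \<exists>a\<in>S. (\<phi> a, c) \<in> R'"
  shows "bij_betw (\<lambda>C. R' `` (\<phi> ` C)) (S // R) (S' // R')"
proof -
  have cls: "R' `` (\<phi> ` (R `` {a})) = R' `` {\<phi> a}" if "a \<in> S" for a
    using R refl[OF that] \<open>sym R'\<close> \<open>trans R'\<close> by (auto simp: Image_iff dest: transD symD)
  have eq: "R `` {a} = R `` {b}" if "(a, b) \<in> R" for a b
    using that \<open>sym R\<close> \<open>trans R\<close> by (auto dest: transD symD)
  have eq': "R' `` {a} = R' `` {b}" if "(a, b) \<in> R'" for a b
    using that \<open>sym R'\<close> \<open>trans R'\<close> by (auto dest: transD symD)
  show ?thesis
    unfolding bij_betw_def
  proof
    show "inj_on (\<lambda>C. R' `` (\<phi> ` C)) (S // R)"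
    proof (rule inj_onI)
      fix C C' assume "C \<in> S // R" "C' \<in> S // R" and e: "R' `` (\<phi> ` C) = R' `` (\<phi> ` C')"
      then obtain a b where ab: "a \<in> S" "C = R `` {a}" "b \<in> S" "C' = R `` {b}"
        by (auto simp: quotient_def)
      then have "R' `` {\<phi> a} = R' `` {\<phi> b}" using e cls by metis
      then have "(\<phi> a, \<phi> b) \<in> R'" using refl'[OF \<phi>[OF ab(3)]] by blast
      then show "C = C'" using inj ab eq by metis
    qed
    show "(\<lambda>C. R' `` (\<phi> ` C)) ` (S // R) = S' // R'"
    proof
      show "(\<lambda>C. R' `` (\<phi> ` C)) ` (S // R) \<subseteq> S' // R'"
      proof
        fix C assume "C \<in> (\<lambda>C. R' `` (\<phi> ` C)) ` (S // R)"
        then obtain a where "a \<in> S" "C = R' `` (\<phi> ` (R `` {a}))" by (auto simp: quotient_def)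
        then show "C \<in> S' // R'" using cls \<phi> by (metis quotientI)
      qed
      show "S' // R' \<subseteq> (\<lambda>C. R' `` (\<phi> ` C)) ` (S // R)"
      proof
        fix C assume "C \<in> S' // R'"
        then obtain c where c: "c \<in> S'" "C = R' `` {c}" by (auto simp: quotient_def)
        then obtain a where a: "a \<in> S" "(\<phi> a, c) \<in> R'" using surj by blast
        then have "C = R' `` (\<phi> ` (R `` {a}))" using cls[OF a(1)] eq'[OF a(2)] c(2) by simp
        then show "C \<in> (\<lambda>C. R' `` (\<phi> ` C)) ` (S // R)"
          using a(1) by (auto simp: quotient_def)
      qed
    qed
  qed
qed

lemma cube_boundary_subset: "cube_boundary n \<subseteq> topspace (cube n)"
  by (auto simp: cube_boundary_def)

text \<open>The condition imposed on the stages of the homotopy depends only on values on the cube,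
  so the ends of the homotopy need to agree with \<open>g\<close> and \<open>h\<close> only
  there.\<close>

lemma homotopy_rel_iff:
  "(g, h) \<in> homotopy_rel n X x \<longleftrightarrow>
    (\<exists>H. continuous_map (prod_topology (top_of_set {0..1::real}) (cube n)) X H \<and>
       (\<forall>t\<in>topspace (cube n). H (0, t) = g t) \<and> (\<forall>t\<in>topspace (cube n). H (1, t) = h t) \<and>
       (\<forall>s\<in>{0..1}. \<forall>t\<in>cube_boundary n. H (s, t) = x))"
proof -
  have "(h ` cube_boundary n \<subseteq> {x}) = (k ` cube_boundary n \<subseteq> {x})"
    if "\<And>t. t \<in> topspace (cube n) \<Longrightarrow> h t = k t" for h k :: "_ \<Rightarrow> 'a"
  proof -
    have "h ` cube_boundary n = k ` cube_boundary n"
      using that cube_boundary_subset by (intro image_cong) auto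
    then show ?thesis by simp
  qed
  from homotopic_with[where P = "\<lambda>k. k ` cube_boundary n \<subseteq> {x}", OF this]
  show ?thesis by (auto simp: homotopy_rel_def image_subset_iff)
qed

lemma sym_homotopy_rel: "sym (homotopy_rel n X x)"
  by (auto simp: homotopy_rel_def sym_def dest: homotopic_with_symD)

lemma trans_homotopy_rel: "trans (homotopy_rel n X x)"
  unfolding homotopy_rel_def trans_def using homotopic_with_trans by fastforce

context cg_universe
begin

theorem weak_equivalence_of_homotopy_lifting:
  assumes hl: "homotopy_lifting Z T z"
  shows "weak_equivalence Z T z"
  unfolding weak_equivalence_def
proof (intro conjI allI impI ballI)
  show z: "continuous_map Z T z" using hl by (simp add: homotopy_lifting_def)
  have zT: "z x \<in> topspace T" if "x \<in> topspace Z" for x using z that by (auto simp: continuous_map_def)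
  let ?pt = "top_of_set {0::real}"
  have pt: "compact_space ?pt" "Hausdorff_space ?pt" "small (topspace ?pt)"
    by (auto intro: small_subset[OF small_real] compact_space_subtopology Hausdorff_space_subtopology)
  \<comment> \<open>Two points of a fiber are two lifts of one map from a point, and a homotopy
    between these is a path.\<close>
  have fibre_path: "path_component_of Z x y" if "x \<in> topspace Z" "y \<in> topspace Z" and e: "z x = z y" for x y
  proof -
    have 1: "continuous_map ?pt Z (\<lambda>_. x)" "continuous_map ?pt Z (\<lambda>_. y)" using that by auto
    obtain H where H: "continuous_map (prod_topology (top_of_set {0..1::real}) ?pt) Z (\<lambda>(t, a). H t a)"
      "\<And>a. a \<in> topspace ?pt \<Longrightarrow> H 0 a = x" "\<And>a. a \<in> topspace ?pt \<Longrightarrow> H 1 a = y"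
      by (rule homotopy_lifting_unique[OF hl pt 1]) (use e in auto)
    have "continuous_map (top_of_set {0..1::real}) (prod_topology (top_of_set {0..1::real}) ?pt) (\<lambda>t. (t, 0))"
      by (simp add: continuous_map_pairwise o_def) (intro continuous_intros)
    from continuous_map_compose'[OF this H(1)]
    have "pathin Z (\<lambda>t. H t 0)" by (simp add: pathin_def)
    moreover have "H 0 0 = x" "H 1 0 = y" using H(2,3) by auto
    ultimately show ?thesis unfolding path_component_of_def by blast
  qed
  \<comment> \<open>A path from \<open>z x\<close> to \<open>z y\<close> lifts; the ends of the lift
    lie in the fibers of \<open>x\<close> and \<open>y\<close>, where \<open>fibre_path\<close>
    joins them to these points.\<close>
  have inj0: "path_component_of Z x y" if x: "x \<in> topspace Z" and y: "y \<in> topspace Z"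
    and e: "path_component_of T (z x) (z y)" for x y
  proof -
    obtain q where q: "continuous_map (top_of_set {0..1::real}) T q" "q 0 = z x" "q 1 = z y"
      using e by (auto simp: path_component_of_def pathin_def)
    obtain s where s: "continuous_map (top_of_set {0..1::real}) Z s" "\<And>a. a \<in> {0..1} \<Longrightarrow> z (s a) = q a"
      using homotopy_lifting_exists[OF hl compact_interval Hausdorff_interval small_interval q(1)]
      by auto
    have sZ: "s 0 \<in> topspace Z" "s 1 \<in> topspace Z" using s(1) by (auto simp: continuous_map_def)
    note [trans] = path_component_of_trans
    have "path_component_of Z x (s 0)" using fibre_path[OF x sZ(1)] s(2) q(2) by simp
    also have "path_component_of Z (s 0) (s 1)"
      unfolding path_component_of_def pathin_def using s(1) by blast
    also have "path_component_of Z (s 1) y" using fibre_path[OF sZ(2) y] s(2) q(3) by simp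
    finally show ?thesis .
  qed
  have surj0: "\<exists>x\<in>topspace Z. path_component_of T (z x) y" if y: "y \<in> topspace T" for y
  proof -
    have "continuous_map ?pt T (\<lambda>_. y)" using y by simp
    from homotopy_lifting_exists[OF hl pt this]
    obtain s where s: "continuous_map ?pt Z s" "z (s 0) = y" by auto
    then show ?thesis
      using y by (intro bexI[of _ "s 0"]) (auto simp: path_component_of_refl continuous_map_def)
  qed
  define R where "R = (\<lambda>X :: 'u topology. {(x, y). path_component_of X x y})"
  have R: "sym (R X)" "trans (R X)" for X
    unfolding R_def sym_def trans_def using path_component_of_sym path_component_of_trans by fastforce+
  have "bij_betw (\<lambda>C. R T `` (z ` C)) (topspace Z // R Z) (topspace T // R T)"
  proof (rule bij_betw_quotient_classes[OF _ R _ R])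
    show "(z a, z b) \<in> R T" if ab: "(a, b) \<in> R Z" for a b
    proof -
      obtain g where "pathin Z g" "g 0 = a" "g 1 = b" using ab by (auto simp: R_def path_component_of_def)
      then have "pathin T (\<lambda>t. z (g t))" "z (g 0) = z a" "z (g 1) = z b"
        using continuous_map_compose'[OF _ z] by (auto simp: pathin_def)
      then show ?thesis unfolding R_def path_component_of_def by blast
    qed
  qed (use zT inj0 surj0 in \<open>auto simp: R_def path_component_of_refl\<close>)
  moreover have "path_components_of X = topspace X // R X" for X
    by (auto simp: path_components_of_def quotient_def R_def)
  moreover have "(\<lambda>C. \<Union>c\<in>C. {y. path_component_of T (z c) y}) = (\<lambda>C. R T `` (z ` C))"
    by (auto simp: R_def)
  ultimately show "bij_betw (\<lambda>C. \<Union>c\<in>C. {y. path_component_of T (z c) y}) (path_components_of Z) (path_components_of T)"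
    by simp
  fix n :: nat and x assume x: "x \<in> topspace Z"
  show "bij_betw (\<lambda>C. homotopy_rel n T (z x) `` ((\<lambda>g. z \<circ> g) ` C)) (homotopy_group n Z x) (homotopy_group n T (z x))"
    unfolding homotopy_group_def
  proof (rule bij_betw_quotient_classes[OF _ sym_homotopy_rel trans_homotopy_rel _ sym_homotopy_rel trans_homotopy_rel])
    show "(a, a) \<in> homotopy_rel n Z x" if "a \<in> spheroids n Z x" for a
      using that by (auto simp: spheroids_def homotopy_rel_def)
    show "(a, a) \<in> homotopy_rel n T (z x)" if "a \<in> spheroids n T (z x)" for a
      using that by (auto simp: spheroids_def homotopy_rel_def)
    show "z \<circ> a \<in> spheroids n T (z x)" if "a \<in> spheroids n Z x" for a
      using that z by (auto simp: spheroids_def intro: continuous_map_compose)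
    show "(z \<circ> a, z \<circ> b) \<in> homotopy_rel n T (z x)" if "(a, b) \<in> homotopy_rel n Z x" for a b
      using that z unfolding homotopy_rel_def
      by (auto elim!: homotopic_with_compose_continuous_map_left)
    \<comment> \<open>Prescribe the constant lift \<open>x\<close> on the boundary. The relative
      lift is a spheroid whose image is homotopic to \<open>g\<close> relative to the
      boundary.\<close>
    show "\<exists>a\<in>spheroids n Z x. (z \<circ> a, g) \<in> homotopy_rel n T (z x)" if g: "g \<in> spheroids n T (z x)" for g
    proof -
      have gc: "continuous_map (cube n) T g" and gb: "\<And>t. t \<in> cube_boundary n \<Longrightarrow> g t = z x"
        using g by (auto simp: spheroids_def)
      have bd: "t \<in> cube_boundary n \<longleftrightarrow> t \<in> topspace (cube n) \<and> cube_norm n t = 1" for t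
        using cube_norm_eq_1 cube_boundary_subset by blast
      obtain \<sigma> h where \<sigma>: "continuous_map (cube n) Z \<sigma>" "\<And>a. \<lbrakk>a \<in> topspace (cube n); cube_norm n a = 1\<rbrakk> \<Longrightarrow> \<sigma> a = x"
        and h: "continuous_map (prod_topology (top_of_set {0..1::real}) (cube n)) T (\<lambda>(t, a). h t a)"
          "\<And>a. a \<in> topspace (cube n) \<Longrightarrow> h 0 a = z (\<sigma> a)" "\<And>a. a \<in> topspace (cube n) \<Longrightarrow> h 1 a = g a"
          "\<And>t a. \<lbrakk>t \<in> {0..1}; a \<in> topspace (cube n); cube_norm n a = 1\<rbrakk> \<Longrightarrow> h t a = g a"
        by (rule relative_lifting[OF hl compact_cube Hausdorff_cube small_cube dilation_structure_cube gc, where \<sigma> = "\<lambda>_. x"])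
          (use x gb bd in auto)
      have "\<sigma> \<in> spheroids n Z x"
        using \<sigma> bd by (auto simp: spheroids_def)
      moreover have "(z \<circ> \<sigma>, g) \<in> homotopy_rel n T (z x)"
        unfolding homotopy_rel_iff
        using h gb bd by (intro exI[of _ "\<lambda>(t, a). h t a"]) auto
      ultimately show ?thesis by blast
    qed
    \<comment> \<open>A homotopy in \<open>T\<close> is a map on the cylinder. Prescribe
      \<open>a\<close> and \<open>b\<close> on the ends and \<open>x\<close> on the sides, and lift
      it relative to this boundary.\<close>
    show "(a, b) \<in> homotopy_rel n Z x"
      if a: "a \<in> spheroids n Z x" and b: "b \<in> spheroids n Z x" and e: "(z \<circ> a, z \<circ> b) \<in> homotopy_rel n T (z x)" for a b
    proof -
      let ?I = "top_of_set {0..1::real}"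
      let ?P = "prod_topology ?I (cube n)"
      obtain q where q: "continuous_map ?P T q"
          "\<And>t. t \<in> topspace (cube n) \<Longrightarrow> q (0, t) = z (a t)" "\<And>t. t \<in> topspace (cube n) \<Longrightarrow> q (1, t) = z (b t)"
          "\<And>s t. \<lbrakk>s \<in> {0..1}; t \<in> cube_boundary n\<rbrakk> \<Longrightarrow> q (s, t) = z x"
        using e unfolding homotopy_rel_iff o_def by metis
      let ?N = "\<lambda>p. max \<bar>2 * fst p - 1\<bar> (cube_norm n (snd p))"
      define \<sigma> where "\<sigma> = (\<lambda>p :: real \<times> (nat \<Rightarrow> real). if fst p = 0 then a (snd p) else if fst p = 1 then b (snd p) else x)"
      have ab: "continuous_map (cube n) Z a" "continuous_map (cube n) Z b"
          "\<And>t. t \<in> cube_boundary n \<Longrightarrow> a t = x" "\<And>t. t \<in> cube_boundary n \<Longrightarrow> b t = x"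
        using a b by (auto simp: spheroids_def)
      have N1: "fst p = 0 \<or> fst p = 1 \<or> snd p \<in> cube_boundary n" if "p \<in> topspace ?P" "?N p = 1" for p
        using that cube_norm_eq_1[of "snd p" n] by (auto simp: max_def abs_if split: if_splits)
      let ?B = "subtopology ?P {p. ?N p = 1}"
      have contN: "continuous_map ?P euclideanreal (\<lambda>p. fst p)" "continuous_map ?P (cube n) snd"
        using continuous_map_fst[of ?I "cube n"] by (auto simp: continuous_map_in_subtopology continuous_map_snd)
      have cn: "continuous_map ?P euclideanreal (\<lambda>p. cube_norm n (snd p))"
        using dilation_structure_cube[of n] by (intro continuous_map_compose'[OF contN(2)]) (simp add: dilation_structure_def)
      define F where "F = (\<lambda>i::nat. if i = 0 then {p \<in> topspace ?B. fst p \<in> {0}}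
         else if i = 1 then {p \<in> topspace ?B. fst p \<in> {1}} else {p \<in> topspace ?B. cube_norm n (snd p) \<in> {1}})"
      define f where "f = (\<lambda>i::nat. if i = 0 then (\<lambda>p. a (snd p)) else if i = 1 then (\<lambda>p. b (snd p))
         else (\<lambda>p :: real \<times> (nat \<Rightarrow> real). x))"
      \<comment> \<open>The prescribed lift is pasted from three closed pieces, the two ends and the
        sides; they agree where they meet since \<open>a\<close> and \<open>b\<close> are
        \<open>x\<close> on the boundary of the cube.\<close>
      have \<sigma>: "continuous_map ?B Z \<sigma>"
      proof (rule pasting_lemma_closed[where I = "{0, 1, 2}" and T = F and f = f])
        show "closedin ?B (F i)" if "i \<in> {0, 1, 2}" for i
        proof -
          have "closedin ?B {p \<in> topspace ?B. fst p \<in> {c}}" "closedin ?B {p \<in> topspace ?B. cube_norm n (snd p) \<in> {c}}" for c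
            by (rule closedin_continuous_map_preimage[where Y = euclideanreal],
                rule continuous_map_from_subtopology, rule contN cn, simp)+
          then show ?thesis unfolding F_def by presburger
        qed
        show "continuous_map (subtopology ?B (F i)) Z (f i)" if "i \<in> {0, 1, 2}" for i
        proof -
          have "continuous_map ?P Z (\<lambda>p. a (snd p))" "continuous_map ?P Z (\<lambda>p. b (snd p))" "continuous_map ?P Z (\<lambda>p. x)"
            using continuous_map_compose'[OF contN(2)] ab x by auto
          then show ?thesis
            unfolding f_def by (intro continuous_map_from_subtopology) presburger
        qed
        have cb: "t \<in> cube_boundary n" if "t \<in> topspace (cube n)" "cube_norm n t = 1" for t
          using that cube_norm_eq_1 by blast
        show "f i p = f j p" if "i \<in> {0, 1, 2}" "j \<in> {0, 1, 2}" "p \<in> topspace ?B \<inter> F i \<inter> F j" for i j p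
          using that ab(3,4) cb[of "snd p"] by (auto simp: F_def f_def split: if_splits)
        show "\<exists>j. j \<in> {0, 1, 2} \<and> p \<in> F j \<and> \<sigma> p = f j p" if p: "p \<in> topspace ?B" for p
        proof -
          have p': "p \<in> topspace ?P" "?N p = 1" using p by auto
          consider "fst p = 0" | "fst p = 1" | "fst p \<noteq> 0" "fst p \<noteq> 1" "snd p \<in> cube_boundary n" using N1[OF p'] by blast
          then show ?thesis
          proof cases
            case 1 then show ?thesis using p by (intro exI[of _ 0]) (simp add: F_def f_def \<sigma>_def)
          next
            case 2 then show ?thesis using p by (intro exI[of _ 1]) (simp add: F_def f_def \<sigma>_def)
          next
            case 3
            then have "cube_norm n (snd p) = 1" using cube_norm_eq_1[of "snd p" n] p' by auto
            then show ?thesis using 3 p by (intro exI[of _ 2]) (simp add: F_def f_def \<sigma>_def)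
          qed
        qed
      qed simp
      have z\<sigma>: "z (\<sigma> p) = q p" if p': "p \<in> topspace ?P" "?N p = 1" for p
      proof -
        obtain s t where p: "p = (s, t)" "s \<in> {0..1}" "t \<in> topspace (cube n)" using p'(1) by auto
        then show ?thesis using N1[OF p'] q(2-4) by (auto simp: \<sigma>_def)
      qed
      have P: "compact_space ?P" "Hausdorff_space ?P" "small (topspace ?P)"
        using compact_interval compact_cube Hausdorff_interval Hausdorff_cube small_Times[OF small_interval small_cube]
        by (simp_all add: compact_space_prod_topology Hausdorff_space_prod_topology)
      obtain \<sigma>' where \<sigma>': "continuous_map ?P Z \<sigma>'" "\<And>p. \<lbrakk>p \<in> topspace ?P; ?N p = 1\<rbrakk> \<Longrightarrow> \<sigma>' p = \<sigma> p"
        by (rule relative_lifting[OF hl P dilation_structure_prod[OF dilation_structure_interval dilation_structure_cube]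
              q(1) \<sigma> z\<sigma>]) auto
      show ?thesis
        unfolding homotopy_rel_iff
      proof (intro exI[of _ \<sigma>'] conjI ballI)
        show "\<sigma>' (0, t) = a t" "\<sigma>' (1, t) = b t" if "t \<in> topspace (cube n)" for t
          using that cube_norm_le_1[OF that] by (subst \<sigma>'(2); simp add: \<sigma>_def)+
        show "\<sigma>' (s, t) = x" if "s \<in> {0..1}" "t \<in> cube_boundary n" for s t
        proof -
          have "t \<in> topspace (cube n)" "cube_norm n t = 1"
            using that(2) cube_boundary_subset cube_norm_eq_1 by blast+
          moreover then have "?N (s, t) = 1" using that(1) by (auto simp: max_def abs_if)
          ultimately show ?thesis using \<sigma>'(2)[of "(s, t)"] that ab(3,4) by (simp add: \<sigma>_def)
        qed
      qed (rule \<sigma>'(1))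
    qed
  qed
qed

end

section \<open>Categories over spaces\<close>

lemma compose_idmap_right: "f \<in> cmap S T \<Longrightarrow> compose (topspace S) f (idmap S) = f"
  by (rule cmap_eqI[of _ S T _ T]) (auto simp: compose_def idmap_def cmap_def intro: continuous_map_eq)

lemma compose_idmap_left: "f \<in> cmap S T \<Longrightarrow> compose (topspace S) (idmap T) f = f"
  by (rule cmap_eqI[OF compose_cmap[OF _ idmap_cmap]]) (auto simp: compose_def idmap_def cmap_app)

lemma compose_cmap_assoc:
  "f \<in> cmap S T \<Longrightarrow> compose (topspace S) h (compose (topspace S) g f) = compose (topspace S) (compose (topspace T) h g) f"
  by (rule ext) (auto simp: compose_def cmap_def continuous_map_def restrict_def)

definition homs :: "('o, 'm, 'u) fibcat \<Rightarrow> 'o \<Rightarrow> 'o \<Rightarrow> 'm set" where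
  "homs X a b = {m \<in> Arr X. Dom X m = a \<and> Cod X m = b}"

lemma homs_Arr: "m \<in> homs X a b \<Longrightarrow> m \<in> Arr X" and homs_Dom: "m \<in> homs X a b \<Longrightarrow> Dom X m = a"
  and homs_Cod: "m \<in> homs X a b \<Longrightarrow> Cod X m = b"
  by (auto simp: homs_def)

lemma Arr_homs: "m \<in> Arr X \<Longrightarrow> m \<in> homs X (Dom X m) (Cod X m)"
  by (auto simp: homs_def)

text \<open>For a category fibered in groupoids, a terminal object \<open>t\<close> means that it is
  the space \<open>Base X t\<close>, up to equivalence; see \<open>equivalence_of_terminal\<close>
  and \<open>terminal_of_equivalence\<close>.\<close>

definition terminal_obj :: "('o, 'm, 'u) fibcat \<Rightarrow> 'o \<Rightarrow> bool" where
  "terminal_obj X t \<longleftrightarrow> t \<in> Obj X \<and> (\<forall>w\<in>Obj X. \<exists>!m. m \<in> homs X w t)"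

definition category_over :: "('o, 'm, 'u) fibcat \<Rightarrow> bool" where
  "category_over X \<longleftrightarrow> category X \<and> over_CGTop X"

lemma fib_category_over: "fibered_in_groupoids X \<Longrightarrow> category_over X"
  by (simp add: fibered_in_groupoids_def category_over_def)

context
  fixes X :: "('o, 'm, 'u) fibcat"
  assumes X: "category_over X"
begin

lemma homs_Obj:
  assumes "m \<in> homs X a b"
  shows "a \<in> Obj X" "b \<in> Obj X"
  using X assms unfolding category_over_def category_def homs_def by blast+

lemma Id_homs: "a \<in> Obj X \<Longrightarrow> Id X a \<in> homs X a a"
  using X by (simp add: category_over_def category_def homs_def)

lemma Cmp_homs: "\<lbrakk>m \<in> homs X a b; n \<in> homs X b c\<rbrakk> \<Longrightarrow> Cmp X n m \<in> homs X a c"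
  using X by (simp add: category_over_def category_def homs_def)

lemma Cmp_Id_right: "m \<in> homs X a b \<Longrightarrow> Cmp X m (Id X a) = m"
  using X by (auto simp: category_over_def category_def homs_def)

lemma Cmp_Id_left: "m \<in> homs X a b \<Longrightarrow> Cmp X (Id X b) m = m"
  using X by (auto simp: category_over_def category_def homs_def)

lemma Cmp_assoc: "\<lbrakk>l \<in> homs X a b; m \<in> homs X b c; n \<in> homs X c d\<rbrakk> \<Longrightarrow> Cmp X n (Cmp X m l) = Cmp X (Cmp X n m) l"
  using X by (auto simp: category_over_def category_def homs_def)

lemma Base_CGTop: "a \<in> Obj X \<Longrightarrow> Base X a \<in> CGTop"
  using X by (simp add: category_over_def over_CGTop_def)

lemma BaseMap_Id: "a \<in> Obj X \<Longrightarrow> BaseMap X (Id X a) = idmap (Base X a)"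
  using X by (simp add: category_over_def over_CGTop_def)

lemma BaseMap_cmap: "m \<in> homs X a b \<Longrightarrow> BaseMap X m \<in> cmap (Base X a) (Base X b)"
  using X by (auto simp: category_over_def over_CGTop_def homs_def)

lemma BaseMap_Cmp: "\<lbrakk>m \<in> homs X a b; n \<in> homs X b c\<rbrakk> \<Longrightarrow>
    BaseMap X (Cmp X n m) = compose (topspace (Base X a)) (BaseMap X n) (BaseMap X m)"
  using X by (auto simp: category_over_def over_CGTop_def homs_def)

end

lemma category_overI:
  assumes "\<And>m. m \<in> Arr X \<Longrightarrow> Dom X m \<in> Obj X \<and> Cod X m \<in> Obj X"
    and "\<And>a. a \<in> Obj X \<Longrightarrow> Id X a \<in> homs X a a"
    and "\<And>a b c m n. \<lbrakk>m \<in> homs X a b; n \<in> homs X b c\<rbrakk> \<Longrightarrow> Cmp X n m \<in> homs X a c"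
    and "\<And>a b m. m \<in> homs X a b \<Longrightarrow> Cmp X m (Id X a) = m"
    and "\<And>a b m. m \<in> homs X a b \<Longrightarrow> Cmp X (Id X b) m = m"
    and "\<And>a b c d l m n. \<lbrakk>l \<in> homs X a b; m \<in> homs X b c; n \<in> homs X c d\<rbrakk> \<Longrightarrow>
        Cmp X n (Cmp X m l) = Cmp X (Cmp X n m) l"
    and "\<And>a. a \<in> Obj X \<Longrightarrow> Base X a \<in> CGTop"
    and "\<And>a. a \<in> Obj X \<Longrightarrow> BaseMap X (Id X a) = idmap (Base X a)"
    and "\<And>a b m. m \<in> homs X a b \<Longrightarrow> BaseMap X m \<in> cmap (Base X a) (Base X b)"
    and "\<And>a b c m n. \<lbrakk>m \<in> homs X a b; n \<in> homs X b c\<rbrakk> \<Longrightarrow>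
        BaseMap X (Cmp X n m) = compose (topspace (Base X a)) (BaseMap X n) (BaseMap X m)"
  shows "category_over X"
  using assms unfolding category_over_def category_def over_CGTop_def homs_def by simp

lemma fibered_in_groupoidsI:
  assumes "category_over X"
    and "\<And>S y g. \<lbrakk>S \<in> CGTop; y \<in> Obj X; g \<in> cmap S (Base X y)\<rbrakk> \<Longrightarrow>
        \<exists>x m. m \<in> homs X x y \<and> Base X x = S \<and> BaseMap X m = g"
    and "\<And>a b c m n g. \<lbrakk>m \<in> homs X b c; n \<in> homs X a c; g \<in> cmap (Base X a) (Base X b);
        compose (topspace (Base X a)) (BaseMap X m) g = BaseMap X n\<rbrakk> \<Longrightarrow>
        \<exists>!k. k \<in> homs X a b \<and> BaseMap X k = g \<and> Cmp X m k = n"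
  shows "fibered_in_groupoids X"
  unfolding fibered_in_groupoids_def
proof (intro conjI ballI impI; (elim conjE)?)
  show "category X" "over_CGTop X" using assms(1) by (auto simp: category_over_def)
  fix S y g assume "S \<in> CGTop" "y \<in> Obj X" "g \<in> cmap S (Base X y)"
  then show "\<exists>m\<in>Arr X. Cod X m = y \<and> Base X (Dom X m) = S \<and> BaseMap X m = g"
    using assms(2)[of S y g] by (auto simp: homs_def)
next
  fix m n g assume "m \<in> Arr X" "n \<in> Arr X" "g \<in> cmap (Base X (Dom X n)) (Base X (Dom X m))" "Cod X m = Cod X n"
    "compose (topspace (Base X (Dom X n))) (BaseMap X m) g = BaseMap X n"
  then have "\<exists>!k. k \<in> homs X (Dom X n) (Dom X m) \<and> BaseMap X k = g \<and> Cmp X m k = n"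
    by (intro assms(3)[of m _ "Cod X m"]) (auto simp: homs_def)
  then show "\<exists>!k. k \<in> Arr X \<and> Dom X k = Dom X n \<and> Cod X k = Dom X m \<and> BaseMap X k = g \<and> Cmp X m k = n"
    by (simp add: homs_def conj_assoc)
qed

context
  fixes X :: "('o, 'm, 'u) fibcat"
  assumes X: "fibered_in_groupoids X"
begin

lemma fib_pullback:
  assumes "S \<in> CGTop" "y \<in> Obj X" "g \<in> cmap S (Base X y)"
  obtains x m where "m \<in> homs X x y" "Base X x = S" "BaseMap X m = g"
  using X assms unfolding fibered_in_groupoids_def homs_def by fastforce

lemma fib_cart:
  assumes "m \<in> homs X b c" "n \<in> homs X a c" "g \<in> cmap (Base X a) (Base X b)"
    "compose (topspace (Base X a)) (BaseMap X m) g = BaseMap X n"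
  shows "\<exists>!k. k \<in> homs X a b \<and> BaseMap X k = g \<and> Cmp X m k = n"
proof -
  have *: "\<forall>m\<in>Arr X. \<forall>n\<in>Arr X. \<forall>g\<in>cmap (Base X (Dom X n)) (Base X (Dom X m)).
        Cod X m = Cod X n \<and>
        compose (topspace (Base X (Dom X n))) (BaseMap X m) g = BaseMap X n \<longrightarrow>
        (\<exists>!k. k \<in> Arr X \<and> Dom X k = Dom X n \<and> Cod X k = Dom X m \<and>
              BaseMap X k = g \<and> Cmp X m k = n)"
    using X by (simp add: fibered_in_groupoids_def)
  have "\<exists>!k. k \<in> Arr X \<and> Dom X k = Dom X n \<and> Cod X k = Dom X m \<and> BaseMap X k = g \<and> Cmp X m k = n"
    using assms by (intro *[rule_format]) (auto simp: homs_def)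
  then show ?thesis using assms by (simp add: homs_def conj_assoc)
qed

lemma fib_cartE:
  assumes "m \<in> homs X b c" "n \<in> homs X a c" "g \<in> cmap (Base X a) (Base X b)"
    "compose (topspace (Base X a)) (BaseMap X m) g = BaseMap X n"
  obtains k where "k \<in> homs X a b" "BaseMap X k = g" "Cmp X m k = n"
  using fib_cart[OF assms] by blast

text \<open>All arrows are cartesian in a category fibered in groupoids, so an arrow is determined
  by its base map and its composite with one arrow out of its target. Most equations between arrows
  below are proved in this way.\<close>

lemma fib_cancel:
  assumes m: "m \<in> homs X b c" and k: "k \<in> homs X a b" "k' \<in> homs X a b"
    and "BaseMap X k = BaseMap X k'" "Cmp X m k = Cmp X m k'"
  shows "k = k'"
proof -
  note co = fib_category_over[OF X]
  have "\<exists>!l. l \<in> homs X a b \<and> BaseMap X l = BaseMap X k \<and> Cmp X m l = Cmp X m k"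
    by (rule fib_cart[OF m Cmp_homs[OF co k(1) m] BaseMap_cmap[OF co k(1)]])
      (simp add: BaseMap_Cmp[OF co k(1) m])
  then show ?thesis using assms by metis
qed

text \<open>The right inverse is the factorization of the identity through \<open>m\<close> over
  \<open>g\<close>; it is a left inverse by cancelling \<open>m\<close>.\<close>

lemma fib_iso_inverse:
  assumes m: "m \<in> homs X a b" and g: "g \<in> cmap (Base X b) (Base X a)"
    and mg: "compose (topspace (Base X b)) (BaseMap X m) g = idmap (Base X b)"
    and gm: "compose (topspace (Base X a)) g (BaseMap X m) = idmap (Base X a)"
  obtains n where "n \<in> homs X b a" "BaseMap X n = g" "Cmp X m n = Id X b" "Cmp X n m = Id X a"
proof -
  note co = fib_category_over[OF X]
  have ab: "a \<in> Obj X" "b \<in> Obj X" using homs_Obj[OF co m] by auto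
  obtain n where n: "n \<in> homs X b a" "BaseMap X n = g" "Cmp X m n = Id X b"
    using fib_cartE[OF m Id_homs[OF co ab(2)] g] mg BaseMap_Id[OF co ab(2)] by metis
  have "Cmp X n m = Id X a"
  proof (rule fib_cancel[OF m Cmp_homs[OF co m n(1)] Id_homs[OF co ab(1)]])
    show "BaseMap X (Cmp X n m) = BaseMap X (Id X a)"
      using gm n BaseMap_Cmp[OF co m n(1)] BaseMap_Id[OF co ab(1)] by simp
    show "Cmp X m (Cmp X n m) = Cmp X m (Id X a)"
      using Cmp_assoc[OF co m n(1) m] n(3) Cmp_Id_left[OF co m] Cmp_Id_right[OF co m] by simp
  qed
  then show thesis using n that by blast
qed

lemma fib_vertical_inverse:
  assumes m: "m \<in> homs X a b" "vertical X m"
  obtains n where "n \<in> homs X b a" "vertical X n" "Cmp X m n = Id X b" "Cmp X n m = Id X a"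
proof -
  have b: "Base X a = Base X b" "BaseMap X m = idmap (Base X b)"
    using m by (auto simp: vertical_def homs_def)
  obtain n where "n \<in> homs X b a" "BaseMap X n = idmap (Base X b)" "Cmp X m n = Id X b" "Cmp X n m = Id X a"
    by (rule fib_iso_inverse[OF m(1), of "idmap (Base X b)"])
      (use b compose_idmap_right[OF idmap_cmap] in auto)
  then show thesis using that b by (auto simp: vertical_def homs_def)
qed

lemma fib_epi:
  assumes m: "m \<in> homs X a b" "vertical X m" and k: "k \<in> homs X b c" "k' \<in> homs X b c"
    and e: "Cmp X k m = Cmp X k' m"
  shows "k = k'"
proof -
  note co = fib_category_over[OF X]
  obtain n where n: "n \<in> homs X b a" "Cmp X m n = Id X b" using fib_vertical_inverse[OF m] by metis
  have "Cmp X (Cmp X k m) n = Cmp X (Cmp X k' m) n" using e by simp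
  then show ?thesis
    using Cmp_assoc[OF co n(1) m(1) k(1)] Cmp_assoc[OF co n(1) m(1) k(2)] n(2) Cmp_Id_right[OF co k(1)]
      Cmp_Id_right[OF co k(2)] by simp
qed

end

context
  fixes A :: "('o, 'm, 'u) fibcat" and B :: "('p, 'n, 'u) fibcat" and F :: "('o, 'm, 'p, 'n) mor"
  assumes F: "morphism A B F"
begin

lemma mor_Obj: "x \<in> Obj A \<Longrightarrow> OM F x \<in> Obj B"
  using F by (auto simp: morphism_def)

lemma mor_Base: "x \<in> Obj A \<Longrightarrow> Base B (OM F x) = Base A x"
  using F by (auto simp: morphism_def)

lemma mor_homs: "m \<in> homs A a b \<Longrightarrow> AM F m \<in> homs B (OM F a) (OM F b)"
  using F by (auto simp: morphism_def homs_def)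

lemma mor_BaseMap: "m \<in> homs A a b \<Longrightarrow> BaseMap B (AM F m) = BaseMap A m"
  using F by (auto simp: morphism_def homs_def)

lemma mor_Id: "x \<in> Obj A \<Longrightarrow> AM F (Id A x) = Id B (OM F x)"
  using F by (auto simp: morphism_def)

lemma mor_Cmp: "\<lbrakk>m \<in> homs A a b; n \<in> homs A b c\<rbrakk> \<Longrightarrow> AM F (Cmp A n m) = Cmp B (AM F n) (AM F m)"
  using F by (auto simp: morphism_def homs_def)

end

lemma morphismI:
  assumes "OM F \<in> extensional (Obj A)" "AM F \<in> extensional (Arr A)"
    and "\<And>x. x \<in> Obj A \<Longrightarrow> OM F x \<in> Obj B"
    and "\<And>x. x \<in> Obj A \<Longrightarrow> Base B (OM F x) = Base A x"
    and "\<And>x. x \<in> Obj A \<Longrightarrow> AM F (Id A x) = Id B (OM F x)"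
    and "\<And>a b m. m \<in> homs A a b \<Longrightarrow> AM F m \<in> homs B (OM F a) (OM F b)"
    and "\<And>a b m. m \<in> homs A a b \<Longrightarrow> BaseMap B (AM F m) = BaseMap A m"
    and "\<And>a b c m n. \<lbrakk>m \<in> homs A a b; n \<in> homs A b c\<rbrakk> \<Longrightarrow> AM F (Cmp A n m) = Cmp B (AM F n) (AM F m)"
  shows "morphism A B F"
  using assms unfolding morphism_def homs_def by (auto simp: PiE_def)

lemma mor_vertical:
  assumes "category_over A" "morphism A B F" "m \<in> homs A a b" "vertical A m"
  shows "vertical B (AM F m)"
  using assms mor_homs[OF assms(2,3)] mor_BaseMap[OF assms(2,3)] mor_Base[OF assms(2)] homs_Obj[OF assms(1,3)]
  by (auto simp: vertical_def homs_def)

lemma two_morphismI: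
  assumes "\<eta> \<in> extensional (Obj A)"
    and "\<And>x. x \<in> Obj A \<Longrightarrow> \<eta> x \<in> homs B (OM F x) (OM G x)"
    and "\<And>x. x \<in> Obj A \<Longrightarrow> vertical B (\<eta> x)"
    and "\<And>a b m. m \<in> homs A a b \<Longrightarrow> Cmp B (\<eta> b) (AM F m) = Cmp B (AM G m) (\<eta> a)"
  shows "two_morphism A B F G \<eta>"
  using assms unfolding two_morphism_def homs_def by (auto simp: PiE_def)

lemma two_morphism_homs: "\<lbrakk>two_morphism A B F G \<eta>; x \<in> Obj A\<rbrakk> \<Longrightarrow> \<eta> x \<in> homs B (OM F x) (OM G x)"
  and two_morphism_vertical: "\<lbrakk>two_morphism A B F G \<eta>; x \<in> Obj A\<rbrakk> \<Longrightarrow> vertical B (\<eta> x)"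
  and two_morphism_natural: "\<lbrakk>two_morphism A B F G \<eta>; m \<in> homs A a b\<rbrakk> \<Longrightarrow>
      Cmp B (\<eta> b) (AM F m) = Cmp B (AM G m) (\<eta> a)"
  and two_morphism_ext: "two_morphism A B F G \<eta> \<Longrightarrow> \<eta> \<in> extensional (Obj A)"
  unfolding two_morphism_def homs_def PiE_def by auto

lemma vertical_BaseMap: "\<lbrakk>m \<in> homs X a b; vertical X m\<rbrakk> \<Longrightarrow> BaseMap X m = idmap (Base X a)"
  and vertical_Base: "\<lbrakk>m \<in> homs X a b; vertical X m\<rbrakk> \<Longrightarrow> Base X a = Base X b"
  by (auto simp: vertical_def homs_def)

lemma verticalI: "\<lbrakk>m \<in> homs X a b; Base X a = Base X b; BaseMap X m = idmap (Base X a)\<rbrakk> \<Longrightarrow> vertical X m"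
  by (auto simp: vertical_def homs_def)

text \<open>This and the next two lemmas form the Yoneda lemma for a category with a terminal object
  \<open>t\<close>: evaluation at \<open>t\<close> is faithful and full on 2-morphisms, and every
  object over the base of \<open>t\<close> is a value. Faithfulness comes from naturality along the
  arrow to \<open>t\<close> and cancellation.\<close>

lemma two_morphism_eqI:
  assumes B: "fibered_in_groupoids B" and t: "terminal_obj A t" and F: "morphism A B F" and G: "morphism A B G"
    and \<eta>: "two_morphism A B F G \<eta>" and \<theta>: "two_morphism A B F G \<theta>" and e: "\<eta> t = \<theta> t"
  shows "\<eta> = \<theta>"
proof (rule extensionalityI[OF two_morphism_ext[OF \<eta>] two_morphism_ext[OF \<theta>]])
  fix w assume w: "w \<in> Obj A"
  then obtain c where c: "c \<in> homs A w t" using t by (auto simp: terminal_obj_def)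
  have h: "\<eta> w \<in> homs B (OM F w) (OM G w)" "\<theta> w \<in> homs B (OM F w) (OM G w)"
    using two_morphism_homs \<eta> \<theta> w by metis+
  show "\<eta> w = \<theta> w"
  proof (rule fib_cancel[OF B mor_homs[OF G c] h])
    show "BaseMap B (\<eta> w) = BaseMap B (\<theta> w)"
      using vertical_BaseMap[OF h(1) two_morphism_vertical[OF \<eta> w]] vertical_BaseMap[OF h(2) two_morphism_vertical[OF \<theta> w]]
      by simp
    show "Cmp B (AM G c) (\<eta> w) = Cmp B (AM G c) (\<theta> w)"
      using two_morphism_natural[OF \<eta> c] two_morphism_natural[OF \<theta> c] e by simp
  qed
qed

text \<open>The component at \<open>w\<close> is forced: it has to be vertical and compatible with
  the arrow \<open>c w\<close> from \<open>w\<close> to \<open>t\<close>, and cartesian lifting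
  gives exactly one such arrow. Naturality follows by cancelling the image of
  \<open>c b\<close>.\<close>

lemma two_morphism_exists:
  assumes A: "category_over A" and B: "fibered_in_groupoids B" and t: "terminal_obj A t"
    and F: "morphism A B F" and G: "morphism A B G"
    and \<alpha>: "\<alpha> \<in> homs B (OM F t) (OM G t)" "vertical B \<alpha>"
  obtains \<eta> where "two_morphism A B F G \<eta>" "\<eta> t = \<alpha>"
proof -
  note co = fib_category_over[OF B]
  have tO: "t \<in> Obj A" using t by (simp add: terminal_obj_def)
  define c where "c = (\<lambda>w. THE m. m \<in> homs A w t)"
  have c: "c w \<in> homs A w t" and c_unique: "m \<in> homs A w t \<Longrightarrow> m = c w" if "w \<in> Obj A" for w m
  proof -
    have ex: "\<exists>!m. m \<in> homs A w t" using t that by (simp add: terminal_obj_def)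
    show "c w \<in> homs A w t" unfolding c_def by (rule theI'[OF ex])
    then show "m = c w" if "m \<in> homs A w t" using ex that by blast
  qed
  let ?P = "\<lambda>w k. k \<in> homs B (OM F w) (OM G w) \<and> BaseMap B k = idmap (Base A w) \<and>
      Cmp B (AM G (c w)) k = Cmp B \<alpha> (AM F (c w))"
  have ex: "\<exists>!k. ?P w k" if w: "w \<in> Obj A" for w
  proof (rule fib_cart[OF B mor_homs[OF G c[OF w]] Cmp_homs[OF co mor_homs[OF F c[OF w]] \<alpha>(1)]])
    note b = mor_Base[OF F w] mor_Base[OF G w] mor_Base[OF F tO] mor_Base[OF G tO]
    show "idmap (Base A w) \<in> cmap (Base B (OM F w)) (Base B (OM G w))" by (simp add: b)
    have cm: "BaseMap A (c w) \<in> cmap (Base A w) (Base A t)" using BaseMap_cmap[OF A c[OF w]] .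
    have "BaseMap B (Cmp B \<alpha> (AM F (c w))) = BaseMap A (c w)"
      using BaseMap_Cmp[OF co mor_homs[OF F c[OF w]] \<alpha>(1)] vertical_BaseMap[OF \<alpha>] mor_BaseMap[OF F c[OF w]] b
        compose_idmap_left[OF cm] by simp
    then show "compose (topspace (Base B (OM F w))) (BaseMap B (AM G (c w))) (idmap (Base A w)) =
        BaseMap B (Cmp B \<alpha> (AM F (c w)))"
      using mor_BaseMap[OF G c[OF w]] b compose_idmap_right[OF cm] by simp
  qed
  define \<eta> where "\<eta> = (\<lambda>w\<in>Obj A. THE k. ?P w k)"
  have \<eta>: "?P w (\<eta> w)" if "w \<in> Obj A" for w
    using theI'[OF ex[OF that]] that by (simp add: \<eta>_def)
  have "two_morphism A B F G \<eta>"
  proof (rule two_morphismI)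
    show "\<eta> \<in> extensional (Obj A)" by (simp add: \<eta>_def)
    show h: "\<eta> w \<in> homs B (OM F w) (OM G w)" if "w \<in> Obj A" for w using \<eta>[OF that] by blast
    show "vertical B (\<eta> w)" if "w \<in> Obj A" for w
      using \<eta>[OF that] mor_Base[OF F that] mor_Base[OF G that] by (intro verticalI[OF h[OF that]]) auto
    fix a b m assume m: "m \<in> homs A a b"
    then have ab: "a \<in> Obj A" "b \<in> Obj A" using homs_Obj[OF A] by auto
    note Fm = mor_homs[OF F m] and Gm = mor_homs[OF G m]
    have cbm: "Cmp A (c b) m = c a" using c_unique[OF ab(1) Cmp_homs[OF A m c[OF ab(2)]]] .
    have bm: "BaseMap A m \<in> cmap (Base A a) (Base A b)" using BaseMap_cmap[OF A m] .
    show "Cmp B (\<eta> b) (AM F m) = Cmp B (AM G m) (\<eta> a)"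
    proof (rule fib_cancel[OF B mor_homs[OF G c[OF ab(2)]] Cmp_homs[OF co Fm h[OF ab(2)]] Cmp_homs[OF co h[OF ab(1)] Gm]])
      show "BaseMap B (Cmp B (\<eta> b) (AM F m)) = BaseMap B (Cmp B (AM G m) (\<eta> a))"
        using BaseMap_Cmp[OF co Fm h[OF ab(2)]] BaseMap_Cmp[OF co h[OF ab(1)] Gm] \<eta>[OF ab(1)] \<eta>[OF ab(2)]
          mor_BaseMap[OF F m] mor_BaseMap[OF G m] mor_Base[OF F ab(1)]
          compose_idmap_left[OF bm] compose_idmap_right[OF bm] by simp
      have "Cmp B (AM G (c b)) (Cmp B (\<eta> b) (AM F m)) = Cmp B (Cmp B \<alpha> (AM F (c b))) (AM F m)"
        using Cmp_assoc[OF co Fm h[OF ab(2)] mor_homs[OF G c[OF ab(2)]]] \<eta>[OF ab(2)] by simp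
      also have "\<dots> = Cmp B \<alpha> (AM F (c a))"
        using Cmp_assoc[OF co Fm mor_homs[OF F c[OF ab(2)]] \<alpha>(1)] mor_Cmp[OF F m c[OF ab(2)]] cbm by simp
      also have "\<dots> = Cmp B (Cmp B (AM G (c b)) (AM G m)) (\<eta> a)"
        using \<eta>[OF ab(1)] mor_Cmp[OF G m c[OF ab(2)]] cbm by simp
      also have "\<dots> = Cmp B (AM G (c b)) (Cmp B (AM G m) (\<eta> a))"
        using Cmp_assoc[OF co h[OF ab(1)] Gm mor_homs[OF G c[OF ab(2)]]] by simp
      finally show "Cmp B (AM G (c b)) (Cmp B (\<eta> b) (AM F m)) = Cmp B (AM G (c b)) (Cmp B (AM G m) (\<eta> a))" .
    qed
  qed
  moreover have "\<eta> t = \<alpha>"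
  proof -
    have ct: "c t = Id A t" using c_unique[OF tO Id_homs[OF A tO]] by simp
    have "?P t \<alpha>"
      using \<alpha> vertical_BaseMap[OF \<alpha>] mor_Base[OF F tO] mor_Id[OF F tO] mor_Id[OF G tO]
        Cmp_Id_left[OF co \<alpha>(1)] Cmp_Id_right[OF co \<alpha>(1)] ct by simp
    then show ?thesis using \<eta>[OF tO] ex[OF tO] by blast
  qed
  ultimately show thesis by (rule that)
qed

text \<open>The value at \<open>w\<close> is a pullback of \<open>x\<close> along the base map of
  the arrow from \<open>w\<close> to \<open>t\<close>; on arrows one takes the unique factorizations
  between these pullbacks, so functoriality is automatic.\<close>

lemma morphism_exists:
  assumes A: "category_over A" and B: "fibered_in_groupoids B" and t: "terminal_obj A t"
    and x: "x \<in> Obj B" "Base B x = Base A t"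
  obtains F where "morphism A B F" "OM F t = x"
proof -
  note co = fib_category_over[OF B]
  have tO: "t \<in> Obj A" using t by (simp add: terminal_obj_def)
  define c where "c = (\<lambda>w. THE m. m \<in> homs A w t)"
  have c: "c w \<in> homs A w t" and c_unique: "m \<in> homs A w t \<Longrightarrow> m = c w" if "w \<in> Obj A" for w m
  proof -
    have ex: "\<exists>!m. m \<in> homs A w t" using t that by (simp add: terminal_obj_def)
    show "c w \<in> homs A w t" unfolding c_def by (rule theI'[OF ex])
    then show "m = c w" if "m \<in> homs A w t" using ex that by blast
  qed
  have ct: "c t = Id A t" using c_unique[OF tO Id_homs[OF A tO]] by simp
  \<comment> \<open>At \<open>t\<close> the pullback is chosen to be \<open>x\<close> with its
    identity, so that \<open>OM F t = x\<close> holds exactly and not only up to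
    isomorphism.\<close>
  have "\<exists>p. (snd p \<in> homs B (fst p) x \<and> Base B (fst p) = Base A w \<and> BaseMap B (snd p) = BaseMap A (c w)) \<and>
      (w = t \<longrightarrow> p = (x, Id B x))" if w: "w \<in> Obj A" for w
  proof (cases "w = t")
    case True
    then show ?thesis
      using Id_homs[OF co x(1)] x BaseMap_Id[OF co x(1)] BaseMap_Id[OF A tO] ct by auto
  next
    case False
    have "BaseMap A (c w) \<in> cmap (Base A w) (Base B x)" using BaseMap_cmap[OF A c[OF w]] x(2) by simp
    from fib_pullback[OF B Base_CGTop[OF A w] x(1) this]
    show ?thesis using False by (metis fst_conv snd_conv)
  qed
  then obtain p where p: "\<And>w. w \<in> Obj A \<Longrightarrow> snd (p w) \<in> homs B (fst (p w)) x"
      "\<And>w. w \<in> Obj A \<Longrightarrow> Base B (fst (p w)) = Base A w"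
      "\<And>w. w \<in> Obj A \<Longrightarrow> BaseMap B (snd (p w)) = BaseMap A (c w)"
      and pt: "p t = (x, Id B x)"
    using tO by metis
  let ?P = "\<lambda>a b m k. k \<in> homs B (fst (p a)) (fst (p b)) \<and> BaseMap B k = BaseMap A m \<and>
      Cmp B (snd (p b)) k = snd (p a)"
  have ex: "\<exists>!k. ?P a b m k" if m: "m \<in> homs A a b" for a b m
  proof -
    have ab: "a \<in> Obj A" "b \<in> Obj A" using homs_Obj[OF A m] by auto
    have "Cmp A (c b) m = c a" using c_unique[OF ab(1) Cmp_homs[OF A m c[OF ab(2)]]] .
    then show ?thesis
      using BaseMap_cmap[OF A m] BaseMap_Cmp[OF A m c[OF ab(2)]] p ab
      by (intro fib_cart[OF B p(1)[OF ab(2)] p(1)[OF ab(1)]]) simp_all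
  qed
  define F where "F = \<lparr>OM = (\<lambda>w\<in>Obj A. fst (p w)), AM = (\<lambda>m\<in>Arr A. THE k. ?P (Dom A m) (Cod A m) m k)\<rparr>"
  have OMF: "OM F w = fst (p w)" if "w \<in> Obj A" for w using that by (simp add: F_def)
  have F: "?P a b m (AM F m)" if m: "m \<in> homs A a b" for a b m
    using theI'[OF ex[OF m]] homs_Arr[OF m] homs_Dom[OF m] homs_Cod[OF m] by (simp add: F_def)
  have F_eq: "k = AM F m" if "m \<in> homs A a b" "?P a b m k" for a b m k
    using ex[OF that(1)] that(2) F[OF that(1)] by blast
  have "morphism A B F"
  proof (rule morphismI)
    show "OM F w \<in> Obj B" if "w \<in> Obj A" for w using OMF[OF that] homs_Obj[OF co p(1)[OF that]] by simp
    show "Base B (OM F w) = Base A w" if "w \<in> Obj A" for w using OMF[OF that] p(2)[OF that] by simp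
    show "AM F (Id A w) = Id B (OM F w)" if w: "w \<in> Obj A" for w
    proof -
      have pw: "fst (p w) \<in> Obj B" using homs_Obj[OF co p(1)[OF w]] by simp
      have "?P w w (Id A w) (Id B (fst (p w)))"
        using Id_homs[OF co pw] BaseMap_Id[OF co pw] BaseMap_Id[OF A w] p(2)[OF w] Cmp_Id_right[OF co p(1)[OF w]] by simp
      from F_eq[OF Id_homs[OF A w] this] show ?thesis using OMF[OF w] by simp
    qed
    show "AM F m \<in> homs B (OM F a) (OM F b)" if m: "m \<in> homs A a b" for a b m
      using F[OF m] OMF homs_Obj[OF A m] by simp
    show "BaseMap B (AM F m) = BaseMap A m" if m: "m \<in> homs A a b" for a b m
      using F[OF m] by simp
    show "AM F (Cmp A n m) = Cmp B (AM F n) (AM F m)" if m: "m \<in> homs A a b" and n: "n \<in> homs A b d" for a b d m n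
    proof -
      have ab: "a \<in> Obj A" "b \<in> Obj A" "d \<in> Obj A" using homs_Obj[OF A m] homs_Obj[OF A n] by auto
      have 1: "AM F m \<in> homs B (fst (p a)) (fst (p b))" "AM F n \<in> homs B (fst (p b)) (fst (p d))"
        using F[OF m] F[OF n] by auto
      have "?P a d (Cmp A n m) (Cmp B (AM F n) (AM F m))"
        using Cmp_homs[OF co 1] BaseMap_Cmp[OF co 1] BaseMap_Cmp[OF A m n] F[OF m] F[OF n] p(2)[OF ab(1)]
          Cmp_assoc[OF co 1 p(1)[OF ab(3)]] by simp
      from F_eq[OF Cmp_homs[OF A m n] this] show ?thesis by simp
    qed
  qed (auto simp: F_def)
  moreover have "OM F t = x" using OMF[OF tO] pt by simp
  ultimately show thesis by (rule that)
qed

section \<open>The stack of a space\<close>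

lemma rep_homs_iff:
  "m \<in> homs (rep T) (U, u) (V, v) \<longleftrightarrow> (\<exists>g. m = ((U, u), g, (V, v)) \<and> U \<in> CGTop \<and> u \<in> cmap U T \<and>
     V \<in> CGTop \<and> v \<in> cmap V T \<and> g \<in> cmap U V \<and> compose (topspace U) v g = u)"
  by (auto simp: homs_def rep_def)

lemma rep_homsE:
  assumes "m \<in> homs (rep T) a b"
  obtains U u g V v where "a = (U, u)" "b = (V, v)" "m = ((U, u), g, (V, v))" "U \<in> CGTop" "u \<in> cmap U T"
     "V \<in> CGTop" "v \<in> cmap V T" "g \<in> cmap U V" "compose (topspace U) v g = u"
  using assms by (cases a; cases b) (auto simp: rep_homs_iff)

lemma rep_Obj [simp]: "(U, u) \<in> Obj (rep T) \<longleftrightarrow> U \<in> CGTop \<and> u \<in> cmap U T"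
  by (simp add: rep_def)

lemma rep_simps [simp]:
  "Dom (rep T) (x, g, y) = x" "Cod (rep T) (x, g, y) = y" "Id (rep T) x = (x, idmap (fst x), x)"
  "Cmp (rep T) (y', h, z) (x, g, y) = (x, compose (topspace (fst x)) h g, z)"
  "Base (rep T) x = fst x" "BaseMap (rep T) (x, g, y) = g"
  by (simp_all add: rep_def)

lemma category_over_rep: "category_over (rep T)"
proof (rule category_overI)
  fix a b c m n assume m: "m \<in> homs (rep T) a b" and n: "n \<in> homs (rep T) b c"
  from m obtain U u g V v where 1: "a = (U, u)" "b = (V, v)" "m = ((U, u), g, (V, v))" "U \<in> CGTop" "u \<in> cmap U T"
     "V \<in> CGTop" "v \<in> cmap V T" "g \<in> cmap U V" "compose (topspace U) v g = u" by (rule rep_homsE)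
  from n obtain W w h where 2: "c = (W, w)" "n = ((V, v), h, (W, w))" "W \<in> CGTop"
     "w \<in> cmap W T" "h \<in> cmap V W" "compose (topspace V) w h = v" using 1(2) by (auto elim: rep_homsE)
  show "Cmp (rep T) n m \<in> homs (rep T) a c"
    using 1 2 compose_cmap[OF 1(8) 2(5)] compose_cmap_assoc[OF 1(8), of w h] by (simp add: rep_homs_iff)
  show "BaseMap (rep T) (Cmp (rep T) n m) = compose (topspace (Base (rep T) a)) (BaseMap (rep T) n) (BaseMap (rep T) m)"
    using 1 2 by simp
next
  fix a b c d l m n
  assume "l \<in> homs (rep T) a b" "m \<in> homs (rep T) b c" "n \<in> homs (rep T) c d"
  then show "Cmp (rep T) n (Cmp (rep T) m l) = Cmp (rep T) (Cmp (rep T) n m) l"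
    by (elim rep_homsE) (auto simp: compose_cmap_assoc)
next
  show "Dom (rep T) m \<in> Obj (rep T) \<and> Cod (rep T) m \<in> Obj (rep T)" if "m \<in> Arr (rep T)" for m
    using Arr_homs[OF that] by (rule rep_homsE) simp
  show "Id (rep T) a \<in> homs (rep T) a a" if "a \<in> Obj (rep T)" for a
    using that by (cases a) (auto simp: rep_homs_iff compose_idmap_right)
  show "Cmp (rep T) m (Id (rep T) a) = m" if "m \<in> homs (rep T) a b" for a b m
    using that by (rule rep_homsE) (simp add: compose_idmap_right)
  show "Cmp (rep T) (Id (rep T) b) m = m" if "m \<in> homs (rep T) a b" for a b m
    using that by (rule rep_homsE) (simp add: compose_idmap_left)
  show "BaseMap (rep T) m \<in> cmap (Base (rep T) a) (Base (rep T) b)" if "m \<in> homs (rep T) a b" for a b m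
    using that by (rule rep_homsE) simp
qed (auto simp: rep_def)

lemma fibered_rep: "fibered_in_groupoids (rep T)"
proof (rule fibered_in_groupoidsI[OF category_over_rep])
  fix S y g assume S: "S \<in> CGTop" and y: "y \<in> Obj (rep T)" and g: "g \<in> cmap S (Base (rep T) y)"
  obtain V v where V: "y = (V, v)" "V \<in> CGTop" "v \<in> cmap V T" using y by (cases y) auto
  then have "((S, compose (topspace S) v g), g, (V, v)) \<in> homs (rep T) (S, compose (topspace S) v g) y"
    using S g compose_cmap by (auto simp: rep_homs_iff)
  then show "\<exists>x m. m \<in> homs (rep T) x y \<and> Base (rep T) x = S \<and> BaseMap (rep T) m = g"
    by (metis fst_conv rep_simps(5,6))
next
  fix a b c m n g assume m: "m \<in> homs (rep T) b c" and n: "n \<in> homs (rep T) a c"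
    and g: "g \<in> cmap (Base (rep T) a) (Base (rep T) b)"
    "compose (topspace (Base (rep T) a)) (BaseMap (rep T) m) g = BaseMap (rep T) n"
  from m obtain V v h W w where 1: "b = (V, v)" "c = (W, w)" "m = ((V, v), h, (W, w))" "V \<in> CGTop" "v \<in> cmap V T"
     "W \<in> CGTop" "w \<in> cmap W T" "h \<in> cmap V W" "compose (topspace V) w h = v" by (rule rep_homsE)
  from n obtain U u l where 2: "a = (U, u)" "n = ((U, u), l, (W, w))" "U \<in> CGTop" "u \<in> cmap U T"
     "l \<in> cmap U W" "compose (topspace U) w l = u" using 1(2) by (auto elim: rep_homsE)
  have "compose (topspace U) v g = u"
    using 1 2 g compose_cmap_assoc[of g U V w h] by simp
  then have k: "((U, u), g, (V, v)) \<in> homs (rep T) (U, u) (V, v)"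
    using 1(4,5) 2(1,3,4) g(1) unfolding rep_homs_iff by (simp add: 1(1))
  have gl: "compose (topspace U) h g = l" using g(2) by (simp add: 1(3) 2(1,2))
  show "\<exists>!k. k \<in> homs (rep T) a b \<and> BaseMap (rep T) k = g \<and> Cmp (rep T) m k = n"
  proof (rule ex1I[of _ "((U, u), g, (V, v))"])
    show "((U, u), g, (V, v)) \<in> homs (rep T) a b \<and> BaseMap (rep T) ((U, u), g, (V, v)) = g \<and>
        Cmp (rep T) m ((U, u), g, (V, v)) = n"
      using k gl by (simp add: 1(1,3) 2(1,2))
    show "k = ((U, u), g, (V, v))" if "k \<in> homs (rep T) a b \<and> BaseMap (rep T) k = g \<and> Cmp (rep T) m k = n" for k
      using that unfolding 1(1) 2(1) by (auto elim: rep_homsE)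
  qed
qed

lemma rep_to_terminal:
  "\<lbrakk>T \<in> CGTop; (U, u) \<in> Obj (rep T)\<rbrakk> \<Longrightarrow> ((U, u), u, (T, idmap T)) \<in> homs (rep T) (U, u) (T, idmap T)"
  by (auto simp: rep_homs_iff compose_idmap_left)

lemma terminal_rep:
  assumes "T \<in> CGTop"
  shows "terminal_obj (rep T) (T, idmap T)"
  unfolding terminal_obj_def
proof (intro conjI ballI)
  show "(T, idmap T) \<in> Obj (rep T)" using assms by simp
  fix w assume "w \<in> Obj (rep T)"
  then obtain U u where w: "w = (U, u)" "(U, u) \<in> Obj (rep T)" by (cases w) auto
  show "\<exists>!m. m \<in> homs (rep T) w (T, idmap T)"
  proof (rule ex1I[of _ "((U, u), u, (T, idmap T))"])
    show "((U, u), u, (T, idmap T)) \<in> homs (rep T) w (T, idmap T)"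
      using rep_to_terminal[OF assms w(2)] w(1) by simp
    show "m = ((U, u), u, (T, idmap T))" if "m \<in> homs (rep T) w (T, idmap T)" for m
      using that unfolding w(1) rep_homs_iff by (auto simp: compose_idmap_left)
  qed
qed

section \<open>Composition of morphisms, and equivalences with spaces\<close>

lemma comp_mor_simps [simp]:
  "x \<in> Obj A \<Longrightarrow> OM (comp_mor A G F) x = OM G (OM F x)"
  "m \<in> Arr A \<Longrightarrow> AM (comp_mor A G F) m = AM G (AM F m)"
  by (simp_all add: comp_mor_def compose_def)

lemma id_mor_simps [simp]:
  "x \<in> Obj A \<Longrightarrow> OM (id_mor A) x = x" "m \<in> Arr A \<Longrightarrow> AM (id_mor A) m = m"
  by (simp_all add: id_mor_def)

lemma morphism_comp_mor:
  assumes A: "category_over A" and F: "morphism A B F" and G: "morphism B C G"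
  shows "morphism A C (comp_mor A G F)"
proof (rule morphismI)
  fix x assume x: "x \<in> Obj A"
  note i = Id_homs[OF A x]
  show "AM (comp_mor A G F) (Id A x) = Id C (OM (comp_mor A G F) x)"
    using x mor_Id[OF F x] mor_Id[OF G mor_Obj[OF F x]] homs_Arr[OF i] by simp
  show "OM (comp_mor A G F) x \<in> Obj C" "Base C (OM (comp_mor A G F) x) = Base A x"
    using x mor_Obj[OF F x] mor_Obj[OF G mor_Obj[OF F x]] mor_Base[OF F x] mor_Base[OF G mor_Obj[OF F x]] by auto
next
  fix a b m assume m: "m \<in> homs A a b"
  note ab = homs_Obj[OF A m]
  show "AM (comp_mor A G F) m \<in> homs C (OM (comp_mor A G F) a) (OM (comp_mor A G F) b)"
    using mor_homs[OF G mor_homs[OF F m]] homs_Arr[OF m] ab by simp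
  show "BaseMap C (AM (comp_mor A G F) m) = BaseMap A m"
    using mor_BaseMap[OF G mor_homs[OF F m]] mor_BaseMap[OF F m] homs_Arr[OF m] by simp
next
  fix a b c m n assume m: "m \<in> homs A a b" and n: "n \<in> homs A b c"
  show "AM (comp_mor A G F) (Cmp A n m) = Cmp C (AM (comp_mor A G F) n) (AM (comp_mor A G F) m)"
    using homs_Arr[OF m] homs_Arr[OF n] homs_Arr[OF Cmp_homs[OF A m n]] mor_Cmp[OF F m n]
      mor_Cmp[OF G mor_homs[OF F m] mor_homs[OF F n]] by simp
qed (auto simp: comp_mor_def compose_def)

lemma morphism_id_mor:
  assumes A: "category_over A"
  shows "morphism A A (id_mor A)"
proof (rule morphismI)
  show "AM (id_mor A) (Id A x) = Id A (OM (id_mor A) x)" if "x \<in> Obj A" for x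
    using that homs_Arr[OF Id_homs[OF A that]] by simp
  show "AM (id_mor A) m \<in> homs A (OM (id_mor A) a) (OM (id_mor A) b)" if m: "m \<in> homs A a b" for a b m
    using m homs_Obj[OF A m] homs_Arr[OF m] by simp
  show "BaseMap A (AM (id_mor A) m) = BaseMap A m" if m: "m \<in> homs A a b" for a b m
    using homs_Arr[OF m] by simp
  show "AM (id_mor A) (Cmp A n m) = Cmp A (AM (id_mor A) n) (AM (id_mor A) m)"
    if m: "m \<in> homs A a b" and n: "n \<in> homs A b c" for a b c m n
    using homs_Arr[OF m] homs_Arr[OF n] homs_Arr[OF Cmp_homs[OF A m n]] by simp
qed (auto simp: id_mor_def)

lemma vertical_Id: "\<lbrakk>category_over X; x \<in> Obj X\<rbrakk> \<Longrightarrow> vertical X (Id X x)"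
  by (intro verticalI[OF Id_homs]) (auto simp: BaseMap_Id)

text \<open>By \<open>morphism_exists\<close> there are morphisms \<open>E\<close> and
  \<open>G\<close> that exchange \<open>t\<close> with the identity of the space. Both composites
  fix a terminal object, so \<open>two_morphism_exists\<close> joins them to the identity.\<close>

lemma equivalence_of_terminal:
  assumes P: "fibered_in_groupoids P" and t: "terminal_obj P t"
  obtains E where "equivalence (rep (Base P t)) P E"
proof -
  note co = fib_category_over[OF P]
  have tO: "t \<in> Obj P" using t by (simp add: terminal_obj_def)
  define Z where "Z = Base P t"
  have Z: "Z \<in> CGTop" using Base_CGTop[OF co tO] by (simp add: Z_def)
  let ?z = "(Z, idmap Z)"
  have zO: "?z \<in> Obj (rep Z)" using Z by simp
  obtain E where E: "morphism (rep Z) P E" "OM E ?z = t"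
    by (rule morphism_exists[OF category_over_rep P terminal_rep[OF Z] tO]) (auto simp: Z_def)
  obtain G where G: "morphism P (rep Z) G" "OM G t = ?z"
    by (rule morphism_exists[OF co fibered_rep t zO]) (auto simp: Z_def)
  have "\<exists>\<eta>. two_morphism (rep Z) (rep Z) (comp_mor (rep Z) G E) (id_mor (rep Z)) \<eta>"
  proof (rule two_morphism_exists[OF category_over_rep fibered_rep terminal_rep[OF Z]
        morphism_comp_mor[OF category_over_rep E(1) G(1)] morphism_id_mor[OF category_over_rep]])
    show "Id (rep Z) ?z \<in> homs (rep Z) (OM (comp_mor (rep Z) G E) ?z) (OM (id_mor (rep Z)) ?z)"
      using E(2) G(2) zO Id_homs[OF category_over_rep zO] by simp
    show "vertical (rep Z) (Id (rep Z) ?z)" using vertical_Id[OF category_over_rep zO] .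
  qed blast
  moreover have "\<exists>\<eta>. two_morphism P P (comp_mor P E G) (id_mor P) \<eta>"
  proof (rule two_morphism_exists[OF co P t morphism_comp_mor[OF co G(1) E(1)] morphism_id_mor[OF co]])
    show "Id P t \<in> homs P (OM (comp_mor P E G) t) (OM (id_mor P) t)"
      using E(2) G(2) tO Id_homs[OF co tO] by simp
    show "vertical P (Id P t)" using vertical_Id[OF co tO] .
  qed blast
  ultimately have "equivalence (rep Z) P E"
    unfolding equivalence_def using E(1) G(1) by blast
  then show thesis using that by (simp add: Z_def)
qed

text \<open>Let \<open>z\<close> be the identity of \<open>Z\<close>. An arrow from \<open>w\<close>
  to \<open>E z\<close> exists because \<open>\<epsilon>\<close> is invertible and \<open>z\<close>
  is terminal. Two such arrows have the same image under \<open>G\<close>, whose target is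
  isomorphic to \<open>z\<close>; naturality of \<open>\<epsilon>\<close> then shows that they are
  equal.\<close>

lemma terminal_of_equivalence:
  assumes P: "fibered_in_groupoids P" and Z: "Z \<in> CGTop" and "equivalence (rep Z) P E"
  shows "terminal_obj P (OM E (Z, idmap Z))"
proof -
  note co = fib_category_over[OF P]
  let ?z = "(Z, idmap Z)"
  have zO: "?z \<in> Obj (rep Z)" using Z by simp
  obtain G \<eta> \<epsilon> where E: "morphism (rep Z) P E" and G: "morphism P (rep Z) G"
    and \<eta>: "two_morphism (rep Z) (rep Z) (comp_mor (rep Z) G E) (id_mor (rep Z)) \<eta>"
    and \<epsilon>: "two_morphism P P (comp_mor P E G) (id_mor P) \<epsilon>"
    using assms(3) unfolding equivalence_def by blast
  let ?t = "OM E ?z"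
  have tO: "?t \<in> Obj P" using mor_Obj[OF E zO] .
  have \<epsilon>h: "\<epsilon> w \<in> homs P (OM E (OM G w)) w" "vertical P (\<epsilon> w)" if "w \<in> Obj P" for w
    using two_morphism_homs[OF \<epsilon> that] two_morphism_vertical[OF \<epsilon> that] that by simp_all
  have \<eta>h: "\<eta> ?z \<in> homs (rep Z) (OM G ?t) ?z" "vertical (rep Z) (\<eta> ?z)"
    using two_morphism_homs[OF \<eta> zO] two_morphism_vertical[OF \<eta> zO] zO by auto
  have "\<exists>!m. m \<in> homs P w ?t" if w: "w \<in> Obj P" for w
  proof (rule ex_ex1I)
    obtain n where n: "n \<in> homs P w (OM E (OM G w))" using fib_vertical_inverse[OF P \<epsilon>h[OF w]] .
    obtain k where k: "k \<in> homs (rep Z) (OM G w) ?z"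
      using terminal_rep[OF Z] mor_Obj[OF G w] by (auto simp: terminal_obj_def)
    show "\<exists>m. m \<in> homs P w ?t" using Cmp_homs[OF co n mor_homs[OF E k]] by blast
    fix m m' assume m: "m \<in> homs P w ?t" and m': "m' \<in> homs P w ?t"
    note Gm = mor_homs[OF G m] and Gm' = mor_homs[OF G m']
    have "Cmp (rep Z) (\<eta> ?z) (AM G m) = Cmp (rep Z) (\<eta> ?z) (AM G m')"
      using terminal_rep[OF Z] mor_Obj[OF G w] Cmp_homs[OF category_over_rep Gm \<eta>h(1)]
        Cmp_homs[OF category_over_rep Gm' \<eta>h(1)] unfolding terminal_obj_def by blast
    moreover obtain \<eta>' where \<eta>': "\<eta>' \<in> homs (rep Z) ?z (OM G ?t)" "Cmp (rep Z) \<eta>' (\<eta> ?z) = Id (rep Z) (OM G ?t)"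
      using fib_vertical_inverse[OF fibered_rep \<eta>h] by metis
    ultimately have "AM G m = AM G m'"
      using Cmp_assoc[OF category_over_rep Gm \<eta>h(1) \<eta>'(1)] Cmp_assoc[OF category_over_rep Gm' \<eta>h(1) \<eta>'(1)]
        Cmp_Id_left[OF category_over_rep Gm] Cmp_Id_left[OF category_over_rep Gm'] by metis
    then have "Cmp P m (\<epsilon> w) = Cmp P m' (\<epsilon> w)"
      using two_morphism_natural[OF \<epsilon> m] two_morphism_natural[OF \<epsilon> m'] homs_Arr[OF m] homs_Arr[OF m'] by simp
    then show "m = m'" using fib_epi[OF P \<epsilon>h[OF w] m m'] by blast
  qed
  then show ?thesis using tO by (simp add: terminal_obj_def)
qed

section \<open>Fiber products\<close>

context
  fixes A :: "('o, 'm, 'u) fibcat" and B :: "('p, 'n, 'u) fibcat" and C :: "('q, 'k, 'u) fibcat"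
    and F :: "('o, 'm, 'q, 'k) mor" and G :: "('p, 'n, 'q, 'k) mor"
begin

private abbreviation "FP \<equiv> fiber_product A B C F G"

lemma fp_Obj: "(a, b, \<phi>) \<in> Obj FP \<longleftrightarrow> a \<in> Obj A \<and> b \<in> Obj B \<and> Base A a = Base B b \<and>
    \<phi> \<in> homs C (OM F a) (OM G b) \<and> vertical C \<phi>"
  by (auto simp: fiber_product_def homs_def Let_def)

lemma fp_homs: "m \<in> homs FP (a, b, \<phi>) (a', b', \<phi>') \<longleftrightarrow> (\<exists>k l. m = ((a, b, \<phi>), (k, l), (a', b', \<phi>')) \<and>
    (a, b, \<phi>) \<in> Obj FP \<and> (a', b', \<phi>') \<in> Obj FP \<and> k \<in> homs A a a' \<and> l \<in> homs B b b' \<and>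
    BaseMap A k = BaseMap B l \<and> Cmp C \<phi>' (AM F k) = Cmp C (AM G l) \<phi>)"
  by (auto simp: fiber_product_def homs_def Let_def)

lemma fp_simps [simp]:
  "Dom FP (x, k, y) = x" "Cod FP (x, k, y) = y" "Id FP (a, b, \<phi>) = ((a, b, \<phi>), (Id A a, Id B b), (a, b, \<phi>))"
  "Cmp FP (y', (m', n'), z) (x, (m, n), y) = (x, (Cmp A m' m, Cmp B n' n), z)"
  "Base FP (a, b, \<phi>) = Base A a" "BaseMap FP (x, (m, n), y) = BaseMap A m"
  by (simp_all add: fiber_product_def Let_def)

lemma fp_homsE:
  assumes "m \<in> homs FP x y"
  obtains a b \<phi> a' b' \<phi>' k l where "x = (a, b, \<phi>)" "y = (a', b', \<phi>')" "m = (x, (k, l), y)"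
    "x \<in> Obj FP" "y \<in> Obj FP" "k \<in> homs A a a'" "l \<in> homs B b b'"
    "BaseMap A k = BaseMap B l" "Cmp C \<phi>' (AM F k) = Cmp C (AM G l) \<phi>"
proof -
  obtain a b \<phi> a' b' \<phi>' where "x = (a, b, \<phi>)" "y = (a', b', \<phi>')" by (cases x; cases y)
  then show thesis using assms that by (simp add: fp_homs) blast
qed

text \<open>An arrow of the fiber product is a pair of arrows over one base map, so pullbacks and
  factorizations are taken in \<open>A\<close> and \<open>B\<close> separately; compatibility in
  \<open>C\<close> is recovered by cancelling an image under \<open>G\<close>.\<close>

lemma fibered_fiber_product:
  assumes A: "fibered_in_groupoids A" and B: "fibered_in_groupoids B" and C: "fibered_in_groupoids C"
    and F: "morphism A C F" and G: "morphism B C G"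
  shows "fibered_in_groupoids FP"
proof -
  note coA = fib_category_over[OF A] and coB = fib_category_over[OF B] and coC = fib_category_over[OF C]
  have Id_fp: "Id FP x \<in> homs FP x x" if x: "x \<in> Obj FP" for x
  proof -
    obtain a b \<phi> where e: "x = (a, b, \<phi>)" by (cases x)
    have o: "a \<in> Obj A" "b \<in> Obj B" "Base A a = Base B b" "\<phi> \<in> homs C (OM F a) (OM G b)"
      using x by (auto simp: e fp_Obj)
    show ?thesis
      using x o unfolding e
      by (auto simp: fp_homs Id_homs[OF coA] Id_homs[OF coB] BaseMap_Id[OF coA] BaseMap_Id[OF coB]
        mor_Id[OF F] mor_Id[OF G] Cmp_Id_left[OF coC] Cmp_Id_right[OF coC])
  qed
  have Cmp_fp: "Cmp FP n m \<in> homs FP x z" if m: "m \<in> homs FP x y" and n: "n \<in> homs FP y z" for x y z m n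
  proof -
    from m obtain a b \<phi> a' b' \<phi>' k l where 1: "x = (a, b, \<phi>)" "y = (a', b', \<phi>')" "m = (x, (k, l), y)"
      "x \<in> Obj FP" "y \<in> Obj FP" "k \<in> homs A a a'" "l \<in> homs B b b'"
      "BaseMap A k = BaseMap B l" "Cmp C \<phi>' (AM F k) = Cmp C (AM G l) \<phi>" by (rule fp_homsE)
    from n obtain a'' b'' \<phi>'' k' l' where 2: "z = (a'', b'', \<phi>'')" "n = (y, (k', l'), z)"
      "z \<in> Obj FP" "k' \<in> homs A a' a''" "l' \<in> homs B b' b''"
      "BaseMap A k' = BaseMap B l'" "Cmp C \<phi>'' (AM F k') = Cmp C (AM G l') \<phi>'"
      using 1(2) by (auto elim: fp_homsE)
    have o: "Base A a = Base B b" "\<phi> \<in> homs C (OM F a) (OM G b)" "\<phi>' \<in> homs C (OM F a') (OM G b')"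
      "\<phi>'' \<in> homs C (OM F a'') (OM G b'')"
      using 1(1,2,4,5) 2(1,3) by (auto simp: fp_Obj)
    have "Cmp C \<phi>'' (AM F (Cmp A k' k)) = Cmp C (Cmp C \<phi>'' (AM F k')) (AM F k)"
      using mor_Cmp[OF F 1(6) 2(4)] Cmp_assoc[OF coC mor_homs[OF F 1(6)] mor_homs[OF F 2(4)] o(4)] by simp
    also have "\<dots> = Cmp C (AM G l') (Cmp C \<phi>' (AM F k))"
      using 2(7) Cmp_assoc[OF coC mor_homs[OF F 1(6)] o(3) mor_homs[OF G 2(5)]] by simp
    also have "\<dots> = Cmp C (AM G (Cmp B l' l)) \<phi>"
      using 1(9) mor_Cmp[OF G 1(7) 2(5)] Cmp_assoc[OF coC o(2) mor_homs[OF G 1(7)] mor_homs[OF G 2(5)]] by simp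
    finally show ?thesis
      using 1 2 Cmp_homs[OF coA 1(6) 2(4)] Cmp_homs[OF coB 1(7) 2(5)] BaseMap_Cmp[OF coA 1(6) 2(4)]
        BaseMap_Cmp[OF coB 1(7) 2(5)] o(1) by (simp add: fp_homs)
  qed
  have co: "category_over FP"
  proof (rule category_overI)
    show "Dom FP m \<in> Obj FP \<and> Cod FP m \<in> Obj FP" if "m \<in> Arr FP" for m
      using Arr_homs[OF that] by (rule fp_homsE) simp
    show "Cmp FP m (Id FP x) = m" if "m \<in> homs FP x y" for x y m
      using that by (rule fp_homsE) (simp add: Cmp_Id_right[OF coA] Cmp_Id_right[OF coB])
    show "Cmp FP (Id FP y) m = m" if "m \<in> homs FP x y" for x y m
      using that by (rule fp_homsE) (simp add: Cmp_Id_left[OF coA] Cmp_Id_left[OF coB])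
    show "Cmp FP n (Cmp FP m l) = Cmp FP (Cmp FP n m) l"
      if "l \<in> homs FP a b" "m \<in> homs FP b c" "n \<in> homs FP c d" for a b c d l m n
      using that by (elim fp_homsE) (auto simp: Cmp_assoc[OF coA] Cmp_assoc[OF coB])
    show "Base FP x \<in> CGTop" if "x \<in> Obj FP" for x
      using that by (cases x) (auto simp: fp_Obj Base_CGTop[OF coB])
    show "BaseMap FP (Id FP x) = idmap (Base FP x)" if "x \<in> Obj FP" for x
      using that by (cases x) (auto simp: fp_Obj BaseMap_Id[OF coA])
    show "BaseMap FP m \<in> cmap (Base FP x) (Base FP y)" if "m \<in> homs FP x y" for x y m
      using that by (rule fp_homsE) (metis BaseMap_cmap[OF coA] fp_simps(5,6))
    show "BaseMap FP (Cmp FP n m) = compose (topspace (Base FP x)) (BaseMap FP n) (BaseMap FP m)"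
      if "m \<in> homs FP x y" "n \<in> homs FP y z" for x y z m n
      using that by (elim fp_homsE) (auto simp: BaseMap_Cmp[OF coA])
  qed (use Id_fp Cmp_fp in auto)
  show ?thesis
  proof (rule fibered_in_groupoidsI[OF co])
    fix S y g assume S: "S \<in> CGTop" and y: "y \<in> Obj FP" and g: "g \<in> cmap S (Base FP y)"
    obtain a b \<phi> where e: "y = (a, b, \<phi>)" by (cases y)
    have o: "a \<in> Obj A" "b \<in> Obj B" "Base A a = Base B b" "\<phi> \<in> homs C (OM F a) (OM G b)" "vertical C \<phi>"
      using y by (auto simp: e fp_Obj)
    have gA: "g \<in> cmap S (Base A a)" and gB: "g \<in> cmap S (Base B b)" using g o(3) by (auto simp: e)
    obtain a' k where k: "k \<in> homs A a' a" "Base A a' = S" "BaseMap A k = g"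
      using fib_pullback[OF A S o(1) gA] by blast
    obtain b' l where l: "l \<in> homs B b' b" "Base B b' = S" "BaseMap B l = g"
      using fib_pullback[OF B S o(2) gB] by blast
    note ab = homs_Obj(1)[OF coA k(1)] homs_Obj(1)[OF coB l(1)]
    have b: "Base C (OM F a') = S" "Base C (OM G b') = S" "Base C (OM F a) = Base A a"
      using mor_Base[OF F ab(1)] mor_Base[OF G ab(2)] mor_Base[OF F o(1)] k l by auto
    \<comment> \<open>The connecting arrow over \<open>S\<close> is the factorization of
      \<open>\<phi> \<circ> F k\<close> through \<open>G l\<close> over the identity.\<close>
    obtain \<psi> where \<psi>: "\<psi> \<in> homs C (OM F a') (OM G b')" "BaseMap C \<psi> = idmap S"
        "Cmp C (AM G l) \<psi> = Cmp C \<phi> (AM F k)"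
    proof (rule fib_cartE[OF C mor_homs[OF G l(1)] Cmp_homs[OF coC mor_homs[OF F k(1)] o(4)]])
      show "idmap S \<in> cmap (Base C (OM F a')) (Base C (OM G b'))" by (simp add: b)
      show "compose (topspace (Base C (OM F a'))) (BaseMap C (AM G l)) (idmap S) = BaseMap C (Cmp C \<phi> (AM F k))"
        using BaseMap_Cmp[OF coC mor_homs[OF F k(1)] o(4)] mor_BaseMap[OF F k(1)] mor_BaseMap[OF G l(1)]
          vertical_BaseMap[OF o(4,5)] b k l compose_idmap_right[OF gA] compose_idmap_left[OF gA] by simp
    qed
    have "vertical C \<psi>" using verticalI[OF \<psi>(1)] b \<psi>(2) by simp
    then have "(a', b', \<psi>) \<in> Obj FP" using ab k l \<psi> by (simp add: fp_Obj)
    then have "((a', b', \<psi>), (k, l), y) \<in> homs FP (a', b', \<psi>) y"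
      using y k l \<psi>(3) unfolding e fp_homs by simp
    then show "\<exists>x m. m \<in> homs FP x y \<and> Base FP x = S \<and> BaseMap FP m = g"
      using k by (metis fp_simps(5,6))
  next
    fix x y z m n g assume m: "m \<in> homs FP y z" and n: "n \<in> homs FP x z"
      and g: "g \<in> cmap (Base FP x) (Base FP y)"
      and mg: "compose (topspace (Base FP x)) (BaseMap FP m) g = BaseMap FP n"
    from m obtain a2 b2 \<phi>2 a3 b3 \<phi>3 k l where 1: "y = (a2, b2, \<phi>2)" "z = (a3, b3, \<phi>3)" "m = (y, (k, l), z)"
      "y \<in> Obj FP" "z \<in> Obj FP" "k \<in> homs A a2 a3" "l \<in> homs B b2 b3"
      "BaseMap A k = BaseMap B l" "Cmp C \<phi>3 (AM F k) = Cmp C (AM G l) \<phi>2" by (rule fp_homsE)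
    from n obtain a1 b1 \<phi>1 k' l' where 2: "x = (a1, b1, \<phi>1)" "n = (x, (k', l'), z)"
      "x \<in> Obj FP" "k' \<in> homs A a1 a3" "l' \<in> homs B b1 b3"
      "BaseMap A k' = BaseMap B l'" "Cmp C \<phi>3 (AM F k') = Cmp C (AM G l') \<phi>1"
      using 1(2) by (auto elim: fp_homsE)
    have o: "a1 \<in> Obj A" "a2 \<in> Obj A" "b1 \<in> Obj B" "b2 \<in> Obj B" "Base A a1 = Base B b1" "Base A a2 = Base B b2"
      "\<phi>1 \<in> homs C (OM F a1) (OM G b1)" "\<phi>2 \<in> homs C (OM F a2) (OM G b2)"
      "vertical C \<phi>1" "vertical C \<phi>2" "\<phi>3 \<in> homs C (OM F a3) (OM G b3)"
      using 1(1,2,4,5) 2(1,3) by (auto simp: fp_Obj)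
    have exA: "\<exists>!i. i \<in> homs A a1 a2 \<and> BaseMap A i = g \<and> Cmp A k i = k'"
      using g mg 1 2 by (intro fib_cart[OF A 1(6) 2(4)]) auto
    have exB: "\<exists>!j. j \<in> homs B b1 b2 \<and> BaseMap B j = g \<and> Cmp B l j = l'"
      using g mg 1 2 o by (intro fib_cart[OF B 1(7) 2(5)]) auto
    obtain i where i: "i \<in> homs A a1 a2" "BaseMap A i = g" "Cmp A k i = k'" using exA by blast
    obtain j where j: "j \<in> homs B b1 b2" "BaseMap B j = g" "Cmp B l j = l'" using exB by blast
    note Fi = mor_homs[OF F i(1)] and Gj = mor_homs[OF G j(1)] and Fk = mor_homs[OF F 1(6)] and Gl = mor_homs[OF G 1(7)]
    have "Cmp C \<phi>2 (AM F i) = Cmp C (AM G j) \<phi>1"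
    proof (rule fib_cancel[OF C Gl Cmp_homs[OF coC Fi o(8)] Cmp_homs[OF coC o(7) Gj]])
      have g1: "g \<in> cmap (Base A a1) (Base A a2)" using g 1 2 by simp
      show "BaseMap C (Cmp C \<phi>2 (AM F i)) = BaseMap C (Cmp C (AM G j) \<phi>1)"
        using BaseMap_Cmp[OF coC Fi o(8)] BaseMap_Cmp[OF coC o(7) Gj] vertical_BaseMap[OF o(7,9)] vertical_BaseMap[OF o(8,10)]
          mor_BaseMap[OF F i(1)] mor_BaseMap[OF G j(1)] mor_Base[OF F o(1)] mor_Base[OF F o(2)] i(2) j(2)
          compose_idmap_left[OF g1] compose_idmap_right[OF g1] by simp
      have "Cmp C (AM G l) (Cmp C \<phi>2 (AM F i)) = Cmp C (Cmp C \<phi>3 (AM F k)) (AM F i)"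
        using Cmp_assoc[OF coC Fi o(8) Gl] 1(9) by simp
      also have "\<dots> = Cmp C \<phi>3 (AM F k')"
        using Cmp_assoc[OF coC Fi Fk o(11)] mor_Cmp[OF F i(1) 1(6)] i(3) by simp
      also have "\<dots> = Cmp C (AM G (Cmp B l j)) \<phi>1" using 2(7) j(3) by simp
      also have "\<dots> = Cmp C (AM G l) (Cmp C (AM G j) \<phi>1)"
        using Cmp_assoc[OF coC o(7) Gj Gl] mor_Cmp[OF G j(1) 1(7)] by simp
      finally show "Cmp C (AM G l) (Cmp C \<phi>2 (AM F i)) = Cmp C (AM G l) (Cmp C (AM G j) \<phi>1)" .
    qed
    then have ij: "(x, (i, j), y) \<in> homs FP x y"
      using 1(1,4) 2(1,3) i j by (simp add: fp_homs)
    show "\<exists>!h. h \<in> homs FP x y \<and> BaseMap FP h = g \<and> Cmp FP m h = n"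
    proof (rule ex1I[of _ "(x, (i, j), y)"])
      show "(x, (i, j), y) \<in> homs FP x y \<and> BaseMap FP (x, (i, j), y) = g \<and> Cmp FP m (x, (i, j), y) = n"
        using ij i j 1(3) 2(2) by simp
      fix h assume h: "h \<in> homs FP x y \<and> BaseMap FP h = g \<and> Cmp FP m h = n"
      then obtain i' j' where ij': "h = (x, (i', j'), y)" "i' \<in> homs A a1 a2" "j' \<in> homs B b1 b2"
        "BaseMap A i' = BaseMap B j'" using 1(1) 2(1) by (auto elim: fp_homsE)
      then have "i' = i" "j' = j" using h exA exB i j 1(3) 2(2) by auto
      then show "h = (x, (i, j), y)" using ij' by simp
    qed
  qed
qed

end

section \<open>Universal arrows and representability\<close>

text \<open>A terminal object of the comma category of \<open>f\<close> over \<open>x\<close>. The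
  arrow \<open>l\<close> need not be vertical: its base map is the map from the representing space
  to the base of \<open>x\<close>.\<close>

definition universal_arrow :: "('o, 'm, 'u) fibcat \<Rightarrow> ('p, 'n, 'u) fibcat \<Rightarrow> ('o, 'm, 'p, 'n) mor \<Rightarrow>
    'p \<Rightarrow> 'o \<Rightarrow> 'n \<Rightarrow> bool" where
  "universal_arrow A B f x b l \<longleftrightarrow> b \<in> Obj A \<and> l \<in> homs B (OM f b) x \<and>
     (\<forall>b'\<in>Obj A. \<forall>l'\<in>homs B (OM f b') x. \<exists>!n. n \<in> homs A b' b \<and> Cmp B l (AM f n) = l')"

lemma universal_arrowD:
  assumes "universal_arrow A B f x b l"
  shows "b \<in> Obj A" "l \<in> homs B (OM f b) x"
    and "\<lbrakk>b' \<in> Obj A; l' \<in> homs B (OM f b') x\<rbrakk> \<Longrightarrow> \<exists>!n. n \<in> homs A b' b \<and> Cmp B l (AM f n) = l'"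
  using assms unfolding universal_arrow_def by blast+

context
  fixes A :: "('o, 'm, 'u) fibcat" and B :: "('p, 'n, 'u) fibcat" and f :: "('o, 'm, 'p, 'n) mor"
    and T :: "'u topology" and p :: "('u slice_obj, 'u slice_arr, 'p, 'n) mor"
  assumes A: "fibered_in_groupoids A" and B: "fibered_in_groupoids B" and f: "morphism A B f"
    and T: "T \<in> CGTop" and p: "morphism (rep T) B p"
begin

private abbreviation "P \<equiv> fiber_product (rep T) A B p f"
private abbreviation "x0 \<equiv> OM p (T, idmap T)"

text \<open>This arrow exhibits \<open>p (U, u)\<close> as the restriction of \<open>x0\<close>
  along \<open>u\<close>.\<close>

private definition pa where "pa = (\<lambda>U u. AM p ((U, u), u, (T, idmap T)))"

private lemma pa:
  assumes "(U, u) \<in> Obj (rep T)"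
  shows "pa U u \<in> homs B (OM p (U, u)) x0" "BaseMap B (pa U u) = u"
  using mor_homs[OF p rep_to_terminal[OF T assms]] mor_BaseMap[OF p rep_to_terminal[OF T assms]]
  by (simp_all add: pa_def)

text \<open>In the fiber product \<open>\<phi>\<close> identifies \<open>f b\<close> with the
  restriction of \<open>x0\<close> along \<open>u\<close>; this amounts to an arrow \<open>l\<close>
  from \<open>f b\<close> to \<open>x0\<close> over \<open>u\<close>. A relation is used so that no
  inverse of \<open>\<phi>\<close> has to be chosen.\<close>

private definition corr where
  "corr o' b l \<longleftrightarrow> (\<exists>U u \<phi>. o' = ((U, u), b, \<phi>) \<and> o' \<in> Obj P \<and> l \<in> homs B (OM f b) x0 \<and>
     Cmp B l \<phi> = pa U u)"

private lemma corr_BaseMap: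
  assumes "corr ((U, u), b, \<phi>) b l"
  shows "BaseMap B l = u" "Base A b = U"
proof -
  note coB = fib_category_over[OF B]
  have h: "((U, u), b, \<phi>) \<in> Obj P" "l \<in> homs B (OM f b) x0" "Cmp B l \<phi> = pa U u"
    using assms by (auto simp: corr_def)
  then have o: "(U, u) \<in> Obj (rep T)" "b \<in> Obj A" "U = Base A b" "\<phi> \<in> homs B (OM p (U, u)) (OM f b)" "vertical B \<phi>"
    by (auto simp: fp_Obj)
  show "Base A b = U" using o by simp
  have "u = compose (topspace (Base B (OM p (U, u)))) (BaseMap B l) (BaseMap B \<phi>)"
    using BaseMap_Cmp[OF coB o(4) h(2)] h(3) pa(2)[OF o(1)] by simp
  also have "\<dots> = BaseMap B l"
    using vertical_BaseMap[OF o(4,5)] vertical_Base[OF o(4,5)] compose_idmap_right[OF BaseMap_cmap[OF coB h(2)]] by simp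
  finally show "BaseMap B l = u" by simp
qed

private lemma corr_exists:
  assumes "o' \<in> Obj P"
  obtains l where "corr o' (fst (snd o')) l"
proof -
  note coB = fib_category_over[OF B]
  obtain U u b \<phi> where e: "o' = ((U, u), b, \<phi>)" by (metis prod.collapse)
  then have o: "(U, u) \<in> Obj (rep T)" "b \<in> Obj A" "U = Base A b" "\<phi> \<in> homs B (OM p (U, u)) (OM f b)" "vertical B \<phi>"
    using assms by (auto simp: fp_Obj)
  obtain \<psi> where \<psi>: "\<psi> \<in> homs B (OM f b) (OM p (U, u))" "Cmp B \<psi> \<phi> = Id B (OM p (U, u))"
    using fib_vertical_inverse[OF B o(4,5)] by metis
  have "Cmp B (Cmp B (pa U u) \<psi>) \<phi> = pa U u"
    using Cmp_assoc[OF coB o(4) \<psi>(1) pa(1)[OF o(1)]] \<psi>(2) Cmp_Id_right[OF coB pa(1)[OF o(1)]] by simp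
  then have "corr o' b (Cmp B (pa U u) \<psi>)"
    unfolding corr_def using assms e Cmp_homs[OF coB \<psi>(1) pa(1)[OF o(1)]] by blast
  then show thesis using that e by simp
qed

private lemma corr_exists':
  assumes b: "b \<in> Obj A" and l: "l \<in> homs B (OM f b) x0"
  obtains \<phi> where "corr ((Base A b, BaseMap B l), b, \<phi>) b l"
proof -
  note coA = fib_category_over[OF A] and coB = fib_category_over[OF B]
  let ?U = "Base A b" and ?u = "BaseMap B l"
  have TO: "(T, idmap T) \<in> Obj (rep T)" using T by simp
  have b1: "Base B (OM f b) = ?U" "Base B x0 = T"
    using mor_Base[OF f b] mor_Base[OF p TO] by auto
  have u: "?u \<in> cmap ?U T" using BaseMap_cmap[OF coB l] b1 by simp
  then have Uu: "(?U, ?u) \<in> Obj (rep T)" using Base_CGTop[OF coA b] by simp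
  have b2: "Base B (OM p (?U, ?u)) = ?U" using mor_Base[OF p Uu] by simp
  obtain \<phi> where \<phi>: "\<phi> \<in> homs B (OM p (?U, ?u)) (OM f b)" "BaseMap B \<phi> = idmap ?U" "Cmp B l \<phi> = pa ?U ?u"
    by (rule fib_cartE[OF B l pa(1)[OF Uu], of "idmap ?U"])
      (use b1 b2 pa(2)[OF Uu] compose_idmap_right[OF u] in auto)
  moreover have "vertical B \<phi>" using verticalI[OF \<phi>(1)] b1 b2 \<phi>(2) by simp
  ultimately have "corr ((?U, ?u), b, \<phi>) b l"
    unfolding corr_def using Uu b l by (auto simp: fp_Obj)
  then show thesis by (rule that)
qed

text \<open>An arrow in the slice over \<open>T\<close> is fixed by its base map and its ends, so
  only the component \<open>n\<close> in \<open>A\<close> is left, and compatibility of the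
  connecting arrows becomes \<open>l2 \<circ> f n = l1\<close>. One direction cancels the vertical
  arrow of the source, the other cancels \<open>l2\<close>.\<close>

private lemma corr_homs:
  assumes c: "corr o1 b1 l1" and c': "corr o2 b2 l2"
  shows "m \<in> homs P o1 o2 \<longleftrightarrow>
    (\<exists>n. n \<in> homs A b1 b2 \<and> Cmp B l2 (AM f n) = l1 \<and> m = (o1, ((fst o1, BaseMap A n, fst o2), n), o2))"
proof -
  note coA = fib_category_over[OF A] and coB = fib_category_over[OF B]
  obtain U u \<phi> V v \<psi> where e: "o1 = ((U, u), b1, \<phi>)" "o2 = ((V, v), b2, \<psi>)"
    and h: "o1 \<in> Obj P" "l1 \<in> homs B (OM f b1) x0" "Cmp B l1 \<phi> = pa U u"
      "o2 \<in> Obj P" "l2 \<in> homs B (OM f b2) x0" "Cmp B l2 \<psi> = pa V v"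
    using c c' unfolding corr_def by blast
  have o: "(U, u) \<in> Obj (rep T)" "U = Base A b1" "\<phi> \<in> homs B (OM p (U, u)) (OM f b1)" "vertical B \<phi>" "b1 \<in> Obj A"
    "(V, v) \<in> Obj (rep T)" "V = Base A b2" "\<psi> \<in> homs B (OM p (V, v)) (OM f b2)" "vertical B \<psi>" "b2 \<in> Obj A"
    using h(1,4) e by (auto simp: fp_Obj)
  have lu: "BaseMap B l1 = u" "BaseMap B l2 = v" using corr_BaseMap c c' e by blast+
  have ppa: "Cmp B (pa V v) (AM p k) = pa U u" if k: "k \<in> homs (rep T) (U, u) (V, v)" for k
  proof -
    have "Cmp (rep T) ((V, v), v, (T, idmap T)) k = ((U, u), u, (T, idmap T))"
      using k by (rule rep_homsE) auto
    then show ?thesis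
      using mor_Cmp[OF p k rep_to_terminal[OF T o(6)]] by (simp add: pa_def)
  qed
  have base1: "Base B (OM p (U, u)) = U" "Base B (OM f b1) = U" "Base B (OM f b2) = V" "Base B (OM p (V, v)) = V"
    using mor_Base[OF p o(1)] mor_Base[OF p o(6)] mor_Base[OF f o(5)] mor_Base[OF f o(10)] o(2,7) by simp_all
  show ?thesis
  proof
    assume "m \<in> homs P o1 o2"
    then obtain k n where kn: "m = (o1, (k, n), o2)" "k \<in> homs (rep T) (U, u) (V, v)" "n \<in> homs A b1 b2"
      "BaseMap (rep T) k = BaseMap A n" "Cmp B \<psi> (AM p k) = Cmp B (AM f n) \<phi>"
      unfolding e by (auto simp: fp_homs)
    note fn = mor_homs[OF f kn(3)] and pk = mor_homs[OF p kn(2)]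
    have "Cmp B (Cmp B l2 (AM f n)) \<phi> = Cmp B l2 (Cmp B \<psi> (AM p k))"
      using Cmp_assoc[OF coB o(3) fn h(5)] kn(5) by simp
    also have "\<dots> = Cmp B l1 \<phi>"
      using Cmp_assoc[OF coB pk o(8) h(5)] h(3,6) ppa[OF kn(2)] by simp
    finally have "Cmp B l2 (AM f n) = l1"
      using fib_epi[OF B o(3,4) Cmp_homs[OF coB fn h(5)] h(2)] by blast
    moreover have "k = ((U, u), BaseMap A n, (V, v))"
      using kn(2,4) by (auto simp: rep_homs_iff)
    ultimately show "\<exists>n. n \<in> homs A b1 b2 \<and> Cmp B l2 (AM f n) = l1 \<and> m = (o1, ((fst o1, BaseMap A n, fst o2), n), o2)"
      using kn e by auto
  next
    assume "\<exists>n. n \<in> homs A b1 b2 \<and> Cmp B l2 (AM f n) = l1 \<and> m = (o1, ((fst o1, BaseMap A n, fst o2), n), o2)"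
    then obtain n where n: "n \<in> homs A b1 b2" "Cmp B l2 (AM f n) = l1" "m = (o1, (((U, u), BaseMap A n, (V, v)), n), o2)"
      using e by auto
    note fn = mor_homs[OF f n(1)]
    have g: "BaseMap A n \<in> cmap U V" using BaseMap_cmap[OF coA n(1)] o by simp
    have "compose (topspace U) v (BaseMap A n) = u"
      using BaseMap_Cmp[OF coB fn h(5)] n(2) lu mor_BaseMap[OF f n(1)] base1 by simp
    then have k: "((U, u), BaseMap A n, (V, v)) \<in> homs (rep T) (U, u) (V, v)" (is "?k \<in> _")
      using o(1,6) g by (auto simp: rep_homs_iff)
    note pk = mor_homs[OF p k]
    have "Cmp B \<psi> (AM p ?k) = Cmp B (AM f n) \<phi>"
    proof (rule fib_cancel[OF B h(5) Cmp_homs[OF coB pk o(8)] Cmp_homs[OF coB o(3) fn]])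
      show "BaseMap B (Cmp B \<psi> (AM p ?k)) = BaseMap B (Cmp B (AM f n) \<phi>)"
        using BaseMap_Cmp[OF coB pk o(8)] BaseMap_Cmp[OF coB o(3) fn] vertical_BaseMap[OF o(3,4)] vertical_BaseMap[OF o(8,9)]
          mor_BaseMap[OF p k] mor_BaseMap[OF f n(1)] base1 compose_idmap_left[OF g] compose_idmap_right[OF g] by simp
      show "Cmp B l2 (Cmp B \<psi> (AM p ?k)) = Cmp B l2 (Cmp B (AM f n) \<phi>)"
        using Cmp_assoc[OF coB pk o(8) h(5)] Cmp_assoc[OF coB o(3) fn h(5)] h(3,6) n(2) ppa[OF k] by simp
    qed
    then show "m \<in> homs P o1 o2"
      using n k h(1,4) unfolding e by (simp add: fp_homs)
  qed
qed

lemma terminal_imp_universal_arrow: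
  assumes t: "terminal_obj P ((Z, z), b, \<phi>)"
  obtains l where "universal_arrow A B f (OM p (T, idmap T)) b l" "BaseMap B l = z" "Base A b = Z"
proof -
  have tO: "((Z, z), b, \<phi>) \<in> Obj P" using t by (simp add: terminal_obj_def)
  obtain l where c: "corr ((Z, z), b, \<phi>) b l" using corr_exists[OF tO] by auto
  have "universal_arrow A B f x0 b l"
    unfolding universal_arrow_def
  proof (intro conjI ballI)
    show "b \<in> Obj A" "l \<in> homs B (OM f b) x0" using c tO by (auto simp: corr_def fp_Obj)
    fix b' l' assume b': "b' \<in> Obj A" "l' \<in> homs B (OM f b') x0"
    then obtain \<phi>' where c': "corr ((Base A b', BaseMap B l'), b', \<phi>') b' l'" (is "corr ?o _ _")
      using corr_exists' by blast
    then have "?o \<in> Obj P" by (auto simp: corr_def)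
    then have ex: "\<exists>!m. m \<in> homs P ?o ((Z, z), b, \<phi>)" using t by (simp add: terminal_obj_def)
    then show "\<exists>!n. n \<in> homs A b' b \<and> Cmp B l (AM f n) = l'"
      unfolding corr_homs[OF c' c] by auto
  qed
  then show thesis using that corr_BaseMap[OF c] by blast
qed

lemma universal_arrow_imp_terminal:
  assumes u: "universal_arrow A B f (OM p (T, idmap T)) b l"
  obtains \<phi> where "terminal_obj P ((Base A b, BaseMap B l), b, \<phi>)"
proof -
  note u' = universal_arrowD[OF u]
  obtain \<phi> where c: "corr ((Base A b, BaseMap B l), b, \<phi>) b l" (is "corr ?t _ _")
    using corr_exists'[OF u'(1,2)] by blast
  have "terminal_obj P ?t"
    unfolding terminal_obj_def
  proof (intro conjI ballI)
    show "?t \<in> Obj P" using c by (auto simp: corr_def)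
    fix w assume w: "w \<in> Obj P"
    obtain l' where c': "corr w (fst (snd w)) l'" using corr_exists[OF w] by blast
    have "fst (snd w) \<in> Obj A" using w by (cases w) (auto simp: fp_Obj)
    moreover have "l' \<in> homs B (OM f (fst (snd w))) x0" using c' by (auto simp: corr_def)
    note 1 = calculation this
    from u'(3)[OF 1] show "\<exists>!m. m \<in> homs P w ?t"
      unfolding corr_homs[OF c' c] by auto
  qed
  then show thesis by (rule that)
qed

end

text \<open>The object \<open>x\<close> is classified by a morphism from the space
  \<open>Base B x\<close>, to which representability applies.\<close>

lemma representable_imp_universal_arrow:
  assumes A: "fibered_in_groupoids A" and B: "fibered_in_groupoids B" and r: "representable A B f" and x: "x \<in> Obj B"
  obtains b l where "universal_arrow A B f x b l"
proof -
  note coB = fib_category_over[OF B]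
  have f: "morphism A B f" using r by (simp add: representable_def)
  have T: "Base B x \<in> CGTop" (is "?T \<in> _") using Base_CGTop[OF coB x] .
  obtain p where p: "morphism (rep ?T) B p" "OM p (?T, idmap ?T) = x"
    by (rule morphism_exists[OF category_over_rep B terminal_rep[OF T] x]) auto
  obtain Z E where Z: "Z \<in> CGTop" "equivalence (rep Z) (fiber_product (rep ?T) A B p f) E"
    using r T p(1) unfolding representable_def by blast
  obtain c z b \<phi> where "OM E (Z, idmap Z) = ((c, z), b, \<phi>)" by (metis prod.collapse)
  then have "terminal_obj (fiber_product (rep ?T) A B p f) ((c, z), b, \<phi>)"
    using terminal_of_equivalence[OF fibered_fiber_product[OF fibered_rep A B p(1) f] Z] by simp
  then show thesis
    using terminal_imp_universal_arrow[OF A B f T p(1)] p(2) that by metis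
qed

lemma representableI:
  assumes A: "fibered_in_groupoids A" and B: "fibered_in_groupoids B" and f: "morphism A B f"
    and u: "\<And>x. x \<in> Obj B \<Longrightarrow> \<exists>b l. universal_arrow A B f x b l"
  shows "representable A B f"
  unfolding representable_def
proof (intro conjI ballI allI impI)
  show "morphism A B f" by (rule f)
  fix T :: "'c topology" and p assume T: "T \<in> CGTop" and p: "morphism (rep T) B p"
  have "(T, idmap T) \<in> Obj (rep T)" using T by simp
  then obtain b l where bl: "universal_arrow A B f (OM p (T, idmap T)) b l"
    using u mor_Obj[OF p] by blast
  obtain \<phi> where t: "terminal_obj (fiber_product (rep T) A B p f) ((Base A b, BaseMap B l), b, \<phi>)"
    by (rule universal_arrow_imp_terminal[OF A B f T p bl])
  obtain E where "equivalence (rep (Base A b)) (fiber_product (rep T) A B p f) E"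
    using equivalence_of_terminal[OF fibered_fiber_product[OF fibered_rep A B p f] t] by auto
  moreover have "Base A b \<in> CGTop"
    using Base_CGTop[OF fib_category_over[OF A]] universal_arrowD(1)[OF bl] by blast
  ultimately show "\<exists>Z\<in>CGTop. \<exists>E. equivalence (rep Z) (fiber_product (rep T) A B p f) E" by blast
qed

text \<open>Any equivalence with the fiber product singles out a terminal object and hence a
  universal arrow, whose base map is the underlying map in the definition.\<close>

lemma universal_weak_equivalenceI:
  assumes A: "fibered_in_groupoids A" and B: "fibered_in_groupoids B" and r: "representable A B f"
    and u: "\<And>x b l. \<lbrakk>x \<in> Obj B; universal_arrow A B f x b l\<rbrakk> \<Longrightarrow>
        weak_equivalence (Base A b) (Base B x) (BaseMap B l)"
  shows "universal_weak_equivalence A B f"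
  unfolding universal_weak_equivalence_def
proof (intro conjI ballI allI impI)
  show "representable A B f" by (rule r)
  have f: "morphism A B f" using r by (simp add: representable_def)
  fix T Z :: "'c topology" and p E assume T: "T \<in> CGTop" and p: "morphism (rep T) B p" and Z: "Z \<in> CGTop"
    and E: "equivalence (rep Z) (fiber_product (rep T) A B p f) E"
  let ?P = "fiber_product (rep T) A B p f"
  have zO: "(Z, idmap Z) \<in> Obj (rep Z)" and TO: "(T, idmap T) \<in> Obj (rep T)" using Z T by simp_all
  have mE: "morphism (rep Z) ?P E" using E by (simp add: equivalence_def)
  obtain c z b \<phi> where e: "OM E (Z, idmap Z) = ((c, z), b, \<phi>)" by (metis prod.collapse)
  have t: "terminal_obj ?P ((c, z), b, \<phi>)"
    using terminal_of_equivalence[OF fibered_fiber_product[OF fibered_rep A B p f] Z E] e by simp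
  then have tO: "((c, z), b, \<phi>) \<in> Obj ?P" by (simp add: terminal_obj_def)
  have "c = Z" using mor_Base[OF mE zO] by (simp add: e)
  obtain l where l: "universal_arrow A B f (OM p (T, idmap T)) b l" "BaseMap B l = z" "Base A b = c"
    by (rule terminal_imp_universal_arrow[OF A B f T p t])
  have "underlying_map Z (comp_mor (rep Z) (fp_proj1 ?P) E) = z"
    using zO tO e by (simp add: underlying_map_def fp_proj1_def)
  then show "weak_equivalence Z T (underlying_map Z (comp_mor (rep Z) (fp_proj1 ?P) E))"
    using u[OF mor_Obj[OF p TO] l(1)] l(2,3) mor_Base[OF p TO] \<open>c = Z\<close> by simp
qed

lemma universal_arrow_iso:
  assumes B: "fibered_in_groupoids B" and f: "morphism A B f"
    and u: "universal_arrow A B f x b l" and i: "i \<in> homs B x x'" and j: "j \<in> homs B x' x"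
    and ij: "Cmp B i j = Id B x'" and ji: "Cmp B j i = Id B x"
  shows "universal_arrow A B f x' b (Cmp B i l)"
proof -
  note co = fib_category_over[OF B] and u' = universal_arrowD[OF u]
  show ?thesis
    unfolding universal_arrow_def
  proof (intro conjI ballI)
    show "b \<in> Obj A" "Cmp B i l \<in> homs B (OM f b) x'" using u' Cmp_homs[OF co _ i] by auto
    fix b' l' assume b': "b' \<in> Obj A" and l': "l' \<in> homs B (OM f b') x'"
    have "Cmp B (Cmp B i l) (AM f n) = l' \<longleftrightarrow> Cmp B l (AM f n) = Cmp B j l'" if n: "n \<in> homs A b' b" for n
    proof -
      note fn = mor_homs[OF f n]
      have "Cmp B (Cmp B i l) (AM f n) = Cmp B i (Cmp B l (AM f n))"
        using Cmp_assoc[OF co fn u'(2) i] by simp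
      moreover have "Cmp B i k = l' \<longleftrightarrow> k = Cmp B j l'" if k: "k \<in> homs B (OM f b') x" for k
        using Cmp_assoc[OF co k i j] Cmp_assoc[OF co l' j i] ij ji Cmp_Id_left[OF co k] Cmp_Id_left[OF co l'] by auto
      ultimately show ?thesis using Cmp_homs[OF co fn u'(2)] by simp
    qed
    then show "\<exists>!n. n \<in> homs A b' b \<and> Cmp B (Cmp B i l) (AM f n) = l'"
      using u'(3)[OF b' Cmp_homs[OF co l' j]] by metis
  qed
qed

section \<open>Mapping stacks\<close>

lemma prod_Obj [simp]: "(a, b) \<in> Obj (prod_stack A B) \<longleftrightarrow> a \<in> Obj A \<and> b \<in> Obj B \<and> Base A a = Base B b"
  by (simp add: prod_stack_def)

lemma prod_simps [simp]:
  "Dom (prod_stack A B) (m, n) = (Dom A m, Dom B n)" "Cod (prod_stack A B) (m, n) = (Cod A m, Cod B n)"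
  "Id (prod_stack A B) (a, b) = (Id A a, Id B b)"
  "Cmp (prod_stack A B) (m', n') (m, n) = (Cmp A m' m, Cmp B n' n)"
  "Base (prod_stack A B) (a, b) = Base A a" "BaseMap (prod_stack A B) (m, n) = BaseMap A m"
  by (simp_all add: prod_stack_def)

lemma prod_homs: "m \<in> homs (prod_stack A B) (a, b) (a', b') \<longleftrightarrow> (\<exists>k l. m = (k, l) \<and> k \<in> homs A a a' \<and>
    l \<in> homs B b b' \<and> BaseMap A k = BaseMap B l \<and> Base A a = Base B b \<and> Base A a' = Base B b')"
  by (auto simp: prod_stack_def homs_def)

lemma prod_homsE:
  assumes "m \<in> homs (prod_stack A B) x y"
  obtains a b a' b' k l where "x = (a, b)" "y = (a', b')" "m = (k, l)" "k \<in> homs A a a'"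
    "l \<in> homs B b b'" "BaseMap A k = BaseMap B l" "Base A a = Base B b" "Base A a' = Base B b'"
proof -
  obtain a b a' b' where "x = (a, b)" "y = (a', b')" by (cases x; cases y)
  then show thesis using assms that by (auto simp: prod_homs)
qed

lemma category_over_prod:
  assumes A: "category_over A" and B: "category_over B"
  shows "category_over (prod_stack A B)"
proof (rule category_overI)
  let ?P = "prod_stack A B"
  show "Dom ?P m \<in> Obj ?P \<and> Cod ?P m \<in> Obj ?P" if "m \<in> Arr ?P" for m
    using Arr_homs[OF that] by (rule prod_homsE) (metis homs_Obj[OF A] homs_Obj[OF B] homs_Cod homs_Dom prod_Obj prod_simps(1,2))
  show "Id ?P x \<in> homs ?P x x" if "x \<in> Obj ?P" for x
    using that by (cases x) (auto simp: prod_homs Id_homs[OF A] Id_homs[OF B] BaseMap_Id[OF A] BaseMap_Id[OF B])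
  show "Cmp ?P n m \<in> homs ?P x z" if "m \<in> homs ?P x y" "n \<in> homs ?P y z" for x y z m n
    using that by (elim prod_homsE)
      (auto simp: prod_homs BaseMap_Cmp[OF A] BaseMap_Cmp[OF B] intro: Cmp_homs[OF A] Cmp_homs[OF B])
  show "Cmp ?P m (Id ?P x) = m" if "m \<in> homs ?P x y" for x y m
    using that by (elim prod_homsE) (auto simp: Cmp_Id_right[OF A] Cmp_Id_right[OF B])
  show "Cmp ?P (Id ?P y) m = m" if "m \<in> homs ?P x y" for x y m
    using that by (elim prod_homsE) (auto simp: Cmp_Id_left[OF A] Cmp_Id_left[OF B])
  show "Cmp ?P n (Cmp ?P m l) = Cmp ?P (Cmp ?P n m) l"
    if "l \<in> homs ?P a b" "m \<in> homs ?P b c" "n \<in> homs ?P c d" for a b c d l m n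
    using that by (elim prod_homsE) (auto simp: Cmp_assoc[OF A] Cmp_assoc[OF B])
  show "Base ?P x \<in> CGTop" if "x \<in> Obj ?P" for x
    using that by (cases x) (auto simp: Base_CGTop[OF B])
  show "BaseMap ?P (Id ?P x) = idmap (Base ?P x)" if "x \<in> Obj ?P" for x
    using that by (cases x) (auto simp: BaseMap_Id[OF A])
  show "BaseMap ?P m \<in> cmap (Base ?P x) (Base ?P y)" if "m \<in> homs ?P x y" for x y m
    using that by (rule prod_homsE) (metis BaseMap_cmap[OF A] prod_simps(5,6))
  show "BaseMap ?P (Cmp ?P n m) = compose (topspace (Base ?P x)) (BaseMap ?P n) (BaseMap ?P m)"
    if "m \<in> homs ?P x y" "n \<in> homs ?P y z" for x y z m n
    using that by (elim prod_homsE) (auto simp: BaseMap_Cmp[OF A])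
qed

section \<open>Products with an identity, and mapping stacks as categories fibered in
  groupoids\<close>

context
  fixes Q :: "('o, 'm, 'u) fibcat" and X :: "('p, 'n, 'u) fibcat"
  assumes Q: "category_over Q" and X: "fibered_in_groupoids X"
begin

private abbreviation "PS S \<equiv> prod_stack (rep S) Q"
private abbreviation "tg S g \<equiv> times_id S g Q"

lemmas coPS = category_over_prod[OF category_over_rep Q]

lemma times_id_OM: "((U, u), y) \<in> Obj (PS S) \<Longrightarrow> OM (tg S g) ((U, u), y) = ((U, compose (topspace U) g u), y)"
  by (auto simp: times_id_def Let_def)

lemma times_id_AM: "(((U, u), k, (V, v)), n) \<in> Arr (PS S) \<Longrightarrow>
    AM (tg S g) (((U, u), k, (V, v)), n) = (((U, compose (topspace U) g u), k, (V, compose (topspace V) g v)), n)"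
  by (auto simp: times_id_def Let_def)

lemma morphism_times_id:
  assumes g: "g \<in> cmap S T"
  shows "morphism (PS S) (PS T) (tg S g)"
proof (rule morphismI)
  show "OM (tg S g) \<in> extensional (Obj (PS S))" "AM (tg S g) \<in> extensional (Arr (PS S))"
    by (auto simp: times_id_def Let_def)
  fix x assume x: "x \<in> Obj (PS S)"
  obtain U u y where e: "x = ((U, u), y)" by (metis prod.collapse)
  have o: "U \<in> CGTop" "u \<in> cmap U S" "y \<in> Obj Q" "U = Base Q y" using x by (auto simp: e)
  note t = times_id_OM[OF x[unfolded e], of g]
  show "OM (tg S g) x \<in> Obj (PS T)" "Base (PS T) (OM (tg S g) x) = Base (PS S) x"
    using o compose_cmap[OF o(2) g] unfolding e t by simp_all
  have "Id (PS S) x \<in> Arr (PS S)" using homs_Arr[OF Id_homs[OF coPS x]] .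
  then show "AM (tg S g) (Id (PS S) x) = Id (PS T) (OM (tg S g) x)"
    using o unfolding e t by (simp add: times_id_AM)
next
  fix a b m assume m: "m \<in> homs (PS S) a b"
  then obtain x y x' y' k l where 1: "a = (x, y)" "b = (x', y')" "m = (k, l)" "k \<in> homs (rep S) x x'"
    "l \<in> homs Q y y'" "BaseMap (rep S) k = BaseMap Q l" "Base (rep S) x = Base Q y" "Base (rep S) x' = Base Q y'"
    by (rule prod_homsE)
  from 1(4) obtain U u h V v where 2: "x = (U, u)" "x' = (V, v)" "k = ((U, u), h, (V, v))" "U \<in> CGTop" "u \<in> cmap U S"
     "V \<in> CGTop" "v \<in> cmap V S" "h \<in> cmap U V" "compose (topspace U) v h = u" by (rule rep_homsE)
  have o: "((U, u), y) \<in> Obj (PS S)" "((V, v), y') \<in> Obj (PS S)" using homs_Obj[OF coPS m] 1 2 by auto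
  have A: "AM (tg S g) m = (((U, compose (topspace U) g u), h, (V, compose (topspace V) g v)), l)"
    using homs_Arr[OF m] unfolding 1(3) 2(3) by (rule times_id_AM)
  have "compose (topspace U) (compose (topspace V) g v) h = compose (topspace U) g u"
    using compose_cmap_assoc[OF 2(8), of g v] 2(9) by simp
  then have "((U, compose (topspace U) g u), h, (V, compose (topspace V) g v)) \<in>
      homs (rep T) (U, compose (topspace U) g u) (V, compose (topspace V) g v)"
    using 2 compose_cmap[OF 2(5) g] compose_cmap[OF 2(7) g] by (simp add: rep_homs_iff)
  then show "AM (tg S g) m \<in> homs (PS T) (OM (tg S g) a) (OM (tg S g) b)"
    using 1 2 unfolding A 1(1,2) 2(1,2) times_id_OM[OF o(1)] times_id_OM[OF o(2)] by (simp add: prod_homs)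
  show "BaseMap (PS T) (AM (tg S g) m) = BaseMap (PS S) m"
    unfolding A using 1(3) 2(3) by simp
next
  fix a b c m n assume m: "m \<in> homs (PS S) a b" and n: "n \<in> homs (PS S) b c"
  from m obtain x y x' y' k l where 1: "a = (x, y)" "b = (x', y')" "m = (k, l)" "k \<in> homs (rep S) x x'"
    by (rule prod_homsE)
  from n obtain x'' y'' k' l' where 2: "c = (x'', y'')" "n = (k', l')" "k' \<in> homs (rep S) x' x''"
    using 1(2) by (auto elim: prod_homsE)
  from 1(4) obtain U u h V v where 3: "x = (U, u)" "x' = (V, v)" "k = ((U, u), h, (V, v))" by (rule rep_homsE)
  from 2(3) obtain h' W w where 4: "k' = ((V, v), h', (W, w))" using 3(2) by (auto elim: rep_homsE)
  have mA: "(((U, u), h, (V, v)), l) \<in> Arr (PS S)" using homs_Arr[OF m] 1(3) 3(3) by simp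
  have nA: "(((V, v), h', (W, w)), l') \<in> Arr (PS S)" using homs_Arr[OF n] 2(2) 4 by simp
  have mnA: "(((U, u), compose (topspace U) h' h, (W, w)), Cmp Q l' l) \<in> Arr (PS S)"
    using homs_Arr[OF Cmp_homs[OF coPS m n]] 1(3) 2(2) 3(3) 4 by simp
  show "AM (tg S g) (Cmp (PS S) n m) = Cmp (PS T) (AM (tg S g) n) (AM (tg S g) m)"
    unfolding 1(3) 2(2) 3(3) 4 using times_id_AM[OF mA] times_id_AM[OF nA] times_id_AM[OF mnA] by simp
qed

text \<open>Strict functoriality of the product with \<open>Q\<close> makes composition in
  \<open>Map\<close> associative exactly, so that \<open>Map\<close> is a category.\<close>

lemma times_id_comp:
  assumes g: "g \<in> cmap R S" and h: "h \<in> cmap S T"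
  shows "x \<in> Obj (PS R) \<Longrightarrow> OM (tg S h) (OM (tg R g) x) = OM (tg R (compose (topspace R) h g)) x"
    and "m \<in> homs (PS R) a b \<Longrightarrow> AM (tg S h) (AM (tg R g) m) = AM (tg R (compose (topspace R) h g)) m"
proof -
  assume x: "x \<in> Obj (PS R)"
  obtain U u y where e: "x = ((U, u), y)" by (metis prod.collapse)
  have u: "u \<in> cmap U R" using x unfolding e by (metis prod_Obj rep_Obj)
  note o = x[unfolded e]
  have "((U, compose (topspace U) g u), y) \<in> Obj (PS S)"
    using mor_Obj[OF morphism_times_id[OF g] x] unfolding e times_id_OM[OF o] .
  from times_id_OM[OF this, of h] show "OM (tg S h) (OM (tg R g) x) = OM (tg R (compose (topspace R) h g)) x"
    unfolding e times_id_OM[OF o] compose_cmap_assoc[OF u] .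
next
  assume m: "m \<in> homs (PS R) a b"
  then obtain x y x' y' k l where 1: "m = (k, l)" "k \<in> homs (rep R) x x'" by (rule prod_homsE)
  from 1(2) obtain U u i V v where 2: "k = ((U, u), i, (V, v))" "u \<in> cmap U R" "v \<in> cmap V R" by (rule rep_homsE)
  have mA: "(((U, u), i, (V, v)), l) \<in> Arr (PS R)" using homs_Arr[OF m] 1 2 by simp
  have "(((U, compose (topspace U) g u), i, (V, compose (topspace V) g v)), l) \<in> Arr (PS S)"
    using homs_Arr[OF mor_homs[OF morphism_times_id[OF g] m]] unfolding 1 2 times_id_AM[OF mA] .
  from times_id_AM[OF this, of h] show "AM (tg S h) (AM (tg R g) m) = AM (tg R (compose (topspace R) h g)) m"
    unfolding 1 2 times_id_AM[OF mA] compose_cmap_assoc[OF 2(2)] compose_cmap_assoc[OF 2(3)] .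
qed

lemma times_id_idmap:
  shows "x \<in> Obj (PS S) \<Longrightarrow> OM (tg S (idmap S)) x = x"
    and "m \<in> homs (PS S) a b \<Longrightarrow> AM (tg S (idmap S)) m = m"
proof -
  assume x: "x \<in> Obj (PS S)"
  obtain U u y where e: "x = ((U, u), y)" by (metis prod.collapse)
  show "OM (tg S (idmap S)) x = x"
    using times_id_OM[OF x[unfolded e], of "idmap S"] x unfolding e by (metis compose_idmap_left prod_Obj rep_Obj)
next
  assume m: "m \<in> homs (PS S) a b"
  then obtain x y x' y' k l where 1: "m = (k, l)" "k \<in> homs (rep S) x x'" by (rule prod_homsE)
  from 1(2) obtain U u i V v where 2: "k = ((U, u), i, (V, v))" "u \<in> cmap U S" "v \<in> cmap V S" by (rule rep_homsE)
  show "AM (tg S (idmap S)) m = m"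
    using times_id_AM[OF homs_Arr[OF m, unfolded 1 2(1)], of "idmap S"]
    unfolding 1 2(1) compose_idmap_left[OF 2(2)] compose_idmap_left[OF 2(3)] .
qed

lemma Map_Obj [simp]: "(T, F) \<in> Obj (Map Q X) \<longleftrightarrow> T \<in> CGTop \<and> morphism (PS T) X F"
  by (simp add: Map_def Let_def)

lemma Map_simps [simp]:
  "Dom (Map Q X) (x, m, y) = x" "Cod (Map Q X) (x, m, y) = y"
  "Id (Map Q X) (T, F) = ((T, F), (idmap T, \<lambda>z\<in>Obj (PS T). Id X (OM F z)), (T, F))"
  "Cmp (Map Q X) (y', (h, \<theta>), z) ((S, F), (g, \<eta>), y) = ((S, F), (compose (topspace S) h g,
     \<lambda>w\<in>Obj (PS S). Cmp X (\<theta> (OM (tg S g) w)) (\<eta> w)), z)"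
  "Base (Map Q X) (T, F) = T" "BaseMap (Map Q X) (x, (g, \<eta>'), y) = g"
  by (simp_all add: Map_def Let_def)

lemma Map_homs:
  "m \<in> homs (Map Q X) (S, F) (T, G) \<longleftrightarrow> (\<exists>g \<eta>. m = ((S, F), (g, \<eta>), (T, G)) \<and>
     S \<in> CGTop \<and> morphism (PS S) X F \<and> T \<in> CGTop \<and> morphism (PS T) X G \<and> g \<in> cmap S T \<and>
     two_morphism (PS S) X F (comp_mor (PS S) G (tg S g)) \<eta>)"
  by (auto simp: Map_def Let_def homs_def)

lemma Map_homsE:
  assumes "m \<in> homs (Map Q X) x y"
  obtains S F g \<eta> T G where "x = (S, F)" "y = (T, G)" "m = ((S, F), (g, \<eta>), (T, G))"
     "S \<in> CGTop" "morphism (PS S) X F" "T \<in> CGTop" "morphism (PS T) X G" "g \<in> cmap S T"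
     "two_morphism (PS S) X F (comp_mor (PS S) G (tg S g)) \<eta>"
proof -
  obtain S F T G where "x = (S, F)" "y = (T, G)" by (cases x; cases y)
  then show thesis using assms that by (auto simp: Map_homs)
qed

lemma two_morphism_pullD:
  assumes "two_morphism (PS S) X F (comp_mor (PS S) G (tg S g)) \<eta>"
  shows "x \<in> Obj (PS S) \<Longrightarrow> \<eta> x \<in> homs X (OM F x) (OM G (OM (tg S g) x))"
    and "x \<in> Obj (PS S) \<Longrightarrow> vertical X (\<eta> x)"
    and "m \<in> homs (PS S) a b \<Longrightarrow> Cmp X (\<eta> b) (AM F m) = Cmp X (AM G (AM (tg S g) m)) (\<eta> a)"
    and "\<eta> \<in> extensional (Obj (PS S))"
  using two_morphism_homs[OF assms, of x] two_morphism_vertical[OF assms, of x]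
    two_morphism_natural[OF assms, of m a b] two_morphism_ext[OF assms] homs_Arr[of m "PS S" a b]
  by auto

lemma two_morphism_pullI:
  assumes "\<eta> \<in> extensional (Obj (PS S))"
    and "\<And>x. x \<in> Obj (PS S) \<Longrightarrow> \<eta> x \<in> homs X (OM F x) (OM G (OM (tg S g) x))"
    and "\<And>x. x \<in> Obj (PS S) \<Longrightarrow> vertical X (\<eta> x)"
    and "\<And>a b m. m \<in> homs (PS S) a b \<Longrightarrow> Cmp X (\<eta> b) (AM F m) = Cmp X (AM G (AM (tg S g) m)) (\<eta> a)"
  shows "two_morphism (PS S) X F (comp_mor (PS S) G (tg S g)) \<eta>"
  using assms homs_Arr by (intro two_morphismI) fastforce+

lemma vertical_Cmp:
  assumes "m \<in> homs X a b" "vertical X m" "n \<in> homs X b c" "vertical X n"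
  shows "vertical X (Cmp X n m)"
proof -
  note co = fib_category_over[OF X]
  show ?thesis
    using vertical_Base[OF assms(1,2)] vertical_Base[OF assms(3,4)] vertical_BaseMap[OF assms(1,2)]
      vertical_BaseMap[OF assms(3,4)] BaseMap_Cmp[OF co assms(1,3)] compose_idmap_left[OF idmap_cmap]
    by (intro verticalI[OF Cmp_homs[OF co assms(1,3)]]) auto
qed

lemma category_over_Map: "category_over (Map Q X)"
proof -
  note coX = fib_category_over[OF X]
  let ?M = "Map Q X"
  have Id_M: "Id ?M x \<in> homs ?M x x" if x: "x \<in> Obj ?M" for x
  proof -
    obtain T F where e: "x = (T, F)" "T \<in> CGTop" and F: "morphism (PS T) X F" using x by (cases x) auto
    have "two_morphism (PS T) X F (comp_mor (PS T) F (tg T (idmap T))) (\<lambda>z\<in>Obj (PS T). Id X (OM F z))"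
    proof (rule two_morphism_pullI)
      fix z assume z: "z \<in> Obj (PS T)"
      show "(\<lambda>z\<in>Obj (PS T). Id X (OM F z)) z \<in> homs X (OM F z) (OM F (OM (tg T (idmap T)) z))"
        "vertical X ((\<lambda>z\<in>Obj (PS T). Id X (OM F z)) z)"
        using z Id_homs[OF coX mor_Obj[OF F z]] vertical_Id[OF coX mor_Obj[OF F z]] by (simp_all add: times_id_idmap(1))
    next
      fix a b m assume m: "m \<in> homs (PS T) a b"
      show "Cmp X ((\<lambda>z\<in>Obj (PS T). Id X (OM F z)) b) (AM F m) =
          Cmp X (AM F (AM (tg T (idmap T)) m)) ((\<lambda>z\<in>Obj (PS T). Id X (OM F z)) a)"
        using homs_Obj[OF coPS m] Cmp_Id_left[OF coX mor_homs[OF F m]] Cmp_Id_right[OF coX mor_homs[OF F m]]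
        by (simp add: times_id_idmap(2)[OF m])
    qed simp
    then show ?thesis using e F unfolding e by (simp add: Map_homs)
  qed
  have Cmp_M: "Cmp ?M n m \<in> homs ?M x z" if m: "m \<in> homs ?M x y" and n: "n \<in> homs ?M y z" for x y z m n
  proof -
    from m obtain R F g \<eta> S G where 1: "x = (R, F)" "y = (S, G)" "m = ((R, F), (g, \<eta>), (S, G))"
     "R \<in> CGTop" "morphism (PS R) X F" "S \<in> CGTop" "morphism (PS S) X G" "g \<in> cmap R S"
     "two_morphism (PS R) X F (comp_mor (PS R) G (tg R g)) \<eta>" by (rule Map_homsE)
    from n obtain h \<theta> T H where 2: "z = (T, H)" "n = ((S, G), (h, \<theta>), (T, H))"
     "T \<in> CGTop" "morphism (PS T) X H" "h \<in> cmap S T"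
     "two_morphism (PS S) X G (comp_mor (PS S) H (tg S h)) \<theta>" using 1(2) by (auto elim: Map_homsE)
    note \<eta> = two_morphism_pullD[OF 1(9)] and \<theta> = two_morphism_pullD[OF 2(6)]
    note g = morphism_times_id[OF 1(8)]
    let ?hg = "compose (topspace R) h g"
    let ?k = "\<lambda>w\<in>Obj (PS R). Cmp X (\<theta> (OM (tg R g) w)) (\<eta> w)"
    have "two_morphism (PS R) X F (comp_mor (PS R) H (tg R ?hg)) ?k"
    proof (rule two_morphism_pullI)
      fix w assume w: "w \<in> Obj (PS R)"
      note gw = mor_Obj[OF g w]
      show "?k w \<in> homs X (OM F w) (OM H (OM (tg R ?hg) w))"
        using w Cmp_homs[OF coX \<eta>(1)[OF w] \<theta>(1)[OF gw]] by (simp add: times_id_comp(1)[OF 1(8) 2(5) w])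
      show "vertical X (?k w)"
        using w vertical_Cmp[OF \<eta>(1,2)[OF w] \<theta>(1,2)[OF gw]] by simp
    next
      fix a b m assume m: "m \<in> homs (PS R) a b"
      note ab = homs_Obj[OF coPS m]
      note gm = mor_homs[OF g m] and gab = mor_Obj[OF g ab(1)] mor_Obj[OF g ab(2)]
      note Fm = mor_homs[OF 1(5) m] and Ggm = mor_homs[OF 1(7) gm]
      note Hhgm = mor_homs[OF 2(4) mor_homs[OF morphism_times_id[OF 2(5)] gm]]
      have "Cmp X (Cmp X (\<theta> (OM (tg R g) b)) (\<eta> b)) (AM F m) = Cmp X (\<theta> (OM (tg R g) b)) (Cmp X (AM G (AM (tg R g) m)) (\<eta> a))"
        using Cmp_assoc[OF coX Fm \<eta>(1)[OF ab(2)] \<theta>(1)[OF gab(2)]] \<eta>(3)[OF m] by simp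
      also have "\<dots> = Cmp X (Cmp X (AM H (AM (tg S h) (AM (tg R g) m))) (\<theta> (OM (tg R g) a))) (\<eta> a)"
        using Cmp_assoc[OF coX \<eta>(1)[OF ab(1)] Ggm \<theta>(1)[OF gab(2)]] \<theta>(3)[OF gm] by simp
      also have "\<dots> = Cmp X (AM H (AM (tg R ?hg) m)) (Cmp X (\<theta> (OM (tg R g) a)) (\<eta> a))"
        using Cmp_assoc[OF coX \<eta>(1)[OF ab(1)] \<theta>(1)[OF gab(1)] Hhgm] times_id_comp(2)[OF 1(8) 2(5) m] by simp
      finally show "Cmp X (?k b) (AM F m) = Cmp X (AM H (AM (tg R ?hg) m)) (?k a)" using ab by simp
    qed simp
    then show ?thesis
      using 1 2 compose_cmap[OF 1(8) 2(5)] by (simp add: Map_homs)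
  qed
  show ?thesis
  proof (rule category_overI)
    show "Dom ?M m \<in> Obj ?M \<and> Cod ?M m \<in> Obj ?M" if "m \<in> Arr ?M" for m
      using Arr_homs[OF that] by (rule Map_homsE) simp
    show "Cmp ?M m (Id ?M x) = m" if m: "m \<in> homs ?M x y" for x y m
    proof -
      from m obtain R F g \<eta> S G where 1: "x = (R, F)" "y = (S, G)" "m = ((R, F), (g, \<eta>), (S, G))"
       "R \<in> CGTop" "morphism (PS R) X F" "S \<in> CGTop" "morphism (PS S) X G" "g \<in> cmap R S"
       "two_morphism (PS R) X F (comp_mor (PS R) G (tg R g)) \<eta>" by (rule Map_homsE)
      note \<eta> = two_morphism_pullD[OF 1(9)]
      have "(\<lambda>w\<in>Obj (PS R). Cmp X (\<eta> (OM (tg R (idmap R)) w)) ((\<lambda>z\<in>Obj (PS R). Id X (OM F z)) w)) = \<eta>"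
        by (rule extensionalityI[OF _ \<eta>(4)]) (auto simp: times_id_idmap(1) Cmp_Id_right[OF coX \<eta>(1)])
      then show ?thesis using 1 compose_idmap_right[OF 1(8)] by simp
    qed
    show "Cmp ?M (Id ?M y) m = m" if m: "m \<in> homs ?M x y" for x y m
    proof -
      from m obtain R F g \<eta> S G where 1: "x = (R, F)" "y = (S, G)" "m = ((R, F), (g, \<eta>), (S, G))"
       "R \<in> CGTop" "morphism (PS R) X F" "S \<in> CGTop" "morphism (PS S) X G" "g \<in> cmap R S"
       "two_morphism (PS R) X F (comp_mor (PS R) G (tg R g)) \<eta>" by (rule Map_homsE)
      note \<eta> = two_morphism_pullD[OF 1(9)]
      have "(\<lambda>w\<in>Obj (PS R). Cmp X ((\<lambda>z\<in>Obj (PS S). Id X (OM G z)) (OM (tg R g) w)) (\<eta> w)) = \<eta>"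
        by (rule extensionalityI[OF _ \<eta>(4)])
          (auto simp: mor_Obj[OF morphism_times_id[OF 1(8)]] Cmp_Id_left[OF coX \<eta>(1)])
      then show ?thesis using 1 compose_idmap_left[OF 1(8)] by simp
    qed
    show "Cmp ?M n (Cmp ?M m l) = Cmp ?M (Cmp ?M n m) l"
      if l: "l \<in> homs ?M a b" and m: "m \<in> homs ?M b c" and n: "n \<in> homs ?M c d" for a b c d l m n
    proof -
      from l obtain R F g \<eta> S G where 1: "a = (R, F)" "b = (S, G)" "l = ((R, F), (g, \<eta>), (S, G))"
       "R \<in> CGTop" "morphism (PS R) X F" "S \<in> CGTop" "morphism (PS S) X G" "g \<in> cmap R S"
       "two_morphism (PS R) X F (comp_mor (PS R) G (tg R g)) \<eta>" by (rule Map_homsE)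
      from m obtain h \<theta> T H where 2: "c = (T, H)" "m = ((S, G), (h, \<theta>), (T, H))"
       "T \<in> CGTop" "morphism (PS T) X H" "h \<in> cmap S T"
       "two_morphism (PS S) X G (comp_mor (PS S) H (tg S h)) \<theta>" using 1(2) by (auto elim: Map_homsE)
      from n obtain i \<zeta> V K where 3: "d = (V, K)" "n = ((T, H), (i, \<zeta>), (V, K))"
       "i \<in> cmap T V" "two_morphism (PS T) X H (comp_mor (PS T) K (tg T i)) \<zeta>" using 2(1) by (auto elim: Map_homsE)
      note \<eta> = two_morphism_pullD[OF 1(9)] and \<theta> = two_morphism_pullD[OF 2(6)] and \<zeta> = two_morphism_pullD[OF 3(4)]
      note g = morphism_times_id[OF 1(8)] and h = morphism_times_id[OF 2(5)]
      have "Cmp X (\<zeta> (OM (tg R (compose (topspace R) h g)) w)) (Cmp X (\<theta> (OM (tg R g) w)) (\<eta> w)) =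
          Cmp X (Cmp X (\<zeta> (OM (tg S h) (OM (tg R g) w))) (\<theta> (OM (tg R g) w))) (\<eta> w)" if w: "w \<in> Obj (PS R)" for w
        using Cmp_assoc[OF coX \<eta>(1)[OF w] \<theta>(1)[OF mor_Obj[OF g w]] \<zeta>(1)[OF mor_Obj[OF h mor_Obj[OF g w]]]]
          times_id_comp(1)[OF 1(8) 2(5) w] by simp
      then show ?thesis
        using 1 2 3 mor_Obj[OF g] by (simp add: compose_cmap_assoc[OF 1(8)] cong: restrict_cong)
    qed
    show "Base ?M x \<in> CGTop" if "x \<in> Obj ?M" for x using that by (cases x) auto
    show "BaseMap ?M (Id ?M x) = idmap (Base ?M x)" if "x \<in> Obj ?M" for x by (cases x) auto
    show "BaseMap ?M m \<in> cmap (Base ?M x) (Base ?M y)" if "m \<in> homs ?M x y" for x y m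
      using that by (rule Map_homsE) auto
    show "BaseMap ?M (Cmp ?M n m) = compose (topspace (Base ?M x)) (BaseMap ?M n) (BaseMap ?M m)"
      if "m \<in> homs ?M x y" "n \<in> homs ?M y z" for x y z m n
      using that by (elim Map_homsE) auto
  qed (use Id_M Cmp_M in auto)
qed

text \<open>A pullback of \<open>(T, G)\<close> along \<open>g\<close> is the composite of
  \<open>G\<close> with \<open>g \<times> id\<close>, and the arrow is the identity 2-morphism.
  Factorizations exist because the components of the required 2-morphism can be solved for one by
  one in \<open>X\<close>.\<close>

lemma fibered_Map: "fibered_in_groupoids (Map Q X)"
proof (rule fibered_in_groupoidsI[OF category_over_Map])
  let ?M = "Map Q X"
  note coX = fib_category_over[OF X]
  fix S y g assume S: "S \<in> CGTop" and y: "y \<in> Obj ?M" and g: "g \<in> cmap S (Base ?M y)"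
  obtain T G where e: "y = (T, G)" "T \<in> CGTop" and G: "morphism (PS T) X G" using y by (cases y) auto
  have g: "g \<in> cmap S T" using g e by simp
  let ?F = "comp_mor (PS S) G (tg S g)"
  have F: "morphism (PS S) X ?F" using morphism_comp_mor[OF coPS morphism_times_id[OF g] G] .
  have "two_morphism (PS S) X ?F ?F (\<lambda>z\<in>Obj (PS S). Id X (OM ?F z))"
  proof (rule two_morphismI)
    show "(\<lambda>z\<in>Obj (PS S). Id X (OM ?F z)) z \<in> homs X (OM ?F z) (OM ?F z)"
      "vertical X ((\<lambda>z\<in>Obj (PS S). Id X (OM ?F z)) z)" if z: "z \<in> Obj (PS S)" for z
      using Id_homs[OF coX mor_Obj[OF F z]] vertical_Id[OF coX mor_Obj[OF F z]] z by simp_all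
    show "Cmp X ((\<lambda>z\<in>Obj (PS S). Id X (OM ?F z)) b) (AM ?F m) = Cmp X (AM ?F m) ((\<lambda>z\<in>Obj (PS S). Id X (OM ?F z)) a)"
      if m: "m \<in> homs (PS S) a b" for a b m
      using homs_Obj[OF coPS m] Cmp_Id_left[OF coX mor_homs[OF F m]] Cmp_Id_right[OF coX mor_homs[OF F m]]
      by (simp del: comp_mor_simps)
  qed simp
  then have "((S, ?F), (g, \<lambda>z\<in>Obj (PS S). Id X (OM ?F z)), (T, G)) \<in> homs ?M (S, ?F) y"
    unfolding e using S e(2) G F g by (simp add: Map_homs)
  then show "\<exists>x m. m \<in> homs ?M x y \<and> Base ?M x = S \<and> BaseMap ?M m = g"
    by (metis Map_simps(5,6))
next
  let ?M = "Map Q X"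
  note coX = fib_category_over[OF X]
  fix x y z m n j assume m: "m \<in> homs ?M y z" and n: "n \<in> homs ?M x z" and j: "j \<in> cmap (Base ?M x) (Base ?M y)"
    and mj: "compose (topspace (Base ?M x)) (BaseMap ?M m) j = BaseMap ?M n"
  from m obtain S F g \<eta> T G where 1: "y = (S, F)" "z = (T, G)" "m = ((S, F), (g, \<eta>), (T, G))"
    "S \<in> CGTop" "morphism (PS S) X F" "T \<in> CGTop" "morphism (PS T) X G" "g \<in> cmap S T"
    "two_morphism (PS S) X F (comp_mor (PS S) G (tg S g)) \<eta>" by (rule Map_homsE)
  from n obtain R H h \<theta> where 2: "x = (R, H)" "n = ((R, H), (h, \<theta>), (T, G))"
    "R \<in> CGTop" "morphism (PS R) X H" "h \<in> cmap R T"
    "two_morphism (PS R) X H (comp_mor (PS R) G (tg R h)) \<theta>" using 1(2) by (auto elim: Map_homsE)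
  have j: "j \<in> cmap R S" and gj: "compose (topspace R) g j = h" using j mj 1 2 by auto
  note \<eta> = two_morphism_pullD[OF 1(9)] and \<theta> = two_morphism_pullD[OF 2(6)]
  note tj = morphism_times_id[OF j]
  have tgj: "OM (tg S g) (OM (tg R j) w) = OM (tg R h) w" if "w \<in> Obj (PS R)" for w
    using times_id_comp(1)[OF j 1(8) that] gj by simp
  \<comment> \<open>The component at \<open>w\<close> is the unique vertical solution of this
    equation; naturality then follows by cancelling \<open>\<eta>\<close>.\<close>
  let ?P = "\<lambda>w k. k \<in> homs X (OM H w) (OM F (OM (tg R j) w)) \<and> BaseMap X k = idmap (Base (PS R) w) \<and>
      Cmp X (\<eta> (OM (tg R j) w)) k = \<theta> w"
  have base: "Base X (OM H w) = Base (PS R) w" "Base X (OM F (OM (tg R j) w)) = Base (PS R) w" if "w \<in> Obj (PS R)" for w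
    using mor_Base[OF 2(4) that] mor_Base[OF 1(5) mor_Obj[OF tj that]] mor_Base[OF tj that] by auto
  have ex: "\<exists>!k. ?P w k" if w: "w \<in> Obj (PS R)" for w
  proof (rule fib_cart[OF X \<eta>(1)[OF mor_Obj[OF tj w]]])
    show "\<theta> w \<in> homs X (OM H w) (OM G (OM (tg S g) (OM (tg R j) w)))" using \<theta>(1)[OF w] tgj[OF w] by simp
    show "idmap (Base (PS R) w) \<in> cmap (Base X (OM H w)) (Base X (OM F (OM (tg R j) w)))" by (simp add: base[OF w])
    show "compose (topspace (Base X (OM H w))) (BaseMap X (\<eta> (OM (tg R j) w))) (idmap (Base (PS R) w)) = BaseMap X (\<theta> w)"
      using vertical_BaseMap[OF \<eta>(1,2)[OF mor_Obj[OF tj w]]] vertical_BaseMap[OF \<theta>(1,2)[OF w]] base[OF w]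
        compose_idmap_left[OF idmap_cmap] by simp
  qed
  define \<kappa> where "\<kappa> = (\<lambda>w\<in>Obj (PS R). THE k. ?P w k)"
  have \<kappa>: "?P w (\<kappa> w)" if "w \<in> Obj (PS R)" for w
    using theI'[OF ex[OF that]] that by (simp add: \<kappa>_def)
  have "two_morphism (PS R) X H (comp_mor (PS R) F (tg R j)) \<kappa>"
  proof (rule two_morphism_pullI)
    show "\<kappa> \<in> extensional (Obj (PS R))" by (simp add: \<kappa>_def)
    show k: "\<kappa> w \<in> homs X (OM H w) (OM F (OM (tg R j) w))" if "w \<in> Obj (PS R)" for w using \<kappa>[OF that] by blast
    show "vertical X (\<kappa> w)" if "w \<in> Obj (PS R)" for w
      using \<kappa>[OF that] base[OF that] by (intro verticalI[OF k[OF that]]) auto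
    fix a b m assume m: "m \<in> homs (PS R) a b"
    note ab = homs_Obj[OF coPS m]
    note jm = mor_homs[OF tj m] and ja = mor_Obj[OF tj ab(1)] and jb = mor_Obj[OF tj ab(2)]
    note Hm = mor_homs[OF 2(4) m] and Fjm = mor_homs[OF 1(5) jm]
    note Ggjm = mor_homs[OF 1(7) mor_homs[OF morphism_times_id[OF 1(8)] jm]]
    show "Cmp X (\<kappa> b) (AM H m) = Cmp X (AM F (AM (tg R j) m)) (\<kappa> a)"
    proof (rule fib_cancel[OF X \<eta>(1)[OF jb] Cmp_homs[OF coX Hm k[OF ab(2)]] Cmp_homs[OF coX k[OF ab(1)] Fjm]])
      note bm = BaseMap_cmap[OF coPS m]
      show "BaseMap X (Cmp X (\<kappa> b) (AM H m)) = BaseMap X (Cmp X (AM F (AM (tg R j) m)) (\<kappa> a))"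
        using BaseMap_Cmp[OF coX Hm k[OF ab(2)]] BaseMap_Cmp[OF coX k[OF ab(1)] Fjm] \<kappa>[OF ab(1)] \<kappa>[OF ab(2)]
          base[OF ab(1)] mor_BaseMap[OF 2(4) m] mor_BaseMap[OF 1(5) jm] mor_BaseMap[OF tj m]
          compose_idmap_left[OF bm] compose_idmap_right[OF bm] by simp
      have "Cmp X (\<eta> (OM (tg R j) b)) (Cmp X (\<kappa> b) (AM H m)) = Cmp X (\<theta> b) (AM H m)"
        using Cmp_assoc[OF coX Hm k[OF ab(2)] \<eta>(1)[OF jb]] \<kappa>[OF ab(2)] by simp
      also have "\<dots> = Cmp X (AM G (AM (tg S g) (AM (tg R j) m))) (Cmp X (\<eta> (OM (tg R j) a)) (\<kappa> a))"
        using \<theta>(3)[OF m] times_id_comp(2)[OF j 1(8) m] gj \<kappa>[OF ab(1)] by simp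
      also have "\<dots> = Cmp X (Cmp X (AM G (AM (tg S g) (AM (tg R j) m))) (\<eta> (OM (tg R j) a))) (\<kappa> a)"
        using Cmp_assoc[OF coX k[OF ab(1)] \<eta>(1)[OF ja] Ggjm] by simp
      also have "\<dots> = Cmp X (\<eta> (OM (tg R j) b)) (Cmp X (AM F (AM (tg R j) m)) (\<kappa> a))"
        using \<eta>(3)[OF jm] Cmp_assoc[OF coX k[OF ab(1)] Fjm \<eta>(1)[OF jb]] by simp
      finally show "Cmp X (\<eta> (OM (tg R j) b)) (Cmp X (\<kappa> b) (AM H m)) =
          Cmp X (\<eta> (OM (tg R j) b)) (Cmp X (AM F (AM (tg R j) m)) (\<kappa> a))" .
    qed
  qed
  then have k: "((R, H), (j, \<kappa>), (S, F)) \<in> homs ?M x y"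
    using 1 2 j by (simp add: Map_homs)
  have \<eta>\<kappa>: "(\<lambda>w\<in>Obj (PS R). Cmp X (\<eta> (OM (tg R j) w)) (\<kappa> w)) = \<theta>"
    by (rule extensionalityI[OF _ \<theta>(4)]) (use \<kappa> in auto)
  show "\<exists>!k. k \<in> homs ?M x y \<and> BaseMap ?M k = j \<and> Cmp ?M m k = n"
  proof (rule ex1I[of _ "((R, H), (j, \<kappa>), (S, F))"])
    show "((R, H), (j, \<kappa>), (S, F)) \<in> homs ?M x y \<and> BaseMap ?M ((R, H), (j, \<kappa>), (S, F)) = j \<and>
        Cmp ?M m ((R, H), (j, \<kappa>), (S, F)) = n"
      using k 1 2 gj \<eta>\<kappa> by simp
    fix k' assume k': "k' \<in> homs ?M x y \<and> BaseMap ?M k' = j \<and> Cmp ?M m k' = n"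
    then obtain \<kappa>' where \<kappa>': "k' = ((R, H), (j, \<kappa>'), (S, F))" "two_morphism (PS R) X H (comp_mor (PS R) F (tg R j)) \<kappa>'"
      unfolding 1(1) 2(1) by (auto simp: Map_homs)
    note \<kappa>'D = two_morphism_pullD[OF \<kappa>'(2)]
    have \<theta>_eq: "(\<lambda>w\<in>Obj (PS R). Cmp X (\<eta> (OM (tg R j) w)) (\<kappa>' w)) = \<theta>"
      using k' \<kappa>'(1) 1(3) 2(2) by simp
    have "\<kappa>' = \<kappa>"
    proof (rule extensionalityI[OF \<kappa>'D(4)])
      show "\<kappa> \<in> extensional (Obj (PS R))" by (simp add: \<kappa>_def)
      fix w assume w: "w \<in> Obj (PS R)"
      have "Cmp X (\<eta> (OM (tg R j) w)) (\<kappa>' w) = \<theta> w"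
        using fun_cong[OF \<theta>_eq, of w] w by simp
      then have "?P w (\<kappa>' w)"
        using \<kappa>'D(1)[OF w] vertical_BaseMap[OF \<kappa>'D(1,2)[OF w]] base[OF w] by simp
      then show "\<kappa>' w = \<kappa> w" using ex[OF w] \<kappa>[OF w] by blast
    qed
    then show "k' = ((R, H), (j, \<kappa>), (S, F))" using \<kappa>'(1) by simp
  qed
qed

end

section \<open>The pushforward as a morphism of mapping stacks\<close>

context
  fixes Q :: "('o, 'm, 'u) fibcat" and X' :: "('p, 'n, 'u) fibcat" and X :: "('q, 'k, 'u) fibcat"
    and f :: "('p, 'n, 'q, 'k) mor"
  assumes Q: "category_over Q" and X': "fibered_in_groupoids X'" and X: "fibered_in_groupoids X"
    and f: "morphism X' X f"
begin

private abbreviation "PF S \<equiv> prod_stack (rep S) Q"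
private abbreviation (input) "fs \<equiv> pushforward Q X' f"

lemma pushforward_OM: "(T, F) \<in> Obj (Map Q X') \<Longrightarrow> OM fs (T, F) = (T, comp_mor (PF T) f F)"
  by (simp add: pushforward_def Let_def)

lemma pushforward_AM: "((S, F), (g, \<eta>), (T, G)) \<in> Arr (Map Q X') \<Longrightarrow>
    AM fs ((S, F), (g, \<eta>), (T, G)) =
      ((S, comp_mor (PF S) f F), (g, compose (Obj (PF S)) (AM f) \<eta>), (T, comp_mor (PF T) f G))"
  by (simp add: pushforward_def Let_def)

lemma morphism_pushforward: "morphism (Map Q X') (Map Q X) fs"
proof -
  note coX' = fib_category_over[OF X'] and coPS = category_over_prod[OF category_over_rep Q]
  note coM = category_over_Map[OF Q X']
  have homsM: "AM fs m \<in> homs (Map Q X) (OM fs x) (OM fs y) \<and> BaseMap (Map Q X) (AM fs m) = BaseMap (Map Q X') m"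
    if m: "m \<in> homs (Map Q X') x y" for x y m
  proof -
    from m obtain S F g \<eta> T G where 1: "x = (S, F)" "y = (T, G)" "m = ((S, F), (g, \<eta>), (T, G))"
     "S \<in> CGTop" "morphism (PF S) X' F" "T \<in> CGTop" "morphism (PF T) X' G" "g \<in> cmap S T"
     "two_morphism (PF S) X' F (comp_mor (PF S) G (times_id S g Q)) \<eta>" by (rule Map_homsE[OF Q X'])
    note \<eta> = two_morphism_pullD[OF Q X' 1(9)] and tg = morphism_times_id[OF Q X' 1(8)]
    have "two_morphism (PF S) X (comp_mor (PF S) f F) (comp_mor (PF S) (comp_mor (PF T) f G) (times_id S g Q))
        (compose (Obj (PF S)) (AM f) \<eta>)"
    proof (rule two_morphism_pullI[OF Q X])
      show "compose (Obj (PF S)) (AM f) \<eta> \<in> extensional (Obj (PF S))" by (simp add: compose_def)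
      fix w assume w: "w \<in> Obj (PF S)"
      show "compose (Obj (PF S)) (AM f) \<eta> w \<in> homs X (OM (comp_mor (PF S) f F) w) (OM (comp_mor (PF T) f G) (OM (times_id S g Q) w))"
        using w mor_homs[OF f \<eta>(1)[OF w]] mor_Obj[OF tg w] by (simp add: compose_def)
      show "vertical X (compose (Obj (PF S)) (AM f) \<eta> w)"
        using w mor_vertical[OF coX' f \<eta>(1,2)[OF w]] by (simp add: compose_def)
    next
      fix a b m assume m: "m \<in> homs (PF S) a b"
      note ab = homs_Obj[OF coPS m]
      note Fm = mor_homs[OF 1(5) m] and Ggm = mor_homs[OF 1(7) mor_homs[OF tg m]]
      show "Cmp X (compose (Obj (PF S)) (AM f) \<eta> b) (AM (comp_mor (PF S) f F) m) =
          Cmp X (AM (comp_mor (PF T) f G) (AM (times_id S g Q) m)) (compose (Obj (PF S)) (AM f) \<eta> a)"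
        using mor_Cmp[OF f Fm \<eta>(1)[OF ab(2)]] mor_Cmp[OF f \<eta>(1)[OF ab(1)] Ggm] \<eta>(3)[OF m] ab
          homs_Arr[OF m] homs_Arr[OF mor_homs[OF tg m]] by (simp add: compose_def)
    qed
    moreover have "morphism (PF S) X (comp_mor (PF S) f F)" "morphism (PF T) X (comp_mor (PF T) f G)"
      using morphism_comp_mor[OF coPS 1(5) f] morphism_comp_mor[OF coPS 1(7) f] .
    moreover have "AM fs m = ((S, comp_mor (PF S) f F), (g, compose (Obj (PF S)) (AM f) \<eta>), (T, comp_mor (PF T) f G))"
      using homs_Arr[OF m] unfolding 1(3) by (rule pushforward_AM)
    ultimately show ?thesis
      using 1 by (simp add: pushforward_OM[of S F] pushforward_OM[of T G] Map_Obj[OF Q X'] Map_homs[OF Q X] Map_simps[OF Q X] Map_simps[OF Q X'])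
  qed
  show ?thesis
  proof (rule morphismI)
    show "OM fs \<in> extensional (Obj (Map Q X'))" "AM fs \<in> extensional (Arr (Map Q X'))"
      by (auto simp: pushforward_def Let_def)
    fix x assume x: "x \<in> Obj (Map Q X')"
    then obtain T F where e: "x = (T, F)" "T \<in> CGTop" and F: "morphism (PF T) X' F"
      by (cases x) (auto simp: Map_Obj[OF Q X'])
    note o = pushforward_OM[OF x[unfolded e(1)]]
    show "OM fs x \<in> Obj (Map Q X)" "Base (Map Q X) (OM fs x) = Base (Map Q X') x"
      using e morphism_comp_mor[OF coPS F f] unfolding e o
      by (simp_all add: Map_Obj[OF Q X] Map_simps[OF Q X] Map_simps[OF Q X'])
    have "compose (Obj (PF T)) (AM f) (\<lambda>z\<in>Obj (PF T). Id X' (OM F z)) = (\<lambda>z\<in>Obj (PF T). Id X (OM (comp_mor (PF T) f F) z))"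
      by (rule extensionalityI[of _ "Obj (PF T)"]) (auto simp: compose_def mor_Id[OF f mor_Obj[OF F]])
    then show "AM fs (Id (Map Q X') x) = Id (Map Q X) (OM fs x)"
      using pushforward_AM[of T F "idmap T" "\<lambda>z\<in>Obj (PF T). Id X' (OM F z)" T F] homs_Arr[OF Id_homs[OF coM x]]
      unfolding e o by (simp add: Map_simps[OF Q X] Map_simps[OF Q X'])
  next
    fix a b c m n assume m: "m \<in> homs (Map Q X') a b" and n: "n \<in> homs (Map Q X') b c"
    from m obtain R F g \<eta> S G where 1: "a = (R, F)" "b = (S, G)" "m = ((R, F), (g, \<eta>), (S, G))"
     "R \<in> CGTop" "morphism (PF R) X' F" "S \<in> CGTop" "morphism (PF S) X' G" "g \<in> cmap R S"
     "two_morphism (PF R) X' F (comp_mor (PF R) G (times_id R g Q)) \<eta>" by (rule Map_homsE[OF Q X'])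
    from n obtain h \<theta> T H where 2: "c = (T, H)" "n = ((S, G), (h, \<theta>), (T, H))"
     "two_morphism (PF S) X' G (comp_mor (PF S) H (times_id S h Q)) \<theta>" using 1(2) by (auto elim: Map_homsE[OF Q X'])
    note \<eta> = two_morphism_pullD[OF Q X' 1(9)] and \<theta> = two_morphism_pullD[OF Q X' 2(3)]
    note tg = morphism_times_id[OF Q X' 1(8)]
    let ?k = "\<lambda>w\<in>Obj (PF R). Cmp X' (\<theta> (OM (times_id R g Q) w)) (\<eta> w)"
    have mn: "Cmp (Map Q X') n m = ((R, F), (compose (topspace R) h g, ?k), (T, H))"
      unfolding 1(3) 2(2) by (simp add: Map_simps[OF Q X'])
    have A: "AM fs m = ((R, comp_mor (PF R) f F), (g, compose (Obj (PF R)) (AM f) \<eta>), (S, comp_mor (PF S) f G))"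
      "AM fs n = ((S, comp_mor (PF S) f G), (h, compose (Obj (PF S)) (AM f) \<theta>), (T, comp_mor (PF T) f H))"
      "AM fs (Cmp (Map Q X') n m) = ((R, comp_mor (PF R) f F), (compose (topspace R) h g, compose (Obj (PF R)) (AM f) ?k), (T, comp_mor (PF T) f H))"
      using pushforward_AM[OF homs_Arr[OF m, unfolded 1(3)]] pushforward_AM[OF homs_Arr[OF n, unfolded 2(2)]]
        pushforward_AM[OF homs_Arr[OF Cmp_homs[OF coM m n], unfolded mn]] unfolding 1(3) 2(2) mn[unfolded 1(3) 2(2)] by auto
    have "compose (Obj (PF R)) (AM f) ?k = (\<lambda>w\<in>Obj (PF R). Cmp X (compose (Obj (PF S)) (AM f) \<theta> (OM (times_id R g Q) w))
        (compose (Obj (PF R)) (AM f) \<eta> w))"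
    proof (rule extensionalityI[of _ "Obj (PF R)"])
      fix w assume w: "w \<in> Obj (PF R)"
      show "compose (Obj (PF R)) (AM f) ?k w = (\<lambda>w\<in>Obj (PF R). Cmp X (compose (Obj (PF S)) (AM f) \<theta> (OM (times_id R g Q) w))
        (compose (Obj (PF R)) (AM f) \<eta> w)) w"
        using w mor_Cmp[OF f \<eta>(1)[OF w] \<theta>(1)[OF mor_Obj[OF tg w]]] mor_Obj[OF tg w] by (simp add: compose_def)
    qed (auto simp: compose_def)
    then show "AM fs (Cmp (Map Q X') n m) = Cmp (Map Q X) (AM fs n) (AM fs m)"
      unfolding A by (simp add: Map_simps[OF Q X])
  qed (use homsM in auto)
qed

end

section \<open>The point of a mapping stack given by a morphism\<close>

context
  fixes Q :: "('o, 'm, 'u) fibcat" and X :: "('q, 'k, 'u) fibcat" and p :: "('o, 'm, 'q, 'k) mor"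
  assumes Q: "category_over Q" and X: "fibered_in_groupoids X" and p: "morphism Q X p"
begin

private abbreviation "PN S \<equiv> prod_stack (rep S) Q"

text \<open>The composite of the projection from \<open>U \<times> Q\<close> to \<open>Q\<close>
  with \<open>p\<close>; it is the value of \<open>name_of\<close> at any map from \<open>U\<close>
  to the point.\<close>

definition constant_family :: "'u topology \<Rightarrow> ('u slice_obj \<times> 'o, 'u slice_arr \<times> 'm, 'q, 'k) mor" where
  "constant_family U = \<lparr>OM = \<lambda>z\<in>Obj (PN U). OM p (snd z), AM = \<lambda>m\<in>Arr (PN U). AM p (snd m)\<rparr>"

lemma constant_family_simps:
  "z \<in> Obj (PN U) \<Longrightarrow> OM (constant_family U) z = OM p (snd z)"
  "m \<in> homs (PN U) a b \<Longrightarrow> AM (constant_family U) m = AM p (snd m)"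
  using homs_Arr by (fastforce simp: constant_family_def)+

lemma snd_prod:
  "z \<in> Obj (PN U) \<Longrightarrow> snd z \<in> Obj Q \<and> Base Q (snd z) = Base (PN U) z"
  "m \<in> homs (PN U) a b \<Longrightarrow> snd m \<in> homs Q (snd a) (snd b) \<and> BaseMap Q (snd m) = BaseMap (PN U) m"
  by (cases z, auto) (elim prod_homsE, auto)+

lemma morphism_constant_family: "morphism (PN U) X (constant_family U)"
proof (rule morphismI)
  note coPS = category_over_prod[OF category_over_rep Q]
  show "OM (constant_family U) \<in> extensional (Obj (PN U))" "AM (constant_family U) \<in> extensional (Arr (PN U))"
    by (auto simp: constant_family_def)
  fix x assume x: "x \<in> Obj (PN U)"
  note s = snd_prod(1)[OF x]
  show "OM (constant_family U) x \<in> Obj X" "Base X (OM (constant_family U) x) = Base (PN U) x"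
    using s mor_Obj[OF p] mor_Base[OF p] by (simp_all add: constant_family_simps(1)[OF x])
  have "snd (Id (PN U) x) = Id Q (snd x)" by (cases x) simp
  then show "AM (constant_family U) (Id (PN U) x) = Id X (OM (constant_family U) x)"
    using constant_family_simps(2)[OF Id_homs[OF coPS x]] constant_family_simps(1)[OF x] mor_Id[OF p] s by simp
next
  fix a b m assume m: "m \<in> homs (PN U) a b"
  note coPS = category_over_prod[OF category_over_rep Q]
  show "AM (constant_family U) m \<in> homs X (OM (constant_family U) a) (OM (constant_family U) b)"
    "BaseMap X (AM (constant_family U) m) = BaseMap (PN U) m"
    using mor_homs[OF p, of "snd m"] mor_BaseMap[OF p, of "snd m"] snd_prod(2)[OF m] homs_Obj[OF coPS m]
    by (auto simp: constant_family_simps(1) constant_family_simps(2)[OF m])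
next
  fix a b c m n assume m: "m \<in> homs (PN U) a b" and n: "n \<in> homs (PN U) b c"
  note coPS = category_over_prod[OF category_over_rep Q]
  have "snd (Cmp (PN U) n m) = Cmp Q (snd n) (snd m)" by (cases m; cases n) simp
  then show "AM (constant_family U) (Cmp (PN U) n m) = Cmp X (AM (constant_family U) n) (AM (constant_family U) m)"
    using constant_family_simps(2)[OF m] constant_family_simps(2)[OF n] constant_family_simps(2)[OF Cmp_homs[OF coPS m n]]
      mor_Cmp[OF p conjunct1[OF snd_prod(2)[OF m]] conjunct1[OF snd_prod(2)[OF n]]] by simp
qed

lemma name_of_OM: "(U, u) \<in> Obj (rep point) \<Longrightarrow> OM (name_of Q X p) (U, u) = (U, constant_family U)"
  by (auto simp: name_of_def Let_def constant_family_def)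

lemma name_of_AM: "((U, u), g, (V, v)) \<in> Arr (rep point) \<Longrightarrow> AM (name_of Q X p) ((U, u), g, (V, v)) =
    ((U, constant_family U), (g, \<lambda>z\<in>Obj (PN U). Id X (OM p (snd z))), (V, constant_family V))"
  by (auto simp: name_of_def Let_def constant_family_def)

lemma morphism_name_of: "morphism (rep point) (Map Q X) (name_of Q X p)"
proof -
  let ?N = "name_of Q X p"
  note coX = fib_category_over[OF X] and coPS = category_over_prod[OF category_over_rep Q]
  have tw: "two_morphism (PN U) X (constant_family U) (comp_mor (PN U) (constant_family V) (times_id U g Q))
      (\<lambda>z\<in>Obj (PN U). Id X (OM p (snd z)))" if g: "g \<in> cmap U V" for U V g
  proof (rule two_morphism_pullI[OF Q X])
    note tg = morphism_times_id[OF Q X g]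
    have sO: "snd (OM (times_id U g Q) z) = snd z" if "z \<in> Obj (PN U)" for z
      using that by (simp add: times_id_def Let_def case_prod_unfold)
    have sA: "snd (AM (times_id U g Q) m) = snd m" if m: "m \<in> homs (PN U) a b" for m a b
      using homs_Arr[OF m] by (simp add: times_id_def Let_def case_prod_unfold)
    fix w assume w: "w \<in> Obj (PN U)"
    have pw: "OM p (snd w) \<in> Obj X" using mor_Obj[OF p] snd_prod(1)[OF w] by blast
    show "(\<lambda>z\<in>Obj (PN U). Id X (OM p (snd z))) w \<in> homs X (OM (constant_family U) w) (OM (constant_family V) (OM (times_id U g Q) w))"
      using w Id_homs[OF coX pw] constant_family_simps(1)[OF w] constant_family_simps(1)[OF mor_Obj[OF tg w]] sO[OF w] by simp
    show "vertical X ((\<lambda>z\<in>Obj (PN U). Id X (OM p (snd z))) w)" using w vertical_Id[OF coX pw] by simp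
  next
    note tg = morphism_times_id[OF Q X g]
    have sA: "snd (AM (times_id U g Q) m) = snd m" if m: "m \<in> homs (PN U) a b" for m a b
      using homs_Arr[OF m] by (simp add: times_id_def Let_def case_prod_unfold)
    fix a b m assume m: "m \<in> homs (PN U) a b"
    note ab = homs_Obj[OF coPS m]
    have pm: "AM p (snd m) \<in> homs X (OM p (snd a)) (OM p (snd b))"
      using mor_homs[OF p] snd_prod(2)[OF m] by blast
    show "Cmp X ((\<lambda>z\<in>Obj (PN U). Id X (OM p (snd z))) b) (AM (constant_family U) m) =
        Cmp X (AM (constant_family V) (AM (times_id U g Q) m)) ((\<lambda>z\<in>Obj (PN U). Id X (OM p (snd z))) a)"
      using ab constant_family_simps(2)[OF m] constant_family_simps(2)[OF mor_homs[OF tg m]] sA[OF m]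
        Cmp_Id_left[OF coX pm] Cmp_Id_right[OF coX pm] by simp
  qed simp
  show ?thesis
  proof (rule morphismI)
    show "OM ?N \<in> extensional (Obj (rep point))" "AM ?N \<in> extensional (Arr (rep point))"
      by (auto simp: name_of_def Let_def)
    fix x assume x: "x \<in> Obj (rep (point :: 'u topology))"
    obtain U u where e: "x = (U, u)" by (cases x)
    note o = name_of_OM[OF x[unfolded e]]
    show "OM ?N x \<in> Obj (Map Q X)" "Base (Map Q X) (OM ?N x) = Base (rep point) x"
      using x morphism_constant_family unfolding e o by (auto simp: Map_Obj[OF Q X] Map_simps[OF Q X])
    have "(\<lambda>z\<in>Obj (PN U). Id X (OM p (snd z))) = (\<lambda>z\<in>Obj (PN U). Id X (OM (constant_family U) z))"
      by (rule restrict_ext) (simp add: constant_family_simps(1))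
    then show "AM ?N (Id (rep point) x) = Id (Map Q X) (OM ?N x)"
      using name_of_AM[of U u "idmap U" U u] homs_Arr[OF Id_homs[OF category_over_rep x]] unfolding e o
      by (simp add: Map_simps[OF Q X])
  next
    fix a b m assume m: "m \<in> homs (rep (point :: 'u topology)) a b"
    note ab = homs_Obj[OF category_over_rep m]
    from m obtain U u g V v where 1: "a = (U, u)" "b = (V, v)" "m = ((U, u), g, (V, v))" "U \<in> CGTop" "u \<in> cmap U point"
     "V \<in> CGTop" "v \<in> cmap V point" "g \<in> cmap U V" by (rule rep_homsE)
    note o = name_of_OM[OF ab(1)[unfolded 1]] name_of_OM[OF ab(2)[unfolded 1]] name_of_AM[OF homs_Arr[OF m, unfolded 1(3)]]
    show "AM ?N m \<in> homs (Map Q X) (OM ?N a) (OM ?N b)" "BaseMap (Map Q X) (AM ?N m) = BaseMap (rep point) m"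
      using 1(4,6,8) tw[OF 1(8)] morphism_constant_family unfolding 1(1-3) o
      by (simp_all add: Map_homs[OF Q X] Map_simps[OF Q X])
  next
    fix a b c m n assume m: "m \<in> homs (rep (point :: 'u topology)) a b" and n: "n \<in> homs (rep point) b c"
    from m obtain U u g V v where 1: "a = (U, u)" "b = (V, v)" "m = ((U, u), g, (V, v))" "g \<in> cmap U V"
      by (rule rep_homsE)
    from n obtain W w h where 2: "n = ((V, v), h, (W, w))" using 1(2) by (auto elim: rep_homsE)
    have mn: "Cmp (rep point) n m = ((U, u), compose (topspace U) h g, (W, w))" using 1 2 by simp
    note tg = morphism_times_id[OF Q X 1(4)]
    note o = name_of_AM[OF homs_Arr[OF m, unfolded 1(3)]] name_of_AM[OF homs_Arr[OF n, unfolded 2]]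
      name_of_AM[OF homs_Arr[OF Cmp_homs[OF category_over_rep m n], unfolded mn]]
    have sO: "snd (OM (times_id U g Q) z) = snd z" if "z \<in> Obj (PN U)" for z
      using that by (simp add: times_id_def Let_def case_prod_unfold)
    have eq: "(\<lambda>z\<in>Obj (PN U). Id X (OM p (snd z))) = (\<lambda>z\<in>Obj (PN U). Cmp X
        ((\<lambda>z\<in>Obj (PN V). Id X (OM p (snd z))) (OM (times_id U g Q) z)) ((\<lambda>z\<in>Obj (PN U). Id X (OM p (snd z))) z))"
    proof (rule restrict_ext)
      fix z assume z: "z \<in> Obj (PN U)"
      have "OM p (snd z) \<in> Obj X" using mor_Obj[OF p] snd_prod(1)[OF z] by blast
      then show "Id X (OM p (snd z)) = Cmp X
        ((\<lambda>z\<in>Obj (PN V). Id X (OM p (snd z))) (OM (times_id U g Q) z)) ((\<lambda>z\<in>Obj (PN U). Id X (OM p (snd z))) z)"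
        using z mor_Obj[OF tg z] sO[OF z] Cmp_Id_left[OF coX Id_homs[OF coX]] by simp
    qed
    show "AM ?N (Cmp (rep point) n m) = Cmp (Map Q X) (AM ?N n) (AM ?N m)"
      unfolding mn unfolding 1(3) 2 o Map_simps[OF Q X] unfolding eq[symmetric] by (rule refl)
  qed
qed

end

section \<open>Universal arrows of the pushforward\<close>

lemma compose_eq_iff:
  assumes "f \<in> cmap S T" "g \<in> cmap T V" "h \<in> cmap S V'"
  shows "compose (topspace S) g f = h \<longleftrightarrow> (\<forall>x\<in>topspace S. g (f x) = h x)"
proof
  assume "compose (topspace S) g f = h"
  then show "\<forall>x\<in>topspace S. g (f x) = h x" by (auto simp: compose_def)
next
  assume "\<forall>x\<in>topspace S. g (f x) = h x"
  then show "compose (topspace S) g f = h"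
    by (intro cmap_eqI[OF compose_cmap[OF assms(1,2)] assms(3)]) (simp add: compose_def)
qed

context cg_universe
begin

lemma uprod_ball: "(\<forall>p\<in>topspace (S \<otimes> (T :: 'u topology)). P p) \<longleftrightarrow>
    (\<forall>a\<in>topspace S. \<forall>b\<in>topspace T. P (upair a b))"
  by (auto simp: topspace_uprod)

text \<open>Pointwise conditions become equations between extensional maps, the form in which base
  maps of composite arrows appear.\<close>

lemma section_space_iff:
  assumes Y: "Y \<in> (CGTop :: 'u topology set)" and Z: "Z \<in> CGTop" and w: "w \<in> cmap W (T \<otimes> Y)"
  shows "section_space T Y W w Z z e \<longleftrightarrow> z \<in> cmap Z T \<and> e \<in> cmap (Z \<otimes> Y) W \<and>
     compose (topspace (Z \<otimes> Y)) w e = umap Z Y z \<and>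
     (\<forall>U\<in>CGTop. \<forall>g\<in>cmap U T. \<forall>k\<in>cmap (U \<otimes> Y) W.
        compose (topspace (U \<otimes> Y)) w k = umap U Y g \<longrightarrow>
        (\<exists>!j. j \<in> cmap U Z \<and> compose (topspace U) z j = g \<and> compose (topspace (U \<otimes> Y)) e (umap U Y j) = k))"
proof -
  have w_iff: "compose (topspace (U \<otimes> Y)) w k = umap U Y g \<longleftrightarrow>
      (\<forall>u\<in>topspace U. \<forall>y\<in>topspace Y. w (k (upair u y)) = upair (g u) y)"
    if "U \<in> CGTop" "g \<in> cmap U T" "k \<in> cmap (U \<otimes> Y) W" for U g k
    using compose_eq_iff[OF that(3) w umap_cmap[OF that(1) Y that(2)]] by (simp add: uprod_ball)
  have z_iff: "compose (topspace U) z j = g \<longleftrightarrow> (\<forall>u\<in>topspace U. z (j u) = g u)"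
    if "z \<in> cmap Z T" "g \<in> cmap U T" "j \<in> cmap U Z" for U g j
    using compose_eq_iff[OF that(3,1,2)] .
  have e_iff: "compose (topspace (U \<otimes> Y)) e (umap U Y j) = k \<longleftrightarrow>
      (\<forall>u\<in>topspace U. \<forall>y\<in>topspace Y. e (upair (j u) y) = k (upair u y))"
    if "e \<in> cmap (Z \<otimes> Y) W" "U \<in> CGTop" "j \<in> cmap U Z" "k \<in> cmap (U \<otimes> Y) W" for U j k
    using compose_eq_iff[OF umap_cmap[OF that(2) Y that(3)] that(1,4)] by (simp add: uprod_ball)
  show ?thesis
  proof (cases "z \<in> cmap Z T \<and> e \<in> cmap (Z \<otimes> Y) W")
    case True
    have "(\<exists>!j. j \<in> cmap U Z \<and> (\<forall>u\<in>topspace U. z (j u) = g u) \<and>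
           (\<forall>u\<in>topspace U. \<forall>y\<in>topspace Y. e (upair (j u) y) = k (upair u y))) \<longleftrightarrow>
        (\<exists>!j. j \<in> cmap U Z \<and> compose (topspace U) z j = g \<and> compose (topspace (U \<otimes> Y)) e (umap U Y j) = k)"
      if "U \<in> CGTop" "g \<in> cmap U T" "k \<in> cmap (U \<otimes> Y) W" for U g k
    proof -
      have "(j \<in> cmap U Z \<and> (\<forall>u\<in>topspace U. z (j u) = g u) \<and>
           (\<forall>u\<in>topspace U. \<forall>y\<in>topspace Y. e (upair (j u) y) = k (upair u y))) \<longleftrightarrow>
        (j \<in> cmap U Z \<and> compose (topspace U) z j = g \<and> compose (topspace (U \<otimes> Y)) e (umap U Y j) = k)" for j
      proof (rule conj_cong[OF refl])
        assume j: "j \<in> cmap U Z"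
        show "((\<forall>u\<in>topspace U. z (j u) = g u) \<and> (\<forall>u\<in>topspace U. \<forall>y\<in>topspace Y. e (upair (j u) y) = k (upair u y))) \<longleftrightarrow>
          (compose (topspace U) z j = g \<and> compose (topspace (U \<otimes> Y)) e (umap U Y j) = k)"
          using z_iff[OF conjunct1[OF True] that(2) j] e_iff[OF conjunct2[OF True] that(1) j that(3)] by (simp only:)
      qed
      then show ?thesis by simp
    qed
    then show ?thesis
      using True w_iff[OF Z] w_iff unfolding section_space_def by simp
  next
    case False
    then show ?thesis unfolding section_space_def by blast
  qed
qed

context
  fixes Y :: "'u topology" and X :: "('p, 'n, 'u) fibcat"
  assumes Y: "Y \<in> CGTop" and X: "fibered_in_groupoids X"
begin

private abbreviation "PY S \<equiv> prod_stack (rep S) (rep Y)"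
private abbreviation "pt S \<equiv> ((S \<otimes> Y, prj1 S Y), (S \<otimes> Y, prj2 S Y))"
private abbreviation "tY S g \<equiv> times_id S g (rep Y)"

lemma category_over_PY: "category_over (PY S)"
  by (rule category_over_prod[OF category_over_rep category_over_rep])

lemma PY_homs_pt:
  assumes S: "S \<in> CGTop" and k: "U \<in> CGTop" "u \<in> cmap U S" "y \<in> cmap U Y"
  shows "\<exists>!m. m \<in> homs (PY S) ((U, u), (U, y)) (pt S)"
    and "m \<in> homs (PY S) ((U, u), (U, y)) (pt S) \<Longrightarrow> BaseMap (PY S) m = (\<lambda>x\<in>topspace U. upair (u x) (y x))"
proof -
  let ?k = "\<lambda>x\<in>topspace U. upair (u x) (y x)"
  let ?m = "(((U, u), ?k, (S \<otimes> Y, prj1 S Y)), ((U, y), ?k, (S \<otimes> Y, prj2 S Y)))"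
  have kc: "?k \<in> cmap U (S \<otimes> Y)"
    using k CGTop_cg by (intro cmap_restrictI continuous_map_upair) (auto dest: cmap_continuous)
  have c1: "compose (topspace U) (prj1 S Y) ?k = u" "compose (topspace U) (prj2 S Y) ?k = y"
    using k by (auto simp: compose_eq_iff[OF kc prj1_cmap k(2)] compose_eq_iff[OF kc prj2_cmap k(3)] cmap_app)
  have m: "?m \<in> homs (PY S) ((U, u), (U, y)) (pt S)"
    using k S Y kc c1 by (simp add: prod_homs rep_homs_iff)
  have unique: "m = ?m" if m: "m \<in> homs (PY S) ((U, u), (U, y)) (pt S)" for m
  proof -
    from m obtain a b where ab: "m = (a, b)" "a \<in> homs (rep S) (U, u) (S \<otimes> Y, prj1 S Y)"
        "b \<in> homs (rep Y) (U, y) (S \<otimes> Y, prj2 S Y)" "BaseMap (rep S) a = BaseMap (rep Y) b"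
      by (auto simp: prod_homs)
    then obtain h where h: "a = ((U, u), h, (S \<otimes> Y, prj1 S Y))" "b = ((U, y), h, (S \<otimes> Y, prj2 S Y))"
        "h \<in> cmap U (S \<otimes> Y)" "compose (topspace U) (prj1 S Y) h = u" "compose (topspace U) (prj2 S Y) h = y"
      by (auto simp: rep_homs_iff)
    have "h = ?k"
    proof (rule cmap_eqI[OF h(3) kc])
      fix x assume x: "x \<in> topspace U"
      obtain s t where st: "h x = upair s t" "s \<in> topspace S" "t \<in> topspace Y"
        using uprodE[OF cmap_app[OF h(3) x]] by metis
      have "u x = prj1 S Y (h x)" "y x = prj2 S Y (h x)"
        using fun_cong[OF h(4), of x] fun_cong[OF h(5), of x] x by (auto simp: compose_def)
      then show "h x = ?k x" using st x by simp
    qed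
    then show ?thesis using ab h by simp
  qed
  show "\<exists>!m. m \<in> homs (PY S) ((U, u), (U, y)) (pt S)" using m unique by blast
  show "BaseMap (PY S) m = ?k" if "m \<in> homs (PY S) ((U, u), (U, y)) (pt S)"
    using unique[OF that] by simp
qed

text \<open>The terminal object is the product cone: the product of the stacks of two spaces is the
  stack of the product space. This makes the Yoneda lemmas applicable to \<open>Map\<close>.\<close>

lemma terminal_PY:
  assumes S: "S \<in> CGTop"
  shows "terminal_obj (PY S) (pt S)"
  unfolding terminal_obj_def
proof (intro conjI ballI)
  show "pt S \<in> Obj (PY S)" using S Y by simp
  fix w assume w: "w \<in> Obj (PY S)"
  obtain U u V y where e: "w = ((U, u), (V, y))" by (metis prod.collapse)
  have "V = U" "U \<in> CGTop" "u \<in> cmap U S" "y \<in> cmap U Y" using w unfolding e by auto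
  then show "\<exists>!m. m \<in> homs (PY S) w (pt S)" using PY_homs_pt(1)[OF S] e by simp
qed

lemma pt_Obj: "S \<in> CGTop \<Longrightarrow> pt S \<in> Obj (PY S)"
  using Y by simp

text \<open>The arrow over \<open>g \<times> id\<close> that compares the terminal objects of
  \<open>S \<times> Y\<close> and \<open>T \<times> Y\<close>; 2-morphisms in \<open>Map\<close> are
  vertical and do not see this map.\<close>

definition base_arrow :: "'u topology \<Rightarrow> 'u topology \<Rightarrow> ('u \<Rightarrow> 'u) \<Rightarrow> 'u slice_arr \<times> 'u slice_arr" where
  "base_arrow S T g = (THE m. m \<in> homs (PY T) (OM (tY S g) (pt S)) (pt T))"

lemma base_arrow:
  assumes S: "S \<in> CGTop" and T: "T \<in> CGTop" and g: "g \<in> cmap S T"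
  shows "base_arrow S T g \<in> homs (PY T) (OM (tY S g) (pt S)) (pt T)"
    and "BaseMap (PY T) (base_arrow S T g) = umap S Y g"
    and "m \<in> homs (PY T) (OM (tY S g) (pt S)) (pt T) \<Longrightarrow> m = base_arrow S T g"
proof -
  have o: "OM (tY S g) (pt S) = ((S \<otimes> Y, compose (topspace (S \<otimes> Y)) g (prj1 S Y)), (S \<otimes> Y, prj2 S Y))"
    using pt_Obj[OF S] by (rule times_id_OM[OF category_over_rep X])
  have c: "compose (topspace (S \<otimes> Y)) g (prj1 S Y) \<in> cmap (S \<otimes> Y) T" using compose_cmap[OF prj1_cmap g] .
  note h = PY_homs_pt[OF T uprod_CGTop[OF S Y] c prj2_cmap]
  show 1: "base_arrow S T g \<in> homs (PY T) (OM (tY S g) (pt S)) (pt T)"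
    unfolding base_arrow_def o by (rule theI'[OF h(1)])
  show "m = base_arrow S T g" if "m \<in> homs (PY T) (OM (tY S g) (pt S)) (pt T)"
    using h(1) that 1 unfolding o by blast
  have "BaseMap (PY T) (base_arrow S T g) = (\<lambda>x\<in>topspace (S \<otimes> Y).
      upair (compose (topspace (S \<otimes> Y)) g (prj1 S Y) x) (prj2 S Y x))"
    using h(2)[OF 1[unfolded o]] .
  also have "\<dots> = umap S Y g"
    by (rule ext) (simp add: umap_def compose_def prj1_def prj2_def)
  finally show "BaseMap (PY T) (base_arrow S T g) = umap S Y g" .
qed

text \<open>The arrow of \<open>X\<close> over \<open>g \<times> id\<close> that corresponds to an
  arrow of \<open>Map\<close> over \<open>g\<close> by the Yoneda lemma: the 2-morphism at the
  terminal object, followed by the comparison along \<open>g \<times> id\<close>.\<close>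

definition eval_arrow :: "('u slice_obj, 'u slice_arr, 'p, 'n, 'u) map_arr \<Rightarrow> 'n" where
  "eval_arrow m = (case m of ((S, F), (g, \<eta>), (T, G)) \<Rightarrow>
     Cmp X (AM G (base_arrow S T g)) (\<eta> (pt S)))"

lemma eval_arrow:
  assumes "m \<in> homs (Map (rep Y) X) (S, F) (T, G)"
  shows "eval_arrow m \<in> homs X (OM F (pt S)) (OM G (pt T))"
    and "BaseMap X (eval_arrow m) = umap S Y (BaseMap (Map (rep Y) X) m)"
proof -
  note coX = fib_category_over[OF X]
  from assms obtain g \<eta> where 1: "m = ((S, F), (g, \<eta>), (T, G))" "S \<in> CGTop" "morphism (PY S) X F" "T \<in> CGTop"
    "morphism (PY T) X G" "g \<in> cmap S T" "two_morphism (PY S) X F (comp_mor (PY S) G (tY S g)) \<eta>"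
    by (auto simp: Map_homs[OF category_over_rep X])
  note \<eta> = two_morphism_pullD[OF category_over_rep X 1(7)]
  note h = \<eta>(1)[OF pt_Obj[OF 1(2)]] and Gb = mor_homs[OF 1(5) base_arrow(1)[OF 1(2,4,6)]]
  have e: "eval_arrow m = Cmp X (AM G (base_arrow S T g)) (\<eta> (pt S))" by (simp add: eval_arrow_def 1(1))
  show "eval_arrow m \<in> homs X (OM F (pt S)) (OM G (pt T))" unfolding e by (rule Cmp_homs[OF coX h Gb])
  have b: "Base X (OM F (pt S)) = S \<otimes> Y" using mor_Base[OF 1(3) pt_Obj[OF 1(2)]] by simp
  show "BaseMap X (eval_arrow m) = umap S Y (BaseMap (Map (rep Y) X) m)"
    unfolding e using BaseMap_Cmp[OF coX h Gb] vertical_BaseMap[OF h \<eta>(2)[OF pt_Obj[OF 1(2)]]] b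
      mor_BaseMap[OF 1(5) base_arrow(1)[OF 1(2,4,6)]] base_arrow(2)[OF 1(2,4,6)]
      compose_idmap_right[OF umap_cmap[OF 1(2) Y 1(6)]] by (simp add: 1(1) Map_simps[OF category_over_rep X])
qed

text \<open>Factoring \<open>k\<close> through the image of \<open>base_arrow\<close> leaves a
  vertical arrow at the terminal object, which extends to a unique 2-morphism.\<close>

lemma eval_arrow_exists:
  assumes F: "(S, F) \<in> Obj (Map (rep Y) X)" and G: "(T, G) \<in> Obj (Map (rep Y) X)" and g: "g \<in> cmap S T"
    and k: "k \<in> homs X (OM F (pt S)) (OM G (pt T))" "BaseMap X k = umap S Y g"
  shows "\<exists>!m. m \<in> homs (Map (rep Y) X) (S, F) (T, G) \<and> BaseMap (Map (rep Y) X) m = g \<and> eval_arrow m = k"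
proof -
  note coX = fib_category_over[OF X] and MS = Map_simps[OF category_over_rep X]
  have S: "S \<in> CGTop" and T: "T \<in> CGTop" and mF: "morphism (PY S) X F" and mG: "morphism (PY T) X G"
    using F G by (auto simp: Map_Obj[OF category_over_rep X])
  note tg = morphism_times_id[OF category_over_rep X g]
  note mGg = morphism_comp_mor[OF category_over_PY tg mG]
  note ptO = pt_Obj[OF S]
  note Gb = mor_homs[OF mG base_arrow(1)[OF S T g]]
  have OMg: "OM (comp_mor (PY S) G (tY S g)) (pt S) = OM G (OM (tY S g) (pt S))" using ptO by simp
  have b: "Base X (OM F (pt S)) = S \<otimes> Y" "Base X (OM G (OM (tY S g) (pt S))) = S \<otimes> Y"
    using mor_Base[OF mF ptO] mor_Base[OF mG mor_Obj[OF tg ptO]] mor_Base[OF tg ptO] by auto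
  let ?A = "\<lambda>\<alpha>. \<alpha> \<in> homs X (OM F (pt S)) (OM G (OM (tY S g) (pt S))) \<and> BaseMap X \<alpha> = idmap (S \<otimes> Y) \<and>
      Cmp X (AM G (base_arrow S T g)) \<alpha> = k"
  have ex: "\<exists>!\<alpha>. ?A \<alpha>"
    using compose_idmap_right[OF umap_cmap[OF S Y g]] b k(2) mor_BaseMap[OF mG base_arrow(1)[OF S T g]] base_arrow(2)[OF S T g]
    by (intro fib_cart[OF X Gb k(1)]) auto
  then obtain \<alpha> where \<alpha>: "?A \<alpha>" by blast
  have v: "vertical X \<alpha>" by (rule verticalI[OF conjunct1[OF \<alpha>]]) (use \<alpha> b in auto)
  obtain \<eta> where \<eta>: "two_morphism (PY S) X F (comp_mor (PY S) G (tY S g)) \<eta>" "\<eta> (pt S) = \<alpha>"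
    using two_morphism_exists[OF category_over_PY X terminal_PY[OF S] mF mGg _ v] \<alpha> OMg by metis
  let ?m = "((S, F), (g, \<eta>), (T, G))"
  show ?thesis
  proof (rule ex1I[of _ ?m])
    show "?m \<in> homs (Map (rep Y) X) (S, F) (T, G) \<and> BaseMap (Map (rep Y) X) ?m = g \<and> eval_arrow ?m = k"
      using S T mF mG g \<eta> \<alpha> by (simp add: Map_homs[OF category_over_rep X] MS eval_arrow_def)
    fix m assume m: "m \<in> homs (Map (rep Y) X) (S, F) (T, G) \<and> BaseMap (Map (rep Y) X) m = g \<and> eval_arrow m = k"
    then obtain \<theta> where \<theta>: "m = ((S, F), (g, \<theta>), (T, G))" "two_morphism (PY S) X F (comp_mor (PY S) G (tY S g)) \<theta>"
      by (auto simp: Map_homs[OF category_over_rep X] MS)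
    note \<theta>D = two_morphism_pullD[OF category_over_rep X \<theta>(2)]
    have "?A (\<theta> (pt S))"
      using m \<theta>D(1)[OF ptO] vertical_BaseMap[OF \<theta>D(1,2)[OF ptO]] b by (auto simp: \<theta>(1) eval_arrow_def)
    then have "\<theta> (pt S) = \<eta> (pt S)" using ex \<alpha> \<eta>(2) by auto
    then have "\<theta> = \<eta>" by (rule two_morphism_eqI[OF X terminal_PY[OF S] mF mGg \<theta>(2) \<eta>(1)])
    then show "m = ?m" using \<theta>(1) by simp
  qed
qed

text \<open>Naturality of \<open>\<theta>\<close> along \<open>base_arrow\<close> moves it past the
  first comparison; the two comparisons compose to the one of the composite map.\<close>

lemma eval_arrow_Cmp:
  assumes m: "m \<in> homs (Map (rep Y) X) a b" and n: "n \<in> homs (Map (rep Y) X) b c"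
  shows "eval_arrow (Cmp (Map (rep Y) X) n m) = Cmp X (eval_arrow n) (eval_arrow m)"
proof -
  note coX = fib_category_over[OF X] and MS = Map_simps[OF category_over_rep X]
  from m obtain R F g \<eta> S G where 1: "a = (R, F)" "b = (S, G)" "m = ((R, F), (g, \<eta>), (S, G))"
    "R \<in> CGTop" "morphism (PY R) X F" "S \<in> CGTop" "morphism (PY S) X G" "g \<in> cmap R S"
    "two_morphism (PY R) X F (comp_mor (PY R) G (tY R g)) \<eta>" by (rule Map_homsE[OF category_over_rep X])
  from n obtain h \<theta> T H where 2: "c = (T, H)" "n = ((S, G), (h, \<theta>), (T, H))"
    "T \<in> CGTop" "morphism (PY T) X H" "h \<in> cmap S T"
    "two_morphism (PY S) X G (comp_mor (PY S) H (tY S h)) \<theta>" using 1(2) by (auto elim: Map_homsE[OF category_over_rep X])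
  note \<eta> = two_morphism_pullD[OF category_over_rep X 1(9)] and \<theta> = two_morphism_pullD[OF category_over_rep X 2(6)]
  note tg = morphism_times_id[OF category_over_rep X 1(8)] and th = morphism_times_id[OF category_over_rep X 2(5)]
  note bg = base_arrow[OF 1(4,6,8)] and bh = base_arrow[OF 1(6) 2(3,5)]
  note bhg = base_arrow[OF 1(4) 2(3) compose_cmap[OF 1(8) 2(5)]]
  let ?p = "pt R" and ?q = "pt S"
  note pO = pt_Obj[OF 1(4)] and qO = pt_Obj[OF 1(6)]
  have tt: "OM (tY S h) (OM (tY R g) ?p) = OM (tY R (compose (topspace R) h g)) ?p"
    using times_id_comp(1)[OF category_over_rep X 1(8) 2(5) pO] .
  \<comment> \<open>Both sides are arrows into a terminal object.\<close>
  have bb: "Cmp (PY T) (base_arrow S T h) (AM (tY S h) (base_arrow R S g)) = base_arrow R T (compose (topspace R) h g)"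
    using Cmp_homs[OF category_over_PY mor_homs[OF th bg(1)] bh(1)] unfolding tt by (rule bhg(3))
  note h1 = \<eta>(1)[OF pO] and h2 = \<theta>(1)[OF qO] and h3 = \<theta>(1)[OF mor_Obj[OF tg pO]]
  note Gb = mor_homs[OF 1(7) bg(1)] and Hb = mor_homs[OF 2(4) bh(1)] and Hthb = mor_homs[OF 2(4) mor_homs[OF th bg(1)]]
  have "Cmp X (eval_arrow n) (eval_arrow m) =
      Cmp X (Cmp X (AM H (base_arrow S T h)) (\<theta> ?q)) (Cmp X (AM G (base_arrow R S g)) (\<eta> ?p))"
    by (simp add: 1(3) 2(2) eval_arrow_def)
  also have "\<dots> = Cmp X (AM H (base_arrow S T h)) (Cmp X (Cmp X (\<theta> ?q) (AM G (base_arrow R S g))) (\<eta> ?p))"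
    using Cmp_assoc[OF coX Cmp_homs[OF coX h1 Gb] h2 Hb] Cmp_assoc[OF coX h1 Gb h2] by simp
  also have "\<dots> = Cmp X (AM H (base_arrow S T h)) (Cmp X (Cmp X (AM H (AM (tY S h) (base_arrow R S g))) (\<theta> (OM (tY R g) ?p))) (\<eta> ?p))"
    using \<theta>(3)[OF bg(1)] by simp
  also have "\<dots> = Cmp X (Cmp X (AM H (base_arrow S T h)) (AM H (AM (tY S h) (base_arrow R S g)))) (Cmp X (\<theta> (OM (tY R g) ?p)) (\<eta> ?p))"
    using Cmp_assoc[OF coX h1 h3 Hthb] Cmp_assoc[OF coX Cmp_homs[OF coX h1 h3] Hthb Hb] by simp
  also have "\<dots> = Cmp X (AM H (base_arrow R T (compose (topspace R) h g))) (Cmp X (\<theta> (OM (tY R g) ?p)) (\<eta> ?p))"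
    using mor_Cmp[OF 2(4) mor_homs[OF th bg(1)] bh(1)] bb by simp
  also have "\<dots> = eval_arrow (Cmp (Map (rep Y) X) n m)"
    using pO by (simp add: 1(3) 2(2) MS eval_arrow_def)
  finally show ?thesis by simp
qed

lemma Map_Obj_exists:
  assumes S: "S \<in> CGTop" and x: "x \<in> Obj X" "Base X x = S \<otimes> Y"
  obtains F where "(S, F) \<in> Obj (Map (rep Y) X)" "OM F (pt S) = x"
proof -
  obtain F where "morphism (PY S) X F" "OM F (pt S) = x"
    by (rule morphism_exists[OF category_over_PY X terminal_PY[OF S] x(1)]) (use x in auto)
  then show thesis using that S by (simp add: Map_Obj[OF category_over_rep X])
qed

end

end

section \<open>From section spaces to universal arrows of the pushforward, and back\<close>

context cg_universe
begin

abbreviation uprod_point :: "'u topology \<Rightarrow> 'u topology \<Rightarrow> 'u slice_obj \<times> 'u slice_obj" where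
  "uprod_point S Y \<equiv> ((S \<otimes> Y, prj1 S Y), (S \<otimes> Y, prj2 S Y))"

context
  fixes Y :: "'u topology" and X' :: "('o, 'm, 'u) fibcat" and X :: "('p, 'n, 'u) fibcat"
    and f :: "('o, 'm, 'p, 'n) mor"
  assumes Y: "Y \<in> CGTop" and X': "fibered_in_groupoids X'" and X: "fibered_in_groupoids X"
    and f: "morphism X' X f"
begin

private abbreviation "M' \<equiv> Map (rep Y) X'"
private abbreviation "M \<equiv> Map (rep Y) X"
private abbreviation (input) "fY \<equiv> pushforward (rep Y) X' f"

private lemma pushforward_morphism: "morphism M' M fY"
  by (rule morphism_pushforward[OF category_over_rep X' X f])

private lemma fibered_M: "fibered_in_groupoids M" "fibered_in_groupoids M'"
  using fibered_Map[OF category_over_rep] X X' by auto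

private lemma pushforward_point:
  assumes "(S, F) \<in> Obj M'"
  shows "OM fY (S, F) \<in> Obj M" "fst (OM fY (S, F)) = S"
    "OM (snd (OM fY (S, F))) (uprod_point S Y) = OM f (OM F (uprod_point S Y))"
    "OM F (uprod_point S Y) \<in> Obj X'" "Base X' (OM F (uprod_point S Y)) = S \<otimes> Y"
proof -
  have S: "S \<in> CGTop" and F: "morphism (prod_stack (rep S) (rep Y)) X' F"
    using assms by (auto simp: Map_Obj[OF category_over_rep X'])
  note pO = pt_Obj[OF Y X' S]
  show "OM fY (S, F) \<in> Obj M" using mor_Obj[OF pushforward_morphism assms] .
  show "fst (OM fY (S, F)) = S" "OM (snd (OM fY (S, F))) (uprod_point S Y) = OM f (OM F (uprod_point S Y))"
    using pO by (simp_all add: pushforward_OM[OF category_over_rep X' X f assms])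
  show "OM F (uprod_point S Y) \<in> Obj X'" "Base X' (OM F (uprod_point S Y)) = S \<otimes> Y"
    using mor_Obj[OF F pO] mor_Base[OF F pO] by auto
qed

lemma eval_arrow_pushforward:
  assumes m: "m \<in> homs M' a b"
  shows "eval_arrow Y X (AM fY m) = AM f (eval_arrow Y X' m)"
proof -
  from m obtain S F g \<eta> T G where 1: "a = (S, F)" "b = (T, G)" "m = ((S, F), (g, \<eta>), (T, G))"
    "S \<in> CGTop" "morphism (prod_stack (rep S) (rep Y)) X' F" "T \<in> CGTop" "morphism (prod_stack (rep T) (rep Y)) X' G"
    "g \<in> cmap S T"
    "two_morphism (prod_stack (rep S) (rep Y)) X' F (comp_mor (prod_stack (rep S) (rep Y)) G (times_id S g (rep Y))) \<eta>"
    by (rule Map_homsE[OF category_over_rep X'])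
  note pO = pt_Obj[OF Y X' 1(4)] and b = base_arrow(1)[OF Y X' 1(4,6,8)]
  note \<eta> = two_morphism_pullD(1)[OF category_over_rep X' 1(9) pO]
  have A: "AM fY m = ((S, comp_mor (prod_stack (rep S) (rep Y)) f F),
      (g, compose (Obj (prod_stack (rep S) (rep Y))) (AM f) \<eta>), (T, comp_mor (prod_stack (rep T) (rep Y)) f G))"
    using homs_Arr[OF m] unfolding 1(3) by (rule pushforward_AM[OF category_over_rep X' X f])
  show ?thesis
    unfolding A using pO homs_Arr[OF b] mor_Cmp[OF f \<eta> mor_homs[OF 1(7) b]]
    by (simp add: 1(3) eval_arrow_def[OF Y X] eval_arrow_def[OF Y X'] compose_def)
qed

context
  fixes T :: "'u topology" and P and c :: 'o and l :: 'n
  assumes P: "(T, P) \<in> Obj M" and u: "universal_arrow X' X f (OM P (uprod_point T Y)) c l"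
begin

text \<open>The object over \<open>T \<otimes> Y\<close> to which \<open>P\<close> corresponds. The
  space pulled back from \<open>f\<close> along it is \<open>W\<close>, with its map
  \<open>w\<close> to \<open>T \<otimes> Y\<close>.\<close>

private abbreviation "x \<equiv> OM P (uprod_point T Y)"
private abbreviation "W \<equiv> Base X' c"
private abbreviation "w \<equiv> BaseMap X l"

private lemma basics: "T \<in> CGTop" "x \<in> Obj X" "Base X x = T \<otimes> Y" "c \<in> Obj X'" "W \<in> CGTop" "Base X (OM f c) = W"
    "l \<in> homs X (OM f c) x" "w \<in> cmap W (T \<otimes> Y)"
proof -
  show T: "T \<in> CGTop" using P by (simp add: Map_Obj[OF category_over_rep X])
  have mP: "morphism (prod_stack (rep T) (rep Y)) X P" using P by (simp add: Map_Obj[OF category_over_rep X])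
  show "x \<in> Obj X" "Base X x = T \<otimes> Y"
    using mor_Obj[OF mP pt_Obj[OF Y X T]] mor_Base[OF mP pt_Obj[OF Y X T]] by auto
  show c: "c \<in> Obj X'" "l \<in> homs X (OM f c) x" using universal_arrowD[OF u] by auto
  then show "W \<in> CGTop" "Base X (OM f c) = W" using Base_CGTop[OF fib_category_over[OF X']] mor_Base[OF f] by auto
  then show "w \<in> cmap W (T \<otimes> Y)"
    using BaseMap_cmap[OF fib_category_over[OF X] c(2)] \<open>Base X x = T \<otimes> Y\<close> by simp
qed

text \<open>Two universal properties are chained: that of \<open>l\<close> turns an arrow to
  \<open>(T, P)\<close> into a map from \<open>U \<otimes> Y\<close> to \<open>W\<close> over
  \<open>T \<otimes> Y\<close>, and that of \<open>Z\<close> turns this into a map from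
  \<open>U\<close> to \<open>Z\<close> over \<open>T\<close>. Cartesian lifting and
  \<open>eval_arrow_exists\<close> lead from maps of spaces back to arrows.\<close>

lemma universal_arrow_of_section_space:
  assumes Z: "Z \<in> CGTop" and s: "section_space T Y W w Z z e"
  obtains F \<mu> where "universal_arrow M' M fY (T, P) (Z, F) \<mu>" "BaseMap M \<mu> = z"
proof -
  note coX = fib_category_over[OF X] and coX' = fib_category_over[OF X'] and b = basics
  note coM = fib_category_over[OF fibered_M(1)]
  have s': "z \<in> cmap Z T" "e \<in> cmap (Z \<otimes> Y) W" "compose (topspace (Z \<otimes> Y)) w e = umap Z Y z"
    and su: "\<And>U g k. \<lbrakk>U \<in> CGTop; g \<in> cmap U T; k \<in> cmap (U \<otimes> Y) W; compose (topspace (U \<otimes> Y)) w k = umap U Y g\<rbrakk> \<Longrightarrow>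
        \<exists>!j. j \<in> cmap U Z \<and> compose (topspace U) z j = g \<and> compose (topspace (U \<otimes> Y)) e (umap U Y j) = k"
    using s unfolding section_space_iff[OF Y Z b(8)] by blast+
  \<comment> \<open>Pulling \<open>c\<close> back along evaluation gives an object over
    \<open>Z \<otimes> Y\<close>, that is, an object of \<open>Map\<close> over \<open>Z\<close>:
    the universal section.\<close>
  obtain c' n where n: "n \<in> homs X' c' c" "Base X' c' = Z \<otimes> Y" "BaseMap X' n = e"
    using fib_pullback[OF X' uprod_CGTop[OF Z Y] b(4) s'(2)] by metis
  obtain F where F: "(Z, F) \<in> Obj M'" "OM F (uprod_point Z Y) = c'"
    by (rule Map_Obj_exists[OF Y X' Z homs_Obj(1)[OF coX' n(1)] n(2)])
  note fn = mor_homs[OF f n(1)] and ppF = pushforward_point[OF F(1)]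
  note k0 = Cmp_homs[OF coX fn b(7)]
  obtain F1 where F1: "OM fY (Z, F) = (Z, F1)" "OM F1 (uprod_point Z Y) = OM f c'" "(Z, F1) \<in> Obj M"
    using ppF F(2) by (metis prod.collapse)
  have fc': "Base X (OM f c') = Z \<otimes> Y" using mor_Base[OF f homs_Obj(1)[OF coX' n(1)]] n(2) by simp
  have Bk0: "BaseMap X (Cmp X l (AM f n)) = umap Z Y z"
    using BaseMap_Cmp[OF coX fn b(7)] mor_BaseMap[OF f n(1)] fc' n(3) s'(3) by simp
  obtain \<mu> where \<mu>: "\<mu> \<in> homs M (Z, F1) (T, P)" "BaseMap M \<mu> = z" "eval_arrow Y X \<mu> = Cmp X l (AM f n)"
    using eval_arrow_exists[OF Y X F1(3) P s'(1)] k0 Bk0 F1(2) by metis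
  have "universal_arrow M' M fY (T, P) (Z, F) \<mu>"
    unfolding universal_arrow_def
  proof (intro conjI ballI)
    show "(Z, F) \<in> Obj M'" "\<mu> \<in> homs M (OM fY (Z, F)) (T, P)" using F \<mu> F1 by auto
    fix o' \<nu> assume o': "o' \<in> Obj M'" and \<nu>: "\<nu> \<in> homs M (OM fY o') (T, P)"
    obtain U H where oe: "o' = (U, H)" by (cases o')
    have UH: "(U, H) \<in> Obj M'" using o' oe by simp
    have U: "U \<in> CGTop" using UH by (simp add: Map_Obj[OF category_over_rep X'])
    let ?h = "OM H (uprod_point U Y)"
    note ppH = pushforward_point[OF UH]
    obtain H1 where H1: "OM fY (U, H) = (U, H1)" "OM H1 (uprod_point U Y) = OM f ?h" "(U, H1) \<in> Obj M"
      using ppH by (metis prod.collapse)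
    have \<nu>': "\<nu> \<in> homs M (U, H1) (T, P)" using \<nu> oe H1 by simp
    note ev = eval_arrow[OF Y X \<nu>', unfolded H1(2)]
    define g where "g = BaseMap M \<nu>"
    have g: "g \<in> cmap U T"
      using BaseMap_cmap[OF coM \<nu>'] by (simp add: g_def Map_simps[OF category_over_rep X])
    obtain h where h: "h \<in> homs X' ?h c" "Cmp X l (AM f h) = eval_arrow Y X \<nu>"
      and hu: "\<And>h'. \<lbrakk>h' \<in> homs X' ?h c; Cmp X l (AM f h') = eval_arrow Y X \<nu>\<rbrakk> \<Longrightarrow> h' = h"
      using universal_arrowD(3)[OF u ppH(4) ev(1)] by blast
    note fh = mor_homs[OF f h(1)]
    have kk: "BaseMap X' h \<in> cmap (U \<otimes> Y) W" using BaseMap_cmap[OF coX' h(1)] ppH(5) by simp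
    have fh_base: "Base X (OM f ?h) = U \<otimes> Y" using mor_Base[OF f ppH(4)] ppH(5) by simp
    have wk: "compose (topspace (U \<otimes> Y)) w (BaseMap X' h) = umap U Y g"
      using BaseMap_Cmp[OF coX fh b(7)] h(2) ev(2) mor_BaseMap[OF f h(1)] fh_base by (simp add: g_def)
    obtain j where j: "j \<in> cmap U Z" "compose (topspace U) z j = g" "compose (topspace (U \<otimes> Y)) e (umap U Y j) = BaseMap X' h"
      and ju: "\<And>j'. \<lbrakk>j' \<in> cmap U Z; compose (topspace U) z j' = g; compose (topspace (U \<otimes> Y)) e (umap U Y j') = BaseMap X' h\<rbrakk> \<Longrightarrow> j' = j"
      using su[OF U g kk wk] by blast
    obtain h2 where h2: "h2 \<in> homs X' ?h c'" "BaseMap X' h2 = umap U Y j" "Cmp X' n h2 = h"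
      by (rule fib_cartE[OF X' n(1) h(1), of "umap U Y j"]) (use umap_cmap[OF U Y j(1)] ppH(5) n j(3) in auto)
    have ex: "\<exists>!m. m \<in> homs M' (U, H) (Z, F) \<and> BaseMap M' m = j \<and> eval_arrow Y X' m = h2"
      by (rule eval_arrow_exists[OF Y X' UH F(1) j(1)]) (use h2 F(2) in auto)
    \<comment> \<open>An arrow of \<open>Map\<close> with given ends is determined by its base map
      and its evaluation, so the equation splits into the two conditions that pin down
      \<open>j\<close> and \<open>h2\<close>.\<close>
    have iff: "Cmp M \<mu> (AM fY m) = \<nu> \<longleftrightarrow> BaseMap M' m = j \<and> eval_arrow Y X' m = h2"
      if m: "m \<in> homs M' (U, H) (Z, F)" for m
    proof -
      have fm: "AM fY m \<in> homs M (U, H1) (Z, F1)" using mor_homs[OF pushforward_morphism m] F1(1) H1(1) by simp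
      note evm = eval_arrow[OF Y X' m, unfolded F(2)]
      have jm: "BaseMap M' m \<in> cmap U Z"
        using BaseMap_cmap[OF fib_category_over[OF fibered_M(2)] m] by (simp add: Map_simps[OF category_over_rep X'])
      have BM: "BaseMap M (Cmp M \<mu> (AM fY m)) = compose (topspace U) z (BaseMap M' m)"
        using BaseMap_Cmp[OF coM fm \<mu>(1)] mor_BaseMap[OF pushforward_morphism m] \<mu>(2)
        by (simp add: Map_simps[OF category_over_rep X])
      have EM: "eval_arrow Y X (Cmp M \<mu> (AM fY m)) = Cmp X l (AM f (Cmp X' n (eval_arrow Y X' m)))"
        using eval_arrow_Cmp[OF Y X fm \<mu>(1)] eval_arrow_pushforward[OF m] \<mu>(3) mor_Cmp[OF f evm(1) n(1)]
          Cmp_assoc[OF coX mor_homs[OF f evm(1)] fn b(7)] by simp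
      show ?thesis
      proof
        assume e: "Cmp M \<mu> (AM fY m) = \<nu>"
        have nh: "Cmp X' n (eval_arrow Y X' m) = h"
          using hu[OF Cmp_homs[OF coX' evm(1) n(1)]] EM e by simp
        have "compose (topspace (U \<otimes> Y)) e (umap U Y (BaseMap M' m)) = BaseMap X' h"
          using BaseMap_Cmp[OF coX' evm(1) n(1)] nh n(3) evm(2) ppH(5) by simp
        then have "BaseMap M' m = j" using ju[OF jm] BM e by (simp add: g_def)
        moreover have "eval_arrow Y X' m = h2"
          by (rule fib_cancel[OF X' n(1) evm(1) h2(1)]) (use evm(2) h2 nh calculation in auto)
        ultimately show "BaseMap M' m = j \<and> eval_arrow Y X' m = h2" by simp
      next
        assume e: "BaseMap M' m = j \<and> eval_arrow Y X' m = h2"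
        have "\<exists>!\<nu>. \<nu> \<in> homs M (U, H1) (T, P) \<and> BaseMap M \<nu> = g \<and> eval_arrow Y X \<nu> = Cmp X l (AM f h)"
          by (rule eval_arrow_exists[OF Y X H1(3) P g]) (use ev h(2) H1(2) in \<open>auto simp: g_def\<close>)
        moreover have "Cmp M \<mu> (AM fY m) \<in> homs M (U, H1) (T, P)" using Cmp_homs[OF coM fm \<mu>(1)] .
        moreover have "BaseMap M (Cmp M \<mu> (AM fY m)) = g" using BM e j(2) by simp
        moreover have "eval_arrow Y X (Cmp M \<mu> (AM fY m)) = Cmp X l (AM f h)" using EM e h2(3) by simp
        ultimately show "Cmp M \<mu> (AM fY m) = \<nu>" using \<nu>' h(2) g_def by metis
      qed
    qed
    show "\<exists>!m. m \<in> homs M' o' (Z, F) \<and> Cmp M \<mu> (AM fY m) = \<nu>"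
      unfolding oe using ex iff by blast
  qed
  then show thesis using that \<mu>(2) by blast
qed

text \<open>The converse identifies representing spaces that are given and not constructed. A map
  \<open>k\<close> over \<open>T \<otimes> Y\<close> is realized as an arrow of \<open>Map\<close>
  into \<open>(T, P)\<close>; the base map of its factorization through \<open>\<mu>\<close> is the
  required map to \<open>Z\<close>.\<close>

lemma section_space_of_universal_arrow:
  assumes v: "universal_arrow M' M fY (T, P) (Z, F) \<mu>"
  obtains e where "section_space T Y W w Z (BaseMap M \<mu>) e"
proof -
  note coX = fib_category_over[OF X] and coX' = fib_category_over[OF X'] and b = basics
  note coM = fib_category_over[OF fibered_M(1)] and coM' = fib_category_over[OF fibered_M(2)]
  note F = universal_arrowD(1)[OF v] and ppF = pushforward_point[OF universal_arrowD(1)[OF v]]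
  have Z: "Z \<in> CGTop" using F by (simp add: Map_Obj[OF category_over_rep X'])
  let ?c = "OM F (uprod_point Z Y)" and ?z = "BaseMap M \<mu>"
  obtain F1 where F1: "OM fY (Z, F) = (Z, F1)" "OM F1 (uprod_point Z Y) = OM f ?c" "(Z, F1) \<in> Obj M"
    using ppF by (metis prod.collapse)
  have \<mu>: "\<mu> \<in> homs M (Z, F1) (T, P)" using universal_arrowD(2)[OF v] F1(1) by simp
  note ev = eval_arrow[OF Y X \<mu>, unfolded F1(2)]
  have z: "?z \<in> cmap Z T" using BaseMap_cmap[OF coM \<mu>] by (simp add: Map_simps[OF category_over_rep X])
  obtain n where n: "n \<in> homs X' ?c c" "Cmp X l (AM f n) = eval_arrow Y X \<mu>"
    using universal_arrowD(3)[OF u ppF(4) ev(1)] by blast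
  note fn = mor_homs[OF f n(1)]
  let ?e = "BaseMap X' n"
  have fc: "Base X (OM f ?c) = Z \<otimes> Y" using mor_Base[OF f ppF(4)] ppF(5) by simp
  have e: "?e \<in> cmap (Z \<otimes> Y) W" using BaseMap_cmap[OF coX' n(1)] ppF(5) by simp
  have we: "compose (topspace (Z \<otimes> Y)) w ?e = umap Z Y ?z"
    using BaseMap_Cmp[OF coX fn b(7)] n(2) ev(2) mor_BaseMap[OF f n(1)] fc by simp
  have "section_space T Y W w Z ?z ?e"
    unfolding section_space_iff[OF Y Z b(8)]
  proof (intro conjI ballI impI)
    fix U g k assume U: "U \<in> CGTop" and g: "g \<in> cmap U T" and k: "k \<in> cmap (U \<otimes> Y) W"
      and wk: "compose (topspace (U \<otimes> Y)) w k = umap U Y g"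
    obtain c2 n2 where n2: "n2 \<in> homs X' c2 c" "Base X' c2 = U \<otimes> Y" "BaseMap X' n2 = k"
      using fib_pullback[OF X' uprod_CGTop[OF U Y] b(4) k] by metis
    note c2 = homs_Obj(1)[OF coX' n2(1)] and fn2 = mor_homs[OF f n2(1)]
    obtain H where H: "(U, H) \<in> Obj M'" "OM H (uprod_point U Y) = c2"
      by (rule Map_Obj_exists[OF Y X' U c2 n2(2)])
    note ppH = pushforward_point[OF H(1)]
    obtain H1 where H1: "OM fY (U, H) = (U, H1)" "OM H1 (uprod_point U Y) = OM f c2" "(U, H1) \<in> Obj M"
      using ppH H(2) by (metis prod.collapse)
    have fc2: "Base X (OM f c2) = U \<otimes> Y" using mor_Base[OF f c2] n2(2) by simp
    have k2: "Cmp X l (AM f n2) \<in> homs X (OM f c2) x" "BaseMap X (Cmp X l (AM f n2)) = umap U Y g"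
      using Cmp_homs[OF coX fn2 b(7)] BaseMap_Cmp[OF coX fn2 b(7)] mor_BaseMap[OF f n2(1)] fc2 n2(3) wk by simp_all
    have ex\<nu>: "\<exists>!\<nu>. \<nu> \<in> homs M (U, H1) (T, P) \<and> BaseMap M \<nu> = g \<and> eval_arrow Y X \<nu> = Cmp X l (AM f n2)"
      by (rule eval_arrow_exists[OF Y X H1(3) P g]) (use k2 H1(2) in auto)
    then obtain \<nu> where \<nu>: "\<nu> \<in> homs M (U, H1) (T, P)" "BaseMap M \<nu> = g" "eval_arrow Y X \<nu> = Cmp X l (AM f n2)" by blast
    have \<nu>F: "\<nu> \<in> homs M (OM fY (U, H)) (T, P)" using \<nu>(1) H1(1) by simp
    obtain m where m: "m \<in> homs M' (U, H) (Z, F)" "Cmp M \<mu> (AM fY m) = \<nu>"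
      and mu: "\<And>m'. \<lbrakk>m' \<in> homs M' (U, H) (Z, F); Cmp M \<mu> (AM fY m') = \<nu>\<rbrakk> \<Longrightarrow> m' = m"
      using universal_arrowD(3)[OF v H(1) \<nu>F] by blast
    have props: "BaseMap M' m' \<in> cmap U Z" "BaseMap M (Cmp M \<mu> (AM fY m')) = compose (topspace U) ?z (BaseMap M' m')"
        "eval_arrow Y X (Cmp M \<mu> (AM fY m')) = Cmp X l (AM f (Cmp X' n (eval_arrow Y X' m')))"
        "eval_arrow Y X' m' \<in> homs X' c2 ?c" "BaseMap X' (eval_arrow Y X' m') = umap U Y (BaseMap M' m')"
        "Cmp M \<mu> (AM fY m') \<in> homs M (U, H1) (T, P)"
      if m': "m' \<in> homs M' (U, H) (Z, F)" for m'
    proof -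
      have fm: "AM fY m' \<in> homs M (U, H1) (Z, F1)" using mor_homs[OF pushforward_morphism m'] F1(1) H1(1) by simp
      note evm = eval_arrow[OF Y X' m', unfolded H(2)]
      show "BaseMap M' m' \<in> cmap U Z"
        using BaseMap_cmap[OF coM' m'] by (simp add: Map_simps[OF category_over_rep X'])
      show "BaseMap M (Cmp M \<mu> (AM fY m')) = compose (topspace U) ?z (BaseMap M' m')"
        using BaseMap_Cmp[OF coM fm \<mu>] mor_BaseMap[OF pushforward_morphism m']
        by (simp add: Map_simps[OF category_over_rep X])
      show "eval_arrow Y X (Cmp M \<mu> (AM fY m')) = Cmp X l (AM f (Cmp X' n (eval_arrow Y X' m')))"
        using eval_arrow_Cmp[OF Y X fm \<mu>] eval_arrow_pushforward[OF m'] n(2) mor_Cmp[OF f evm(1) n(1)]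
          Cmp_assoc[OF coX mor_homs[OF f evm(1)] fn b(7)] by simp
      show "eval_arrow Y X' m' \<in> homs X' c2 ?c" "BaseMap X' (eval_arrow Y X' m') = umap U Y (BaseMap M' m')"
        using evm by auto
      show "Cmp M \<mu> (AM fY m') \<in> homs M (U, H1) (T, P)" using Cmp_homs[OF coM fm \<mu>] .
    qed
    show "\<exists>!j. j \<in> cmap U Z \<and> compose (topspace U) ?z j = g \<and> compose (topspace (U \<otimes> Y)) ?e (umap U Y j) = k"
    proof (rule ex1I[of _ "BaseMap M' m"], intro conjI)
      show "BaseMap M' m \<in> cmap U Z" using props(1)[OF m(1)] .
      show "compose (topspace U) ?z (BaseMap M' m) = g" using props(2)[OF m(1)] m(2) \<nu>(2) by simp
      have "Cmp X l (AM f (Cmp X' n (eval_arrow Y X' m))) = Cmp X l (AM f n2)"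
        using props(3)[OF m(1)] m(2) \<nu>(3) by simp
      then have "Cmp X' n (eval_arrow Y X' m) = n2"
        using universal_arrowD(3)[OF u c2 k2(1)] Cmp_homs[OF coX' props(4)[OF m(1)] n(1)] n2(1) by blast
      then show "compose (topspace (U \<otimes> Y)) ?e (umap U Y (BaseMap M' m)) = k"
        using BaseMap_Cmp[OF coX' props(4)[OF m(1)] n(1)] props(5)[OF m(1)] n2 by simp
      fix j assume j: "j \<in> cmap U Z \<and> compose (topspace U) ?z j = g \<and> compose (topspace (U \<otimes> Y)) ?e (umap U Y j) = k"
      then have jc: "j \<in> cmap U Z" by blast
      obtain h where h: "h \<in> homs X' c2 ?c" "BaseMap X' h = umap U Y j" "Cmp X' n h = n2"
        by (rule fib_cartE[OF X' n(1) n2(1), of "umap U Y j"]) (use umap_cmap[OF U Y jc] ppF(5) n2 j in auto)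
      obtain m' where m': "m' \<in> homs M' (U, H) (Z, F)" "BaseMap M' m' = j" "eval_arrow Y X' m' = h"
        using eval_arrow_exists[OF Y X' H(1) F jc] h H(2) by metis
      have "Cmp M \<mu> (AM fY m') = \<nu>"
        using ex\<nu> \<nu> props(2,3,6)[OF m'(1)] m'(2,3) h(3) j by metis
      then show "j = BaseMap M' m" using mu[OF m'(1)] m'(2) by simp
    qed
  qed (use z e we in auto)
  then show thesis by (rule that)
qed

end

end

end

section \<open>Sections over paracompact spaces\<close>

text \<open>All points have the same image component in the one-point space, so injectivity on path
  components gives a path. In a space of sections such a path is a homotopy of lifts.\<close>

lemma weakly_contractible_path_connected:
  assumes "weakly_contractible Z" "a \<in> topspace Z" "b \<in> topspace Z"
  shows "path_component_of Z a b"
proof -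
  let ?D = "discrete_topology {()}"
  have "bij_betw (\<lambda>C. \<Union>c\<in>C. {y. path_component_of ?D () y}) (path_components_of Z) (path_components_of ?D)"
    using assms(1) unfolding weakly_contractible_def weak_equivalence_def by (elim conjE)
  then have inj: "inj_on (\<lambda>C. \<Union>c\<in>C. {y. path_component_of ?D () y}) (path_components_of Z)"
    by (rule bij_betw_imp_inj_on)
  have mem: "Collect (path_component_of Z a) \<in> path_components_of Z" "Collect (path_component_of Z b) \<in> path_components_of Z"
    using assms(2,3) by (auto simp: path_components_of_def)
  have ab: "a \<in> Collect (path_component_of Z a)" "b \<in> Collect (path_component_of Z b)"
    using assms(2,3) by (auto simp: path_component_of_refl)
  then have "(\<Union>c\<in>Collect (path_component_of Z a). {y. path_component_of ?D () y}) =
      (\<Union>c\<in>Collect (path_component_of Z b). {y. path_component_of ?D () y})"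
    by blast
  from inj_onD[OF inj this mem] show ?thesis using ab(2) by blast
qed

context cg_universe
begin

lemma point_CGTop: "(point :: 'u topology) \<in> CGTop"
  by (rule compact_Hausdorff_CGTop)
    (auto simp: point_def small_space_def finite_lesspoll compact_space_discrete_topology)

lemma topspace_point: "topspace point = {undefined}"
  by (simp add: point_def)

lemma cmap_to_point: "z \<in> cmap Z point \<longleftrightarrow> z = (\<lambda>_\<in>topspace Z. undefined)"
proof
  assume z: "z \<in> cmap Z point"
  show "z = (\<lambda>_\<in>topspace Z. undefined)"
    using z cmap_app[OF z] by (intro extensionalityI[of _ "topspace Z"]) (auto simp: cmap_def topspace_point)
next
  show "z = (\<lambda>_\<in>topspace Z. undefined) \<Longrightarrow> z \<in> cmap Z point"
    by (simp only:) (rule cmap_restrictI, simp add: topspace_point)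
qed

text \<open>Here \<open>Z\<close> represents families of sections of \<open>w\<close> over
  \<open>T\<close>. It is \<open>section_space\<close> over a point, with
  \<open>point \<otimes> T\<close> replaced by \<open>T\<close>.\<close>

definition sections_space :: "'u topology \<Rightarrow> 'u topology \<Rightarrow> ('u \<Rightarrow> 'u) \<Rightarrow> 'u topology \<Rightarrow> ('u \<Rightarrow> 'u) \<Rightarrow> bool" where
  "sections_space T W w Z e \<longleftrightarrow> e \<in> cmap (Z \<otimes> T) W \<and>
     (\<forall>a\<in>topspace Z. \<forall>t\<in>topspace T. w (e (upair a t)) = t) \<and>
     (\<forall>U\<in>CGTop. \<forall>k\<in>cmap (U \<otimes> T) W.
        (\<forall>u\<in>topspace U. \<forall>t\<in>topspace T. w (k (upair u t)) = t) \<longrightarrow>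
        (\<exists>!j. j \<in> cmap U Z \<and> (\<forall>u\<in>topspace U. \<forall>t\<in>topspace T. e (upair (j u) t) = k (upair u t))))"

lemma sections_space_iff:
  assumes w: "w \<in> cmap W T" and w': "\<And>a. a \<in> topspace W \<Longrightarrow> w' a = upair undefined (w a)"
    and z: "z \<in> cmap Z point"
  shows "section_space point T W w' Z z e \<longleftrightarrow> sections_space T W w Z e"
proof -
  have zc: "z' a = undefined" if "z' \<in> cmap V point" "a \<in> topspace V" for z' V a
    using that by (simp add: cmap_to_point)
  have *: "(\<forall>u\<in>topspace U. \<forall>t\<in>topspace T. w' (k (upair u t)) = upair (g u) t) \<longleftrightarrow>
      (\<forall>u\<in>topspace U. \<forall>t\<in>topspace T. w (k (upair u t)) = t)"
    if k: "k \<in> cmap (U \<otimes> T) W" and g: "g \<in> cmap U point" for U k g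
    using w'[OF cmap_app[OF k]] zc[OF g] by simp
  have j: "(\<forall>u\<in>topspace U. z (j u) = g u) \<longleftrightarrow> True" if "j \<in> cmap U Z" "g \<in> cmap U point" for U j g
    using zc[OF z cmap_app[OF that(1)]] zc[OF that(2)] by simp
  have ex: "(\<exists>!j. j \<in> cmap U Z \<and> (\<forall>u\<in>topspace U. z (j u) = g u) \<and> Q j) \<longleftrightarrow> (\<exists>!j. j \<in> cmap U Z \<and> Q j)"
    if "g \<in> cmap U point" for U g Q
    using j[OF _ that] by metis
  have g0: "(\<lambda>_\<in>topspace U. undefined) \<in> cmap U point" for U :: "'u topology"
    by (simp add: cmap_to_point)
  show ?thesis
  proof
    assume s: "section_space point T W w' Z z e"
    then have e: "e \<in> cmap (Z \<otimes> T) W" by (simp add: section_space_def)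
    show "sections_space T W w Z e"
      unfolding sections_space_def
    proof (intro conjI ballI impI)
      show "w (e (upair a t)) = t" if "a \<in> topspace Z" "t \<in> topspace T" for a t
        using *[OF e z] s that unfolding section_space_def by blast
      fix U k assume U: "U \<in> CGTop" and k: "k \<in> cmap (U \<otimes> T) W"
        and wk: "\<forall>u\<in>topspace U. \<forall>t\<in>topspace T. w (k (upair u t)) = t"
      have "\<forall>u\<in>topspace U. \<forall>t\<in>topspace T. w' (k (upair u t)) = upair ((\<lambda>_\<in>topspace U. undefined) u) t"
        using *[OF k g0] wk by blast
      then have "\<exists>!j. j \<in> cmap U Z \<and> (\<forall>u\<in>topspace U. z (j u) = (\<lambda>_\<in>topspace U. undefined) u) \<and>
           (\<forall>u\<in>topspace U. \<forall>t\<in>topspace T. e (upair (j u) t) = k (upair u t))"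
        using s[unfolded section_space_def, THEN conjunct2, THEN conjunct2, THEN conjunct2, rule_format, OF U g0 k] by blast
      then show "\<exists>!j. j \<in> cmap U Z \<and> (\<forall>u\<in>topspace U. \<forall>t\<in>topspace T. e (upair (j u) t) = k (upair u t))"
        unfolding ex[OF g0] .
    qed (rule e)
  next
    assume s: "sections_space T W w Z e"
    then have e: "e \<in> cmap (Z \<otimes> T) W" by (simp add: sections_space_def)
    show "section_space point T W w' Z z e"
      unfolding section_space_def
    proof (intro conjI ballI impI)
      show "w' (e (upair a t)) = upair (z a) t" if "a \<in> topspace Z" "t \<in> topspace T" for a t
        using *[OF e z] s that unfolding sections_space_def by blast
      fix U g k assume U: "U \<in> CGTop" and g: "g \<in> cmap U point" and k: "k \<in> cmap (U \<otimes> T) W"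
        and "\<forall>u\<in>topspace U. \<forall>t\<in>topspace T. w' (k (upair u t)) = upair (g u) t"
      then have "\<forall>u\<in>topspace U. \<forall>t\<in>topspace T. w (k (upair u t)) = t"
        using *[OF k g] by blast
      then have "\<exists>!j. j \<in> cmap U Z \<and> (\<forall>u\<in>topspace U. \<forall>t\<in>topspace T. e (upair (j u) t) = k (upair u t))"
        using s[unfolded sections_space_def, THEN conjunct2, THEN conjunct2, rule_format, OF U k] by blast
      then show "\<exists>!j. j \<in> cmap U Z \<and> (\<forall>u\<in>topspace U. z (j u) = g u) \<and>
           (\<forall>u\<in>topspace U. \<forall>t\<in>topspace T. e (upair (j u) t) = k (upair u t))"
        unfolding ex[OF g] .
    qed (use z e in auto)
  qed
qed

text \<open>The two bracketings of a triple product code their points differently, hence the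
  explicit recoding.\<close>

lemma assoc_cmap:
  assumes "A \<in> CGTop" "B \<in> CGTop" "C \<in> (CGTop :: 'u topology set)" and k: "k \<in> cmap (A \<otimes> (B \<otimes> C)) W"
  shows "(\<lambda>p\<in>topspace ((A \<otimes> B) \<otimes> C). k (upair (ufst (ufst p)) (upair (usnd (ufst p)) (usnd p)))) \<in> cmap ((A \<otimes> B) \<otimes> C) W"
proof (rule cmap_restrictI)
  let ?P = "(A \<otimes> B) \<otimes> C"
  note cg = CGTop_cg[OF uprod_CGTop[OF uprod_CGTop[OF assms(1,2)] assms(3)]]
  have 1: "continuous_map ?P A (\<lambda>p. ufst (ufst p))" "continuous_map ?P B (\<lambda>p. usnd (ufst p))"
    using continuous_map_compose'[OF continuous_map_ufst continuous_map_ufst]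
      continuous_map_compose'[OF continuous_map_ufst continuous_map_usnd] .
  show "continuous_map ?P W (\<lambda>p. k (upair (ufst (ufst p)) (upair (usnd (ufst p)) (usnd p))))"
    by (rule continuous_map_compose'[OF continuous_map_upair[OF cg 1(1) continuous_map_upair[OF cg 1(2) continuous_map_usnd]]
          cmap_continuous[OF k]])
qed

text \<open>A section of \<open>W\<close> over \<open>T \<otimes> Y\<close> is a section over
  \<open>T\<close> of the space \<open>V\<close> of sections along \<open>Y\<close>. The two
  universal properties extend this to families over any \<open>U\<close>, so the same
  \<open>Z\<close> represents both.\<close>

lemma sections_space_curry:
  assumes T: "T \<in> CGTop" and Y: "Y \<in> CGTop" and Z: "Z \<in> CGTop"
    and e: "sections_space (T \<otimes> Y) W w Z e" and s: "section_space T Y W w V v \<epsilon>"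
  shows "\<exists>e'. sections_space T V v Z e'"
proof -
  have ec: "e \<in> cmap (Z \<otimes> (T \<otimes> Y)) W" and we: "\<And>a b. \<lbrakk>a \<in> topspace Z; b \<in> topspace (T \<otimes> Y)\<rbrakk> \<Longrightarrow> w (e (upair a b)) = b"
    and eu: "\<And>U k. \<lbrakk>U \<in> CGTop; k \<in> cmap (U \<otimes> (T \<otimes> Y)) W;
        \<forall>u\<in>topspace U. \<forall>b\<in>topspace (T \<otimes> Y). w (k (upair u b)) = b\<rbrakk> \<Longrightarrow>
        \<exists>!j. j \<in> cmap U Z \<and> (\<forall>u\<in>topspace U. \<forall>b\<in>topspace (T \<otimes> Y). e (upair (j u) b) = k (upair u b))"
    using e unfolding sections_space_def by blast+
  have v: "v \<in> cmap V T" and \<epsilon>: "\<epsilon> \<in> cmap (V \<otimes> Y) W"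
    and w\<epsilon>: "\<And>a y. \<lbrakk>a \<in> topspace V; y \<in> topspace Y\<rbrakk> \<Longrightarrow> w (\<epsilon> (upair a y)) = upair (v a) y"
    and \<epsilon>u: "\<And>U g k. \<lbrakk>U \<in> CGTop; g \<in> cmap U T; k \<in> cmap (U \<otimes> Y) W;
        \<forall>u\<in>topspace U. \<forall>y\<in>topspace Y. w (k (upair u y)) = upair (g u) y\<rbrakk> \<Longrightarrow>
        \<exists>!j. j \<in> cmap U V \<and> (\<forall>u\<in>topspace U. v (j u) = g u) \<and>
           (\<forall>u\<in>topspace U. \<forall>y\<in>topspace Y. \<epsilon> (upair (j u) y) = k (upair u y))"
    using s unfolding section_space_def by blast+
  let ?k = "\<lambda>p\<in>topspace ((Z \<otimes> T) \<otimes> Y). e (upair (ufst (ufst p)) (upair (usnd (ufst p)) (usnd p)))"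
  have "\<exists>!j. j \<in> cmap (Z \<otimes> T) V \<and> (\<forall>p\<in>topspace (Z \<otimes> T). v (j p) = prj2 Z T p) \<and>
           (\<forall>p\<in>topspace (Z \<otimes> T). \<forall>y\<in>topspace Y. \<epsilon> (upair (j p) y) = ?k (upair p y))"
    using we by (intro \<epsilon>u uprod_CGTop Z T prj2_cmap assoc_cmap Y ec) (simp add: uprod_ball)
  then obtain e2 where e2: "e2 \<in> cmap (Z \<otimes> T) V"
      "\<And>a t. \<lbrakk>a \<in> topspace Z; t \<in> topspace T\<rbrakk> \<Longrightarrow> v (e2 (upair a t)) = t"
      "\<And>a t y. \<lbrakk>a \<in> topspace Z; t \<in> topspace T; y \<in> topspace Y\<rbrakk> \<Longrightarrow>
        \<epsilon> (upair (e2 (upair a t)) y) = e (upair a (upair t y))"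
    by (auto simp: uprod_ball)
  have "sections_space T V v Z e2"
    unfolding sections_space_def
  proof (intro conjI ballI impI)
    fix U k assume U: "U \<in> CGTop" and k: "k \<in> cmap (U \<otimes> T) V"
      and vk: "\<forall>u\<in>topspace U. \<forall>t\<in>topspace T. v (k (upair u t)) = t"
    let ?k2 = "\<lambda>p\<in>topspace (U \<otimes> (T \<otimes> Y)). \<epsilon> (upair (k (upair (ufst p) (ufst (usnd p)))) (usnd (usnd p)))"
    let ?P = "U \<otimes> (T \<otimes> Y)"
    note cg = CGTop_cg[OF uprod_CGTop[OF U uprod_CGTop[OF T Y]]]
    have 1: "continuous_map ?P T (\<lambda>p. ufst (usnd p))" "continuous_map ?P Y (\<lambda>p. usnd (usnd p))"
      using continuous_map_compose'[OF continuous_map_usnd continuous_map_ufst]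
        continuous_map_compose'[OF continuous_map_usnd continuous_map_usnd] .
    have "continuous_map ?P V (\<lambda>p. k (upair (ufst p) (ufst (usnd p))))"
      by (rule continuous_map_compose'[OF continuous_map_upair[OF cg continuous_map_ufst 1(1)] cmap_continuous[OF k]])
    then have k2: "?k2 \<in> cmap ?P W"
      by (intro cmap_restrictI continuous_map_compose'[OF continuous_map_upair[OF cg _ 1(2)] cmap_continuous[OF \<epsilon>]])
    have kV: "k (upair u t) \<in> topspace V" if "u \<in> topspace U" "t \<in> topspace T" for u t
      using cmap_app[OF k] that by simp
    have "\<exists>!j. j \<in> cmap U Z \<and> (\<forall>u\<in>topspace U. \<forall>b\<in>topspace (T \<otimes> Y). e (upair (j u) b) = ?k2 (upair u b))"
      using w\<epsilon> vk kV by (intro eu U k2) (simp add: uprod_ball)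
    moreover have "(\<forall>u\<in>topspace U. \<forall>b\<in>topspace (T \<otimes> Y). e (upair (j u) b) = ?k2 (upair u b)) \<longleftrightarrow>
        (\<forall>u\<in>topspace U. \<forall>t\<in>topspace T. e2 (upair (j u) t) = k (upair u t))" if j: "j \<in> cmap U Z" for j
    proof
      assume "\<forall>u\<in>topspace U. \<forall>t\<in>topspace T. e2 (upair (j u) t) = k (upair u t)"
      then show "\<forall>u\<in>topspace U. \<forall>b\<in>topspace (T \<otimes> Y). e (upair (j u) b) = ?k2 (upair u b)"
        using e2(3)[symmetric] cmap_app[OF j] by (simp add: uprod_ball)
    next
      \<comment> \<open>Maps into \<open>V\<close> over \<open>T\<close> are determined by their
        transposes, and the composite of \<open>e2\<close> with \<open>j \<times> id\<close> has the
        same transpose as \<open>k\<close>.\<close>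
      assume ej: "\<forall>u\<in>topspace U. \<forall>b\<in>topspace (T \<otimes> Y). e (upair (j u) b) = ?k2 (upair u b)"
      note UT = uprod_CGTop[OF U T]
      let ?k3 = "\<lambda>p\<in>topspace ((U \<otimes> T) \<otimes> Y). ?k2 (upair (ufst (ufst p)) (upair (usnd (ufst p)) (usnd p)))"
      have "\<exists>!i. i \<in> cmap (U \<otimes> T) V \<and> (\<forall>p\<in>topspace (U \<otimes> T). v (i p) = prj2 U T p) \<and>
           (\<forall>p\<in>topspace (U \<otimes> T). \<forall>y\<in>topspace Y. \<epsilon> (upair (i p) y) = ?k3 (upair p y))"
        using w\<epsilon> vk kV by (intro \<epsilon>u UT prj2_cmap assoc_cmap U T Y k2) (simp add: uprod_ball)
      moreover have "compose (topspace (U \<otimes> T)) e2 (umap U T j) \<in> cmap (U \<otimes> T) V"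
        using compose_cmap[OF umap_cmap[OF U T j] e2(1)] .
      ultimately have "compose (topspace (U \<otimes> T)) e2 (umap U T j) = k"
        using k vk kV ej e2(2,3) cmap_app[OF j] by (auto simp: uprod_ball compose_def)
      then show "\<forall>u\<in>topspace U. \<forall>t\<in>topspace T. e2 (upair (j u) t) = k (upair u t)"
        by (auto simp: compose_def)
    qed
    ultimately show "\<exists>!j. j \<in> cmap U Z \<and> (\<forall>u\<in>topspace U. \<forall>t\<in>topspace T. e2 (upair (j u) t) = k (upair u t))"
      by (metis (no_types, lifting))
  qed (use e2 in auto)
  then show ?thesis by blast
qed

section \<open>Spaces of lifts as spaces of sections\<close>

context
  fixes X' :: "('o, 'm, 'u) fibcat" and X :: "('p, 'n, 'u) fibcat" and f :: "('o, 'm, 'p, 'n) mor"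
  assumes X': "fibered_in_groupoids X'" and X: "fibered_in_groupoids X" and f: "morphism X' X f"
begin

context
  fixes T :: "'u topology" and p and c :: 'o and l :: 'n
  assumes T: "T \<in> CGTop" and p: "morphism (rep T) X p"
    and u: "universal_arrow X' X f (OM p (T, idmap T)) c l"
begin

private abbreviation "NX \<equiv> name_of (rep T) X p"
private abbreviation "fT \<equiv> pushforward (rep T) X' f"

text \<open>At the point, the family named by \<open>p\<close> corresponds to the value of
  \<open>p\<close> at the projection from \<open>point \<otimes> T\<close> to \<open>T\<close>. This
  projection is a homeomorphism, so the value is isomorphic to that at the identity of
  \<open>T\<close>, and the universal arrow is moved along the isomorphism.\<close>

lemma lifts_universal_arrow:
  obtains P l' where "OM NX (point, idmap point) = (point, P)" "(point, P) \<in> Obj (Map (rep T) X)"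
    "universal_arrow X' X f (OM P (uprod_point point T)) c l'"
    "\<forall>a\<in>topspace (Base X' c). BaseMap X l' a = upair undefined (BaseMap X l a)"
    "BaseMap X l \<in> cmap (Base X' c) T"
proof -
  note coX = fib_category_over[OF X] and pt = point_CGTop
  let ?P = "constant_family (rep T) p point"
  have ptO: "(point, idmap point) \<in> Obj (rep (point :: 'u topology))" using pt by simp
  have N: "OM NX (point, idmap point) = (point, ?P)"
    using ptO by (rule name_of_OM[OF category_over_rep X p])
  have PO: "(point, ?P) \<in> Obj (Map (rep T) X)"
    using pt morphism_constant_family[OF category_over_rep X p] by (simp add: Map_Obj[OF category_over_rep X])
  let ?b = "(point \<otimes> T, prj2 point T)" and ?t = "(T, idmap T)"
  have bO: "?b \<in> Obj (rep T)" and tO: "?t \<in> Obj (rep T)" using pt T by simp_all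
  have P1: "OM ?P (uprod_point point T) = OM p ?b"
    using constant_family_simps(1)[OF category_over_rep X p pt_Obj[OF T X pt]] by simp
  note i0 = mor_homs[OF p rep_to_terminal[OF T bO]] and i0B = mor_BaseMap[OF p rep_to_terminal[OF T bO]]
  let ?i0 = "AM p (?b, prj2 point T, ?t)"
  have bb: "Base X (OM p ?b) = point \<otimes> T" "Base X (OM p ?t) = T" using mor_Base[OF p bO] mor_Base[OF p tO] by auto
  let ?g = "\<lambda>t\<in>topspace T. upair undefined t"
  have g: "?g \<in> cmap T (point \<otimes> T)"
    using continuous_map_upair[OF CGTop_cg[OF T], of point "\<lambda>_. undefined" T id]
    by (intro cmap_restrictI) (simp add: topspace_point)
  obtain i where i: "i \<in> homs X (OM p ?t) (OM p ?b)" "BaseMap X i = ?g" "Cmp X ?i0 i = Id X (OM p ?t)" "Cmp X i ?i0 = Id X (OM p ?b)"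
  proof (rule fib_iso_inverse[OF X i0])
    show "?g \<in> cmap (Base X (OM p ?t)) (Base X (OM p ?b))" using g bb by simp
    show "compose (topspace (Base X (OM p ?t))) (BaseMap X ?i0) ?g = idmap (Base X (OM p ?t))"
      unfolding bb i0B using compose_eq_iff[OF g prj2_cmap idmap_cmap[of T]] by (simp add: topspace_point idmap_def)
    show "compose (topspace (Base X (OM p ?b))) ?g (BaseMap X ?i0) = idmap (Base X (OM p ?b))"
      unfolding bb i0B using compose_eq_iff[OF prj2_cmap g idmap_cmap[of "point \<otimes> T"]]
      by (simp add: topspace_point idmap_def uprod_ball)
  qed
  note l = universal_arrowD(1,2)[OF u]
  have fc: "Base X (OM f c) = Base X' c" using mor_Base[OF f l(1)] .
  have w: "BaseMap X l \<in> cmap (Base X' c) T" using BaseMap_cmap[OF coX l(2)] fc bb by simp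
  show thesis
  proof (rule that[OF N PO])
    show "universal_arrow X' X f (OM ?P (uprod_point point T)) c (Cmp X i l)"
      unfolding P1 by (rule universal_arrow_iso[OF X f u i(1) i0 i(4,3)])
    show "\<forall>a\<in>topspace (Base X' c). BaseMap X (Cmp X i l) a = upair undefined (BaseMap X l a)"
      using BaseMap_Cmp[OF coX l(2) i(1)] fc i(2) cmap_app[OF w] by (simp add: compose_def)
  qed (rule w)
qed

text \<open>The equivalence yields a terminal object of the stack of lifts, this a universal arrow
  of the pushforward at the named point, and this a section space over the point.\<close>

lemma lifts_imp_sections_space:
  assumes Z: "Z \<in> CGTop" and E: "equivalence (rep Z) (lifts (rep T) X' X f p) E"
  obtains e where "sections_space T (Base X' c) (BaseMap X l) Z e"
proof -
  note M' = fibered_Map[OF category_over_rep X'] and M = fibered_Map[OF category_over_rep X]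
  note mf = morphism_pushforward[OF category_over_rep X' X f] and mN = morphism_name_of[OF category_over_rep X p]
  obtain P l' where P: "OM NX (point, idmap point) = (point, P)" "(point, P) \<in> Obj (Map (rep T) X)"
    and u': "universal_arrow X' X f (OM P (uprod_point point T)) c l'"
    and l': "\<forall>a\<in>topspace (Base X' c). BaseMap X l' a = upair undefined (BaseMap X l a)"
    and w: "BaseMap X l \<in> cmap (Base X' c) T"
    by (rule lifts_universal_arrow)
  let ?L = "lifts (rep T) X' X f p"
  have zO: "(Z, idmap Z) \<in> Obj (rep Z)" using Z by simp
  have mE: "morphism (rep Z) ?L E" using E by (simp add: equivalence_def)
  have fL: "fibered_in_groupoids ?L"
    unfolding lifts_def by (rule fibered_fiber_product[OF fibered_rep M' M mN mf])
  obtain d z b \<phi> where e: "OM E (Z, idmap Z) = ((d, z), b, \<phi>)" by (metis prod.collapse)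
  have "d = Z" using mor_Base[OF mE zO] unfolding e lifts_def by simp
  have t: "terminal_obj ?L ((Z, z), b, \<phi>)"
    using terminal_of_equivalence[OF fL Z E] e \<open>d = Z\<close> by simp
  obtain \<mu> where \<mu>: "universal_arrow (Map (rep T) X') (Map (rep T) X) fT (point, P) b \<mu>" "BaseMap (Map (rep T) X) \<mu> = z"
      "Base (Map (rep T) X') b = Z"
    by (rule terminal_imp_universal_arrow[OF M' M mf point_CGTop mN t[unfolded lifts_def]]) (simp add: P(1))
  obtain F where F: "b = (Z, F)" using \<mu>(3) by (cases b) (simp add: Map_simps[OF category_over_rep X'])
  obtain e where e: "section_space point T (Base X' c) (BaseMap X l') Z z e"
    using section_space_of_universal_arrow[OF T X' X f P(2) u' \<mu>(1)[unfolded F]] \<mu>(2) by metis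
  then have "z \<in> cmap Z point" by (simp add: section_space_def)
  then show thesis using that sections_space_iff[OF w l'[rule_format]] e by blast
qed

lemma sections_space_imp_lifts:
  assumes Z: "Z \<in> CGTop" and e: "sections_space T (Base X' c) (BaseMap X l) Z e"
  obtains E where "equivalence (rep Z) (lifts (rep T) X' X f p) E"
proof -
  note M' = fibered_Map[OF category_over_rep X'] and M = fibered_Map[OF category_over_rep X]
  note mf = morphism_pushforward[OF category_over_rep X' X f] and mN = morphism_name_of[OF category_over_rep X p]
  obtain P l' where P: "OM NX (point, idmap point) = (point, P)" "(point, P) \<in> Obj (Map (rep T) X)"
    and u': "universal_arrow X' X f (OM P (uprod_point point T)) c l'"
    and l': "\<forall>a\<in>topspace (Base X' c). BaseMap X l' a = upair undefined (BaseMap X l a)"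
    and w: "BaseMap X l \<in> cmap (Base X' c) T"
    by (rule lifts_universal_arrow)
  let ?L = "lifts (rep T) X' X f p"
  have fL: "fibered_in_groupoids ?L"
    unfolding lifts_def by (rule fibered_fiber_product[OF fibered_rep M' M mN mf])
  let ?z = "\<lambda>_\<in>topspace Z. undefined"
  have z: "?z \<in> cmap Z point" by (simp add: cmap_to_point)
  have "section_space point T (Base X' c) (BaseMap X l') Z ?z e"
    using sections_space_iff[OF w l'[rule_format] z] e by blast
  then obtain F \<mu> where \<mu>: "universal_arrow (Map (rep T) X') (Map (rep T) X) fT (point, P) (Z, F) \<mu>"
    using universal_arrow_of_section_space[OF T X' X f P(2) u' Z] by metis
  obtain \<phi> where t: "terminal_obj ?L ((Base (Map (rep T) X') (Z, F), BaseMap (Map (rep T) X) \<mu>), (Z, F), \<phi>)"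
    using universal_arrow_imp_terminal[OF M' M mf point_CGTop mN] \<mu> P(1) unfolding lifts_def by metis
  obtain E where "equivalence (rep Z) ?L E"
    using equivalence_of_terminal[OF fL t] by (auto simp: lifts_def Map_simps[OF category_over_rep X'])
  then show thesis by (rule that)
qed

end

section \<open>Consequences of weak parashrinkability\<close>

context
  assumes wp: "weakly_parashrinkable X' X f"
begin

lemma parashrinkable_sections_space:
  assumes T: "T \<in> CGTop" "paracompact_space T" and x: "x \<in> Obj X" "Base X x = T"
    and u: "universal_arrow X' X f x c l"
  obtains Z e where "Z \<in> CGTop" "weakly_contractible Z" "topspace Z \<noteq> {}" "sections_space T (Base X' c) (BaseMap X l) Z e"
proof -
  obtain p where p: "morphism (rep T) X p" "OM p (T, idmap T) = x"
    by (rule morphism_exists[OF category_over_rep X terminal_rep[OF T(1)] x(1)]) (use x in auto)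
  obtain Z E where Z: "Z \<in> CGTop" "equivalence (rep Z) (lifts (rep T) X' X f p) E" "weakly_contractible Z" "topspace Z \<noteq> {}"
    using wp T p(1) unfolding weakly_parashrinkable_def by blast
  obtain e where "sections_space T (Base X' c) (BaseMap X l) Z e"
    by (rule lifts_imp_sections_space[OF T(1) p(1) _ Z(1,2)]) (use u p(2) in auto)
  then show thesis using that Z by blast
qed

text \<open>Sections over \<open>A\<close> of the space pulled back along \<open>q\<close> are the
  lifts of \<open>q\<close> to \<open>Base X' c\<close>. What is kept is a weakly contractible
  parameter space with a continuous family \<open>E\<close> of lifts in which every lift
  occurs.\<close>

lemma parashrinkable_pullback:
  assumes x: "x \<in> Obj X" and u: "universal_arrow X' X f x c l"
    and A: "A \<in> CGTop" "paracompact_space A" and q: "q \<in> cmap A (Base X x)"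
  obtains Z E where "Z \<in> CGTop" "weakly_contractible Z" "topspace Z \<noteq> {}" "E \<in> cmap (Z \<otimes> A) (Base X' c)"
    "\<forall>z\<in>topspace Z. \<forall>a\<in>topspace A. BaseMap X l (E (upair z a)) = q a"
    "\<forall>k\<in>cmap A (Base X' c). (\<forall>a\<in>topspace A. BaseMap X l (k a) = q a) \<longrightarrow>
        (\<exists>z\<in>topspace Z. \<forall>a\<in>topspace A. E (upair z a) = k a)"
proof -
  note coX = fib_category_over[OF X] and coX' = fib_category_over[OF X']
  note l = universal_arrowD(1,2)[OF u]
  let ?W = "Base X' c" and ?w = "BaseMap X l"
  obtain xA i where i: "i \<in> homs X xA x" "Base X xA = A" "BaseMap X i = q"
    using fib_pullback[OF X A(1) x q] by metis
  note xA = homs_Obj(1)[OF coX i(1)]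
  obtain cA lA where uA: "universal_arrow X' X f xA cA lA"
    using representable_imp_universal_arrow[OF X' X _ xA] wp unfolding weakly_parashrinkable_def by metis
  note lA = universal_arrowD(1,2)[OF uA]
  let ?WA = "Base X' cA" and ?wA = "BaseMap X lA"
  have fc: "Base X (OM f cA) = ?WA" "Base X (OM f c) = ?W" using mor_Base[OF f] lA(1) l(1) by auto
  obtain r where r: "r \<in> homs X' cA c" "Cmp X l (AM f r) = Cmp X i lA"
    using universal_arrowD(3)[OF u lA(1) Cmp_homs[OF coX lA(2) i(1)]] by blast
  let ?r = "BaseMap X' r"
  have rc: "?r \<in> cmap ?WA ?W" using BaseMap_cmap[OF coX' r(1)] .
  have wAc: "?wA \<in> cmap ?WA A" using BaseMap_cmap[OF coX lA(2)] fc i(2) by simp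
  have wr: "?w (?r a) = q (?wA a)" if "a \<in> topspace ?WA" for a
  proof -
    have "compose (topspace ?WA) ?w ?r = compose (topspace ?WA) q ?wA"
      using BaseMap_Cmp[OF coX mor_homs[OF f r(1)] l(2)] BaseMap_Cmp[OF coX lA(2) i(1)] r(2) mor_BaseMap[OF f r(1)] fc i(3)
      by simp
    from fun_cong[OF this, of a] show ?thesis using that by (simp add: compose_def)
  qed
  \<comment> \<open>A lift of \<open>q\<close> factors through the pulled-back space
    \<open>?WA\<close> as a section.\<close>
  have lift: "\<exists>k'\<in>cmap A ?WA. (\<forall>a\<in>topspace A. ?wA (k' a) = a) \<and> (\<forall>a\<in>topspace A. ?r (k' a) = k a)"
    if k: "k \<in> cmap A ?W" and wk: "\<And>a. a \<in> topspace A \<Longrightarrow> ?w (k a) = q a" for k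
  proof -
    obtain c2 n where n: "n \<in> homs X' c2 c" "Base X' c2 = A" "BaseMap X' n = k"
      using fib_pullback[OF X' A(1) l(1) k] by metis
    note c2 = homs_Obj(1)[OF coX' n(1)] and fn = mor_homs[OF f n(1)]
    have fc2: "Base X (OM f c2) = A" using mor_Base[OF f c2] n(2) by simp
    have lfn: "Cmp X l (AM f n) \<in> homs X (OM f c2) x" using Cmp_homs[OF coX fn l(2)] .
    have "BaseMap X (Cmp X l (AM f n)) = compose (topspace A) ?w k"
      using BaseMap_Cmp[OF coX fn l(2)] mor_BaseMap[OF f n(1)] fc2 n(3) by simp
    also have "\<dots> = q"
    proof (rule compose_eq_iff[THEN iffD2, OF k _ q])
      show "?w \<in> cmap ?W (Base X x)" using BaseMap_cmap[OF coX l(2)] fc(2) by simp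
      show "\<forall>a\<in>topspace A. ?w (k a) = q a" using wk by blast
    qed
    finally have Bq: "BaseMap X (Cmp X l (AM f n)) = q" .
    obtain m where m: "m \<in> homs X (OM f c2) xA" "BaseMap X m = idmap A" "Cmp X i m = Cmp X l (AM f n)"
      by (rule fib_cartE[OF X i(1) lfn, of "idmap A"]) (use fc2 i(2,3) Bq compose_idmap_right[OF q] in auto)
    obtain h where h: "h \<in> homs X' c2 cA" "Cmp X lA (AM f h) = m"
      using universal_arrowD(3)[OF uA c2 m(1)] by blast
    note fh = mor_homs[OF f h(1)]
    have "Cmp X l (AM f (Cmp X' r h)) = Cmp X l (AM f n)"
      using mor_Cmp[OF f h(1) r(1)] Cmp_assoc[OF coX fh mor_homs[OF f r(1)] l(2)] r(2)
        Cmp_assoc[OF coX fh lA(2) i(1)] h(2) m(3) by simp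
    then have rh: "Cmp X' r h = n"
      using universal_arrowD(3)[OF u c2 lfn] Cmp_homs[OF coX' h(1) r(1)] n(1) by blast
    have hc: "BaseMap X' h \<in> cmap A ?WA" using BaseMap_cmap[OF coX' h(1)] n(2) by simp
    have "compose (topspace A) ?wA (BaseMap X' h) = idmap A"
      using BaseMap_Cmp[OF coX fh lA(2)] h(2) m(2) mor_BaseMap[OF f h(1)] fc2 by simp
    moreover have "compose (topspace A) ?r (BaseMap X' h) = k"
      using BaseMap_Cmp[OF coX' h(1) r(1)] rh n(2,3) by simp
    ultimately show ?thesis
      using hc compose_eq_iff[OF hc wAc idmap_cmap[of A]] compose_eq_iff[OF hc rc k]
      by (intro bexI[of _ "BaseMap X' h"]) (auto simp: idmap_def)
  qed
  obtain Z e where Z: "Z \<in> CGTop" "weakly_contractible Z" "topspace Z \<noteq> {}" "sections_space A ?WA ?wA Z e"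
    by (rule parashrinkable_sections_space[OF A xA i(2) uA])
  have e: "e \<in> cmap (Z \<otimes> A) ?WA" "\<And>z a. \<lbrakk>z \<in> topspace Z; a \<in> topspace A\<rbrakk> \<Longrightarrow> ?wA (e (upair z a)) = a"
    and eu: "\<And>U k. \<lbrakk>U \<in> CGTop; k \<in> cmap (U \<otimes> A) ?WA; \<forall>u\<in>topspace U. \<forall>t\<in>topspace A. ?wA (k (upair u t)) = t\<rbrakk> \<Longrightarrow>
        \<exists>!j. j \<in> cmap U Z \<and> (\<forall>u\<in>topspace U. \<forall>t\<in>topspace A. e (upair (j u) t) = k (upair u t))"
    using Z(4) unfolding sections_space_def by blast+
  let ?E = "compose (topspace (Z \<otimes> A)) ?r e"
  have E_eq: "?E (upair z a) = ?r (e (upair z a))" if "z \<in> topspace Z" "a \<in> topspace A" for z a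
    using that by (simp add: compose_def)
  have eW: "e (upair z a) \<in> topspace ?WA" if "z \<in> topspace Z" "a \<in> topspace A" for z a
    using cmap_app[OF e(1)] that by simp
  show thesis
  proof (rule that[OF Z(1-3) compose_cmap[OF e(1) rc]])
    show "\<forall>z\<in>topspace Z. \<forall>a\<in>topspace A. ?w (?E (upair z a)) = q a"
      using E_eq wr[OF eW] e(2) by simp
    show "\<forall>k\<in>cmap A ?W. (\<forall>a\<in>topspace A. ?w (k a) = q a) \<longrightarrow>
        (\<exists>z\<in>topspace Z. \<forall>a\<in>topspace A. ?E (upair z a) = k a)"
    proof (intro ballI impI)
    fix k assume k: "k \<in> cmap A ?W" "\<forall>a\<in>topspace A. ?w (k a) = q a"
    obtain k' where k': "k' \<in> cmap A ?WA" "\<forall>a\<in>topspace A. ?wA (k' a) = a" "\<forall>a\<in>topspace A. ?r (k' a) = k a"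
      using lift[OF k(1)] k(2) by blast
    \<comment> \<open>A single section is a family over the one-point space; its classifying map
      picks the parameter.\<close>
    have kc: "compose (topspace (point \<otimes> A)) k' (prj2 point A) \<in> cmap (point \<otimes> A) ?WA"
      using compose_cmap[OF prj2_cmap k'(1)] .
    have "\<exists>!j. j \<in> cmap point Z \<and> (\<forall>u\<in>topspace point. \<forall>t\<in>topspace A. e (upair (j u) t) =
        compose (topspace (point \<otimes> A)) k' (prj2 point A) (upair u t))"
      by (rule eu[OF point_CGTop kc]) (use k'(2) in \<open>simp add: compose_def\<close>)
    then obtain j where j: "j \<in> cmap point Z" "\<And>t. t \<in> topspace A \<Longrightarrow> e (upair (j undefined) t) = k' t"
      by (auto simp: compose_def topspace_point)
    then have jZ: "j undefined \<in> topspace Z" using cmap_app[OF j(1)] by (simp add: topspace_point)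
    then show "\<exists>z\<in>topspace Z. \<forall>a\<in>topspace A. ?E (upair z a) = k a"
      using j(2) k'(3) E_eq by (intro bexI[of _ "j undefined"]) auto
    qed
  qed
qed

lemma homotopy_lifting_section_space:
  assumes T: "T \<in> CGTop" and Y: "Y \<in> CGTop" "paracompact_space Y"
    and x: "x \<in> Obj X" "Base X x = T \<otimes> Y" and u: "universal_arrow X' X f x c l"
    and Z: "Z \<in> CGTop" and s: "section_space T Y (Base X' c) (BaseMap X l) Z z e"
  shows "homotopy_lifting Z T z"
  unfolding homotopy_lifting_def
proof (intro conjI allI impI; (elim conjE)?)
  let ?W = "Base X' c" and ?w = "BaseMap X l"
  have z: "z \<in> cmap Z T" and e: "e \<in> cmap (Z \<otimes> Y) ?W"
    and we: "\<And>a y. \<lbrakk>a \<in> topspace Z; y \<in> topspace Y\<rbrakk> \<Longrightarrow> ?w (e (upair a y)) = upair (z a) y"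
    and su: "\<And>U g k. \<lbrakk>U \<in> CGTop; g \<in> cmap U T; k \<in> cmap (U \<otimes> Y) ?W;
        \<forall>u\<in>topspace U. \<forall>y\<in>topspace Y. ?w (k (upair u y)) = upair (g u) y\<rbrakk> \<Longrightarrow>
        \<exists>!j. j \<in> cmap U Z \<and> (\<forall>u\<in>topspace U. z (j u) = g u) \<and>
           (\<forall>u\<in>topspace U. \<forall>y\<in>topspace Y. e (upair (j u) y) = k (upair u y))"
    using s unfolding section_space_def by blast+
  show "continuous_map Z T z" using z by (rule cmap_continuous)
  fix D :: "'u topology" assume D: "D \<in> CGTop" "compact_space D" "Hausdorff_space D"
  \<comment> \<open>Compactness of \<open>D\<close> makes weak parashrinkability applicable over
    \<open>D \<otimes> Y\<close>.\<close>
  have DY: "D \<otimes> Y \<in> CGTop" "paracompact_space (D \<otimes> Y)"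
    using uprod_CGTop[OF D(1) Y(1)] paracompact_compact_uprod[OF D(2,3,1) Y] .
  {
    fix q assume "continuous_map D T q"
    then have q: "restrict q (topspace D) \<in> cmap D T" by (rule cmap_restrictI)
    have Q: "umap D Y (restrict q (topspace D)) \<in> cmap (D \<otimes> Y) (Base X x)"
      using umap_cmap[OF D(1) Y(1) q] x(2) by simp
    obtain ZA E where ZA: "ZA \<in> CGTop" "weakly_contractible ZA" "topspace ZA \<noteq> {}" "E \<in> cmap (ZA \<otimes> (D \<otimes> Y)) ?W"
      "\<forall>a\<in>topspace ZA. \<forall>b\<in>topspace (D \<otimes> Y). ?w (E (upair a b)) = umap D Y (restrict q (topspace D)) b"
      by (rule parashrinkable_pullback[OF x(1) u DY Q])
    obtain a where a: "a \<in> topspace ZA" using ZA(3) by blast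
    \<comment> \<open>Any one lift over \<open>D \<otimes> Y\<close> transposes to a map from
      \<open>D\<close> to \<open>Z\<close> that lifts \<open>q\<close>.\<close>
    let ?k = "\<lambda>b\<in>topspace (D \<otimes> Y). E (upair a b)"
    have "continuous_map (D \<otimes> Y) (ZA \<otimes> (D \<otimes> Y)) (\<lambda>b. upair a (id b))"
      using a by (intro continuous_map_upair CGTop_cg DY) auto
    from continuous_map_compose'[OF this cmap_continuous[OF ZA(4)]]
    have k: "?k \<in> cmap (D \<otimes> Y) ?W" by (intro cmap_restrictI) simp
    have "\<exists>!j. j \<in> cmap D Z \<and> (\<forall>d\<in>topspace D. z (j d) = restrict q (topspace D) d) \<and>
           (\<forall>d\<in>topspace D. \<forall>y\<in>topspace Y. e (upair (j d) y) = ?k (upair d y))"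
      using ZA(5) a by (intro su D(1) q k) auto
    then obtain j where "j \<in> cmap D Z" "\<forall>d\<in>topspace D. z (j d) = restrict q (topspace D) d" by blast
    then show "\<exists>s. continuous_map D Z s \<and> (\<forall>d\<in>topspace D. z (s d) = q d)"
      by (intro exI[of _ j]) (auto intro: cmap_continuous)
  next
    fix s0 s1 assume "continuous_map D Z s0" "continuous_map D Z s1" and zs: "\<forall>d\<in>topspace D. z (s0 d) = z (s1 d)"
    then have s: "restrict s0 (topspace D) \<in> cmap D Z" "restrict s1 (topspace D) \<in> cmap D Z"
      by (auto intro: cmap_restrictI)
    let ?s0 = "restrict s0 (topspace D)" and ?s1 = "restrict s1 (topspace D)"
    let ?q = "compose (topspace D) z ?s0"
    have q: "?q \<in> cmap D T" using compose_cmap[OF s(1) z] .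
    have Q: "umap D Y ?q \<in> cmap (D \<otimes> Y) (Base X x)" using umap_cmap[OF D(1) Y(1) q] x(2) by simp
    obtain ZA E where ZA: "ZA \<in> CGTop" "weakly_contractible ZA" "topspace ZA \<noteq> {}"
      and E: "E \<in> cmap (ZA \<otimes> (D \<otimes> Y)) ?W"
      "\<forall>a\<in>topspace ZA. \<forall>b\<in>topspace (D \<otimes> Y). ?w (E (upair a b)) = umap D Y ?q b"
      "\<forall>k\<in>cmap (D \<otimes> Y) ?W. (\<forall>b\<in>topspace (D \<otimes> Y). ?w (k b) = umap D Y ?q b) \<longrightarrow>
        (\<exists>a\<in>topspace ZA. \<forall>b\<in>topspace (D \<otimes> Y). E (upair a b) = k b)"
      by (rule parashrinkable_pullback[OF x(1) u DY Q])
    let ?k = "\<lambda>\<sigma>. compose (topspace (D \<otimes> Y)) e (umap D Y \<sigma>)"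
    have kc: "?k \<sigma> \<in> cmap (D \<otimes> Y) ?W" if "\<sigma> \<in> cmap D Z" for \<sigma>
      using compose_cmap[OF umap_cmap[OF D(1) Y(1) that] e] .
    have wk: "?w (?k \<sigma> b) = umap D Y ?q b"
      if \<sigma>: "\<sigma> \<in> cmap D Z" "\<forall>d\<in>topspace D. z (\<sigma> d) = z (s0 d)" and b: "b \<in> topspace (D \<otimes> Y)" for \<sigma> b
    proof -
      obtain d y where "b = upair d y" "d \<in> topspace D" "y \<in> topspace Y" using b by (rule uprodE)
      then show ?thesis using \<sigma>(2) we[OF cmap_app[OF \<sigma>(1)]] by (simp add: compose_def)
    qed
    have z1: "\<forall>d\<in>topspace D. z (?s1 d) = z (s0 d)" and z0: "\<forall>d\<in>topspace D. z (?s0 d) = z (s0 d)" using zs by auto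
    \<comment> \<open>The transposes of the two given lifts occur in the family \<open>E\<close>, at
      parameters \<open>a0\<close> and \<open>a1\<close>.\<close>
    obtain a0 where a0: "a0 \<in> topspace ZA" "\<forall>b\<in>topspace (D \<otimes> Y). E (upair a0 b) = ?k ?s0 b"
      using E(3)[rule_format, OF kc[OF s(1)] wk[OF s(1) z0]] by blast
    obtain a1 where a1: "a1 \<in> topspace ZA" "\<forall>b\<in>topspace (D \<otimes> Y). E (upair a1 b) = ?k ?s1 b"
      using E(3)[rule_format, OF kc[OF s(2)] wk[OF s(2) z1]] by blast
    obtain \<gamma> where \<gamma>: "continuous_map (top_of_set {0..1::real}) ZA \<gamma>" "\<gamma> 0 = a0" "\<gamma> 1 = a1"
      using weakly_contractible_path_connected[OF ZA(2) a0(1) a1(1)] by (auto simp: path_component_of_def pathin_def)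
    note ZD = uprod_CGTop[OF ZA(1) D(1)]
    let ?g = "compose (topspace (ZA \<otimes> D)) ?q (prj2 ZA D)"
    let ?E2 = "\<lambda>p\<in>topspace ((ZA \<otimes> D) \<otimes> Y). E (upair (ufst (ufst p)) (upair (usnd (ufst p)) (usnd p)))"
    \<comment> \<open>The whole family \<open>E\<close> transposes at once to a map \<open>j\<close>
      over \<open>T\<close>.\<close>
    have "\<exists>!j. j \<in> cmap (ZA \<otimes> D) Z \<and> (\<forall>p\<in>topspace (ZA \<otimes> D). z (j p) = ?g p) \<and>
           (\<forall>p\<in>topspace (ZA \<otimes> D). \<forall>y\<in>topspace Y. e (upair (j p) y) = ?E2 (upair p y))"
      using E(2) by (intro su ZD compose_cmap[OF prj2_cmap q] assoc_cmap ZA(1) D(1) Y(1) E(1)) (auto simp: uprod_ball compose_def)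
    then obtain j where j: "j \<in> cmap (ZA \<otimes> D) Z" "\<And>a d. \<lbrakk>a \<in> topspace ZA; d \<in> topspace D\<rbrakk> \<Longrightarrow> z (j (upair a d)) = z (s0 d)"
       "\<And>a d y. \<lbrakk>a \<in> topspace ZA; d \<in> topspace D; y \<in> topspace Y\<rbrakk> \<Longrightarrow> e (upair (j (upair a d)) y) = E (upair a (upair d y))"
      by (auto simp: uprod_ball compose_def)
    \<comment> \<open>By uniqueness of transposes, \<open>j\<close> restricts to the given lift at
      its parameter.\<close>
    have slice: "j (upair a d) = \<sigma> d"
      if \<sigma>: "\<sigma> \<in> cmap D Z" "\<forall>d\<in>topspace D. z (\<sigma> d) = z (s0 d)"
        and a: "a \<in> topspace ZA" "\<forall>b\<in>topspace (D \<otimes> Y). E (upair a b) = ?k \<sigma> b" and d: "d \<in> topspace D" for a \<sigma> d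
    proof -
      let ?j = "\<lambda>d\<in>topspace D. j (upair a d)"
      have "continuous_map D (ZA \<otimes> D) (\<lambda>d. upair a (id d))"
        using a D(1) by (intro continuous_map_upair CGTop_cg) auto
      from continuous_map_compose'[OF this cmap_continuous[OF j(1)]]
      have jc: "?j \<in> cmap D Z" by (intro cmap_restrictI) simp
      have "\<exists>!i. i \<in> cmap D Z \<and> (\<forall>d\<in>topspace D. z (i d) = ?q d) \<and>
           (\<forall>d\<in>topspace D. \<forall>y\<in>topspace Y. e (upair (i d) y) = ?k \<sigma> (upair d y))"
      proof (intro su D(1) q kc \<sigma>(1) ballI)
        show "?w (?k \<sigma> (upair d y)) = upair (?q d) y" if "d \<in> topspace D" "y \<in> topspace Y" for d y
          using wk[OF \<sigma>, of "upair d y"] umap_upair[OF that, of ?q] that by (simp del: umap_upair restrict_apply)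
      qed
      moreover have "\<forall>d\<in>topspace D. z (?j d) = ?q d" using j(2)[OF a(1)] by (simp add: compose_def)
      moreover have "\<forall>d\<in>topspace D. \<forall>y\<in>topspace Y. e (upair (?j d) y) = ?k \<sigma> (upair d y)"
        using j(3)[OF a(1)] a(2) by simp
      moreover have "\<forall>d\<in>topspace D. z (\<sigma> d) = ?q d" using \<sigma>(2) by (simp add: compose_def)
      moreover have "\<forall>d\<in>topspace D. \<forall>y\<in>topspace Y. e (upair (\<sigma> d) y) = ?k \<sigma> (upair d y)"
        by (simp add: compose_def)
      ultimately have "?j = \<sigma>" using jc \<sigma>(1) by blast
      from fun_cong[OF this, of d] show ?thesis using d by simp
    qed
    have \<gamma>Z: "\<gamma> t \<in> topspace ZA" if "t \<in> {0..1}" for t using \<gamma>(1) that by (auto simp: continuous_map_def)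
    \<comment> \<open>The homotopy follows a path in the parameter space from \<open>a0\<close> to
      \<open>a1\<close>; each stage is a lift because \<open>j\<close> is a map over
      \<open>T\<close>.\<close>
    let ?H = "\<lambda>t d. j (upair (\<gamma> t) d)"
    have "continuous_map (prod_topology (top_of_set {0..1::real}) D) (ZA \<otimes> D) (\<lambda>(t, d). upair (\<gamma> t) (id d))"
      using D CGTop_small[OF D(1)]
      by (intro continuous_map_upair_prod compact_interval Hausdorff_interval small_interval \<gamma>(1)) auto
    from continuous_map_compose'[OF this cmap_continuous[OF j(1)]]
    have H: "continuous_map (prod_topology (top_of_set {0..1::real}) D) Z (\<lambda>(t, d). ?H t d)"
      by (simp add: case_prod_unfold)
    have H01: "?H 0 d = s0 d" "?H 1 d = s1 d" if "d \<in> topspace D" for d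
      using slice[OF s(1) z0 a0 that] slice[OF s(2) z1 a1 that] \<gamma>(2,3) that by simp_all
    show "\<exists>H. continuous_map (prod_topology (top_of_set {0..1::real}) D) Z (\<lambda>(t, d). H t d) \<and>
           (\<forall>d\<in>topspace D. H 0 d = s0 d \<and> H 1 d = s1 d \<and> (\<forall>t\<in>{0..1}. z (H t d) = z (s0 d)))"
      using H H01 j(2)[OF \<gamma>Z] by (intro exI[of _ ?H]) auto
  }
qed

text \<open>An object of \<open>Map\<close> over \<open>T\<close> corresponds to an object of
  \<open>X\<close> over \<open>T \<otimes> Y\<close>. There \<open>f\<close> has a universal arrow,
  and the section space of its base map represents the pushforward.\<close>

lemma representable_pushforward:
  assumes Y: "Y \<in> CGTop"
  shows "representable (Map (rep Y) X') (Map (rep Y) X) (pushforward (rep Y) X' f)"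
proof (rule representableI[OF fibered_Map[OF category_over_rep X'] fibered_Map[OF category_over_rep X]
      morphism_pushforward[OF category_over_rep X' X f]])
  fix a assume a: "a \<in> Obj (Map (rep Y) X)"
  obtain T P where e: "a = (T, P)" by (cases a)
  note TP = a[unfolded e]
  have T: "T \<in> CGTop" and mP: "morphism (prod_stack (rep T) (rep Y)) X P"
    using TP by (auto simp: Map_Obj[OF category_over_rep X])
  let ?x = "OM P (uprod_point T Y)"
  have x: "?x \<in> Obj X" "Base X ?x = T \<otimes> Y"
    using mor_Obj[OF mP pt_Obj[OF Y X T]] mor_Base[OF mP pt_Obj[OF Y X T]] by auto
  obtain c l where u: "universal_arrow X' X f ?x c l"
    using representable_imp_universal_arrow[OF X' X _ x(1)] wp unfolding weakly_parashrinkable_def by metis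
  note cl = universal_arrowD(1,2)[OF u]
  have "Base X' c \<in> CGTop" using Base_CGTop[OF fib_category_over[OF X'] cl(1)] .
  moreover have "BaseMap X l \<in> cmap (Base X' c) (T \<otimes> Y)"
    using BaseMap_cmap[OF fib_category_over[OF X] cl(2)] mor_Base[OF f cl(1)] x(2) by simp
  ultimately obtain Z z e where "Z \<in> CGTop" "section_space T Y (Base X' c) (BaseMap X l) Z z e"
    using exists_section_space[OF T Y] by blast
  then obtain F \<mu> where "universal_arrow (Map (rep Y) X') (Map (rep Y) X) (pushforward (rep Y) X' f) (T, P) (Z, F) \<mu>"
    using universal_arrow_of_section_space[OF Y X' X f TP u] by metis
  then show "\<exists>b l. universal_arrow (Map (rep Y) X') (Map (rep Y) X) (pushforward (rep Y) X' f) a b l"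
    unfolding e by blast
qed

lemma universal_weak_equivalence_pushforward:
  assumes Y: "Y \<in> CGTop" "paracompact_space Y"
  shows "universal_weak_equivalence (Map (rep Y) X') (Map (rep Y) X) (pushforward (rep Y) X' f)"
proof (rule universal_weak_equivalenceI[OF fibered_Map[OF category_over_rep X'] fibered_Map[OF category_over_rep X]
      representable_pushforward[OF Y(1)]])
  let ?M' = "Map (rep Y) X'" and ?M = "Map (rep Y) X" and ?f = "pushforward (rep Y) X' f"
  fix a b \<mu> assume a: "a \<in> Obj ?M" and v: "universal_arrow ?M' ?M ?f a b \<mu>"
  obtain T P where e: "a = (T, P)" by (cases a)
  obtain Z F where e': "b = (Z, F)" by (cases b)
  note TP = a[unfolded e] and v' = v[unfolded e e']
  have T: "T \<in> CGTop" and mP: "morphism (prod_stack (rep T) (rep Y)) X P"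
    using TP by (auto simp: Map_Obj[OF category_over_rep X])
  have Z: "Z \<in> CGTop" using universal_arrowD(1)[OF v'] by (simp add: Map_Obj[OF category_over_rep X'])
  let ?x = "OM P (uprod_point T Y)"
  have x: "?x \<in> Obj X" "Base X ?x = T \<otimes> Y"
    using mor_Obj[OF mP pt_Obj[OF Y(1) X T]] mor_Base[OF mP pt_Obj[OF Y(1) X T]] by auto
  obtain c l where u: "universal_arrow X' X f ?x c l"
    using representable_imp_universal_arrow[OF X' X _ x(1)] wp unfolding weakly_parashrinkable_def by metis
  obtain s where s: "section_space T Y (Base X' c) (BaseMap X l) Z (BaseMap ?M \<mu>) s"
    by (rule section_space_of_universal_arrow[OF Y(1) X' X f TP u v'])
  have "weak_equivalence Z T (BaseMap ?M \<mu>)"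
    by (rule weak_equivalence_of_homotopy_lifting[OF homotopy_lifting_section_space[OF T Y x u Z s]])
  then show "weak_equivalence (Base ?M' b) (Base ?M a) (BaseMap ?M \<mu>)"
    unfolding e e' by (simp add: Map_simps[OF category_over_rep X] Map_simps[OF category_over_rep X'])
qed

end

end

lemma weakly_parashrinkable_pushforward:
  fixes X' :: "('o, 'm, 'u) fibcat" and X :: "('p, 'n, 'u) fibcat" and f :: "('o, 'm, 'p, 'n) mor"
  assumes X': "fibered_in_groupoids X'" and X: "fibered_in_groupoids X" and f: "morphism X' X f"
    and wp: "weakly_parashrinkable X' X f"
    and Y: "Y \<in> CGTop" "compact_space Y" "Hausdorff_space Y"
  shows "weakly_parashrinkable (Map (rep Y) X') (Map (rep Y) X) (pushforward (rep Y) X' f)"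
  unfolding weakly_parashrinkable_def
proof (intro conjI ballI allI impI)
  let ?M' = "Map (rep Y) X'" and ?M = "Map (rep Y) X" and ?f = "pushforward (rep Y) X' f"
  note M' = fibered_Map[OF category_over_rep X'] and M = fibered_Map[OF category_over_rep X]
  note mf = morphism_pushforward[OF category_over_rep X' X f]
  show "representable ?M' ?M ?f" by (rule representable_pushforward[OF X' X f wp Y(1)])
  fix T :: "'u topology" and p assume T: "T \<in> CGTop" "paracompact_space T" and p: "morphism (rep T) ?M p"
  have tO: "(T, idmap T) \<in> Obj (rep T)" using T by simp
  obtain T' P where e: "OM p (T, idmap T) = (T', P)" by (cases "OM p (T, idmap T)")
  have "T' = T" using mor_Base[OF p tO] e by (simp add: Map_simps[OF category_over_rep X])
  note e = e[unfolded this]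
  have TP: "(T, P) \<in> Obj ?M" using mor_Obj[OF p tO] e by simp
  then have mP: "morphism (prod_stack (rep T) (rep Y)) X P" by (simp add: Map_Obj[OF category_over_rep X])
  let ?x = "OM P (uprod_point T Y)"
  have x: "?x \<in> Obj X" "Base X ?x = T \<otimes> Y"
    using mor_Obj[OF mP pt_Obj[OF Y(1) X T(1)]] mor_Base[OF mP pt_Obj[OF Y(1) X T(1)]] by auto
  obtain c l where u: "universal_arrow X' X f ?x c l"
    using representable_imp_universal_arrow[OF X' X _ x(1)] wp unfolding weakly_parashrinkable_def by metis
  note cl = universal_arrowD(1,2)[OF u]
  let ?W = "Base X' c" and ?w = "BaseMap X l"
  have W: "?W \<in> CGTop" using Base_CGTop[OF fib_category_over[OF X'] cl(1)] .
  have w: "?w \<in> cmap ?W (T \<otimes> Y)"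
    using BaseMap_cmap[OF fib_category_over[OF X] cl(2)] mor_Base[OF f cl(1)] x(2) by simp
  \<comment> \<open>Compactness of \<open>Y\<close> makes \<open>T \<otimes> Y\<close> paracompact,
    so weak parashrinkability of \<open>f\<close> applies to sections over it.\<close>
  obtain Z s where Z: "Z \<in> CGTop" "weakly_contractible Z" "topspace Z \<noteq> {}" "sections_space (T \<otimes> Y) ?W ?w Z s"
    by (rule parashrinkable_sections_space[OF X' X f wp uprod_CGTop[OF T(1) Y(1)]
          paracompact_uprod_compact[OF Y(2,3,1) T] x u])
  obtain V v \<epsilon> where V: "V \<in> CGTop" "section_space T Y ?W ?w V v \<epsilon>"
    using exists_section_space[OF T(1) Y(1) W w] by blast
  obtain F \<mu> where \<mu>: "universal_arrow ?M' ?M ?f (T, P) (V, F) \<mu>" "BaseMap ?M \<mu> = v"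
    by (rule universal_arrow_of_section_space[OF Y(1) X' X f TP u V])
  \<comment> \<open>Currying turns these sections into sections of \<open>V\<close> over
    \<open>T\<close>, where \<open>V\<close> represents the pushforward along \<open>P\<close>; the
    same weakly contractible \<open>Z\<close> therefore serves.\<close>
  obtain s' where "sections_space T V v Z s'"
    using sections_space_curry[OF T(1) Y(1) Z(1,4) V(2)] by blast
  then have s': "sections_space T (Base ?M' (V, F)) (BaseMap ?M \<mu>) Z s'"
    using \<mu>(2) by (simp add: Map_simps[OF category_over_rep X'])
  have u': "universal_arrow ?M' ?M ?f (OM p (T, idmap T)) (V, F) \<mu>" using \<mu>(1) e by simp
  obtain E where "equivalence (rep Z) (lifts (rep T) ?M' ?M ?f p) E"
    by (rule sections_space_imp_lifts[OF M' M mf T(1) p u' Z(1) s'])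
  then show "\<exists>Z\<in>CGTop. (\<exists>E. equivalence (rep Z) (lifts (rep T) ?M' ?M ?f p) E) \<and>
      weakly_contractible Z \<and> topspace Z \<noteq> {}"
    using Z by blast
qed

end

theorem theorem6p4:
  fixes X' :: "('o, 'm, 'u) fibcat" and X :: "('p, 'n, 'u) fibcat"
    and f :: "('o, 'm, 'p, 'n) mor" and Y :: "'u topology"
  assumes "universe TYPE('u)"
    and "stack X'" and "stack X"
    and "morphism X' X f" and "representable X' X f"
    and "weakly_parashrinkable X' X f"
    and "Y \<in> CGTop" and "paracompact_space Y"
  shows "universal_weak_equivalence (Map (rep Y) X') (Map (rep Y) X) (pushforward (rep Y) X' f)
    \<and> (compact_space Y \<longrightarrow>
        weakly_parashrinkable (Map (rep Y) X') (Map (rep Y) X) (pushforward (rep Y) X' f))"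
proof -
  interpret cg_universe "TYPE('u)" by unfold_locales (rule assms(1))
  have X: "fibered_in_groupoids X'" "fibered_in_groupoids X" using assms(2,3) by (auto simp: stack_def)
  have "Hausdorff_space Y" using assms(8) by (simp add: paracompact_space_def)
  then show ?thesis
    using universal_weak_equivalence_pushforward[OF X assms(4,6,7,8)]
      weakly_parashrinkable_pushforward[OF X assms(4,6,7)] by blast
qed

end
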